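(* Let $(A,\mathfrak{m},k)$ be a local complete intersection ring. Let $M$ and $N$ be two finitely generated $A$-modules, and let $I$ be an ideal of $A$. Then $\mathrm{cx}_A(M,N/I^jN)$ is constant for all $j \gg 0$, i.e. there exists $j_0$ such that $\mathrm{cx}_A(M,N/I^jN) = \mathrm{cx}_A(M,N/I^{j_0}N)$ for all $j\ge j_0$.
   Context: All rings are commutative Noetherian with identity. A local ring $A$ is a local complete intersection ring if its $\mathfrak{m}$-adic completion is $\widehat{A} = Q/(\mathbf{f})$, where $Q$ is a complete regular local ring and $\mathbf{f}=f_1,\ldots,f_c$ is a $Q$-regular sequence. For finitely generated $A$-modules $U,V$, the complexity of the pair $(U,V)$ is $$\mathrm{cx}_A(U,V) = \inf\left\{b\in\mathbb{N} : \limsup_{n\rightarrow\infty}\frac{\mu(\mathrm{Ext}_A^n(U,V))}{n^{b-1}}<\infty \right\},$$ where $\mathbb{N}$ is the set of non-negative integers and $\mu(D)$ denotes the minimal number of generators of a finitely generated $A$-module $D$. *)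

theory Defs
  imports
    "HOL-Algebra.Ring_Divisibility"
    "HOL-Algebra.Ideal_Product"
    "HOL-Algebra.QuotRing"
    "HOL-Algebra.Module"
    "HOL-Library.FuncSet"
    "HOL-Library.Extended_Nat"
    "HOL-Library.Extended_Real"
begin

section \<open>Modules\<close>

text \<open>
  The record type of modules extends that of rings, so a module also carries the fields \<open>mult\<close>
  and \<open>one\<close>. The locale \<^locale>\<open>module\<close> ignores them, and they are left unspecified below.
\<close>

definition mod_span :: "('a, 'r) ring_scheme \<Rightarrow> ('a, 'b, 's) module_scheme \<Rightarrow> 'b set \<Rightarrow> 'b set"
  where "mod_span R M S = \<Inter>{H. submodule H R M \<and> S \<subseteq> H}"

definition fin_gen :: "('a, 'r) ring_scheme \<Rightarrow> ('a, 'b, 's) module_scheme \<Rightarrow> bool"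
  where "fin_gen R M \<longleftrightarrow> (\<exists>S. finite S \<and> S \<subseteq> carrier M \<and> mod_span R M S = carrier M)"

text \<open>Only meaningful when the module is finitely generated.\<close>

definition min_gens :: "('a, 'r) ring_scheme \<Rightarrow> ('a, 'b, 's) module_scheme \<Rightarrow> nat"
  where "min_gens R M =
    (LEAST n. \<exists>S. finite S \<and> card S = n \<and> S \<subseteq> carrier M \<and> mod_span R M S = carrier M)"

definition self_module :: "('a, 'r) ring_scheme \<Rightarrow> ('a, 'a) module"
  where "self_module R =
    \<lparr>carrier = carrier R, mult = mult R, one = one R, zero = zero R, add = add R, smult = mult R\<rparr>"

definition quot_module :: "('a, 'b, 's) module_scheme \<Rightarrow> 'b set \<Rightarrow> ('a, 'b set) module"
  where "quot_module M H =
    \<lparr>carrier = a_rcosets\<^bsub>M\<^esub> H, mult = undefined, one = undefined, zero = H, add = set_add M,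
     smult = (\<lambda>a X. \<Union>x\<in>X. H +>\<^bsub>M\<^esub> (a \<odot>\<^bsub>M\<^esub> x))\<rparr>"

definition ideal_smult ::
  "('a, 'r) ring_scheme \<Rightarrow> 'a set \<Rightarrow> ('a, 'b, 's) module_scheme \<Rightarrow> 'b set"
  where "ideal_smult R I M = mod_span R M {a \<odot>\<^bsub>M\<^esub> x | a x. a \<in> I \<and> x \<in> carrier M}"

text \<open>Powers in the monoid of ideals, so that \<open>ideal_pow R I 0\<close> is the whole ring.\<close>

abbreviation ideal_pow :: "('a, 'r) ring_scheme \<Rightarrow> 'a set \<Rightarrow> nat \<Rightarrow> 'a set"
  where "ideal_pow R I n \<equiv> I [^]\<^bsub>ideals_set R\<^esub> n"

text \<open>Linear maps are made extensional, so that equality of maps is equality on the carrier.\<close>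

definition mod_hom ::
  "('a, 'r) ring_scheme \<Rightarrow> ('a, 'b, 's) module_scheme \<Rightarrow> ('a, 'c, 't) module_scheme
    \<Rightarrow> ('b \<Rightarrow> 'c) set"
  where "mod_hom R M N = {f \<in> carrier M \<rightarrow>\<^sub>E carrier N.
    (\<forall>x\<in>carrier M. \<forall>y\<in>carrier M. f (x \<oplus>\<^bsub>M\<^esub> y) = f x \<oplus>\<^bsub>N\<^esub> f y) \<and>
    (\<forall>a\<in>carrier R. \<forall>x\<in>carrier M. f (a \<odot>\<^bsub>M\<^esub> x) = a \<odot>\<^bsub>N\<^esub> f x)}"

definition Hom_module ::
  "('a, 'r) ring_scheme \<Rightarrow> ('a, 'b, 's) module_scheme \<Rightarrow> ('a, 'c, 't) module_scheme
    \<Rightarrow> ('a, 'b \<Rightarrow> 'c) module"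
  where "Hom_module R M N =
    \<lparr>carrier = mod_hom R M N, mult = undefined, one = undefined,
     zero = (\<lambda>x\<in>carrier M. \<zero>\<^bsub>N\<^esub>),
     add = (\<lambda>f g. \<lambda>x\<in>carrier M. f x \<oplus>\<^bsub>N\<^esub> g x),
     smult = (\<lambda>a f. \<lambda>x\<in>carrier M. a \<odot>\<^bsub>N\<^esub> f x)\<rparr>"

definition free_module :: "('a, 'r) ring_scheme \<Rightarrow> nat \<Rightarrow> ('a, nat \<Rightarrow> 'a) module"
  where "free_module R n =
    \<lparr>carrier = {..<n} \<rightarrow>\<^sub>E carrier R, mult = undefined, one = undefined,
     zero = (\<lambda>i\<in>{..<n}. \<zero>\<^bsub>R\<^esub>),
     add = (\<lambda>v w. \<lambda>i\<in>{..<n}. v i \<oplus>\<^bsub>R\<^esub> w i),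
     smult = (\<lambda>a v. \<lambda>i\<in>{..<n}. a \<otimes>\<^bsub>R\<^esub> v i)\<rparr>"


section \<open>Ext and complexity\<close>

text \<open>
  An exact sequence \<open>\<cdots> \<rightarrow> R\<^bsup>\<beta> 2\<^esup> \<rightarrow> R\<^bsup>\<beta> 1\<^esup> \<rightarrow> R\<^bsup>\<beta> 0\<^esup> \<rightarrow> M \<rightarrow> 0\<close>, where \<open>d n\<close> goes from degree
  \<open>n + 1\<close> to degree \<open>n\<close> and \<open>\<epsilon>\<close> is the augmentation.
\<close>

definition free_resolution ::
  "('a, 'r) ring_scheme \<Rightarrow> ('a, 'b, 's) module_scheme \<Rightarrow> (nat \<Rightarrow> nat)
    \<Rightarrow> (nat \<Rightarrow> (nat \<Rightarrow> 'a) \<Rightarrow> (nat \<Rightarrow> 'a)) \<Rightarrow> ((nat \<Rightarrow> 'a) \<Rightarrow> 'b) \<Rightarrow> bool"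
  where "free_resolution R M \<beta> d \<epsilon> \<longleftrightarrow>
    \<epsilon> \<in> mod_hom R (free_module R (\<beta> 0)) M \<and>
    (\<forall>n. d n \<in> mod_hom R (free_module R (\<beta> (Suc n))) (free_module R (\<beta> n))) \<and>
    \<epsilon> ` carrier (free_module R (\<beta> 0)) = carrier M \<and>
    d 0 ` carrier (free_module R (\<beta> 1)) = a_kernel (free_module R (\<beta> 0)) M \<epsilon> \<and>
    (\<forall>n. d (Suc n) ` carrier (free_module R (\<beta> (Suc (Suc n)))) =
         a_kernel (free_module R (\<beta> (Suc n))) (free_module R (\<beta> n)) (d n))"

text \<open>
  The \<open>n\<close>-th cohomology of the complex obtained by applying \<open>Hom(-, N)\<close> to a resolution
  (without the augmentation).
\<close>

definition dual_cocycles ::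
  "('a, 'r) ring_scheme \<Rightarrow> (nat \<Rightarrow> nat) \<Rightarrow> (nat \<Rightarrow> (nat \<Rightarrow> 'a) \<Rightarrow> (nat \<Rightarrow> 'a))
    \<Rightarrow> ('a, 'c, 't) module_scheme \<Rightarrow> nat \<Rightarrow> ((nat \<Rightarrow> 'a) \<Rightarrow> 'c) set"
  where "dual_cocycles R \<beta> d N n =
    a_kernel (Hom_module R (free_module R (\<beta> n)) N) (Hom_module R (free_module R (\<beta> (Suc n))) N)
      (\<lambda>f. compose (carrier (free_module R (\<beta> (Suc n)))) f (d n))"

fun dual_coboundaries ::
  "('a, 'r) ring_scheme \<Rightarrow> (nat \<Rightarrow> nat) \<Rightarrow> (nat \<Rightarrow> (nat \<Rightarrow> 'a) \<Rightarrow> (nat \<Rightarrow> 'a))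
    \<Rightarrow> ('a, 'c, 't) module_scheme \<Rightarrow> nat \<Rightarrow> ((nat \<Rightarrow> 'a) \<Rightarrow> 'c) set"
  where
    "dual_coboundaries R \<beta> d N 0 = {\<zero>\<^bsub>Hom_module R (free_module R (\<beta> 0)) N\<^esub>}"
  | "dual_coboundaries R \<beta> d N (Suc n) =
      (\<lambda>f. compose (carrier (free_module R (\<beta> (Suc n)))) f (d n)) `
        carrier (Hom_module R (free_module R (\<beta> n)) N)"

definition dual_cohomology ::
  "('a, 'r) ring_scheme \<Rightarrow> (nat \<Rightarrow> nat) \<Rightarrow> (nat \<Rightarrow> (nat \<Rightarrow> 'a) \<Rightarrow> (nat \<Rightarrow> 'a))
    \<Rightarrow> ('a, 'c, 't) module_scheme \<Rightarrow> nat \<Rightarrow> ('a, ((nat \<Rightarrow> 'a) \<Rightarrow> 'c) set) module"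
  where "dual_cohomology R \<beta> d N n =
    quot_module
      ((Hom_module R (free_module R (\<beta> n)) N)\<lparr>carrier := dual_cocycles R \<beta> d N n\<rparr>)
      (dual_coboundaries R \<beta> d N n)"

text \<open>
  For a finitely generated module over a Noetherian ring a resolution by finite free modules
  exists, and the cohomology does not depend on it up to isomorphism. Here one is chosen.
\<close>

definition Ext ::
  "('a, 'r) ring_scheme \<Rightarrow> nat \<Rightarrow> ('a, 'b, 's) module_scheme \<Rightarrow> ('a, 'c, 't) module_scheme
    \<Rightarrow> ('a, ((nat \<Rightarrow> 'a) \<Rightarrow> 'c) set) module"
  where "Ext R n M N =
    (let (\<beta>, d) = (SOME (\<beta>, d). \<exists>\<epsilon>. free_resolution R M \<beta> d \<epsilon>) in dual_cohomology R \<beta> d N n)"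

text \<open>
  The exponent \<open>b - 1\<close> is an integer: for \<open>b = 0\<close> the quotient is \<open>n * \<mu>(Ext)\<close>. With values in
  \<^typ>\<open>enat\<close> the infimum of the empty set is \<open>\<infinity>\<close>.
\<close>

definition complexity ::
  "('a, 'r) ring_scheme \<Rightarrow> ('a, 'b, 's) module_scheme \<Rightarrow> ('a, 'c, 't) module_scheme \<Rightarrow> enat"
  where "complexity R U V =
    Inf (enat ` {b :: nat.
      limsup (\<lambda>n. ereal (real (min_gens R (Ext R n U V)) / real n powi (int b - 1))) < \<infinity>})"


section \<open>Local complete intersection rings\<close>

locale noetherian_local_ring =
  noetherian_ring R + cring R + maximalideal \<mm> R for R (structure) and \<mm> +
  assumes maximal_unique: "maximalideal J R \<Longrightarrow> J = \<mm>"

definition krull_dim :: "('a, 'r) ring_scheme \<Rightarrow> enat"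
  where "krull_dim R =
    Sup (enat ` {n. \<exists>P. (\<forall>i\<le>n. primeideal (P i) R) \<and> (\<forall>i<n. P i \<subset> P (Suc i))})"

locale regular_local_ring = noetherian_local_ring +
  assumes regular: "krull_dim R = enat (min_gens R ((self_module R)\<lparr>carrier := \<mm>\<rparr>))"

text \<open>
  The inverse limit of the rings \<open>R / I\<^bsup>n\<^esup>\<close>. The transition map sends a coset of \<open>I\<^bsup>n+1\<^esup>\<close> to the
  coset of \<open>I\<^bsup>n\<^esup>\<close> containing it, so compatibility of a sequence of cosets is inclusion.
\<close>

definition adic_completion :: "('a, 'r) ring_scheme \<Rightarrow> 'a set \<Rightarrow> (nat \<Rightarrow> 'a set) ring"
  where "adic_completion R I =
    \<lparr>carrier = {x. (\<forall>n. x n \<in> carrier (R Quot ideal_pow R I n)) \<and> (\<forall>n. x (Suc n) \<subseteq> x n)},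
     mult = (\<lambda>x y n. x n \<otimes>\<^bsub>R Quot ideal_pow R I n\<^esub> y n),
     one = (\<lambda>n. \<one>\<^bsub>R Quot ideal_pow R I n\<^esub>),
     zero = (\<lambda>n. \<zero>\<^bsub>R Quot ideal_pow R I n\<^esub>),
     add = (\<lambda>x y n. x n \<oplus>\<^bsub>R Quot ideal_pow R I n\<^esub> y n)\<rparr>"

definition adically_complete :: "('a, 'r) ring_scheme \<Rightarrow> 'a set \<Rightarrow> bool"
  where "adically_complete R I \<longleftrightarrow>
    (\<lambda>r n. ideal_pow R I n +>\<^bsub>R\<^esub> r) \<in> ring_iso R (adic_completion R I)"

definition nonzerodivisor :: "('a, 'r) ring_scheme \<Rightarrow> 'a \<Rightarrow> bool"
  where "nonzerodivisor R a \<longleftrightarrow> (\<forall>x\<in>carrier R. a \<otimes>\<^bsub>R\<^esub> x = \<zero>\<^bsub>R\<^esub> \<longrightarrow> x = \<zero>\<^bsub>R\<^esub>)"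

definition regular_sequence :: "('a, 'r) ring_scheme \<Rightarrow> 'a list \<Rightarrow> bool"
  where "regular_sequence R fs \<longleftrightarrow>
    set fs \<subseteq> carrier R \<and>
    (\<forall>i<length fs. nonzerodivisor (R Quot Idl\<^bsub>R\<^esub> (set (take i fs)))
                                  (Idl\<^bsub>R\<^esub> (set (take i fs)) +>\<^bsub>R\<^esub> (fs ! i))) \<and>
    Idl\<^bsub>R\<^esub> (set fs) \<noteq> carrier R"

text \<open>
  HOL cannot quantify over the type of the elements of \<open>Q\<close> inside a definition, so that type is a
  parameter. A theorem that assumes this predicate with a type variable \<open>'q\<close> covers all \<open>Q\<close>.
\<close>

definition local_complete_intersection ::
  "'q itself \<Rightarrow> ('a, 'r) ring_scheme \<Rightarrow> 'a set \<Rightarrow> bool"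
  where "local_complete_intersection T R \<mm> \<longleftrightarrow>
    noetherian_local_ring R \<mm> \<and>
    (\<exists>(Q :: 'q ring) \<nn> fs.
       regular_local_ring Q \<nn> \<and> adically_complete Q \<nn> \<and> regular_sequence Q fs \<and>
       adic_completion R \<mm> \<simeq> Q Quot Idl\<^bsub>Q\<^esub> (set fs))"

end

theory Submission
  imports Defs "HOL-Library.Set_Algebras" "HOL-Library.Function_Algebras" "HOL-Algebra.IntRing"
begin

text \<open>
  Over \<open>Q/(f)\<close> with \<open>Q\<close> regular, the family of all \<open>Ext\<^sup>n(M, I\<^sup>jN)\<close> is Noetherian over Eisenbud's
  operators together with multiplication by generators of \<open>I\<close>: going from \<open>f\<^sub>1, \<dots>, f\<^sub>c\<^sub>-\<^sub>1\<close> to \<open>f\<^sub>1, \<dots>, f\<^sub>c\<close> the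
  cone of the new operator lowers the level, and Hilbert's basis theorem adjoins the operator; at level
  \<open>0\<close> projective dimensions are finite. Hence for large \<open>j\<close> the kernels of \<open>Ext(M, I\<^sup>jN) \<rightarrow> Ext(M, N)\<close> satisfy
  \<open>K\<^sub>j\<^sub>+\<^sub>1 = I K\<^sub>j\<close> and the images satisfy the same recursion, so that the growth of both, and with it that of
  \<open>Ext(M, N/I\<^sup>jN)\<close>, stabilises. The result descends along the faithfully flat completion. To work in type
  classes, every ring is a quotient of one free commutative ring, with modules as subquotients of free ones.
\<close>

text \<open>The main obstacle is that \<mu> is not monotone: a submodule may need more generators
  than the module. It becomes monotone up to a constant factor once one Artin-Rees exponent
  \<open>r\<close> serves all cohomological degrees, because \<mu> of the submodule is then bounded
  by the length of the module modulo the \<open>r\<close>-th power of the maximal ideal. This is why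
  chain conditions are stated for whole families. The growth stabilises for two different reasons.
  Passing from \<open>K_j\<close> to \<open>I K_j\<close> multiplies the number of generators by at
  most a constant, so the set of admissible exponents grows with \<open>j\<close>; an increasing
  sequence of up-closed sets of naturals is eventually constant. The images lie between
  \<open>I^j H\<close> and \<open>I H\<close> for \<open>H = Ext(M,N)\<close>, so the growth of
  \<open>H\<close> modulo the image is that of \<open>H/IH\<close>. Finite projective dimension over
  \<open>Q\<close> rests on regular sequences, while regularity is given by Krull dimension. The
  link is the growth of the lengths modulo powers of the maximal ideal: a chain of primes with
  \<open>d\<close> strict steps forces maximal growth, and this makes \<open>d\<close> generators of
  the maximal ideal a regular sequence.\<close>

lemmas plusE = set_plus_elim and plusI = set_plus_intro

section \<open>Noetherian families of subgroups\<close>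

definition sgp :: "'v::ab_group_add set => bool"
  where "sgp H \<longleftrightarrow> 0 : H & (ALL x:H. ALL y:H. x - y : H)"

lemma sgpI: "0 : H ==> (!!x y. x : H ==> y : H ==> x - y : H) ==> sgp H"
  by (simp add: sgp_def)

lemma sgp_zero: "sgp H ==> 0 : H" by (simp add: sgp_def)

lemma sgp_diff: "sgp H ==> x : H ==> y : H ==> x - y : H" by (simp add: sgp_def)

lemma sgp_neg: "sgp H ==> x : H ==> - x : H"
  using sgp_diff[of H 0 x] sgp_zero by auto

lemma sgp_add: "sgp H ==> x : H ==> y : H ==> x + y : H"
  using sgp_diff[of H x "- y"] sgp_neg by auto

lemma sgp_sum: "sgp H ==> (!!i. i : S ==> f i : H) ==> sum f S : H"
  by (induction S rule: infinite_finite_induct) (auto intro: sgp_zero sgp_add)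

lemma sgp_UNIV: "sgp UNIV" by (simp add: sgp_def)

lemma sgp_cancel: "sgp H ==> x - y : H ==> y : H ==> x : H"
  using sgp_add by fastforce

lemma sgp_cancel': "sgp H ==> x - y : H ==> x : H ==> y : H"
  using sgp_diff[of H x "x - y"] by simp

lemma sgp_trans: "sgp H ==> x - y : H ==> y - z : H ==> x - z : H"
  using sgp_add[of H "x - y" "y - z"] by simp

lemma sgp_Int: "sgp H ==> sgp K ==> sgp (H Int K)"
  by (auto simp: sgp_def)

lemma sgp_image:
  fixes f :: "'u::ab_group_add => 'v::ab_group_add"
  assumes f: "!!x y. f (x - y) = f x - f y" and H: "sgp H"
  shows "sgp (f ` H)"
proof (rule sgpI)
  show "0 : f ` H" using f[of 0 0] sgp_zero[OF H] by (metis diff_self imageI)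
  show "x - y : f ` H" if "x : f ` H" "y : f ` H" for x y using that sgp_diff[OF H] by (auto simp flip: f)
qed

lemma sgp_vimage:
  fixes f :: "'u::ab_group_add => 'v::ab_group_add"
  assumes f: "!!x y. f (x - y) = f x - f y" and H: "sgp H"
  shows "sgp {x. f x : H}"
  using f[of 0 0] sgp_zero[OF H] sgp_diff[OF H] by (simp add: sgp_def f)

lemma sgp_plus: "sgp H ==> sgp K ==> sgp (H + K)"
proof (rule sgpI)
  assume H: "sgp H" and K: "sgp K"
  show "0 : H + K" using plusI[of 0 H 0 K] sgp_zero H K by auto
  fix x y assume "x : H + K" "y : H + K"
  then obtain a b c d where "x = a + b" "a : H" "b : K" "y = c + d" "c : H" "d : K"
    by (metis plusE)
  thus "x - y : H + K"
    using plusI[of "a - c" H "b - d" K] sgp_diff H K by (auto simp: algebra_simps)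
qed

lemma plus_upper1: "0 : K ==> H <= H + (K :: 'v::ab_group_add set)"
  by (metis add.right_neutral plusI subsetI)

lemma plus_upper2: "0 : H ==> K <= H + (K :: 'v::ab_group_add set)"
  by (metis add.left_neutral plusI subsetI)

lemma plus_split: "a : H ==> x - a : K ==> x : H + (K :: 'v::ab_group_add set)"
  by (metis add.commute diff_add_cancel plusI)

lemma plus_split': "x - b : H ==> b : K ==> x : H + (K :: 'v::ab_group_add set)"
  by (metis diff_add_cancel plusI)

lemma plus_least: "sgp L ==> H <= L ==> K <= L ==> H + K <= L"
  by (auto elim!: plusE intro: sgp_add)

lemma plus_mono: "H <= H' ==> K <= K' ==> H + K <= H' + (K' :: 'v::ab_group_add set)"
  by (rule set_plus_mono2)

lemma mem_plus: "x : H + K \<longleftrightarrow> (EX a:H. EX b:K. x = a + b)"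
  by (auto simp: set_plus_def)

text \<open>The modular law in the form used throughout: strictness of an inclusion is detected in
  the intersection with \<open>M\<close> or in the sum with \<open>M\<close>.\<close>

lemma modular_cancel:
  assumes "sgp H2" "H1 <= H2" "H2 Int M <= H1" "H2 <= H1 + M" "sgp H1"
  shows "H1 = H2"
proof
  show "H2 <= H1"
  proof
    fix x assume x: "x : H2"
    then obtain a b where ab: "x = a + b" "a : H1" "b : M" using assms(4) by (metis plusE subsetD)
    hence "b : H2" using x assms(1,2) sgp_diff[of H2 x a] by auto
    thus "x : H1" using ab assms(3,5) sgp_add by blast
  qed
qed (use assms in auto)

text \<open>An operator consists of a map of degrees and, for each degree, a map of the ambient
  group. A graded module is a family of subgroups of one type, so several gradings can be treated
  uniformly.\<close>

type_synonym ('i, 'v) op = "('i => 'i) \<times> ('i => 'v => 'v)"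

definition additive_op :: "('i, 'v::ab_group_add) op => bool"
  where "additive_op w \<longleftrightarrow> (ALL i x y. snd w i (x + y) = snd w i x + snd w i y)"

lemma additive_add: "additive_op w ==> snd w i (x + y) = snd w i x + snd w i y"
  by (simp add: additive_op_def)

lemma additive_zero: "additive_op w ==> snd w i 0 = 0"
  using additive_add[of w i 0 0] by simp

lemma additive_diff: "additive_op w ==> snd w i (x - y) = snd w i x - snd w i y"
  using additive_add[of w i "x - y" y] by (simp add: algebra_simps)

definition stable :: "('i, 'v) op set => ('i => 'v set) => bool"
  where "stable W H \<longleftrightarrow> (ALL w:W. ALL i. ALL x:H i. snd w i x : H (fst w i))"

definition subfam :: "('i, 'v::ab_group_add) op set => ('i => 'v set) => ('i => 'v set) => ('i => 'v set) => bool"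
  where "subfam W lo hi H \<longleftrightarrow> (ALL i. sgp (H i) & lo i <= H i & H i <= hi i) & stable W H"

text \<open>The ascending chain condition for graded submodules of \<open>hi/lo\<close>. The index
  \<open>k\<close> does not depend on the degree, which later makes Artin-Rees exponents uniform in
  the cohomological degree.\<close>

definition noeth :: "('i, 'v::ab_group_add) op set => ('i => 'v set) => ('i => 'v set) => bool"
  where "noeth W lo hi \<longleftrightarrow> (ALL H. (ALL k. subfam W lo hi (H k)) & (ALL k i. H k i <= H (Suc k) i)
    --> (EX k. ALL l>=k. H l = H k))"

lemma stableD: "stable W H ==> w : W ==> x : H i ==> snd w i x : H (fst w i)"
  by (simp add: stable_def)

lemma stableI: "(!!w i x. w : W ==> x : H i ==> snd w i x : H (fst w i)) ==> stable W H"
  by (simp add: stable_def)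

lemma subfamI:
  "(!!i. sgp (H i)) ==> (!!i. lo i <= H i) ==> (!!i. H i <= hi i) ==> stable W H ==> subfam W lo hi H"
  by (simp add: subfam_def)

lemma subfamD:
  assumes "subfam W lo hi H"
  shows "sgp (H i)" "lo i <= H i" "H i <= hi i" "stable W H"
  using assms by (auto simp: subfam_def)

lemma noethD:
  assumes "noeth W lo hi" "!!k. subfam W lo hi (H k)" "!!k i. H k i <= H (Suc k) i"
  obtains k where "!!l. l >= k ==> H l = H k"
  using assms unfolding noeth_def by blast

lemma noeth_stabilises:
  assumes "noeth W lo hi" "!!k. subfam W lo hi (H k)" "!!k i. H k i <= H (Suc k) i"
  shows "EX k. ALL l>=k. H l = H k"
  using assms unfolding noeth_def by blast

lemma noethI:
  assumes "!!H. (!!k. subfam W lo hi (H k)) ==> (!!k i. H k i <= H (Suc k) i) ==> EX k. ALL l>=k. H l = H k"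
  shows "noeth W lo hi"
  using assms unfolding noeth_def by blast

lemma noeth_mono:
  assumes "noeth W lo hi" "W <= W'" "!!i. lo i <= lo' i" "!!i. hi' i <= hi i"
  shows "noeth W' lo' hi'"
proof (rule noethI)
  fix H assume H: "!!k. subfam W' lo' hi' (H k)" and inc: "!!k i. H k i <= H (Suc k) i"
  have "subfam W lo hi (H k)" for k
    using H[of k] assms(2-4) unfolding subfam_def stable_def by (meson subset_iff)
  thus "EX k. ALL l>=k. H l = H k" using assms(1) inc unfolding noeth_def by blast
qed

lemma chain_mono_fam:
  fixes H :: "nat => 'i => 'v set"
  assumes "!!k i. H k i <= H (Suc k) i" "k <= l"
  shows "H k i <= H l i"
  using assms(2) by (rule lift_Suc_mono_le[of "%k. H k i", OF assms(1)])

text \<open>A chain is recovered from its intersections with \<open>mid\<close> and its sums with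
  \<open>mid\<close>; both stabilise, and the modular law compares the members.\<close>

lemma noeth_ext:
  assumes n1: "noeth W lo mid" and n2: "noeth W mid hi"
    and mid: "subfam W lo hi mid" and add: "!!w. w : W ==> additive_op w"
    and hi: "!!i. sgp (hi i)"
  shows "noeth W lo hi"
proof (rule noethI)
  fix H assume H: "!!k. subfam W lo hi (H k)" and inc: "!!k i. H k i <= H (Suc k) i"
  define A where "A k i = H k i Int mid i" for k i
  define B where "B k i = H k i + mid i" for k i
  have "subfam W lo mid (A k)" for k
    using H[of k] mid unfolding subfam_def A_def stable_def by (auto intro: sgp_Int)
  moreover have "A k i <= A (Suc k) i" for k i using inc by (auto simp: A_def)
  ultimately obtain k1 where k1: "!!l. l >= k1 ==> A l = A k1" by (rule noethD[OF n1]) blast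
  have "subfam W mid hi (B k)" for k
  proof (rule subfamI)
    show "sgp (B k i)" for i unfolding B_def using subfamD(1)[OF H] subfamD(1)[OF mid] by (rule sgp_plus)
    show "mid i <= B k i" for i unfolding B_def by (rule plus_upper2[OF sgp_zero[OF subfamD(1)[OF H]]])
    show "B k i <= hi i" for i unfolding B_def by (rule plus_least[OF hi subfamD(3)[OF H] subfamD(3)[OF mid]])
    show "stable W (B k)"
    proof (rule stableI)
      fix w i x assume w: "w : W" and "x : B k i"
      then obtain a b where ab: "x = a + b" "a : H k i" "b : mid i" unfolding B_def by (metis plusE)
      show "snd w i x : B k (fst w i)"
        unfolding B_def ab(1) additive_add[OF add[OF w]]
        using stableD[OF subfamD(4)[OF H] w ab(2)] stableD[OF subfamD(4)[OF mid] w ab(3)] by blast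
    qed
  qed
  moreover have "B k i <= B (Suc k) i" for k i unfolding B_def using inc by (intro plus_mono) auto
  ultimately obtain k2 where k2: "!!l. l >= k2 ==> B l = B k2" by (rule noethD[OF n2]) blast
  define k where "k = max k1 k2"
  have "H l = H k" if "l >= k" for l
  proof
    fix i
    have "A l = A k" "B l = B k" using k1[of l] k1[of k] k2[of l] k2[of k] that by (auto simp: k_def)
    hence eq: "H l i Int mid i = H k i Int mid i" "H l i + mid i = H k i + mid i"
      by (simp_all add: A_def B_def fun_eq_iff)
    have "H k i <= H l i" using inc that by (rule chain_mono_fam)
    moreover have "H l i <= H l i + mid i" by (rule plus_upper1[OF sgp_zero[OF subfamD(1)[OF mid]]])
    ultimately show "H l i = H k i"
      using modular_cancel[of "H l i" "H k i" "mid i"] eq subfamD(1)[OF H] by auto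
  qed
  thus "EX k. ALL l>=k. H l = H k" by blast
qed

lemma noeth_trivial:
  fixes lo hi :: "'i => 'v::ab_group_add set"
  assumes "!!i. hi i <= lo i"
  shows "noeth W lo hi"
proof (rule noethI)
  fix H :: "nat => 'i => 'v set" assume H: "!!k. subfam W lo hi (H k)"
  have "H k i = lo i" for k i using subfamD(2,3)[OF H] assms by blast
  hence "H k = H 0" for k by (simp add: fun_eq_iff)
  thus "EX k. ALL l>=k. H l = H k" by blast
qed

text \<open>\<open>ph\<close> embeds \<open>hi/lo\<close> into \<open>hi'/lo'\<close>, and chains
  are pushed forward as \<open>ph H + lo'\<close>. For these to be stable, each operator of the
  target must be induced, modulo \<open>lo'\<close>, by one of the source; that is the direction of
  \<open>ops\<close>.\<close>

lemma noeth_embed: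
  fixes ph :: "'i => 'v::ab_group_add => 'u::ab_group_add" and W :: "('i, 'v) op set" and W' :: "('i, 'u) op set"
  assumes n: "noeth W' lo' hi'"
    and lo': "subfam W' lo' hi' lo'" and hi'_sgp: "!!i. sgp (hi' i)" and add': "!!w. w : W' ==> additive_op w"
    and add: "!!i x y. ph i (x + y) = ph i x + ph i y"
    and maps: "!!i x. x : hi i ==> ph i x : hi' i"
    and ker: "!!i x. x : hi i ==> ph i x : lo' i ==> x : lo i"
    and ops: "!!w'. w' : W' ==> EX w:W. fst w = fst w' &
      (ALL i. ALL x:hi i. snd w' i (ph i x) - ph (fst w i) (snd w i x) : lo' (fst w i))"
  shows "noeth W lo hi"
proof (rule noethI)
  fix H assume H: "!!k. subfam W lo hi (H k)" and inc: "!!k i. H k i <= H (Suc k) i"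
  define A where "A k i = ph i ` H k i + lo' i" for k i
  have d: "ph i (x - y) = ph i x - ph i y" for i x y using add[of i "x - y" y] by (simp add: algebra_simps)
  have im: "sgp (ph i ` H k i)" for k i by (rule sgp_image[OF d subfamD(1)[OF H]])
  have "subfam W' lo' hi' (A k)" for k
  proof (rule subfamI)
    show "sgp (A k i)" for i unfolding A_def using im subfamD(1)[OF lo'] by (rule sgp_plus)
    show "lo' i <= A k i" for i unfolding A_def by (rule plus_upper2[OF sgp_zero[OF im]])
    show "A k i <= hi' i" for i unfolding A_def
      by (rule plus_least[OF hi'_sgp]) (use maps subfamD(3)[OF H] subfamD(3)[OF lo'] in blast)+
    show "stable W' (A k)"
    proof (rule stableI)
      fix w' i x assume w': "w' : W'" and "x : A k i"
      then obtain a b where ab: "x = ph i a + b" "a : H k i" "b : lo' i" unfolding A_def by (auto elim: plusE)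
      from ops[OF w'] obtain w where w: "w : W" "fst w = fst w'"
         "!!i x. x : hi i ==> snd w' i (ph i x) - ph (fst w i) (snd w i x) : lo' (fst w i)" by blast
      have 1: "snd w i a : H k (fst w i)" by (rule stableD[OF subfamD(4)[OF H] w(1) ab(2)])
      have 2: "snd w' i (ph i a) - ph (fst w i) (snd w i a) : lo' (fst w i)"
        using w(3) subfamD(3)[OF H] ab(2) by blast
      have 3: "snd w' i b : lo' (fst w i)" using stableD[OF subfamD(4)[OF lo'] w' ab(3)] w(2) by simp
      have "snd w' i x = ph (fst w i) (snd w i a) + ((snd w' i (ph i a) - ph (fst w i) (snd w i a)) + snd w' i b)"
        unfolding ab(1) additive_add[OF add'[OF w']] by simp
      thus "snd w' i x : A k (fst w' i)"
        unfolding A_def w(2)[symmetric] using 1 sgp_add[OF subfamD(1)[OF lo'] 2 3] by (metis imageI plusI)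
    qed
  qed
  moreover have "A k i <= A (Suc k) i" for k i unfolding A_def using inc by (intro plus_mono) auto
  ultimately obtain k where k: "!!l. l >= k ==> A l = A k" by (rule noethD[OF n]) blast
  have "H l i = H k i" if "l >= k" for l i
  proof
    show "H k i <= H l i" using inc that by (rule chain_mono_fam)
    show "H l i <= H k i"
    proof
      fix x assume x: "x : H l i"
      have "ph i ` H l i <= A l i" unfolding A_def by (rule plus_upper1[OF sgp_zero[OF subfamD(1)[OF lo']]])
      hence "ph i x : A k i" using x k[OF that] by auto
      then obtain a b where ab: "ph i x = ph i a + b" "a : H k i" "b : lo' i" unfolding A_def by (auto elim: plusE)
      have "a : H l i" using ab(2) `H k i <= H l i` by blast
      hence "x - a : hi i" using x sgp_diff[OF subfamD(1)[OF H]] subfamD(3)[OF H] by blast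
      moreover have "ph i (x - a) : lo' i" using ab d by simp
      ultimately have "x - a : H k i" using ker subfamD(2)[OF H] by blast
      thus "x : H k i" using ab(2) sgp_cancel subfamD(1)[OF H] by blast
    qed
  qed
  hence "H l = H k" if "l >= k" for l using that by (intro ext) blast
  thus "EX k. ALL l>=k. H l = H k" by blast
qed

text \<open>The joint kernels of the maps in \<open>C\<close> filter \<open>hi\<close>; each layer
  embeds into \<open>hi'/lo'\<close> by a single map. This carries chain conditions from a module to
  its finite powers.\<close>

lemma noeth_joint:
  fixes ph :: "'k => 'i => 'v::ab_group_add => 'u::ab_group_add" and W :: "('i, 'v) op set" and W' :: "('i, 'u) op set"
  assumes fin: "finite B"
    and n: "noeth W' lo' hi'"
    and lo': "subfam W' lo' hi' lo'" and hi'_sgp: "!!i. sgp (hi' i)" and add': "!!w. w : W' ==> additive_op w"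
    and addW: "!!w. w : W ==> additive_op w"
    and hi: "subfam W lo hi hi"
    and add: "!!k i x y. ph k i (x + y) = ph k i x + ph k i y"
    and maps: "!!k i x. k : B ==> x : hi i ==> ph k i x : hi' i"
    and ker: "!!i x. x : hi i ==> x : lo i \<longleftrightarrow> (ALL k:B. ph k i x : lo' i)"
    and ops': "!!w'. w' : W' ==> EX w:W. fst w = fst w' &
      (ALL i. ALL x:hi i. ALL k:B. snd w' i (ph k i x) = ph k (fst w i) (snd w i x))"
    and ops: "!!w. w : W ==> EX w':W'. fst w = fst w' &
      (ALL i. ALL x:hi i. ALL k:B. snd w' i (ph k i x) = ph k (fst w i) (snd w i x))"
  shows "noeth W lo hi"
proof -
  have z: "ph k i 0 = 0" for k i using add[of k i 0 0] by simp
  have d: "ph k i (x - y) = ph k i x - ph k i y" for k i x y using add[of k i "x - y" y] by (simp add: algebra_simps)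
  have "noeth W (%i. {x:hi i. ALL k:C. ph k i x : lo' i}) hi" if "C <= B" "finite C" for C
    using that(2,1)
  proof (induction C)
    case empty
    thus ?case by (intro noeth_trivial) auto
  next
    case (insert c C)
    define L where "L C i = {x:hi i. ALL k:C. ph k i x : lo' i}" for C i
    have L_eq: "L C = (%i. {x:hi i. ALL k:C. ph k i x : lo' i})" for C by (simp add: L_def fun_eq_iff)
    have Ls: "subfam W (L D) hi (L C)" if "C <= D" "D <= B" for C D
    proof (rule subfamI)
      show "sgp (L C i)" for i
        by (rule sgpI) (auto simp: L_def z d sgp_zero[OF subfamD(1)[OF hi]] sgp_zero[OF subfamD(1)[OF lo']]
          sgp_diff[OF subfamD(1)[OF hi]] sgp_diff[OF subfamD(1)[OF lo']])
      show "L D i <= L C i" for i using that by (auto simp: L_def)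
      show "L C i <= hi i" for i by (auto simp: L_def)
      show "stable W (L C)"
      proof (rule stableI)
        fix w i x assume w: "w : W" and x: "x : L C i"
        from ops[OF w] obtain w' where w': "w' : W'" "fst w = fst w'"
          "!!i x k. x : hi i ==> k : B ==> snd w' i (ph k i x) = ph k (fst w i) (snd w i x)" by blast
        have "snd w i x : hi (fst w i)" using stableD[OF subfamD(4)[OF hi] w] x by (auto simp: L_def)
        moreover have "ph k (fst w i) (snd w i x) : lo' (fst w i)" if "k : C" for k
          using w'(3)[of x i k] stableD[OF subfamD(4)[OF lo'] w'(1), of "ph k i x" i] w'(2) x that `C <= D` `D <= B`
          by (auto simp: L_def)
        ultimately show "snd w i x : L C (fst w i)" by (simp add: L_def)
      qed
    qed
    have "noeth W (L C) hi" unfolding L_eq using insert by blast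
    moreover have "noeth W (L (insert c C)) (L C)"
    proof (rule noeth_embed[where ph = "ph c", OF n lo' hi'_sgp add'])
      show "ph c i (x + y) = ph c i x + ph c i y" for i x y by (rule add)
      show "ph c i x : hi' i" if "x : L C i" for i x using that maps insert by (auto simp: L_def)
      show "x : L (insert c C) i" if "x : L C i" "ph c i x : lo' i" for i x using that by (auto simp: L_def)
      fix w' assume "w' : W'"
      from ops'[OF this] obtain w where w: "w:W" "fst w = fst w'"
        "!!i x k. x : hi i ==> k : B ==> snd w' i (ph k i x) = ph k (fst w i) (snd w i x)" by blast
      have "snd w' i (ph c i x) - ph c (fst w i) (snd w i x) : lo' (fst w i)" if "x : L C i" for i x
        using w(3)[of x i c] that insert sgp_zero[OF subfamD(1)[OF lo']] by (auto simp: L_def)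
      thus "EX w:W. fst w = fst w' & (ALL i. ALL x:L C i. snd w' i (ph c i x) - ph c (fst w i) (snd w i x) : lo' (fst w i))"
        using w(1,2) by blast
    qed
    ultimately have "noeth W (L (insert c C)) hi"
      using noeth_ext[of W "L (insert c C)" "L C" hi] Ls[of C "insert c C"] addW subfamD(1)[OF hi] insert(4) by blast
    thus ?case unfolding L_eq .
  qed
  from this[OF subset_refl fin] have "noeth W (%i. {x:hi i. ALL k:B. ph k i x : lo' i}) hi" .
  thus ?thesis
  proof (rule noeth_mono)
    show "{x : hi i. ALL k:B. ph k i x : lo' i} <= lo i" for i using ker by blast
  qed auto
qed

text \<open>This is \<open>lo + y E\<close> in degree \<open>k\<close>. The \<open>{0}\<close>
  covers degrees outside the range of the index map. That map will be injective, so at most one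
  \<open>i\<close> contributes and the result is a subgroup.\<close>

definition addim :: "('i, 'v::ab_group_add) op => ('i => 'v set) => ('i => 'v set) => 'i => 'v set"
  where "addim y E lo k = lo k + ({0} Un {snd y i e | i e. fst y i = k & e : E i})"

lemma addim_sgp:
  assumes "inj (fst y)" "additive_op y" "!!i. sgp (lo i)" "!!i. sgp (E i)"
  shows "sgp (addim y E lo k)"
proof -
  have "sgp ({0} Un {snd y i e | i e. fst y i = k & e : E i})"
  proof (cases "EX i. fst y i = k")
    case True
    then obtain i where i: "fst y i = k" by blast
    have "0 : snd y i ` E i" using additive_zero[OF assms(2), of i] sgp_zero[OF assms(4)[of i]] by (metis imageI)
    moreover have "{snd y j e | j e. fst y j = k & e : E j} = snd y i ` E i"
      using i assms(1) by (auto dest: injD)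
    ultimately have eq: "{0} Un {snd y j e | j e. fst y j = k & e : E j} = snd y i ` E i" by blast
    show ?thesis unfolding eq by (rule sgp_image[OF additive_diff[OF assms(2)] assms(4)])
  next
    case False
    have z: "{0} Un {snd y i e | i e. fst y i = k & e : E i} = {0}" using False by auto
    show ?thesis unfolding z by (simp add: sgp_def)
  qed
  thus ?thesis unfolding addim_def using assms(3) sgp_plus by blast
qed

lemma addim_upper: "lo k <= addim y E lo k"
  unfolding addim_def by (rule plus_upper1) auto

lemma addim_upperD: "x : lo k ==> x : addim y E lo k"
  by (rule subsetD[OF addim_upper])

lemma addim_im: "sgp (lo (fst y i)) ==> e : E i ==> snd y i e : addim y E lo (fst y i)"
  unfolding addim_def mem_plus by (rule bexI[of _ 0], rule bexI[of _ "snd y i e"]) (auto intro: sgp_zero)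

lemma addim_cases:
  assumes "x : addim y E lo k"
  obtains "x : lo k" | l i e where "x = l + snd y i e" "l : lo k" "fst y i = k" "e : E i"
  using assms unfolding addim_def by (auto simp: mem_plus)

lemma addim_least:
  assumes "sgp S" "lo k <= S" "!!i e. fst y i = k ==> e : E i ==> snd y i e : S"
  shows "addim y E lo k <= S"
  unfolding addim_def by (rule plus_least) (use assms sgp_zero in auto)

text \<open>
  Hilbert's basis theorem: \<open>y\<close> is a new variable of positive degree, and a family is determined
  by the leading coefficients \<open>L m\<close> below.
\<close>

definition commutes :: "('i, 'v::ab_group_add) op => ('i, 'v) op => ('i => 'v set) => ('i => 'v set) => bool"
  where "commutes w y lo hi \<longleftrightarrow> (ALL i. fst w (fst y i) = fst y (fst w i) &
     (ALL x:hi i. snd w (fst y i) (snd y i x) - snd y (fst w i) (snd w i x) : lo (fst w (fst y i))))"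

primrec pw :: "('i, 'v) op => nat => 'i => 'v => 'v" where
  "pw y 0 i x = x"
| "pw y (Suc m) i x = pw y m (fst y i) (snd y i x)"

lemma pw_add: "additive_op y ==> pw y m i (a + b) = pw y m i a + pw y m i b"
  by (induction m arbitrary: i a b) (auto simp: additive_op_def)

lemma pw_diff: "additive_op y ==> pw y m i (a - b) = pw y m i a - pw y m i b"
  using pw_add[of y m i "a - b" b] by (simp add: algebra_simps)

lemma pw_stable: "stable {y} H ==> a : H i ==> pw y m i a : H ((fst y ^^ m) i)"
  by (induction m arbitrary: i a) (auto simp: stable_def funpow_swap1)

lemma pw_commutes:
  assumes "commutes w y lo hi" "stable {y} hi" "stable {w, y} lo" "additive_op y" "x : hi i" "!!i. sgp (lo i)"
    "stable {w} hi" "additive_op w"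
  shows "fst w ((fst y ^^ m) i) = (fst y ^^ m) (fst w i) &
    snd w ((fst y ^^ m) i) (pw y m i x) - pw y m (fst w i) (snd w i x) : lo (fst w ((fst y ^^ m) i))"
  using assms(5)
proof (induction m arbitrary: i x)
  case 0
  thus ?case using sgp_zero[OF assms(6)] by simp
next
  case (Suc m)
  have yx: "snd y i x : hi (fst y i)" using assms(2) Suc by (simp add: stable_def)
  note IH1 = conjunct1[OF Suc.IH[OF yx]] and IH2 = conjunct2[OF Suc.IH[OF yx]]
  have c: "fst w (fst y i) = fst y (fst w i)"
    "snd w (fst y i) (snd y i x) - snd y (fst w i) (snd w i x) : lo (fst w (fst y i))"
    using assms(1) Suc.prems unfolding commutes_def by blast+
  have "pw y m (fst w (fst y i)) (snd w (fst y i) (snd y i x) - snd y (fst w i) (snd w i x))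
     : lo ((fst y ^^ m) (fst w (fst y i)))"
    using assms(3) c(2) by (intro pw_stable) (auto simp: stable_def)
  hence "pw y m (fst w (fst y i)) (snd w (fst y i) (snd y i x)) - pw y m (fst y (fst w i)) (snd y (fst w i) (snd w i x))
     : lo (fst w ((fst y ^^ Suc m) i))"
    using IH1 c(1) by (simp add: pw_diff[OF assms(4)] funpow_swap1)
  moreover have "snd w ((fst y ^^ Suc m) i) (pw y (Suc m) i x) - pw y m (fst w (fst y i)) (snd w (fst y i) (snd y i x))
     : lo (fst w ((fst y ^^ Suc m) i))"
    using IH2 by (simp add: funpow_swap1)
  ultimately have "snd w ((fst y ^^ Suc m) i) (pw y (Suc m) i x) - pw y m (fst y (fst w i)) (snd y (fst w i) (snd w i x))
     : lo (fst w ((fst y ^^ Suc m) i))"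
    by (meson assms(6) sgp_trans)
  thus ?case using IH1 c(1) by (simp add: funpow_swap1)
qed

lemma addim_stable:
  assumes lo: "stable W lo" and E: "stable W E" and add: "!!w. w : W ==> additive_op w"
    and comm: "!!w. w : W ==> commutes w y lo E"
    and losg: "!!i. sgp (lo i)" and sg: "!!i. sgp (addim y E lo i)"
  shows "stable W (addim y E lo)"
proof (rule stableI)
  fix w i d assume w: "w : W" and d: "d : addim y E lo i"
  from d show "snd w i d : addim y E lo (fst w i)"
  proof (cases rule: addim_cases)
    case 1
    from stableD[OF lo w 1] show ?thesis by (rule addim_upperD)
  next
    case (2 l i' e)
    have c: "fst w (fst y i') = fst y (fst w i')"
      "snd w (fst y i') (snd y i' e) - snd y (fst w i') (snd w i' e) : lo (fst w (fst y i'))"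
      using comm[OF w] 2(4) unfolding commutes_def by blast+
    have we: "snd w i' e : E (fst w i')" using stableD[OF E w 2(4)] .
    have a: "snd w i l : addim y E lo (fst w i)"
      using stableD[OF lo w 2(2)] by (rule addim_upperD)
    have b: "snd y (fst w i') (snd w i' e) : addim y E lo (fst w i)"
      using addim_im[where y = y and lo = lo and E = E and i = "fst w i'" and e = "snd w i' e", OF losg we] c(1) 2(3)
      by simp
    have "snd w i (snd y i' e) - snd y (fst w i') (snd w i' e) : addim y E lo (fst w i)"
      unfolding 2(3)[symmetric] using c(2) by (rule addim_upperD)
    from sgp_cancel[OF sg this b] show ?thesis
      unfolding 2(1) additive_add[OF add[OF w]] using sgp_add[OF sg a] by simp
  qed
qed

text \<open>Modulo \<open>D = y hi + lo\<close>, the elements sent into \<open>H k\<close> by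
  \<open>y^m\<close> form a family \<open>L m k\<close> increasing in both \<open>m\<close> and
  \<open>k\<close>. Its rows and its diagonal stabilise; the chain is rebuilt from the
  \<open>L m k\<close> by induction on the degree, which works because \<open>y\<close> raises
  degrees.\<close>

lemma noeth_hilbert:
  fixes deg :: "'i => nat"
  assumes n: "noeth W (addim y hi lo) hi"
    and lo: "subfam (insert y W) lo hi lo" and hi: "subfam (insert y W) lo hi hi"
    and addW: "!!w. w : W ==> additive_op w" and addy: "additive_op y"
    and inj: "inj (fst y)" and deg: "!!i. deg (fst y i) > deg i"
    and comm: "!!w. w : W ==> commutes w y lo hi"
  shows "noeth (insert y W) lo hi"
proof (rule noethI)
  fix H assume H: "!!k. subfam (insert y W) lo hi (H k)" and inc: "!!k i. H k i <= H (Suc k) i"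
  have Hy: "stable {y} (H k)" "stable W (H k)" for k using subfamD(4)[OF H[of k]] by (auto simp: stable_def)
  have hiy: "stable {y} hi" "stable W hi" using subfamD(4)[OF hi] by (auto simp: stable_def)
  have loy: "stable {y} lo" "stable W lo" using subfamD(4)[OF lo] by (auto simp: stable_def)
  note losg = subfamD(1)[OF lo] and hisg = subfamD(1)[OF hi] and Hsg = subfamD(1)[OF H]
  define C where "C m k i = {e : hi i. pw y m i e : H k ((fst y ^^ m) i)}" for m k i
  define D where "D = addim y hi lo"
  define L where "L m k i = C m k i + D i" for m k i
  have Dsg: "sgp (D i)" for i unfolding D_def by (rule addim_sgp[OF inj addy losg hisg])
  have Dhi: "D i <= hi i" for i unfolding D_def
    by (rule addim_least) (use hisg subfamD(3)[OF lo] hiy in "auto simp: stable_def")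
  have pw0: "pw y m i 0 = 0" for m i using pw_diff[OF addy, of m i 0 0] by simp
  have Csg: "sgp (C m k i)" for m k i
    by (rule sgpI) (auto simp: C_def pw0 pw_diff[OF addy] sgp_zero[OF hisg] sgp_zero[OF Hsg] sgp_diff[OF hisg] sgp_diff[OF Hsg])
  have Lsub: "subfam W D hi (L m k)" for m k
  proof (rule subfamI)
    show "sgp (L m k i)" for i unfolding L_def using Csg Dsg by (rule sgp_plus)
    show "D i <= L m k i" for i unfolding L_def by (rule plus_upper2[OF sgp_zero[OF Csg]])
    show "L m k i <= hi i" for i unfolding L_def by (rule plus_least[OF hisg _ Dhi]) (auto simp: C_def)
    show "stable W (L m k)"
    proof (rule stableI)
      fix w i x assume w: "w : W" and "x : L m k i"
      then obtain c d where cd: "x = c + d" "c : C m k i" "d : D i" unfolding L_def by (auto elim: plusE)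
      have sw: "stable {w} hi" "stable {w, y} lo" "stable {w} (H k)"
        using w hiy loy Hy by (auto simp: stable_def)
      have 1: "snd w i c : C m k (fst w i)"
      proof -
        have chi: "c : hi i" and cH: "pw y m i c : H k ((fst y ^^ m) i)" using cd by (auto simp: C_def)
        from pw_commutes[OF comm[OF w] hiy(1) sw(2) addy chi losg sw(1) addW[OF w], of m]
        have e: "fst w ((fst y ^^ m) i) = (fst y ^^ m) (fst w i)"
          and "snd w ((fst y ^^ m) i) (pw y m i c) - pw y m (fst w i) (snd w i c) : H k (fst w ((fst y ^^ m) i))"
          using subfamD(2)[OF H] by blast+
        moreover have "snd w ((fst y ^^ m) i) (pw y m i c) : H k (fst w ((fst y ^^ m) i))"
          using sw(3) cH by (simp add: stable_def)
        ultimately have "pw y m (fst w i) (snd w i c) : H k ((fst y ^^ m) (fst w i))"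
          using sgp_cancel'[OF Hsg] by metis
        thus ?thesis using sw(1) chi by (simp add: C_def stable_def)
      qed
      have 2: "snd w i d : D (fst w i)"
        using addim_stable[OF loy(2) hiy(2) addW comm losg Dsg[unfolded D_def]] w cd(3)
        unfolding D_def by (rule stableD)
      show "snd w i x : L m k (fst w i)" unfolding cd(1) additive_add[OF addW[OF w]] L_def using 1 2 by blast
    qed
  qed
  have Ck: "C m k i <= C m (Suc k) i" for m k i using inc by (auto simp: C_def)
  have Cm: "C m k i <= C (Suc m) k i" for m k i
  proof
    fix e assume e: "e : C m k i"
    have "pw y (Suc m) i e = snd y ((fst y ^^ m) i) (pw y m i e)"
      by (induction m arbitrary: i e) (auto simp: funpow_swap1)
    thus "e : C (Suc m) k i" using e Hy(1)[of k] by (auto simp: C_def stable_def)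
  qed
  have Lk: "L m k i <= L m (Suc k) i" and Lm: "L m k i <= L (Suc m) k i" for m k i
    unfolding L_def using Ck Cm by (intro plus_mono; auto)+
  have stab: "EX k. ALL l>=k. L m l = L m k" for m
    by (rule noeth_stabilises[where H = "%k. L m k", OF n[folded D_def] Lsub Lk])
  have "EX k. ALL l>=k. L l l = L k k"
  proof -
    have "L k k i <= L (Suc k) (Suc k) i" for k i by (rule subset_trans[OF Lk Lm])
    thus ?thesis by (rule noeth_stabilises[where H = "%k. L k k", OF n[folded D_def] Lsub])
  qed
  then obtain k0 where k0: "!!l. l >= k0 ==> L l l = L k0 k0" by blast
  have Lkm: "L m k i <= L m' k' i" if "m <= m'" "k <= k'" for m k m' k' i
    using chain_mono_fam[of "%m. L m k", OF Lm that(1)] chain_mono_fam[of "%k. L m' k", OF Lk that(2)] by blast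
  \<comment> \<open>Beyond the diagonal index all \<open>L m l\<close> coincide, so only the
    finitely many rows \<open>m <= k0\<close> need bounds of their own.\<close>
  have big: "L m l i = L k0 k0 i" if "m >= k0" "l >= k0" for m l i
  proof
    show "L k0 k0 i <= L m l i" using Lkm that by blast
    show "L m l i <= L k0 k0 i" using Lkm[of m "max m l" l "max m l" i] k0[of "max m l"] that by auto
  qed
  from stab obtain K where K: "!!m l. l >= K m ==> L m l = L m (K m)" by metis
  define k where "k = Max (insert k0 (K ` {..k0}))"
  have kk: "k >= k0" "!!m. m <= k0 ==> k >= K m" unfolding k_def by (intro Max_ge; simp)+
  have Lstab: "L m l i = L m k i" if "l >= k" for m l i
  proof (cases "m <= k0")
    case True
    thus ?thesis using K[of m l] K[of m k] kk(2)[OF True] that by auto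
  next
    case False
    thus ?thesis using big[of m l i] big[of m k i] kk(1) that by auto
  qed
  have main: "C m l i <= C m k i" if "l >= k" for m l i
  proof (induction "deg i" arbitrary: i m rule: less_induct)
    case less
    show ?case
    proof
      fix e assume e: "e : C m l i"
      hence "e : L m l i" unfolding L_def using plus_upper1[OF sgp_zero[OF Dsg]] by blast
      hence "e : L m k i" using Lstab[OF that] by simp
      then obtain c d where cd: "e = c + d" "c : C m k i" "d : D i" unfolding L_def by (auto elim: plusE)
      have cl: "c : C m l i" using chain_mono_fam[of "%k. C m k", OF Ck that] cd(2) by blast
      have loC: "lo i <= C m j i" for j
        using pw_stable[OF loy(1), of _ i m] subfamD(3)[OF lo] subfamD(2)[OF H] by (fastforce simp: C_def)
      from cd(3)[unfolded D_def] have "d : C m k i"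
      proof (cases rule: addim_cases)
        case 1
        thus ?thesis using loC by blast
      next
        case (2 b i' e')
        have "d : C m l i" using e cl sgp_diff[OF Csg, of e m l i c] cd(1) by simp
        hence "snd y i' e' : C m l i" using 2(1,2) loC[of l] sgp_diff[OF Csg, of d m l i b] by auto
        \<comment> \<open>Dividing by \<open>y\<close> lowers the degree and adds one power of
          \<open>y\<close>; hence \<open>m\<close> is generalised in the induction.\<close>
        hence "e' : C (Suc m) l i'" using 2(3,4) by (auto simp: C_def funpow_swap1)
        moreover have "deg i' < deg i" using deg[of i'] 2(3) by simp
        ultimately have "e' : C (Suc m) k i'" using less by blast
        hence "snd y i' e' : C m k i" using 2(3) hiy(1) by (auto simp: C_def funpow_swap1 stable_def)
        thus ?thesis using 2(1,2) loC[of k] sgp_add[OF Csg] by blast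
      qed
      thus "e : C m k i" using cd sgp_add[OF Csg] by blast
    qed
  qed
  have "H l i = H k i" if "l >= k" for l i
  proof
    show "H k i <= H l i" using inc that by (rule chain_mono_fam)
    show "H l i <= H k i" using main[OF that, of 0 i] subfamD(3)[OF H] by (auto simp: C_def)
  qed
  hence "H l = H k" if "l >= k" for l using that by (intro ext) blast
  thus "EX k. ALL l>=k. H l = H k" by blast
qed

primrec addims :: "('i, 'v::ab_group_add) op list => ('i => 'v set) => ('i => 'v set) => 'i => 'v set" where
  "addims [] E lo = lo"
| "addims (y # ys) E lo = addims ys E (addim y E lo)"

lemma addims_upper: "lo k <= addims ys E lo k"
proof (induction ys arbitrary: lo)
  case (Cons y ys)
  thus ?case using addim_upper[of lo k y E] by (simp add: subset_trans)
qed simp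

lemma addims_sgp:
  assumes "!!y. y : set ys ==> inj (fst y) & additive_op y" "!!i. sgp (lo i)" "!!i. sgp (E i)"
  shows "sgp (addims ys E lo k)"
  using assms(1,2)
proof (induction ys arbitrary: lo)
  case (Cons y ys)
  thus ?case using addim_sgp[of y _ E, OF _ _ _ assms(3)] by simp
qed simp

lemma addims_im:
  assumes "!!y. y : set ys ==> inj (fst y) & additive_op y" "!!i. sgp (lo i)" "!!i. sgp (E i)"
    "y : set ys" "e : E i"
  shows "snd y i e : addims ys E lo (fst y i)"
  using assms(1,2,4)
proof (induction ys arbitrary: lo)
  case (Cons z ys)
  have sg: "sgp (addim z E lo j)" for j
    using addim_sgp[of z lo E j] Cons.prems assms(3) by simp
  show ?case
  proof (cases "y = z")
    case True
    thus ?thesis using addim_im[of lo y i e E] Cons.prems(2) assms(5) subsetD[OF addims_upper] by simp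
  next
    case False
    thus ?thesis using Cons.IH[of "addim z E lo"] Cons.prems sg by simp
  qed
qed simp

lemma addims_least:
  assumes "sgp S" "lo k <= S" "!!y i e. y : set ys ==> fst y i = k ==> e : E i ==> snd y i e : S"
  shows "addims ys E lo k <= S"
  using assms(2,3)
proof (induction ys arbitrary: lo)
  case (Cons y ys)
  have "addim y E lo k <= S" by (rule addim_least[OF assms(1)]) (use Cons.prems in auto)
  thus ?case using Cons.IH[of "addim y E lo"] Cons.prems by simp
qed simp

lemma commutes_mono: "commutes w y lo hi ==> (!!i. lo i <= lo' i) ==> commutes w y lo' hi"
  unfolding commutes_def by blast

lemma addims_stable:
  assumes "!!y. y : set ys ==> inj (fst y) & additive_op y" "!!i. sgp (lo i)" "!!i. sgp (E i)"
    and "stable W lo" and E: "stable W E" and add: "!!w. w : W ==> additive_op w"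
    and "!!w y. w : W ==> y : set ys ==> commutes w y lo E"
  shows "stable W (addims ys E lo)"
  using assms(1,2,4,7)
proof (induction ys arbitrary: lo)
  case (Cons y ys)
  have sg: "sgp (addim y E lo i)" for i by (rule addim_sgp) (use Cons.prems assms(3) in auto)
  have "stable W (addim y E lo)"
    by (rule addim_stable[OF _ E add _ _ sg]) (use Cons.prems in auto)
  moreover have "commutes w y' (addim y E lo) E" if "w : W" "y' : set ys" for w y'
    by (rule commutes_mono[OF _ addim_upper]) (use Cons.prems(4) that in auto)
  ultimately show ?case using Cons.IH[of "addim y E lo"] Cons.prems sg by simp
qed simp

text \<open>The variables are adjoined one by one. The hypothesis concerns \<open>hi\<close> modulo
  the images of all of them, and each step restores one image.\<close>

lemma noeth_hilbert_list:
  fixes deg :: "'i => nat"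
  assumes "noeth W (addims ys hi lo) hi"
    and "subfam (W Un set ys) lo hi lo" and "subfam (W Un set ys) lo hi hi"
    and add: "!!w. w : W Un set ys ==> additive_op w"
    and "!!y. y : set ys ==> inj (fst y)" and "!!y i. y : set ys ==> deg (fst y i) > deg i"
    and "!!w y. w : W Un set ys ==> y : set ys ==> commutes w y lo hi"
  shows "noeth (W Un set ys) lo hi"
  using assms
proof (induction ys arbitrary: lo)
  case (Cons y ys)
  define lo1 where "lo1 = addim y hi lo"
  note lo = Cons.prems(2) and hi = Cons.prems(3)
  have hi': "stable (W Un set ys) hi" "stable (W Un set ys) lo"
    using subfamD(4)[OF hi] subfamD(4)[OF lo] by (auto simp: stable_def)
  have add': "additive_op w" if "w : W Un set ys" for w using Cons.prems(4) that by auto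
  have comm: "commutes w y lo hi" if "w : W Un set ys" for w using Cons.prems(7)[of w y] that by auto
  have inj: "inj (fst y)" and addy: "additive_op y" using Cons.prems(4,5) by auto
  have sg: "sgp (lo1 i)" for i unfolding lo1_def
    by (rule addim_sgp[OF inj addy subfamD(1)[OF lo] subfamD(1)[OF hi]])
  have up: "lo i <= lo1 i" for i unfolding lo1_def by (rule addim_upper)
  have st: "stable (W Un set ys) lo1" unfolding lo1_def
    by (rule addim_stable[OF hi'(2,1) add' comm subfamD(1)[OF lo] sg[unfolded lo1_def]])
  have lohi: "lo1 i <= hi i" for i unfolding lo1_def
  proof (rule addim_least)
    show "sgp (hi i)" "lo i <= hi i" using subfamD(1,2)[OF hi] by auto
    fix j e assume "fst y j = i" "e : hi j"
    thus "snd y j e : hi i" using stableD[OF subfamD(4)[OF hi], of y e j] by simp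
  qed
  have comm1: "commutes w z lo1 hi" if "w : W Un set ys" "z : set ys" for w z
    by (rule commutes_mono[OF _ up]) (use Cons.prems(7) that in auto)
  have "noeth (W Un set ys) lo1 hi"
  proof (rule Cons.IH)
    show "noeth W (addims ys hi lo1) hi" using Cons.prems(1) by (simp add: lo1_def)
    show "subfam (W Un set ys) lo1 hi lo1" using sg lohi st by (auto intro!: subfamI)
    show "subfam (W Un set ys) lo1 hi hi" using subfamD(1)[OF hi] lohi hi'(1) by (auto intro!: subfamI)
  qed (use Cons.prems(4,5,6) comm1 in auto)
  hence "noeth (insert y (W Un set ys)) lo hi" unfolding lo1_def
  proof (rule noeth_hilbert[where deg = deg and W = "W Un set ys" and y = y and lo = lo and hi = hi])
    show "additive_op y" "inj (fst y)" by fact+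
    show "additive_op w" "commutes w y lo hi" if "w : W Un set ys" for w using add' comm that by blast+
    show "subfam (insert y (W Un set ys)) lo hi lo" "subfam (insert y (W Un set ys)) lo hi hi"
      using lo hi by simp_all
    show "deg i < deg (fst y i)" for i using Cons.prems(6) by auto
  qed
  thus ?case by simp
qed simp

text \<open>
  The generators of a stable subfamily have bounded degree: compare the subfamilies generated in
  degrees at most \<open>k\<close>.
\<close>

lemma noeth_generated:
  fixes deg :: "'i => nat"
  assumes n: "noeth (W Un set ys) lo hi" and mid: "subfam (W Un set ys) lo hi mid"
    and lo: "subfam (W Un set ys) lo hi lo"
    and add: "!!w. w : W Un set ys ==> additive_op w"
    and inj: "!!y. y : set ys ==> inj (fst y)" and degy: "!!y i. y : set ys ==> deg (fst y i) = Suc (deg i)"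
    and degW: "!!w i. w : W ==> deg (fst w i) = deg i"
    and comm: "!!w y. w : W ==> y : set ys ==> commutes w y lo mid"
  shows "EX k. ALL i. deg i > k --> mid i <= addims ys mid lo i"
proof -
  \<comment> \<open>\<open>F k\<close> consists of the stable subfamilies that agree with
    \<open>mid\<close> in degrees at most \<open>k\<close>, so \<open>G k\<close> is the subfamily
    generated by these degrees.\<close>
  define F where "F k = {H. subfam (W Un set ys) lo mid H & (ALL i. deg i <= k --> mid i <= H i)}" for k
  define G where "G k i = (INT H:F k. H i)" for k i
  have midF: "mid : F k" for k using mid by (auto simp: F_def subfam_def)
  have "subfam (W Un set ys) lo mid (G k)" for k
  proof (rule subfamI)
    show "sgp (G k i)" for i unfolding G_def by (rule sgpI) (auto simp: F_def subfam_def intro: sgp_zero sgp_diff)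
    show "lo i <= G k i" for i unfolding G_def by (auto simp: F_def subfam_def)
    show "G k i <= mid i" for i unfolding G_def using midF by blast
    show "stable (W Un set ys) (G k)"
    proof (rule stableI)
      fix w i x assume "w : W Un set ys" "x : G k i"
      thus "snd w i x : G k (fst w i)" unfolding G_def by (auto simp: F_def subfam_def stable_def)
    qed
  qed
  moreover have "G k i <= G (Suc k) i" for k i
  proof -
    have "F (Suc k) <= F k" unfolding F_def using le_SucI by blast
    thus ?thesis unfolding G_def by blast
  qed
  moreover have "noeth (W Un set ys) lo mid" using n by (rule noeth_mono) (use subfamD(3)[OF mid] in auto)
  ultimately have "EX k. ALL l>=k. G l = G k" by (intro noeth_stabilises)
  then obtain k where k: "!!l. l >= k ==> G l = G k" by blast
  have "mid i <= addims ys mid lo i" if di: "deg i > k" for i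
  proof -
    obtain m where m: "deg i = Suc m" using di by (cases "deg i") auto
    hence mk: "m >= k" using di by simp
    \<comment> \<open>\<open>T\<close> is \<open>mid\<close> with degree \<open>m + 1\<close> cut
      down to what \<open>ys\<close> produces from \<open>mid\<close>. It is stable and agrees with
      \<open>mid\<close> up to degree \<open>m\<close>, hence contains \<open>G m\<close>; as
      \<open>G m = G (Suc m)\<close>, nothing was lost in degree \<open>m + 1\<close>.\<close>
    define T where "T j = (if deg j = Suc m then addims ys mid lo j else mid j)" for j
    have ysok: "inj (fst y) & additive_op y" if "y : set ys" for y using that inj add by blast
    have Tmid: "addims ys mid lo j <= mid j" for j
    proof (rule addims_least)
      show "sgp (mid j)" "lo j <= mid j" using subfamD(1,2)[OF mid] by auto
      fix y i e assume "y : set ys" "fst y i = j" "e : mid i"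
      thus "snd y i e : mid j" using stableD[OF subfamD(4)[OF mid], of y e i] by simp
    qed
    have "T : F m"
    proof -
      have "subfam (W Un set ys) lo mid T"
      proof (rule subfamI)
        show "sgp (T j)" for j unfolding T_def
          using addims_sgp[OF ysok subfamD(1)[OF lo] subfamD(1)[OF mid]] subfamD(1)[OF mid] by simp
        show "lo j <= T j" for j unfolding T_def using addims_upper[of lo j ys mid] subfamD(2)[OF mid, of j] by auto
        show "T j <= mid j" for j unfolding T_def using Tmid by simp
        have stW: "stable W (addims ys mid lo)"
        proof (rule addims_stable[OF ysok subfamD(1)[OF lo] subfamD(1)[OF mid]])
          show "stable W lo" "stable W mid" using subfamD(4)[OF lo] subfamD(4)[OF mid] by (auto simp: stable_def)
        qed (use add comm in auto)
        show "stable (W Un set ys) T"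
        proof (rule stableI)
          fix w j x assume w: "w : W Un set ys" and x: "x : T j"
          have xm: "x : mid j" using x Tmid by (auto simp: T_def split: if_splits dest: subsetD)
          have wm: "snd w j x : mid (fst w j)" using stableD[OF subfamD(4)[OF mid] w xm] .
          show "snd w j x : T (fst w j)"
          proof (cases "w : set ys")
            case True
            hence "snd w j x : addims ys mid lo (fst w j)"
              by (intro addims_im[where i = j] ysok subfamD(1)[OF lo] subfamD(1)[OF mid] xm)
            thus ?thesis using wm by (simp add: T_def)
          next
            case False
            hence wW: "w : W" using w by blast
            show ?thesis
            proof (cases "deg j = Suc m")
              case True
              hence "x : addims ys mid lo j" using x by (simp add: T_def)
              from stableD[OF stW wW this] show ?thesis using True degW[OF wW] by (simp add: T_def)
            next
              case False
              thus ?thesis using wm degW[OF wW] by (simp add: T_def)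
            qed
          qed
        qed
      qed
      thus ?thesis by (auto simp: F_def T_def)
    qed
    hence "G m i <= T i" unfolding G_def by blast
    moreover have "mid i <= G (Suc m) i" unfolding G_def by (rule INT_greatest) (use m in "simp add: F_def")
    moreover have "G (Suc m) = G m" using k[of m] k[of "Suc m"] mk by simp
    ultimately show ?thesis using m by (auto simp: T_def)
  qed
  thus ?thesis by blast
qed

section \<open>Families with a grading that all operators preserve\<close>

definition slice_op :: "('i, 'v) op => ('n \<times> 'i, 'v) op"
  where "slice_op w = ((%(n, i). (n, fst w i)), (%(n, i). snd w i))"

lemma slice_op_simps [simp]: "fst (slice_op w) (n, i) = (n, fst w i)" "snd (slice_op w) (n, i) = snd w i"
  by (simp_all add: slice_op_def)

lemma slice_op_additive: "additive_op w ==> additive_op (slice_op w)"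
  by (auto simp: additive_op_def)

text \<open>A grading that no operator changes splits the family into independent slices; with
  finitely many nonzero ones, the maximum of their stabilisation indices serves all.\<close>

lemma noeth_slices:
  assumes fin: "finite B"
    and n: "!!n. n : B ==> noeth W (%i. lo (n, i)) (%i. hi (n, i))"
    and triv: "!!n i. n ~: B ==> hi (n, i) <= lo (n, i)"
  shows "noeth (slice_op ` W) lo hi"
proof (rule noethI)
  fix H assume H: "!!k. subfam (slice_op ` W) lo hi (H k)" and inc: "!!k i. H k i <= H (Suc k) i"
  have "EX k. ALL l>=k. (%i. H l (n, i)) = (%i. H k (n, i))" for n
  proof (cases "n : B")
    case True
    show ?thesis
    proof (rule noeth_stabilises[where H = "%k i. H k (n, i)", OF n[OF True]])
      show "subfam W (%i. lo (n, i)) (%i. hi (n, i)) (%i. H k (n, i))" for k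
        using H[of k] unfolding subfam_def stable_def by fastforce
    qed (rule inc)
  next
    case False
    have "H l (n, i) = lo (n, i)" for l i
      using subfamD(2,3)[OF H[of l], of "(n, i)"] triv[OF False, of i] by blast
    thus ?thesis by simp
  qed
  then obtain K where K: "!!n l. l >= K n ==> (%i. H l (n, i)) = (%i. H (K n) (n, i))" by metis
  define k where "k = Max (insert 0 (K ` B))"
  have kK: "k >= K n" if "n : B" for n unfolding k_def by (rule Max_ge) (use fin that in auto)
  have "H l (n, i) = H k (n, i)" if "l >= k" for l n i
  proof (cases "n : B")
    case True
    have "(%i. H l (n, i)) = (%i. H k (n, i))"
      using K[of n l] K[of n k] kK[OF True] that by simp
    thus ?thesis by (rule fun_cong)
  next
    case False
    thus ?thesis
      using subfamD(2,3)[OF H[of l], of "(n, i)"] subfamD(2,3)[OF H[of k], of "(n, i)"] triv[OF False, of i] by blast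
  qed
  hence "H l = H k" if "l >= k" for l using that by (intro ext) auto
  thus "EX k. ALL l>=k. H l = H k" by blast
qed

section \<open>Modules over a commutative ring\<close>

text \<open>The scalar multiplication is a parameter, since the ring acts both on itself and on
  function spaces. Submodules are sets, and a quotient module is a pair
  \<open>lo <= hi\<close>.\<close>

locale scal =
  fixes sc :: "'r::comm_ring_1 => 'v::ab_group_add => 'v"
  assumes sc_add_right: "sc a (x + y) = sc a x + sc a y"
    and sc_add_left: "sc (a + b) x = sc a x + sc b x"
    and sc_assoc: "sc a (sc b x) = sc (a * b) x"
    and sc_one: "sc 1 x = x"
begin

lemma sc_zero_right: "sc a 0 = 0" using sc_add_right[of a 0 0] by simp
lemma sc_zero_left: "sc 0 x = 0" using sc_add_left[of 0 0 x] by simp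
lemma sc_diff_right: "sc a (x - y) = sc a x - sc a y"
  using sc_add_right[of a "x - y" y] by (simp add: algebra_simps)
lemma sc_diff_left: "sc (a - b) x = sc a x - sc b x"
  using sc_add_left[of "a - b" b x] by (simp add: algebra_simps)
definition smod :: "'v set => bool"
  where "smod H \<longleftrightarrow> sgp H & (ALL c. ALL x:H. sc c x : H)"

lemma smodI: "sgp H ==> (!!c x. x : H ==> sc c x : H) ==> smod H" by (simp add: smod_def)
lemma smod_sgp: "smod H ==> sgp H" by (simp add: smod_def)
lemma smod_sc: "smod H ==> x : H ==> sc c x : H" by (simp add: smod_def)
lemma smod_0: "smod H ==> 0 : H" by (simp add: smod_def sgp_def)
lemma smod_add: "smod H ==> x : H ==> y : H ==> x + y : H" by (simp add: smod_def sgp_add)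
lemma smod_diff: "smod H ==> x : H ==> y : H ==> x - y : H" by (simp add: smod_def sgp_diff)
lemma smod_UNIV: "smod UNIV" by (simp add: smod_def sgp_UNIV)
lemma smod_triv: "smod {0}" by (simp add: smod_def sgp_def sc_zero_right)

lemma smod_plus:
  assumes "smod H" "smod K"
  shows "smod (H + K)"
proof (rule smodI)
  show "sgp (H + K)" using assms by (intro sgp_plus smod_sgp)
  fix c x assume "x : H + K"
  then obtain a b where ab: "x = a + b" "a : H" "b : K" by (rule plusE)
  show "sc c x : H + K" unfolding ab(1) sc_add_right using ab assms smod_sc by (intro plusI) auto
qed

lemma upper1: "smod K ==> H <= H + K" by (rule plus_upper1[OF smod_0])

lemma upper2: "smod H ==> K <= H + K" by (rule plus_upper2[OF smod_0])

lemma smod_Int: "smod H ==> smod K ==> smod (H Int K)"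
  by (auto simp: smod_def intro: sgp_Int)

lemma smod_image: "smod H ==> smod (sc c ` H)"
proof (rule smodI)
  assume H: "smod H"
  show "sgp (sc c ` H)" by (rule sgp_image[OF sc_diff_right smod_sgp[OF H]])
  fix d x assume "x : sc c ` H"
  then obtain a where "x = sc c a" "a : H" by blast
  hence "sc d x = sc c (sc d a)" "sc d a : H" using smod_sc[OF H] by (auto simp: sc_assoc mult.commute)
  thus "sc d x : sc c ` H" by blast
qed

lemma smod_range: "smod (range (%c. sc c g))"
  by (rule smodI[OF sgp_image[OF sc_diff_left sgp_UNIV]]) (auto simp: sc_assoc)

text \<open>For a submodule \<open>H\<close> this is the product of \<open>H\<close> with the ideal
  generated by the list, as \<open>H\<close> absorbs the coefficients.\<close>

primrec lmul :: "'r list => 'v set => 'v set" where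
  "lmul [] H = {0}"
| "lmul (a # as) H = sc a ` H + lmul as H"

lemma lmul_smod: "smod H ==> smod (lmul as H)"
  by (induction as) (auto intro: smod_triv smod_plus smod_image)

lemma lmul_mono: "H <= K ==> lmul as H <= lmul as K"
proof (induction as)
  case (Cons a as)
  hence "sc a ` H + lmul as H <= sc a ` K + lmul as K" by (intro plus_mono) auto
  thus ?case by simp
qed simp

lemma lmul_least: "sgp L ==> (!!a x. a : set as ==> x : H ==> sc a x : L) ==> lmul as H <= L"
proof (induction as)
  case (Cons a as)
  have "sc a ` H + lmul as H <= L"
    by (rule plus_least) (use Cons in auto)
  thus ?case by simp
qed (auto simp: sgp_zero)

lemma lmul_subset: "smod H ==> lmul as H <= H"
  by (rule lmul_least) (auto simp: smod_sgp smod_sc)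

lemma lmul_im: "smod H ==> a : set as ==> x : H ==> sc a x : lmul as H"
proof (induction as)
  case (Cons b as)
  show ?case
  proof (cases "a = b")
    case True
    thus ?thesis using Cons.prems plus_upper1[of "lmul as H" "sc b ` H"] smod_0[OF lmul_smod] by auto
  next
    case False
    hence "sc a x : lmul as H" using Cons by simp
    thus ?thesis
      using plus_upper2[of "sc b ` H" "lmul as H"] smod_0[OF smod_image[OF Cons.prems(1)]] by auto
  qed
qed simp

lemma lmul_plus_subset: "smod H ==> smod K ==> lmul as (H + K) <= lmul as H + lmul as K"
proof (rule lmul_least)
  assume H: "smod H" and K: "smod K"
  show "sgp (lmul as H + lmul as K)" using H K by (intro sgp_plus smod_sgp lmul_smod)
  fix a x assume "a : set as" "x : H + K"
  thus "sc a x : lmul as H + lmul as K"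
    using lmul_im[OF H] lmul_im[OF K] by (auto simp: sc_add_right intro!: plusI elim!: plusE)
qed

definition lpow :: "'r list => nat => 'v set => 'v set"
  where "lpow as n H = (lmul as ^^ n) H"

lemma lpow_0 [simp]: "lpow as 0 H = H" by (simp add: lpow_def)
lemma lpow_Suc: "lpow as (Suc n) H = lmul as (lpow as n H)" by (simp add: lpow_def)
lemma lpow_Suc2: "lpow as (Suc n) H = lpow as n (lmul as H)" by (simp add: lpow_def funpow_swap1)
lemma lpow_add: "lpow as (m + n) H = lpow as m (lpow as n H)" by (simp add: lpow_def funpow_add)

lemma lpow_smod: "smod H ==> smod (lpow as n H)"
  by (induction n) (auto simp: lpow_Suc intro: lmul_smod)

lemma lpow_mono: "H <= K ==> lpow as n H <= lpow as n K"
  by (induction n) (auto simp: lpow_Suc dest: lmul_mono)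

lemma lpow_subset: "smod H ==> lpow as n H <= H"
proof (induction n)
  case (Suc n)
  thus ?case using lmul_subset[OF lpow_smod[OF Suc.prems, of as n]] by (auto simp: lpow_Suc)
qed simp

lemma lpow_antimono: "smod H ==> m <= n ==> lpow as n H <= lpow as m H"
  using lpow_add[of as m "n - m" H] lpow_mono[OF lpow_subset, of H as m as "n - m"] by simp

lemma lpow_plus_subset: "smod H ==> smod K ==> lpow as n (H + K) <= lpow as n H + lpow as n K"
proof (induction n)
  case (Suc n)
  have "lmul as (lpow as n (H + K)) <= lmul as (lpow as n H + lpow as n K)" using Suc by (intro lmul_mono) simp
  also have "... <= lmul as (lpow as n H) + lmul as (lpow as n K)"
    using Suc.prems by (intro lmul_plus_subset lpow_smod)
  finally show ?case by (simp add: lpow_Suc)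
qed simp

primrec gspan :: "'v list => 'v set" where
  "gspan [] = {0}"
| "gspan (g # gs) = range (%c. sc c g) + gspan gs"

lemma gspan_smod: "smod (gspan gs)"
  by (induction gs) (auto intro: smod_triv smod_plus smod_range)

lemma gspan_base: "g : set gs ==> g : gspan gs"
proof (induction gs)
  case (Cons h gs)
  show ?case
  proof (cases "g = h")
    case True
    have "h : range (%c. sc c h)" using sc_one[of h] by (metis rangeI)
    from subsetD[OF upper1[OF gspan_smod[of gs]] this] show ?thesis using True by simp
  next
    case False
    hence "g : gspan gs" using Cons by simp
    thus ?thesis using plus_upper2[of "range (%c. sc c h)" "gspan gs"] smod_0[OF smod_range[of h]] by auto
  qed
qed simp

lemma gspan_least: "smod L ==> set gs <= L ==> gspan gs <= L"
proof (induction gs)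
  case (Cons g gs)
  have "range (%c. sc c g) + gspan gs <= L"
    by (rule plus_least) (use Cons in "auto simp: smod_sgp smod_sc")
  thus ?case by simp
qed (auto simp: smod_0)

text \<open>The quotient \<open>hi/lo\<close> is generated by \<open>n\<close> elements. Repetitions
  are allowed, and padding by \<open>0\<close> makes the property monotone in
  \<open>n\<close>.\<close>

definition gen :: "nat => 'v set => 'v set => bool"
  where "gen n lo hi \<longleftrightarrow> (EX gs. length gs = n & set gs <= hi & hi <= lo + gspan gs)"

lemma gen_mono_n: "gen m lo hi ==> m <= n ==> 0 : hi ==> gen n lo hi"
proof -
  assume "gen m lo hi" "m <= n" and z: "0 : hi"
  then obtain gs where gs: "length gs = m" "set gs <= hi" "hi <= lo + gspan gs" by (auto simp: gen_def)
  have "gspan gs <= gspan (gs @ replicate (n - m) 0)"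
    by (rule gspan_least[OF gspan_smod]) (auto intro: gspan_base)
  hence "hi <= lo + gspan (gs @ replicate (n - m) 0)"
    using gs(3) plus_mono[OF subset_refl] by (meson subset_trans)
  thus ?thesis
    unfolding gen_def using gs `m <= n` z by (intro exI[of _ "gs @ replicate (n - m) 0"]) auto
qed

lemma gen_mono_lo: "gen n lo hi ==> lo <= lo' ==> gen n lo' hi"
  unfolding gen_def
  apply (elim exE conjE)
  subgoal for gs using plus_mono[of lo lo' "gspan gs" "gspan gs"] by (intro exI[of _ gs]) auto
  done

lemma gspan_append: "gspan (gs @ hs) = gspan gs + gspan hs"
  by (induction gs) (auto simp: add.assoc)

lemma gen_ext:
  assumes "gen m lo mid" "gen n mid hi" "mid <= hi"
  shows "gen (m + n) lo hi"
proof -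
  from assms(1,2) obtain gs hs where g: "length gs = m" "set gs <= mid" "mid <= lo + gspan gs"
    and h: "length hs = n" "set hs <= hi" "hi <= mid + gspan hs" unfolding gen_def by blast
  have "mid + gspan hs <= (lo + gspan gs) + gspan hs" using g(3) by (rule plus_mono) simp
  hence "hi <= lo + gspan (gs @ hs)" using h(3) unfolding gspan_append by (simp add: add.assoc)
  thus ?thesis unfolding gen_def using g h assms(3) by (intro exI[of _ "gs @ hs"]) auto
qed

text \<open>A lower bound \<open>n\<close> for the length of \<open>hi/lo\<close>, witnessed by
  \<open>n\<close> strict inclusions of submodules. The rule \<open>weak\<close> adds inclusions
  that may be equalities, so bounds survive enlarging the top. Lengths themselves, possibly
  infinite, are never formed.\<close>

inductive chain :: "'v set => nat => 'v set => bool" for lo where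
  base: "smod H ==> lo <= H ==> chain lo 0 H"
| step: "chain lo n H ==> smod H' ==> H \<subset> H' ==> chain lo (Suc n) H'"
| weak: "chain lo n H ==> smod H' ==> H <= H' ==> chain lo n H'"

lemma chain_smod: "chain lo n H ==> smod H & lo <= H"
  by (induction rule: chain.induct) auto

lemma chain_lo: "chain lo n H ==> lo' <= lo ==> chain lo' n H"
  by (induction rule: chain.induct) (auto intro: chain.intros)

lemma chain_append: "chain mid n hi ==> chain lo m mid ==> chain lo (m + n) hi"
  by (induction rule: chain.induct) (auto intro: chain.intros)

text \<open>Subadditivity of length: by the modular law each strict step remains strict after
  intersecting with \<open>mid\<close> or after adding \<open>mid\<close>.\<close>

lemma chain_split:
  assumes "chain lo n hi" "smod mid" "lo <= mid"
  shows "EX m k. n <= m + k & chain lo m (hi Int mid) & chain mid k (hi + mid)"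
  using assms(1)
proof (induction rule: chain.induct)
  case (base H)
  thus ?case using assms plus_upper2[of H mid]
    by (intro exI[of _ 0]) (auto intro!: chain.base smod_Int smod_plus simp: smod_0)
next
  case (step n H H')
  then obtain m k where mk: "n <= m + k" "chain lo m (H Int mid)" "chain mid k (H + mid)" by blast
  have H: "smod H" using chain_smod step by blast
  have sm: "smod (H' Int mid)" "smod (H' + mid)" using step assms by (auto intro: smod_Int smod_plus)
  have sub: "H Int mid <= H' Int mid" "H + mid <= H' + mid" using step(3) plus_mono[OF psubset_imp_subset[OF step(3)] subset_refl] by auto
  have "H' <= H' + mid" using assms by (intro plus_upper1 smod_0)
  hence "H Int mid ~= H' Int mid | H + mid ~= H' + mid"
    using modular_cancel[of H' H mid] step H by (auto simp: smod_sgp)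
  thus ?case
  proof
    assume ne: "H Int mid ~= H' Int mid"
    have "chain lo (Suc m) (H' Int mid)" by (rule chain.step[OF mk(2) sm(1)]) (use ne sub(1) in blast)
    moreover have "chain mid k (H' + mid)" by (rule chain.weak[OF mk(3) sm(2) sub(2)])
    moreover have "Suc n <= Suc m + k" using mk(1) by simp
    ultimately show ?thesis by blast
  next
    assume ne: "H + mid ~= H' + mid"
    have "chain mid (Suc k) (H' + mid)" by (rule chain.step[OF mk(3) sm(2)]) (use ne sub(2) in blast)
    moreover have "chain lo m (H' Int mid)" by (rule chain.weak[OF mk(2) sm(1) sub(1)])
    moreover have "Suc n <= m + Suc k" using mk(1) by simp
    ultimately show ?thesis by blast
  qed
next
  case (weak n H H')
  then obtain m k where mk: "n <= m + k" "chain lo m (H Int mid)" "chain mid k (H + mid)" by blast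
  have sm: "smod (H' Int mid)" "smod (H' + mid)" using weak assms by (auto intro: smod_Int smod_plus)
  have sub: "H Int mid <= H' Int mid" "H + mid <= H' + mid" using weak(3) plus_mono[OF weak(3) subset_refl] by auto
  show ?case using mk(1) chain.weak[OF mk(2) sm(1) sub(1)] chain.weak[OF mk(3) sm(2) sub(2)] by blast
qed

text \<open>\<open>F\<close> preserves and reflects inclusions between \<open>lo\<close> and
  \<open>T\<close>, hence it preserves strict ones.\<close>

lemma chain_transfer:
  assumes "chain lo n hi" "hi <= T"
    and F: "!!H. smod H ==> lo <= H ==> H <= T ==> smod (F H) & lo' <= F H"
    and mono: "!!H H'. smod H ==> smod H' ==> lo <= H ==> H <= H' ==> H' <= T ==> F H <= F H'"
    and refl: "!!H H'. smod H ==> smod H' ==> lo <= H ==> H <= H' ==> H' <= T ==> F H' <= F H ==> H' <= H"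
  shows "chain lo' n (F hi)"
  using assms(1,2)
proof (induction rule: chain.induct)
  case (base H)
  thus ?case using F[of H] by (intro chain.base) auto
next
  case (step n H H')
  have H: "smod H" "lo <= H" "lo <= H'" "H <= T" "H <= H'"
    using chain_smod[OF step.hyps(1)] step.hyps(3) step.prems by auto
  note m = mono[OF H(1) step.hyps(2) H(2,5) step.prems] and r = refl[OF H(1) step.hyps(2) H(2,5) step.prems]
  have "F H \<subset> F H'" using m r step.hyps(3) by blast
  from chain.step[OF step.IH[OF H(4)] _ this] show ?case using F[OF step.hyps(2) H(3) step.prems] by blast
next
  case (weak n H H')
  have H: "smod H" "lo <= H" "lo <= H'" "H <= T"
    using chain_smod[OF weak.hyps(1)] weak.hyps(3) weak.prems by auto
  note m = mono[OF H(1) weak.hyps(2) H(2) weak.hyps(3) weak.prems]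
  from chain.weak[OF weak.IH[OF H(4)] _ m] show ?case using F[OF weak.hyps(2) H(3) weak.prems] by blast
qed

text \<open>Generators are chosen greedily: while \<open>hi\<close> is not exhausted, a new element
  yields a strict step, and the bound on chains ends the process.\<close>

lemma chain_bound_gen:
  assumes "!!n. chain lo n hi ==> n <= k" "smod lo" "smod hi" "lo <= hi"
  shows "gen k lo hi"
proof -
  define P where "P m \<longleftrightarrow> (EX gs. length gs = m & set gs <= hi & chain lo m (lo + gspan gs))" for m
  have "P 0" unfolding P_def using assms by (auto intro!: chain.base)
  have le: "m <= k" if "P m" for m
  proof -
    obtain gs where gs: "set gs <= hi" "chain lo m (lo + gspan gs)" using `P m` P_def by blast
    have "lo + gspan gs <= hi" using gs assms by (intro plus_least gspan_least smod_sgp) auto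
    hence "chain lo m hi" using gs assms by (blast intro: chain.weak)
    thus ?thesis by (rule assms(1))
  qed
  define m where "m = (GREATEST m. P m)"
  have Pm: "P m" unfolding m_def using `P 0` le by (rule GreatestI_nat)
  have max: "n <= m" if "P n" for n unfolding m_def using that le by (rule Greatest_le_nat)
  obtain gs where gs: "length gs = m" "set gs <= hi" "chain lo m (lo + gspan gs)" using Pm P_def by blast
  have "hi <= lo + gspan gs"
  proof (rule ccontr)
    assume "~ ?thesis"
    then obtain x where x: "x : hi" "x ~: lo + gspan gs" by blast
    have "gspan gs <= gspan (x # gs)" by (rule gspan_least[OF gspan_smod]) (auto intro!: gspan_base simp del: gspan.simps)
    hence 1: "lo + gspan gs <= lo + gspan (x # gs)" by (intro plus_mono subset_refl)
    have "x : lo + gspan (x # gs)"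
      using subsetD[OF upper2[OF assms(2)] gspan_base[of x "x # gs"]] by simp
    hence "lo + gspan gs \<subset> lo + gspan (x # gs)" using 1 x by blast
    hence "chain lo (Suc m) (lo + gspan (x # gs))"
      using gs(3) assms by (intro chain.step[OF gs(3)] smod_plus gspan_smod)
    hence "P (Suc m)" unfolding P_def using gs x by (intro exI[of _ "x # gs"]) auto
    thus False using max by fastforce
  qed
  hence "gen m lo hi" unfolding gen_def using gs by blast
  thus ?thesis using gen_mono_n le[OF Pm] assms smod_0 by blast
qed

end

lemma gspan_semilinear:
  fixes sc :: "'r::comm_ring_1 => 'v::ab_group_add => 'v" and sc' :: "'s::comm_ring_1 => 'u::ab_group_add => 'u"
  assumes sc: "scal sc" "scal sc'" and F: "!!x y. F (x + y) = F x + F y" "!!a x. F (sc a x) = sc' (f a) (F x)"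
  shows "F ` scal.gspan sc gs <= scal.gspan sc' (map F gs)"
proof -
  interpret a: scal sc by fact
  interpret b: scal sc' by fact
  note sm = b.gspan_smod[of "map F gs"]
  have d: "F (x - y) = F x - F y" for x y using F(1)[of "x - y" y] by (simp add: algebra_simps)
  have "a.gspan gs <= {x. F x : b.gspan (map F gs)}"
  proof (rule a.gspan_least[OF a.smodI[OF sgp_vimage[OF d b.smod_sgp[OF sm]]]])
    show "sc c x : {x. F x : b.gspan (map F gs)}" if "x : {x. F x : b.gspan (map F gs)}" for c x
      using that b.smod_sc[OF sm] by (simp add: F(2))
  qed (auto intro: b.gspan_base)
  thus ?thesis by blast
qed

lemma lpow_semilinear:
  fixes sc :: "'r::comm_ring_1 => 'v::ab_group_add => 'v" and sc' :: "'s::comm_ring_1 => 'u::ab_group_add => 'u"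
  assumes sc: "scal sc" "scal sc'" and F: "!!x y. F (x + y) = F x + F y" "!!a x. F (sc a x) = sc' (f a) (F x)"
    and H: "F ` H <= H'" "scal.smod sc' H'"
  shows "F ` scal.lpow sc as n H <= scal.lpow sc' (map f as) n H'"
proof (induction n)
  case 0
  show ?case using H(1) by (simp add: scal.lpow_0[OF sc(1)] scal.lpow_0[OF sc(2)])
next
  case (Suc n)
  interpret a: scal sc by fact
  interpret b: scal sc' by fact
  note sm = b.lpow_smod[OF H(2), of "map f as"]
  have d: "F (x - y) = F x - F y" for x y using F(1)[of "x - y" y] by (simp add: algebra_simps)
  have "a.lmul as (a.lpow as n H) <= {x. F x : b.lpow (map f as) (Suc n) H'}"
  proof (rule a.lmul_least[OF sgp_vimage[OF d b.smod_sgp[OF sm]]])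
    fix a x assume "a : set as" "x : a.lpow as n H"
    thus "sc a x : {x. F x : b.lpow (map f as) (Suc n) H'}"
      unfolding b.lpow_Suc mem_Collect_eq F(2) using Suc by (intro b.lmul_im sm) auto
  qed
  thus ?case unfolding a.lpow_Suc by blast
qed

lemmas lpow_linear = lpow_semilinear[where f = "%a. a", unfolded list.map_ident]

lemma lpow_linear_image:
  fixes sc :: "'r::comm_ring_1 => 'v::ab_group_add => 'v" and sc' :: "'r => 'u::ab_group_add => 'u"
  assumes sc: "scal sc" "scal sc'" and F: "!!x y. F (x + y) = F x + F y" "!!a x. F (sc a x) = sc' a (F x)"
    and H: "scal.smod sc H"
  shows "scal.lpow sc' as n (F ` H) <= F ` scal.lpow sc as n H"
proof (induction n)
  case 0
  show ?case by (simp add: scal.lpow_0[OF sc(1)] scal.lpow_0[OF sc(2)])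
next
  case (Suc n)
  interpret a: scal sc by fact
  interpret b: scal sc' by fact
  note sm = a.lpow_smod[OF H, of as]
  have d: "F (x - y) = F x - F y" for x y using F(1)[of "x - y" y] by (simp add: algebra_simps)
  show ?case unfolding b.lpow_Suc
  proof (rule b.lmul_least[OF sgp_image[OF d a.smod_sgp[OF sm]]])
    fix a x assume a: "a : set as" and "x : b.lpow as n (F ` H)"
    then obtain u where u: "x = F u" "u : a.lpow as n H" using Suc by blast
    show "sc' a x : F ` a.lpow as (Suc n) H"
      unfolding u(1) F(2)[symmetric] a.lpow_Suc by (intro imageI a.lmul_im sm a u(2))
  qed
qed

text \<open>Submodules for \<open>rs\<close> are the ideals of the ring; \<open>vs\<close> is the
  free module of functions with pointwise scalars.\<close>

global_interpretation rs: scal "(*) :: 'r::comm_ring_1 => 'r => 'r"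
  by standard (simp_all add: algebra_simps)

global_interpretation vs: scal "%(c::'r::comm_ring_1) (v::'x => 'r) x. c * v x"
  by standard (simp_all add: algebra_simps fun_eq_iff)

text \<open>The quotient by \<open>q\<close> is local with maximal ideal generated by
  \<open>as\<close>, up to properness of that ideal.\<close>

definition locl :: "'r::comm_ring_1 set => 'r list => bool"
  where "locl q as \<longleftrightarrow> (ALL c. c : q + rs.gspan as | (EX u. u * c - 1 : q))"

text \<open>The ideal generated by \<open>as\<close> lies in the Jacobson radical modulo
  \<open>q\<close>.\<close>

definition jac :: "'r::comm_ring_1 set => 'r list => bool"
  where "jac q as \<longleftrightarrow> (ALL c:rs.gspan as. EX u. u * (1 - c) - 1 : q)"

context scal
begin

text \<open>\<open>q\<close> annihilates \<open>hi/lo\<close>, which makes it a module over the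
  quotient by \<open>q\<close>; this is how rings other than the ambient one enter.\<close>

definition killed :: "'r set => 'v set => 'v set => bool"
  where "killed q lo hi \<longleftrightarrow> (ALL c:q. ALL x:hi. sc c x : lo)"

lemma killed_mono: "killed q lo hi ==> lo <= lo' ==> hi' <= hi ==> killed q lo' hi'"
  unfolding killed_def by blast

lemma gspan_killed:
  assumes "smod lo" "lmul as hi <= lo" "c : rs.gspan as" "x : hi" "smod hi"
  shows "sc c x : lo"
  using assms(2,3)
proof (induction as arbitrary: c)
  case Nil
  thus ?case using assms smod_0 by (simp add: sc_zero_left)
next
  case (Cons a as)
  have sub: "sc a ` hi <= lo" "lmul as hi <= lo"
    using Cons.prems(1) upper1[OF lmul_smod[OF assms(5)], of "sc a ` hi" as]
      upper2[OF smod_image[OF assms(5)], of "lmul as hi" a] by auto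
  from Cons.prems(2) obtain b d where c: "c = b * a + d" "d : rs.gspan as" by (auto elim!: plusE)
  have "sc a x : lo" using sub(1) assms(4) by blast
  hence "sc b (sc a x) : lo" by (rule smod_sc[OF assms(1)])
  moreover have "sc d x : lo" by (rule Cons.IH[OF sub(2) c(2)])
  ultimately show ?case using smod_add[OF assms(1)] by (simp add: c(1) sc_add_left sc_assoc)
qed

lemma lmul_range: "lmul as (range (%c. sc c g)) <= (%c. sc c g) ` rs.gspan as"
proof (rule lmul_least)
  show "sgp ((%c. sc c g) ` rs.gspan as)" by (rule sgp_image[OF sc_diff_left rs.smod_sgp[OF rs.gspan_smod]])
  fix a x assume a: "a : set as" and "x : range (%c. sc c g)"
  then obtain c where c: "x = sc c g" by blast
  have "c * a : rs.gspan as" using rs.smod_sc[OF rs.gspan_smod rs.gspan_base[OF a]] .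
  thus "sc a x : (%c. sc c g) ` rs.gspan as" unfolding c sc_assoc by (metis imageI mult.commute)
qed

text \<open>One generator \<open>g\<close> is removed at a time: \<open>(1 - c) g\<close> is
  expressed by the others modulo \<open>H\<close>, with \<open>c\<close> in the ideal of
  \<open>as\<close>, and \<open>1 - c\<close> is a unit modulo \<open>q\<close>.\<close>

lemma nakayama:
  assumes "gen n H hi" and H: "smod H" and hi: "smod hi" and sub: "hi <= H + lmul as hi"
    and killed: "killed q H hi" and jac: "jac q as"
  shows "hi <= H"
  using assms(1)
proof (induction n)
  case 0
  thus ?case by (auto simp: gen_def)
next
  case (Suc n)
  then obtain gs0 where gs0: "length gs0 = Suc n" "set gs0 <= hi" "hi <= H + gspan gs0" by (auto simp: gen_def)
  obtain g gs where g: "gs0 = g # gs" using gs0(1) by (cases gs0) auto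
  define K where "K = H + gspan gs"
  have K: "smod K" unfolding K_def by (intro smod_plus H gspan_smod)
  have HK: "H <= K" unfolding K_def by (rule upper1[OF gspan_smod])
  have sK: "gspan gs <= K" unfolding K_def by (rule upper2[OF H])
  have gh: "g : hi" using gs0(2) g by simp
  have "lmul as hi <= lmul as (H + gspan gs0)" by (rule lmul_mono[OF gs0(3)])
  also have "... <= lmul as H + lmul as (gspan gs0)" by (rule lmul_plus_subset[OF H gspan_smod])
  also have "... <= lmul as H + (lmul as (range (%c. sc c g)) + lmul as (gspan gs))"
    using plus_mono[OF subset_refl lmul_plus_subset[OF smod_range gspan_smod]] unfolding g by simp
  also have "... <= H + ((%c. sc c g) ` rs.gspan as + gspan gs)"
    by (intro plus_mono lmul_subset H gspan_smod lmul_range)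
  finally have "g : H + (H + ((%c. sc c g) ` rs.gspan as + gspan gs))"
    using sub gh plus_mono[OF subset_refl] by blast
  then obtain h r where hr: "g = h + r" "h : H" "r : H + ((%c. sc c g) ` rs.gspan as + gspan gs)" by (rule plusE)
  from hr(3) obtain h' s where hs: "r = h' + s" "h' : H" "s : (%c. sc c g) ` rs.gspan as + gspan gs" by (rule plusE)
  from hs(3) obtain z k where zk: "s = z + k" "z : (%c. sc c g) ` rs.gspan as" "k : gspan gs" by (rule plusE)
  from zk(2) obtain c where "z = sc c g" "c : rs.gspan as" by blast
  with hr hs zk have e: "g = h + (h' + (sc c g + k))" "h : H" "h' : H" "c : rs.gspan as" "k : gspan gs" by auto
  have "sc (1 - c) g = h + h' + k" using e(1) by (simp add: sc_diff_left sc_one algebra_simps)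
  hence 1: "sc (1 - c) g : K" using e smod_add[OF K] HK sK by (metis subsetD)
  obtain u where u: "u * (1 - c) - 1 : q" using jac e(4) unfolding jac_def by blast
  have "sc (u * (1 - c) - 1) g : K" using killed u gh HK unfolding killed_def by blast
  hence "sc (u * (1 - c)) g - g : K" by (simp add: sc_diff_left sc_one)
  moreover have "sc (u * (1 - c)) g : K" using smod_sc[OF K 1, of u] by (simp add: sc_assoc)
  ultimately have gK: "g : K" using sgp_cancel'[OF smod_sgp[OF K]] by blast
  have "H + gspan gs0 <= K" unfolding g gspan.simps
  proof (intro plus_least smod_sgp K HK sK)
    show "range (%c. sc c g) <= K" using smod_sc[OF K gK] by blast
  qed
  hence "hi <= H + gspan gs" using gs0(3) unfolding K_def by blast
  moreover have "length gs = n" "set gs <= hi" using gs0 g by auto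
  ultimately have "gen n H hi" unfolding gen_def by blast
  thus ?case by (rule Suc.IH)
qed

section \<open>Noetherian modules\<close>

definition scop :: "'r => ('i, 'v) op" where "scop c = (id, %_. sc c)"

lemma scop_simps [simp]: "fst (scop c) i = i" "snd (scop c) i x = sc c x"
  by (simp_all add: scop_def)

lemma scop_additive: "additive_op (scop c)"
  by (simp add: additive_op_def sc_add_right)

text \<open>A module is a family over a one-point index set whose operators are the scalars, so the
  results on families apply.\<close>

definition rno :: "'v set => 'v set => bool"
  where "rno lo hi \<longleftrightarrow> noeth (range scop) (%_::unit. lo) (%_. hi)"

lemma subfam_scop: "subfam (range scop) (%_. lo) (%_. hi) (%_. H) \<longleftrightarrow> smod H & lo <= H & H <= hi"
  by (auto simp: subfam_def stable_def smod_def)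

lemma rno_acc:
  assumes "rno lo hi" "!!k::nat. smod (F k)" "!!k. lo <= F k" "!!k. F k <= hi" "!!k. F k <= F (Suc k)"
  shows "EX k. ALL l>=k. F l = F k"
proof -
  have "EX k. ALL l>=k. (%_::unit. F l) = (%_. F k)"
    by (rule noeth_stabilises[where H = "%k _. F k", OF assms(1)[unfolded rno_def]])
      (use assms(2-5) in "auto simp: subfam_scop")
  thus ?thesis by (simp add: fun_eq_iff)
qed

lemma rno_mono: "rno lo hi ==> lo <= lo' ==> hi' <= hi ==> rno lo' hi'"
  unfolding rno_def by (erule noeth_mono) auto

lemma rno_gen:
  assumes "rno lo hi" "smod lo" "smod hi" "lo <= hi"
  shows "EX n. gen n lo hi"
proof (rule ccontr)
  assume "~ ?thesis"
  hence ex: "EX x. x : hi & x ~: lo + gspan gs" if "set gs <= hi" for gs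
    using that unfolding gen_def by blast
  define nx where "nx gs = (SOME x. x : hi & x ~: lo + gspan gs)" for gs
  have nx: "nx gs : hi" "nx gs ~: lo + gspan gs" if "set gs <= hi" for gs
    using someI_ex[OF ex[OF that]] unfolding nx_def by auto
  define G where "G k = ((%gs. nx gs # gs) ^^ k) []" for k
  have GS: "G (Suc k) = nx (G k) # G k" for k by (simp add: G_def)
  have Gh: "set (G k) <= hi" for k
  proof (induction k)
    case (Suc k)
    thus ?case using nx(1) by (simp add: GS)
  qed (simp add: G_def)
  have "EX k. ALL l>=k. lo + gspan (G l) = lo + gspan (G k)"
  proof (rule rno_acc[OF assms(1)])
    show "smod (lo + gspan (G k))" for k by (intro smod_plus assms gspan_smod)
    show "lo <= lo + gspan (G k)" for k by (rule upper1[OF gspan_smod])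
    show "lo + gspan (G k) <= hi" for k by (intro plus_least smod_sgp assms gspan_least Gh)
    show "lo + gspan (G k) <= lo + gspan (G (Suc k))" for k
      unfolding GS by (intro plus_mono subset_refl gspan_least gspan_smod) (auto intro!: gspan_base simp del: gspan.simps)
  qed
  then obtain k where "lo + gspan (G (Suc k)) = lo + gspan (G k)" by (meson le_SucI order_refl)
  moreover have "nx (G k) : lo + gspan (G (Suc k))"
    using subsetD[OF upper2[OF assms(2)] gspan_base[of "nx (G k)" "G (Suc k)"]] by (simp add: GS)
  ultimately show False using nx(2)[OF Gh] by blast
qed

definition linear_op :: "('i, 'v) op => bool"
  where "linear_op w \<longleftrightarrow> additive_op w & (ALL i c x. snd w i (sc c x) = sc c (snd w i x))"

lemma linear_additive: "linear_op w ==> additive_op w" by (simp add: linear_op_def)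

lemma scop_linear: "linear_op (scop c)"
  by (simp add: linear_op_def scop_additive sc_assoc mult.commute)

definition yop :: "'r => (nat \<times> 'i, 'v) op"
  where "yop a = ((%(r, i). (Suc r, i)), (%_. sc a))"

lemma yop_simps [simp]: "fst (yop a) (r, i) = (Suc r, i)" "snd (yop a) p x = sc a x"
  by (simp_all add: yop_def)

lemma yop_inj: "inj (fst (yop a))"
  by (rule injI) (auto simp: yop_def split: prod.splits)

lemma yop_additive: "additive_op (yop a)"
  by (simp add: additive_op_def sc_add_right)

text \<open>The Rees family has the component \<open>(as)^r hi + lo\<close> in degree
  \<open>r\<close>. Modulo the images of the operators \<open>yop a\<close> only degree
  \<open>0\<close> survives, where it is \<open>hi/lo\<close>; Hilbert's basis theorem adjoins these
  operators.\<close>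

lemma noeth_rees:
  fixes as :: "'r list" and W :: "('i, 'v) op set"
  assumes n: "noeth W lo hi" and lo: "subfam W lo hi lo" and hi: "subfam W lo hi hi"
    and smlo: "!!i. smod (lo i)" and smhi: "!!i. smod (hi i)" and lin: "ALL w:W. linear_op w"
  defines "loR \<equiv> %(r::nat, i). lo i" and "hiR \<equiv> %(r, i). lpow as r (hi i) + lo i"
    and "WR \<equiv> slice_op ` W Un set (map yop as)"
  shows "noeth WR loR hiR" "subfam WR loR hiR loR" "subfam WR loR hiR hiR"
    "!!w. w : WR ==> linear_op w"
    "!!w a. w : WR ==> a : set as ==> commutes w (yop a) loR hiR"
proof -
  have loR [simp]: "loR (r, i) = lo i" and hiR [simp]: "hiR (r, i) = lpow as r (hi i) + lo i" for r i
    by (simp_all add: loR_def hiR_def)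
  have smloR: "smod (loR p)" for p by (cases p) (simp add: smlo)
  have smhiR: "smod (hiR p)" for p by (cases p) (simp add: smod_plus lpow_smod smlo smhi)
  have lohi: "loR p <= hiR p" for p
    by (cases p) (simp add: plus_upper2 smod_0[OF lpow_smod[OF smhi]])
  show lin': "linear_op w" if "w : WR" for w
    using that unfolding WR_def
  proof
    assume "w : slice_op ` W"
    thus ?thesis using lin by (auto simp: linear_op_def slice_op_additive)
  next
    assume "w : set (map yop as)"
    thus ?thesis by (auto simp: linear_op_def yop_additive sc_assoc mult.commute)
  qed
  show comm: "commutes w (yop a) loR hiR" if "w : WR" "a : set as" for w a
    using that lin'[OF that(1)] smod_0[OF smloR] unfolding WR_def
    by (auto simp: commutes_def linear_op_def)
  have stlo: "stable WR loR"
  proof (rule stableI)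
    fix w p x assume "w : WR" "x : loR p"
    thus "snd w p x : loR (fst w p)"
      using stableD[OF subfamD(4)[OF lo]] smod_sc[OF smlo] by (cases p) (auto simp: WR_def)
  qed
  have sthi: "stable WR hiR"
  proof (rule stableI)
    fix w p x assume w: "w : WR" and x: "x : hiR p"
    obtain r i where p: "p = (r, i)" by (cases p)
    from x p obtain a b where ab: "x = a + b" "a : lpow as r (hi i)" "b : lo i" by (auto elim!: plusE)
    from w show "snd w p x : hiR (fst w p)" unfolding WR_def
    proof
      assume "w : slice_op ` W"
      then obtain v where v: "w = slice_op v" "v : W" by blast
      have lv: "snd v i (x + y) = snd v i x + snd v i y" "snd v i (sc c x) = sc c (snd v i x)" for x y c
        using lin[rule_format, OF v(2)] by (auto simp: linear_op_def additive_op_def)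
      have "snd v i ` lpow as r (hi i) <= lpow as r (hi (fst v i))"
        by (rule lpow_linear[OF scal_axioms scal_axioms lv _ smhi]) (use stableD[OF subfamD(4)[OF hi] v(2)] in blast)
      hence "snd v i a : lpow as r (hi (fst v i))" using ab(2) by blast
      moreover have "snd v i b : lo (fst v i)" by (rule stableD[OF subfamD(4)[OF lo] v(2) ab(3)])
      ultimately show ?thesis by (auto simp: v(1) p ab(1) lv(1) intro!: plusI)
    next
      assume "w : set (map yop as)"
      then obtain c where c: "w = yop c" "c : set as" by auto
      have "sc c a : lpow as (Suc r) (hi i)" using lmul_im[OF lpow_smod[OF smhi] c(2) ab(2)] by (simp add: lpow_Suc)
      moreover have "sc c b : lo i" using smod_sc[OF smlo ab(3)] .
      ultimately show ?thesis by (auto simp: c(1) p ab(1) sc_add_right intro!: plusI)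
    qed
  qed
  show slo: "subfam WR loR hiR loR" by (rule subfamI) (use smod_sgp[OF smloR] lohi stlo in auto)
  show shi: "subfam WR loR hiR hiR" by (rule subfamI) (use smod_sgp[OF smhiR] lohi sthi in auto)
  have yok: "inj (fst y) & additive_op y" if "y : set (map yop as)" for y
    using that yop_inj yop_additive by auto
  have base: "noeth (slice_op ` W) (addims (map yop as) hiR loR) hiR"
  proof (rule noeth_slices[where B = "{0}"])
    fix n :: nat assume "n : {0}"
    hence n0: "n = 0" by simp
    show "noeth W (%i. addims (map yop as) hiR loR (n, i)) (%i. hiR (n, i))"
    proof (rule noeth_mono[OF n subset_refl])
      show "lo i <= addims (map yop as) hiR loR (n, i)" for i
        using addims_upper[of loR "(n, i)" "map yop as" hiR] by simp
      show "hiR (n, i) <= hi i" for i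
        by (simp add: n0) (rule plus_least[OF smod_sgp[OF smhi] subset_refl subfamD(2)[OF hi]])
    qed
  next
    fix n :: nat and i assume "n ~: {0}"
    then obtain r where r: "n = Suc r" by (cases n) auto
    have sg: "sgp (addims (map yop as) hiR loR (n, i))"
      by (rule addims_sgp[OF yok smod_sgp[OF smloR] smod_sgp[OF smhiR]])
    have im: "sc a x : addims (map yop as) hiR loR (n, i)" if "a : set as" "x : hiR (r, i)" for a x
      using addims_im[where y = "yop a" and ys = "map yop as" and i = "(r, i)" and E = hiR and lo = loR,
        OF yok smod_sgp[OF smloR] smod_sgp[OF smhiR] _ that(2)] that(1) by (simp add: r)
    have "lmul as (lpow as r (hi i)) <= addims (map yop as) hiR loR (n, i)"
    proof (rule lmul_least[OF sg im])
      fix a x assume "x : lpow as r (hi i)"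
      thus "x : hiR (r, i)" using upper1[OF smlo, of "lpow as r (hi i)" i] by auto
    qed
    moreover have "lo i <= addims (map yop as) hiR loR (n, i)"
      using addims_upper[of loR "(n, i)" "map yop as" hiR] by simp
    ultimately show "hiR (n, i) <= addims (map yop as) hiR loR (n, i)"
      using plus_least[OF sg] by (simp add: r lpow_Suc)
  qed simp
  show "noeth WR loR hiR" unfolding WR_def
  proof (rule noeth_hilbert_list[where deg = fst, OF base])
    show "subfam (slice_op ` W Un set (map yop as)) loR hiR loR" "subfam (slice_op ` W Un set (map yop as)) loR hiR hiR"
      using slo shi unfolding WR_def .
    show "additive_op w" if "w : slice_op ` W Un set (map yop as)" for w
      using lin'[unfolded WR_def, OF that] by (rule linear_additive)
    show "inj (fst y)" if "y : set (map yop as)" for y using yok[OF that] by blast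
    show "fst p < fst (fst y p)" if "y : set (map yop as)" for y p using that by (cases p) auto
    show "commutes w y loR hiR" if "w : slice_op ` W Un set (map yop as)" "y : set (map yop as)" for w y
      using comm[unfolded WR_def, OF that(1)] that(2) by auto
  qed
qed

text \<open>The trace of \<open>mid\<close> on the Rees family is a stable subfamily, hence
  generated in bounded Rees degree. The exponent \<open>k\<close> is the same for all
  \<open>i\<close>, as is needed when \<open>i\<close> contains the cohomological degree.\<close>

lemma artin_rees:
  fixes W :: "('i, 'v) op set"
  assumes n: "noeth W lo hi" and lo: "subfam W lo hi lo" and hi: "subfam W lo hi hi" and mid: "subfam W lo hi mid"
    and smlo: "!!i. smod (lo i)" and smhi: "!!i. smod (hi i)" and smmid: "!!i. smod (mid i)"
    and lin: "ALL w:W. linear_op w"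
  shows "EX k. ALL m i. mid i Int (lpow as (k + m) (hi i) + lo i) <= lpow as m (mid i) + lo i"
proof -
  define loR where "loR = (%(r::nat, i). lo i)"
  define hiR where "hiR = (%(r, i). lpow as r (hi i) + lo i)"
  define midR where "midR = (%(r, i). mid i Int (lpow as r (hi i) + lo i))"
  define WR :: "(nat \<times> 'i, 'v) op set" where "WR = slice_op ` W Un set (map yop as)"
  note R = noeth_rees[where as = as, OF n lo hi smlo smhi lin, folded loR_def hiR_def WR_def]
  have loR [simp]: "loR (r, i) = lo i" and hiR [simp]: "hiR (r, i) = lpow as r (hi i) + lo i"
    and midR [simp]: "midR (r, i) = mid i Int (lpow as r (hi i) + lo i)" for r i
    by (simp_all add: loR_def hiR_def midR_def)
  have smhiR: "smod (lpow as r (hi i) + lo i)" for r i by (intro smod_plus lpow_smod smlo smhi)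
  have lohiR: "lo i <= lpow as r (hi i) + lo i" for r i by (rule upper2[OF lpow_smod[OF smhi]])
  have smmidR: "smod (midR p)" for p by (cases p) (simp add: smod_Int smmid smhiR)
  have subR: "subfam WR loR hiR midR"
  proof (rule subfamI)
    show "sgp (midR p)" for p by (rule smod_sgp[OF smmidR])
    show "loR p <= midR p" for p using subfamD(2)[OF mid] lohiR by (cases p) auto
    show "midR p <= hiR p" for p by (cases p) auto
    show "stable WR midR"
    proof (rule stableI)
      fix w p x assume w: "w : WR" and x: "x : midR p"
      obtain r i where p: "p = (r, i)" by (cases p)
      have "snd w p x : hiR (fst w p)" by (rule stableD[OF subfamD(4)[OF R(3)] w]) (use x p in auto)
      moreover have "snd w p x : mid (snd (fst w p))"
        using w stableD[OF subfamD(4)[OF mid]] smod_sc[OF smmid] x p unfolding WR_def by auto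
      ultimately show "snd w p x : midR (fst w p)" by (cases "fst w p") auto
    qed
  qed
  have "EX k. ALL p. fst p > k --> midR p <= addims (map yop as) midR loR p"
  proof (rule noeth_generated[where deg = fst and W = "slice_op ` W" and hi = hiR], unfold WR_def[symmetric])
    show "commutes w y loR midR" if "w : slice_op ` W" "y : set (map yop as)" for w y
    proof -
      have "w : WR" using that by (simp add: WR_def)
      with R(5)[OF this] that(2) subfamD(3)[OF subR] show ?thesis unfolding commutes_def by fastforce
    qed
    show "additive_op w" if "w : WR" for w using R(4)[OF that] by (rule linear_additive)
    show "inj (fst y)" if "y : set (map yop as)" for y using that yop_inj by auto
  qed (use R(1,2) subR in auto)
  then obtain k where k: "!!r i. r > k ==> midR (r, i) <= addims (map yop as) midR loR (r, i)" by auto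
  have ar: "mid i Int (lpow as (Suc r) (hi i) + lo i) <= lmul as (mid i Int (lpow as r (hi i) + lo i)) + lo i"
    if "r >= k" for r i
  proof -
    have "addims (map yop as) midR loR (Suc r, i) <= lmul as (midR (r, i)) + lo i"
    proof (rule addims_least)
      show "sgp (lmul as (midR (r, i)) + lo i)" by (intro sgp_plus smod_sgp lmul_smod smmidR smlo)
      show "loR (Suc r, i) <= lmul as (midR (r, i)) + lo i"
        using upper2[OF lmul_smod[OF smmidR[of "(r, i)"]], of "lo i" as] by simp
      fix y p e assume y: "y : set (map yop as)" and p: "fst y p = (Suc r, i)" and e: "e : midR p"
      obtain a where a: "y = yop a" "a : set as" using y by auto
      have pp: "p = (r, i)" using p a by (cases p) auto
      have "sc a e : lmul as (midR (r, i))" using lmul_im[OF smmidR a(2) e] unfolding pp .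
      hence "sc a e : lmul as (midR (r, i)) + lo i" using upper1[OF smlo] by blast
      thus "snd y p e : lmul as (midR (r, i)) + lo i" using a by simp
    qed
    thus ?thesis using k[of "Suc r" i] that by auto
  qed
  have "mid i Int (lpow as (k + m) (hi i) + lo i) <= lpow as m (mid i) + lo i" for m i
  proof (induction m)
    case 0
    thus ?case using upper1[OF smlo, of "mid i"] by auto
  next
    case (Suc m)
    have "mid i Int (lpow as (k + Suc m) (hi i) + lo i) <= lmul as (mid i Int (lpow as (k + m) (hi i) + lo i)) + lo i"
      using ar[of "k + m" i] by simp
    also have "... <= lmul as (lpow as m (mid i) + lo i) + lo i" by (intro plus_mono lmul_mono Suc.IH subset_refl)
    also have "... <= (lmul as (lpow as m (mid i)) + lmul as (lo i)) + lo i"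
      by (intro plus_mono subset_refl lmul_plus_subset lpow_smod smlo smmid)
    also have "... = lpow as (Suc m) (mid i) + (lmul as (lo i) + lo i)" by (simp add: lpow_Suc add.assoc)
    also have "... <= lpow as (Suc m) (mid i) + lo i"
      by (intro plus_mono subset_refl plus_least smod_sgp smlo lmul_subset)
    finally show ?case .
  qed
  thus ?thesis by blast
qed

lemma artin_rees_single:
  assumes "rno lo hi" "smod lo" "smod hi" "smod mid" "lo <= mid" "mid <= hi"
  shows "EX k. ALL m. mid Int (lpow as (k + m) hi + lo) <= lpow as m mid + lo"
proof -
  have "EX k. ALL m (i::unit). mid Int (lpow as (k + m) hi + lo) <= lpow as m mid + lo"
    by (rule artin_rees[where mid = "%_. mid" and lo = "%_. lo" and hi = "%_. hi", OF assms(1)[unfolded rno_def]])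
      (use assms scop_linear in "auto simp: subfam_scop")
  thus ?thesis by blast
qed

text \<open>The intersection \<open>mid\<close> of all \<open>(as)^r hi + lo\<close> satisfies
  \<open>mid <= (as) mid + lo\<close> by Artin-Rees, and Nakayama's lemma applies.\<close>

lemma krull_intersection:
  assumes "rno lo hi" "smod lo" "smod hi" "lo <= hi" "killed q lo hi" "jac q as"
    and "x : hi" "!!r. x : lpow as r hi + lo"
  shows "x : lo"
proof -
  define mid where "mid = {x : hi. ALL r. x : lpow as r hi + lo}"
  have sm: "smod (lpow as r hi + lo)" for r by (intro smod_plus lpow_smod assms)
  have mid: "smod mid"
    unfolding mid_def by (rule smodI, rule sgpI)
      (auto simp: smod_0[OF sm] smod_0[OF assms(3)] smod_diff[OF sm] smod_diff[OF assms(3)]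
        smod_sc[OF sm] smod_sc[OF assms(3)])
  have lm: "lo <= mid" unfolding mid_def
    using assms(4) upper2[OF lpow_smod[OF assms(3)], of lo] by blast
  have mh: "mid <= hi" by (auto simp: mid_def)
  from artin_rees_single[OF assms(1-3) mid lm mh, of as] obtain k where
    "!!m. mid Int (lpow as (k + m) hi + lo) <= lpow as m mid + lo" by blast
  from this[of 1] have "mid <= lpow as 1 mid + lo" by (auto simp: mid_def)
  hence "mid <= lo + lmul as mid" by (simp add: lpow_Suc add.commute)
  moreover obtain n where "gen n lo mid" using rno_gen[OF rno_mono[OF assms(1) subset_refl mh] assms(2) mid lm] by blast
  moreover have "killed q lo mid" by (rule killed_mono[OF assms(5) subset_refl mh])
  ultimately have "mid <= lo" using nakayama assms(2,6) mid by blast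
  thus ?thesis using assms(7,8) by (auto simp: mid_def)
qed

section \<open>Length against number of generators\<close>

lemma chain_trivial: "chain lo n hi ==> hi <= lo ==> n = 0"
proof (induction rule: chain.induct)
  case (step n H H')
  thus ?case using chain_smod by blast
qed auto

text \<open>Here \<open>hi/lo\<close> is a vector space over the residue field, and chains are
  bounded by the dimension. The induction splits off one generator \<open>g\<close>; the quotient by
  the others is cyclic, so it has length at most one.\<close>

lemma chain_le_gen:
  assumes "gen k lo hi" and lo: "smod lo" and hi: "smod hi" and "lo <= hi" and m: "lmul as hi <= lo"
    and killed: "killed q lo hi" and locl: "locl q as" and "chain lo n hi"
  shows "n <= k"
  using assms(1,3,4,5,6,8)
proof (induction k arbitrary: hi n)
  case 0
  hence "hi <= lo" by (auto simp: gen_def)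
  thus ?case using chain_trivial 0 by blast
next
  case (Suc k)
  from Suc.prems(1) obtain gs0 where gs0: "length gs0 = Suc k" "set gs0 <= hi" "hi <= lo + gspan gs0" by (auto simp: gen_def)
  obtain g gs where g: "gs0 = g # gs" using gs0(1) by (cases gs0) auto
  note hi = Suc.prems(2) and lohi = Suc.prems(3)
  define mid where "mid = lo + gspan gs"
  have mid: "smod mid" unfolding mid_def by (intro smod_plus lo gspan_smod)
  have lm: "lo <= mid" unfolding mid_def by (rule upper1[OF gspan_smod])
  have mh: "mid <= hi" unfolding mid_def using gs0 g by (intro plus_least smod_sgp hi lohi gspan_least) auto
  obtain m j where mj: "n <= m + j" "chain lo m (hi Int mid)" "chain mid j (hi + mid)"
    using chain_split[OF Suc.prems(6) mid lm] by blast
  have "hi Int mid = mid" using mh by blast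
  moreover have "hi + mid <= hi" by (intro plus_least smod_sgp hi subset_refl mh)
  ultimately have mj': "chain lo m mid" "chain mid j hi" using mj chain.weak[OF mj(3) hi] by auto
  have "gen k lo mid"
  proof -
    have "set gs <= mid" using gspan_base upper2[OF lo, of "gspan gs"] unfolding mid_def by blast
    thus ?thesis unfolding gen_def using gs0 g by (intro exI[of _ gs]) (auto simp: mid_def)
  qed
  moreover have "lmul as mid <= lo" using Suc.prems(4) lmul_mono[OF mh] by blast
  moreover have "killed q lo mid" by (rule killed_mono[OF Suc.prems(5) subset_refl mh])
  ultimately have "m <= k" using Suc.IH[of mid m] mid lm mj'(1) by blast
  have gh: "g : hi" using gs0 g by simp
  have "j <= 1 & (j = 1 --> hi <= H)" if "chain mid j H" "H <= hi" for j H
    using that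
  proof (induction rule: chain.induct)
    case (step n H H')
    have n0: "n = 0" using step.IH step.hyps step.prems by (metis One_nat_def le_Suc_eq le_zero_eq order_antisym psubsetE subset_trans)
    have Hm: "mid <= H" using chain_smod[OF step.hyps(1)] by blast
    obtain x where x: "x : H'" "x ~: H" using step.hyps(3) by blast
    have "x : lo + (range (%c. sc c g) + gspan gs)" using x(1) step.prems gs0(3) unfolding g gspan.simps by blast
    then obtain a c b where e: "x = a + (sc c g + b)" "a : lo" "b : gspan gs" by (auto elim!: plusE)
    have ab: "a + b : mid" unfolding mid_def using e(2,3) by blast
    have xe: "x = (a + b) + sc c g" using e(1) by (simp add: algebra_simps)
    \<comment> \<open>Otherwise \<open>c g\<close> would lie in \<open>lo\<close> and the step could
      not be strict. So \<open>c\<close> is a unit and \<open>g\<close> itself lies in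
      \<open>H'\<close>.\<close>
    have "c ~: q + rs.gspan as"
    proof
      assume "c : q + rs.gspan as"
      then obtain c1 c2 where c: "c = c1 + c2" "c1 : q" "c2 : rs.gspan as" by (rule plusE)
      have "sc c1 g : lo" using Suc.prems(5) c(2) gh unfolding killed_def by blast
      moreover have "sc c2 g : lo" by (rule gspan_killed[OF lo Suc.prems(4) c(3) gh hi])
      ultimately have "sc c g : lo" unfolding c(1) sc_add_left by (rule smod_add[OF lo])
      hence "x : mid" unfolding xe using ab lm smod_add[OF mid] by blast
      thus False using Hm x by blast
    qed
    then obtain u where u: "u * c - 1 : q" using locl unfolding locl_def by blast
    have H': "smod H'" "mid <= H'" using step.hyps Hm by auto
    have "sc c g = x - (a + b)" using xe by simp
    hence "sc c g : H'" using smod_diff[OF H'(1) x(1)] ab H'(2) by auto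
    hence "sc (u * c) g : H'" using smod_sc[OF H'(1)] by (metis sc_assoc)
    moreover have "sc (u * c - 1) g : H'" using Suc.prems(5) u gh lm H'(2) unfolding killed_def by blast
    hence "sc (u * c) g - g : H'" by (simp add: sc_diff_left sc_one)
    ultimately have gH: "g : H'" using sgp_cancel'[OF smod_sgp[OF H'(1)]] by blast
    have "lo + (range (%c. sc c g) + gspan gs) <= H'"
    proof (intro plus_least smod_sgp H')
      show "lo <= H'" using lm H'(2) by blast
      show "range (%c. sc c g) <= H'" using smod_sc[OF H'(1) gH] by blast
      show "gspan gs <= H'" using upper2[OF lo, of "gspan gs"] H'(2) unfolding mid_def by blast
    qed
    hence "hi <= H'" using gs0(3) unfolding g gspan.simps by blast
    thus ?case using n0 by simp
  qed auto
  hence "j <= 1" using mj'(2) by blast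
  thus ?case using mj(1) `m <= k` by simp
qed

lemma lmul_gspan: "lmul as (gspan gs) <= gspan (concat (map (%a. map (sc a) gs) as))"
proof (induction as)
  case (Cons a as)
  have "sc a ` gspan gs <= gspan (map (sc a) gs)"
    by (rule gspan_semilinear[where f = "%a. a", OF scal_axioms scal_axioms]) (simp_all add: sc_add_right sc_assoc mult.commute)
  thus ?case using plus_mono[OF _ Cons.IH] by (simp add: gspan_append)
qed simp

lemma gen_lmul_lo:
  assumes "gen k lo hi" "smod lo" "smod hi"
  shows "gen (length as * k) (lmul as lo) (lmul as hi)"
proof -
  obtain gs where gs: "length gs = k" "set gs <= hi" "hi <= lo + gspan gs" using assms(1) by (auto simp: gen_def)
  define hs where "hs = concat (map (%a. map (sc a) gs) as)"
  have "lmul as hi <= lmul as (lo + gspan gs)" by (rule lmul_mono[OF gs(3)])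
  also have "... <= lmul as lo + lmul as (gspan gs)" by (rule lmul_plus_subset[OF assms(2) gspan_smod])
  also have "... <= lmul as lo + gspan hs" unfolding hs_def by (intro plus_mono subset_refl lmul_gspan)
  finally have "lmul as hi <= lmul as lo + gspan hs" .
  moreover have "length hs = length as * k" unfolding hs_def by (induction as) (auto simp: gs(1))
  moreover have "set hs <= lmul as hi"
  proof
    fix x assume "x : set hs"
    then obtain a g where "a : set as" "g : set gs" "x = sc a g" by (auto simp: hs_def)
    thus "x : lmul as hi" using lmul_im[OF assms(3)] subsetD[OF gs(2)] by simp
  qed
  ultimately show ?thesis unfolding gen_def by (intro exI[of _ hs] conjI)
qed

lemma gen_lmul: "gen k lo hi ==> smod lo ==> smod hi ==> gen (length as * k) lo (lmul as hi)"
  by (rule gen_mono_lo[OF gen_lmul_lo lmul_subset])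

lemma gen_lpow:
  assumes "gen k lo hi" "smod lo" "smod hi"
  shows "gen (length as ^ t * k) lo (lpow as t hi)"
proof (induction t)
  case (Suc t)
  show ?case using gen_lmul[OF Suc.IH assms(2) lpow_smod[OF assms(3)], of as] by (simp add: lpow_Suc mult.assoc)
qed (use assms in simp)

lemma gen_plus_lo:
  assumes "gen k lo hi" "lo <= lo'" "smod lo" "smod lo'"
  shows "gen k lo' (hi + lo)"
proof -
  obtain gs where gs: "length gs = k" "set gs <= hi" "hi <= lo + gspan gs" using assms(1) by (auto simp: gen_def)
  have "hi + lo <= lo' + gspan gs"
  proof (rule plus_least)
    show "sgp (lo' + gspan gs)" by (intro sgp_plus smod_sgp assms gspan_smod)
    show "hi <= lo' + gspan gs" using gs(3) plus_mono[OF assms(2) subset_refl] by blast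
    show "lo <= lo' + gspan gs" using assms(2) upper1[OF gspan_smod, of lo' gs] by blast
  qed
  moreover have "set gs <= hi + lo" using gs(2) upper1[OF assms(3), of hi] by blast
  ultimately show ?thesis unfolding gen_def using gs(1) by blast
qed

text \<open>The layers \<open>(as)^t hi / (as)^(t+1) hi\<close> are vector spaces with at most
  \<open>length as ^ t * k\<close> generators, and their lengths add up.\<close>

lemma chain_lpow_bound:
  assumes "gen k lo hi" and lo: "smod lo" and hi: "smod hi" and lohi: "lo <= hi"
    and killed: "killed q lo hi" and locl: "locl q as"
  shows "chain (lpow as r hi + lo) n hi ==> n <= (\<Sum>t<r. length as ^ t) * k"
proof (induction r arbitrary: n)
  case 0
  have "hi <= lpow as 0 hi + lo" using upper1[OF lo, of hi] by simp
  thus ?case using chain_trivial[OF 0] by simp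
next
  case (Suc r)
  define mid where "mid = lpow as r hi + lo"
  define lo1 where "lo1 = lpow as (Suc r) hi + lo"
  have mid: "smod mid" unfolding mid_def by (intro smod_plus lpow_smod lo hi)
  have lo1: "smod lo1" unfolding lo1_def by (intro smod_plus lpow_smod lo hi)
  have l1m: "lo1 <= mid" unfolding lo1_def mid_def
    by (rule plus_mono[OF lpow_antimono[OF hi] subset_refl]) simp
  have mh: "mid <= hi" unfolding mid_def by (intro plus_least smod_sgp hi lpow_subset lohi)
  have ll1: "lo <= lo1" unfolding lo1_def by (rule upper2[OF lpow_smod[OF hi]])
  obtain m j where mj: "n <= m + j" "chain lo1 m (hi Int mid)" "chain mid j (hi + mid)"
    using chain_split[OF Suc.prems[folded lo1_def] mid l1m] by blast
  have "hi Int mid = mid" using mh by blast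
  hence c1: "chain lo1 m mid" using mj(2) by simp
  have c2: "chain mid j hi"
    by (rule chain.weak[OF mj(3) hi]) (intro plus_least smod_sgp hi subset_refl mh)
  have "m <= length as ^ r * k"
  proof (rule chain_le_gen[OF _ lo1 mid l1m _ _ locl c1])
    show "gen (length as ^ r * k) lo1 mid" unfolding mid_def
      by (rule gen_plus_lo[OF gen_lpow[OF assms(1) lo hi] ll1 lo lo1])
    have "lmul as mid <= lmul as (lpow as r hi) + lmul as lo" unfolding mid_def
      by (intro lmul_plus_subset lpow_smod hi lo)
    also have "... <= lo1" unfolding lo1_def lpow_Suc by (intro plus_mono subset_refl lmul_subset lo)
    finally show "lmul as mid <= lo1" .
    show "killed q lo1 mid" by (rule killed_mono[OF killed ll1 mh])
  qed
  moreover have "j <= (\<Sum>t<r. length as ^ t) * k" using Suc.IH c2 unfolding mid_def by blast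
  ultimately show ?case using mj(1) by (simp add: algebra_simps)
qed

text \<open>A substitute for monotonicity of the number of generators. By Nakayama's lemma it
  suffices to generate \<open>mid/(as)mid\<close>; by \<open>ar\<close> this is a subquotient of
  \<open>hi/(as)^r hi\<close>, whose length is at most a constant times \<open>k\<close>. The
  constant depends on \<open>r\<close> and \<open>length as\<close> only.\<close>

lemma gen_submodule:
  assumes gen: "gen k lo hi" and lo: "smod lo" and mid: "smod mid" and hi: "smod hi" and lm: "lo <= mid" and mh: "mid <= hi"
    and ar: "mid Int (lpow as r hi + lo) <= lmul as mid + lo"
    and killed: "killed q lo hi" and locl: "locl q as" and jac: "jac q as" and fg: "gen n0 lo mid"
  shows "gen ((\<Sum>t<r. length as ^ t) * k) lo mid"
proof -
  define X where "X = lpow as r hi + lo"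
  define Y where "Y = lmul as mid + lo"
  have X: "smod X" unfolding X_def by (intro smod_plus lpow_smod lo hi)
  have Y: "smod Y" unfolding Y_def by (intro smod_plus lmul_smod lo mid)
  have lohi: "lo <= hi" using lm mh by blast
  have Xh: "X <= hi" unfolding X_def by (intro plus_least smod_sgp hi lpow_subset lohi)
  have Ym: "Y <= mid" unfolding Y_def by (intro plus_least smod_sgp mid lmul_subset lm)
  have "n <= (\<Sum>t<r. length as ^ t) * k" if c: "chain Y n mid" for n
  proof -
    have "chain X n (mid + X)"
    proof (rule chain_transfer[where T = mid, OF c subset_refl])
      fix H H' assume H: "smod H" "smod H'" "Y <= H" "H <= H'" "H' <= mid"
      show "H + X <= H' + X" by (rule plus_mono[OF H(4) subset_refl])
      assume "H' + X <= H + X"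
      hence "H' <= H + X" using upper1[OF X, of H'] by blast
      moreover have "H' Int X <= H" using ar H(3,5) unfolding X_def Y_def by blast
      ultimately show "H' <= H" using modular_cancel[of H' H X] H smod_sgp by blast
    next
      fix H assume H: "smod H"
      show "smod (H + X) & X <= H + X" using smod_plus[OF H X] upper2[OF H] by blast
    qed
    hence "chain X n hi" by (rule chain.weak[OF _ hi]) (intro plus_least smod_sgp hi mh Xh)
    thus ?thesis unfolding X_def by (rule chain_lpow_bound[OF gen lo hi lohi killed locl])
  qed
  hence "gen ((\<Sum>t<r. length as ^ t) * k) Y mid" using chain_bound_gen Y mid Ym by blast
  then obtain gs where gs: "length gs = (\<Sum>t<r. length as ^ t) * k" "set gs <= mid" "mid <= Y + gspan gs"
    by (auto simp: gen_def)
  have sm: "smod (lo + gspan gs)" by (intro smod_plus lo gspan_smod)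
  have l1: "lo <= lo + gspan gs" by (rule upper1[OF gspan_smod])
  have "mid <= lo + gspan gs"
  proof (rule nakayama[OF gen_mono_lo[OF fg l1] sm mid _ _ jac])
    show "mid <= lo + gspan gs + lmul as mid" using gs(3) unfolding Y_def by (simp add: ac_simps)
    show "killed q (lo + gspan gs) mid" by (rule killed_mono[OF killed l1 mh])
  qed
  thus ?thesis unfolding gen_def using gs by blast
qed

end

section \<open>Transfer along linear maps\<close>

lemma rno_joint:
  fixes sc :: "'r::comm_ring_1 => 'v::ab_group_add => 'v" and sc' :: "'r => 'u::ab_group_add => 'u"
  assumes sc: "scal sc" "scal sc'" and fin: "finite B" and rno: "scal.rno sc' lo' hi'"
    and F: "!!k x y. F k (x + y) = F k x + F k y" "!!k c x. F k (sc c x) = sc' c (F k x)"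
    and hi: "scal.smod sc hi" and lo': "scal.smod sc' lo'" and hi': "scal.smod sc' hi'" and lh: "lo' <= hi'"
    and maps: "!!k x. k : B ==> x : hi ==> F k x : hi'" and lo: "lo = {x : hi. ALL k:B. F k x : lo'}"
  shows "scal.rno sc lo hi"
proof -
  interpret a: scal sc by fact
  interpret b: scal sc' by fact
  show ?thesis unfolding a.rno_def
  proof (rule noeth_joint[where ph = "%k _. F k", OF fin rno[unfolded b.rno_def]])
    show "subfam (range b.scop) (%_. lo') (%_. hi') (%_. lo')" using lo' lh by (simp add: b.subfam_scop)
    show "subfam (range a.scop) (%_. lo) (%_. hi) (%_. hi)" using hi by (auto simp: a.subfam_scop lo)
    show "sgp hi'" by (rule b.smod_sgp[OF hi'])
    show "additive_op w" if "w : range b.scop" for w :: "(unit, 'u) op" using that b.scop_additive by blast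
    show "additive_op w" if "w : range a.scop" for w :: "(unit, 'v) op" using that a.scop_additive by blast
    show "EX w:range a.scop. fst w = fst w' & (ALL j. ALL x:hi. ALL k:B. snd w' j (F k x) = F k (snd w j x))"
      if "w' : range b.scop" for w' :: "(unit, 'u) op"
      using that by (auto simp: F b.scop_def a.scop_def)
    show "EX w':range b.scop. fst w = fst w' & (ALL j. ALL x:hi. ALL k:B. snd w' j (F k x) = F k (snd w j x))"
      if "w : range a.scop" for w :: "(unit, 'v) op"
      using that by (auto simp: F b.scop_def a.scop_def)
  qed (auto simp: F lo maps)
qed

context
  fixes ph :: "('x => 'r::comm_ring_1) => 'y => 'r"
  assumes add: "!!u v. ph (u + v) = ph u + ph v" and sc: "!!c v. ph (%x. c * v x) = (%x. c * ph v x)"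
begin

lemma lin_diff: "ph (u - v) = ph u - ph v" using add[of "u - v" v] by (simp add: algebra_simps)

lemma smod_lin_image: "vs.smod H ==> vs.smod (ph ` H)"
  by (rule vs.smodI[OF sgp_image[OF lin_diff vs.smod_sgp]]) (auto simp: sc[symmetric] intro: vs.smod_sc)

lemma smod_lin_vimage: assumes "vs.smod H" shows "vs.smod {v. ph v : H}"
  using sgp_vimage[of ph H, OF lin_diff vs.smod_sgp[OF assms]] vs.smod_sc[OF assms] by (intro vs.smodI) (simp_all add: sc)

lemma gspan_lin_image: "ph ` vs.gspan gs <= vs.gspan (map ph gs)"
  by (rule gspan_semilinear[where f = "%a. a", OF vs.scal_axioms vs.scal_axioms]) (simp_all add: add sc)

lemma gen_lin_image:
  assumes "vs.gen n lo hi" "ph ` lo <= lo'" "vs.smod lo'" "vs.smod lo"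
  shows "vs.gen n lo' (ph ` hi + lo')"
proof -
  obtain gs where gs: "length gs = n" "set gs <= hi" "hi <= lo + vs.gspan gs" using assms(1) by (auto simp: vs.gen_def)
  have sm: "vs.smod (lo' + vs.gspan (map ph gs))" by (intro vs.smod_plus assms vs.gspan_smod)
  have "ph ` hi <= lo' + vs.gspan (map ph gs)"
  proof
    fix y assume "y : ph ` hi"
    then obtain x where x: "y = ph x" "x : lo + vs.gspan gs" using gs(3) by blast
    from x(2) obtain a b where ab: "x = a + b" "a : lo" "b : vs.gspan gs" by (rule plusE)
    have "ph a : lo'" "ph b : vs.gspan (map ph gs)" using ab assms(2) gspan_lin_image[of gs] by blast+
    thus "y : lo' + vs.gspan (map ph gs)" unfolding x(1) ab(1) add by (rule plusI)
  qed
  moreover have "lo' <= lo' + vs.gspan (map ph gs)" by (rule vs.upper1[OF vs.gspan_smod])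
  ultimately have "ph ` hi + lo' <= lo' + vs.gspan (map ph gs)" by (rule plus_least[OF vs.smod_sgp[OF sm]])
  moreover have "set (map ph gs) <= ph ` hi + lo'" using gs(2) vs.upper1[OF assms(3), of "ph ` hi"] by auto
  ultimately show ?thesis unfolding vs.gen_def using gs(1) by (intro exI[of _ "map ph gs"]) simp
qed

text \<open>Preimages of the generators suffice because elements sent into \<open>lo'\<close> lie in
  \<open>lo\<close>. Together with \<open>gen_lin_image\<close> this compares subquotients that
  \<open>ph\<close> identifies.\<close>

lemma gen_lin_pullback:
  assumes gen: "vs.gen n lo' mid" and mid: "mid <= ph ` hi + lo'" "ph ` hi <= mid"
    and hi: "vs.smod hi" and lo': "vs.smod lo'" and ker: "!!x. x : hi ==> ph x : lo' ==> x : lo"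
  shows "vs.gen n lo hi"
proof -
  obtain gs where gs: "length gs = n" "set gs <= mid" "mid <= lo' + vs.gspan gs" using gen by (auto simp: vs.gen_def)
  have "EX h. h : hi & g - ph h : lo'" if "g : set gs" for g
  proof -
    have "g : ph ` hi + lo'" using that gs(2) mid(1) by blast
    then obtain a b where "g = a + b" "a : ph ` hi" "b : lo'" by (rule plusE)
    thus ?thesis by auto
  qed
  then obtain c where c: "!!g. g : set gs ==> c g : hi & g - ph (c g) : lo'" by metis
  define hs where "hs = map c gs"
  have hsub: "vs.gspan hs <= hi" by (rule vs.gspan_least[OF hi]) (use c in "auto simp: hs_def")
  have sm: "vs.smod (lo' + ph ` vs.gspan hs)" by (intro vs.smod_plus lo' smod_lin_image vs.gspan_smod)
  have "set gs <= lo' + ph ` vs.gspan hs"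
  proof
    fix g assume g: "g : set gs"
    have "c g : vs.gspan hs" using g by (intro vs.gspan_base) (simp add: hs_def)
    thus "g : lo' + ph ` vs.gspan hs" by (intro plus_split'[OF conjunct2[OF c[OF g]]] imageI)
  qed
  hence gsub: "vs.gspan gs <= lo' + ph ` vs.gspan hs" by (rule vs.gspan_least[OF sm])
  have up: "lo' <= lo' + ph ` vs.gspan hs"
    by (rule vs.upper1[OF smod_lin_image[OF vs.gspan_smod]])
  have "lo' + vs.gspan gs <= lo' + ph ` vs.gspan hs" by (rule plus_least[OF vs.smod_sgp[OF sm] up gsub])
  hence all: "ph x : lo' + ph ` vs.gspan hs" if "x : hi" for x using that mid(2) gs(3) by blast
  have "hi <= lo + vs.gspan hs"
  proof
    fix x assume x: "x : hi"
    from all[OF x] obtain l z where lz: "ph x = l + z" "l : lo'" "z : ph ` vs.gspan hs" by (rule plusE)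
    then obtain y where y: "z = ph y" "y : vs.gspan hs" by blast
    have "x - y : hi" using x y(2) hsub vs.smod_diff[OF hi] by blast
    moreover have "ph (x - y) : lo'" using lz y by (simp add: lin_diff)
    ultimately have "x - y : lo" by (rule ker)
    thus "x : lo + vs.gspan hs" using y(2) by (rule plus_split')
  qed
  thus ?thesis unfolding vs.gen_def using gs(1) c by (intro exI[of _ hs]) (auto simp: hs_def)
qed

end

section \<open>Cohomology operators\<close>

lemma sum_fun: "sum f A x = (SUM i:A. f i x)"
  by (induction A rule: infinite_finite_induct) auto

subsection \<open>Matrices with rows and columns in finite index sets\<close>

text \<open>Matrices are functions on all pairs of indices and the summation set is explicit;
  \<open>meq\<close> looks only at the relevant rows and columns.\<close>

definition mm :: "'k set => ('k => 'k => 'r::comm_ring_1) => ('k => 'k => 'r) => 'k => 'k => 'r"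
  where "mm B X Y = (%i j. SUM l:B. X i l * Y l j)"

definition meq :: "'r::comm_ring_1 set => 'k set => 'k set => ('k => 'k => 'r) => ('k => 'k => 'r) => bool"
  where "meq J R C X Y \<longleftrightarrow> (ALL i:R. ALL j:C. X i j - Y i j : J)"

definition lapp :: "'k set => ('k => 'k => 'r::comm_ring_1) => ('k => 'r) => 'k => 'r"
  where "lapp C X a = (%i. SUM j:C. X i j * a j)"

lemma mm_assoc: "mm C (mm B X Y) Z = mm B X (mm C Y Z)"
proof (intro ext)
  fix i j
  have "mm C (mm B X Y) Z i j = (SUM l:C. SUM k:B. X i k * Y k l * Z l j)"
    by (simp add: mm_def sum_distrib_right)
  also have "... = (SUM k:B. SUM l:C. X i k * Y k l * Z l j)" by (rule sum.swap)
  also have "... = mm B X (mm C Y Z) i j" by (simp add: mm_def sum_distrib_left mult.assoc)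
  finally show "mm C (mm B X Y) Z i j = mm B X (mm C Y Z) i j" .
qed

lemma lapp_mm: "lapp C (mm B X Y) a = lapp B X (lapp C Y a)"
proof (intro ext)
  fix i
  have "lapp C (mm B X Y) a i = (SUM l:C. SUM k:B. X i k * Y k l * a l)"
    by (simp add: mm_def lapp_def sum_distrib_right)
  also have "... = (SUM k:B. SUM l:C. X i k * Y k l * a l)" by (rule sum.swap)
  also have "... = lapp B X (lapp C Y a) i" by (simp add: lapp_def sum_distrib_left mult.assoc)
  finally show "lapp C (mm B X Y) a i = lapp B X (lapp C Y a) i" .
qed

lemma meq_sym: "rs.smod J ==> meq J R C X Y ==> meq J R C Y X"
  unfolding meq_def using rs.smod_sgp sgp_neg by (metis minus_diff_eq)

lemma meq_trans: "rs.smod J ==> meq J R C X Y ==> meq J R C Y Z ==> meq J R C X Z"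
  unfolding meq_def using rs.smod_sgp sgp_trans by blast

lemma ideal_sum: "rs.smod J ==> (!!i. i : S ==> f i : J) ==> sum f S : J"
  using rs.smod_sgp sgp_sum by blast

lemma ideal_mult: "rs.smod J ==> x : J ==> c * x : J"
  using rs.smod_sc by blast

lemma ideal_mult2: "rs.smod J ==> x : J ==> x * c : J"
  using rs.smod_sc[of J x c] by (simp add: mult.commute)

lemma meq_mm_left: "rs.smod J ==> meq J R B X X' ==> meq J R C (mm B X Y) (mm B X' Y)"
  unfolding meq_def mm_def by (auto simp: sum_subtractf[symmetric] left_diff_distrib[symmetric] intro!: ideal_sum ideal_mult2)

lemma meq_mm_right: "rs.smod J ==> meq J B C Y Y' ==> meq J R C (mm B X Y) (mm B X Y')"
  unfolding meq_def mm_def by (auto simp: sum_subtractf[symmetric] right_diff_distrib[symmetric] intro!: ideal_sum ideal_mult)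

lemma lapp_cong:
  assumes "rs.smod J" "!!j. j : C ==> a j - b j : J"
  shows "lapp C X a i - lapp C X b i : J"
  unfolding lapp_def
  by (auto simp: sum_subtractf[symmetric] right_diff_distrib[symmetric] assms intro!: ideal_sum ideal_mult)

lemma lapp_meq:
  assumes "rs.smod J" "meq J R C X Y" "i : R"
  shows "lapp C X a i - lapp C Y a i : J"
  using assms(2,3) unfolding lapp_def meq_def
  by (auto simp: sum_subtractf[symmetric] left_diff_distrib[symmetric] assms(1) intro!: ideal_sum ideal_mult2)

lemma lapp_diff: "lapp C X (%j. a j - b j) i = lapp C X a i - lapp C X b i"
  by (simp add: lapp_def right_diff_distrib sum_subtractf)

subsection \<open>Ideals generated by a sequence\<close>

primrec jr :: "'r::comm_ring_1 set => (nat => 'r) => nat => 'r set" where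
  "jr q f 0 = q"
| "jr q f (Suc r) = jr q f r + range (%c. c * f r)"

text \<open>Regularity is meant modulo \<open>q\<close>; properness of the generated ideal is a
  separate matter.\<close>

definition reg :: "'r::comm_ring_1 set => (nat => 'r) => nat => bool"
  where "reg q f r \<longleftrightarrow> (ALL s<r. ALL y. f s * y : jr q f s --> y : jr q f s)"

lemma jr_smod: "rs.smod q ==> rs.smod (jr q f r)"
  by (induction r) (auto intro!: rs.smod_plus rs.smod_range)

lemma jr_mono: "rs.smod q ==> s <= r ==> jr q f s <= jr q f r"
proof (induction r)
  case (Suc r)
  have "jr q f r <= jr q f (Suc r)" unfolding jr.simps
    by (rule rs.upper1[OF rs.smod_range])
  thus ?case using Suc by (cases "s = Suc r") auto
qed simp

lemma jr_gen: "rs.smod q ==> s < r ==> f s * c : jr q f r"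
proof -
  assume q: "rs.smod q" and s: "s < r"
  have "c * f s : jr q f (Suc s)" unfolding jr.simps
    by (rule subsetD[OF rs.upper2[OF jr_smod[OF q]]]) blast
  thus ?thesis using jr_mono[OF q, of "Suc s" r f] s by (auto simp: mult.commute)
qed

lemma jr_SucE:
  assumes "x : jr q f (Suc r)"
  obtains c where "x - f r * c : jr q f r"
proof -
  from assms obtain a c where "x = a + c * f r" "a : jr q f r" by (auto elim!: plusE)
  thus thesis using that[of c] by (simp add: mult.commute)
qed

lemma jr_repr:
  assumes "x : jr q f r"
  shows "EX g. x - (\<Sum>s<r. f s * g s) : q"
  using assms
proof (induction r arbitrary: x)
  case 0
  thus ?case by simp
next
  case (Suc r)
  from Suc.prems obtain c where "x - f r * c : jr q f r" by (rule jr_SucE)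
  then obtain g where g: "x - f r * c - (\<Sum>s<r. f s * g s) : q" using Suc.IH by blast
  have "(\<Sum>s<Suc r. f s * (g(r := c)) s) = (\<Sum>s<r. f s * g s) + f r * c" by (simp add: fun_upd_def)
  hence "x - (\<Sum>s<Suc r. f s * (g(r := c)) s) = x - f r * c - (\<Sum>s<r. f s * g s)"
    by (simp add: algebra_simps)
  thus ?case using g by metis
qed

lemma jr_sum: "rs.smod q ==> (\<Sum>s<r. f s * g s) : jr q f r"
  by (rule ideal_sum[OF jr_smod]) (auto intro: jr_gen)

lemma reg_last:
  assumes q: "rs.smod q" and reg: "reg q f (Suc r)" and sum: "(\<Sum>s<Suc r. f s * a s) : q"
  shows "a r : jr q f r"
proof -
  have "f r * a r = (\<Sum>s<Suc r. f s * a s) - (\<Sum>s<r. f s * a s)" by simp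
  moreover have "(\<Sum>s<Suc r. f s * a s) : jr q f r" using sum jr_mono[OF q, of 0 r f] by auto
  ultimately have "f r * a r : jr q f r" using rs.smod_diff[OF jr_smod[OF q] _ jr_sum[OF q]] by metis
  thus ?thesis using reg unfolding reg_def by blast
qed

lemma reg_mono: "reg q f r ==> s <= r ==> reg q f s"
  unfolding reg_def by auto

text \<open>The last coefficient is a combination of the earlier \<open>f s\<close>; moving it into
  the other coefficients gives a shorter relation for the induction.\<close>

lemma reg_syzygy:
  assumes q: "rs.smod q" and "reg q f r" "(\<Sum>s<r. f s * a s) : q" "s < r"
  shows "a s : jr q f r"
  using assms(2-4)
proof (induction r arbitrary: a s)
  case (Suc r)
  have ar: "a r : jr q f r" by (rule reg_last[OF q Suc.prems(1,2)])
  show ?case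
  proof (cases "s = r")
    case True
    thus ?thesis using ar jr_mono[OF q, of r "Suc r" f] by auto
  next
    case False
    hence sr: "s < r" using Suc.prems by simp
    obtain g where g: "a r - (\<Sum>s<r. f s * g s) : q" using jr_repr[OF ar] by blast
    have "(\<Sum>s<r. f s * (a s + f r * g s)) = (\<Sum>s<Suc r. f s * a s) - f r * (a r - (\<Sum>s<r. f s * g s))"
      by (simp add: algebra_simps sum.distrib sum_distrib_left)
    also have "... : q" using rs.smod_diff[OF q Suc.prems(2)] ideal_mult[OF q g] by blast
    finally have "a s + f r * g s : jr q f r"
      using Suc.IH[of "%s. a s + f r * g s" s] reg_mono[OF Suc.prems(1)] sr by simp
    hence "a s + f r * g s : jr q f (Suc r)" using jr_mono[OF q, of r "Suc r" f] by auto
    moreover have "f r * g s : jr q f (Suc r)" by (rule jr_gen[OF q]) simp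
    ultimately show ?thesis using rs.smod_diff[OF jr_smod[OF q]] by (metis add_diff_cancel_right')
  qed
qed simp

subsection \<open>Lifted resolutions and their cones\<close>

text \<open>
  Over \<open>Q/(f\<^sub>0, \<dots>, f\<^sub>r)\<close> a complex is lifted to matrices over \<open>Q\<close>; the square of the lifted
  differential is a combination of the \<open>f s\<close>, whose coefficients are Eisenbud's operators \<open>t s\<close>.
  Degrees are shifted by one, so that \<open>B 0\<close> is empty.
\<close>

abbreviation sqz :: "'r::comm_ring_1 set => (nat => 'k set) => (nat => 'k => 'k => 'r) => nat => bool"
  where "sqz J B d n \<equiv> meq J (B n) (B (Suc (Suc n))) (mm (B (Suc n)) (d n) (d (Suc n))) (%_ _. 0)"

text \<open>Exactness is asked from \<open>n0\<close> on, since reduction modulo a nonzerodivisor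
  costs one degree.\<close>

definition exact :: "'r::comm_ring_1 set => nat => (nat => 'k set) => (nat => 'k => 'k => 'r) => bool"
  where "exact J n0 B d \<longleftrightarrow> (ALL n>=n0. ALL a. (ALL i:B n. lapp (B (Suc n)) (d n) a i : J) -->
     (EX c. ALL j:B (Suc n). a j - lapp (B (Suc (Suc n))) (d (Suc n)) c j : J))"

definition lifted :: "'r::comm_ring_1 set => (nat => 'r) => nat => (nat => 'k set) => (nat => 'k => 'k => 'r)
    => (nat => nat => 'k => 'k => 'r) => bool"
  where "lifted q f r B d t \<longleftrightarrow> (ALL n. finite (B n)) & B 0 = {} & exact (jr q f r) 1 B d &
    (ALL n. meq q (B n) (B (Suc (Suc n))) (mm (B (Suc n)) (d n) (d (Suc n))) (%i j. \<Sum>s<r. f s * t s n i j))"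

definition comm_err :: "(nat => 'k set) => (nat => 'k => 'k => 'r::comm_ring_1) => (nat => 'k => 'k => 'r) => nat => 'k => 'k => 'r"
  where "comm_err B d t n i j = mm (B (Suc n)) (d n) (t (Suc n)) i j - mm (B (Suc (Suc n))) (t n) (d (Suc (Suc n))) i j"

abbreviation homot :: "'r::comm_ring_1 set => (nat => 'r) => nat => (nat => 'k set) => (nat => 'k => 'k => 'r)
    => (nat => nat => 'k => 'k => 'r) => (nat => nat => 'k => 'k => 'r) => nat => bool"
  where "homot q f r B d t h n \<equiv> meq q (B n) (B (Suc (Suc (Suc n)))) (comm_err B d (t r) n) (%i j. \<Sum>s<r. f s * h s n i j)"

lemma mm_sum_right: "mm B X (%i j. SUM s:S. f s * t s i j) i j = (SUM s:S. f s * mm B X (t s) i j)"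
proof -
  have "mm B X (%i j. SUM s:S. f s * t s i j) i j = (SUM l:B. SUM s:S. f s * (X i l * t s l j))"
    by (simp add: mm_def sum_distrib_left mult.left_commute)
  also have "... = (SUM s:S. SUM l:B. f s * (X i l * t s l j))" by (rule sum.swap)
  finally show ?thesis by (simp add: mm_def sum_distrib_left)
qed

lemma mm_sum_left: "mm B (%i j. SUM s:S. f s * t s i j) Y i j = (SUM s:S. f s * mm B (t s) Y i j)"
proof -
  have "mm B (%i j. SUM s:S. f s * t s i j) Y i j = (SUM l:B. SUM s:S. f s * (t s i l * Y l j))"
    by (simp add: mm_def sum_distrib_right mult.assoc)
  also have "... = (SUM s:S. SUM l:B. f s * (t s i l * Y l j))" by (rule sum.swap)
  finally show ?thesis by (simp add: mm_def sum_distrib_left)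
qed

text \<open>The triple product of differentials is associative. Expanding the square on either side
  gives a relation between the \<open>f s\<close> whose coefficients are the commutators.\<close>

lemma comm_err_sum:
  assumes q: "rs.smod q" and l: "lifted q f r B d t" and i: "i : B n" and j: "j : B (Suc (Suc (Suc n)))"
  shows "(\<Sum>s<r. f s * comm_err B d (t s) n i j) : q"
proof -
  let ?T = "%n i j. \<Sum>s<r. f s * t s n i j"
  have sq: "meq q (B n) (B (Suc (Suc n))) (mm (B (Suc n)) (d n) (d (Suc n))) (?T n)" for n
    using l by (simp add: lifted_def)
  have "meq q (B n) (B (Suc (Suc (Suc n)))) (mm (B (Suc (Suc n))) (mm (B (Suc n)) (d n) (d (Suc n))) (d (Suc (Suc n))))
     (mm (B (Suc (Suc n))) (?T n) (d (Suc (Suc n))))"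
    by (rule meq_mm_left[OF q sq])
  moreover have "meq q (B n) (B (Suc (Suc (Suc n)))) (mm (B (Suc n)) (d n) (mm (B (Suc (Suc n))) (d (Suc n)) (d (Suc (Suc n)))))
     (mm (B (Suc n)) (d n) (?T (Suc n)))"
    by (rule meq_mm_right[OF q sq])
  ultimately have "meq q (B n) (B (Suc (Suc (Suc n)))) (mm (B (Suc n)) (d n) (?T (Suc n))) (mm (B (Suc (Suc n))) (?T n) (d (Suc (Suc n))))"
    unfolding mm_assoc using meq_trans[OF q meq_sym[OF q]] by blast
  hence "mm (B (Suc n)) (d n) (?T (Suc n)) i j - mm (B (Suc (Suc n))) (?T n) (d (Suc (Suc n))) i j : q"
    using i j by (auto simp: meq_def)
  thus ?thesis
    by (simp add: mm_sum_left mm_sum_right comm_err_def right_diff_distrib sum_subtractf)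
qed

lemma lifted_commutes:
  assumes q: "rs.smod q" and l: "lifted q f r B d t" and reg: "reg q f r" and s: "s < r"
  shows "meq (jr q f r) (B n) (B (Suc (Suc (Suc n)))) (mm (B (Suc n)) (d n) (t s (Suc n))) (mm (B (Suc (Suc n))) (t s n) (d (Suc (Suc n))))"
  unfolding meq_def
proof (intro ballI)
  fix i j assume "i : B n" "j : B (Suc (Suc (Suc n)))"
  from reg_syzygy[OF q reg comm_err_sum[OF q l this] s]
  show "mm (B (Suc n)) (d n) (t s (Suc n)) i j - mm (B (Suc (Suc n))) (t s n) (d (Suc (Suc n))) i j : jr q f r"
    by (simp add: comm_err_def)
qed

text \<open>The commutator of the last operator is the last coefficient of a relation, so it lies in
  the ideal of the earlier \<open>f s\<close>. Its coefficients \<open>h s\<close> there are the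
  homotopies used for the cone.\<close>

lemma lifted_homotopy:
  assumes q: "rs.smod q" and l: "lifted q f (Suc r) B d t" and reg: "reg q f (Suc r)"
  shows "EX h. ALL n. homot q f r B d t h n"
proof -
  have "ALL n i j. EX g. i : B n --> j : B (Suc (Suc (Suc n))) --> comm_err B d (t r) n i j - (\<Sum>s<r. f s * g s) : q"
    using jr_repr[OF reg_last[OF q reg comm_err_sum[OF q l]]] by metis
  then obtain g where "!!n i j. i : B n ==> j : B (Suc (Suc (Suc n))) ==>
    comm_err B d (t r) n i j - (\<Sum>s<r. f s * g n i j s) : q" by metis
  thus ?thesis by (intro exI[of _ "%s n i j. g n i j s"]) (simp add: meq_def)
qed

text \<open>Expanding the commutator of \<open>t r\<close> with the square of the differential in
  two ways gives a relation with coefficients \<open>G s\<close>, the commutator of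
  \<open>t s\<close> and \<open>t r\<close> minus the boundary of \<open>h s\<close>. The syzygy
  lemma puts each \<open>G s\<close> into the ideal.\<close>

lemma homotopy_commutator:
  assumes q: "rs.smod q" and l: "lifted q f (Suc r) B d t" and reg: "reg q f (Suc r)"
    and h: "!!n. homot q f r B d t h n"
    and s: "s < r" and i: "i : B n" and j: "j : B (Suc (Suc (Suc (Suc n))))"
  shows "mm (B (Suc (Suc n))) (t s n) (t r (Suc (Suc n))) i j - mm (B (Suc (Suc n))) (t r n) (t s (Suc (Suc n))) i j
    - (mm (B (Suc n)) (d n) (h s (Suc n)) i j + mm (B (Suc (Suc (Suc n)))) (h s n) (d (Suc (Suc (Suc n)))) i j) : jr q f r"
proof -
  let ?n1 = "Suc n" and ?n2 = "Suc (Suc n)" and ?n3 = "Suc (Suc (Suc n))" and ?n4 = "Suc (Suc (Suc (Suc n)))"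
  let ?T = "%n i j. \<Sum>s<Suc r. f s * t s n i j" and ?H = "%n i j. \<Sum>s<r. f s * h s n i j"
  have sq: "meq q (B n) (B (Suc (Suc n))) (mm (B (Suc n)) (d n) (d (Suc n))) (?T n)" for n
    using l by (simp add: lifted_def)
  have a: "mm (B ?n2) (mm (B ?n1) (d n) (d ?n1)) (t r ?n2) i j - mm (B ?n2) (?T n) (t r ?n2) i j : q"
    using meq_mm_left[OF q sq[of n], of "B ?n4" "t r ?n2"] i j by (auto simp: meq_def)
  have b: "mm (B ?n2) (t r n) (mm (B ?n3) (d ?n2) (d ?n3)) i j - mm (B ?n2) (t r n) (?T ?n2) i j : q"
    using meq_mm_right[OF q sq[of ?n2], of "B n" "t r n"] i j by (auto simp: meq_def)
  have c: "mm (B ?n1) (d n) (comm_err B d (t r) ?n1) i j - mm (B ?n1) (d n) (?H ?n1) i j : q"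
    using meq_mm_right[OF q h[of ?n1], of "B n" "d n"] i j by (auto simp: meq_def)
  have e: "mm (B ?n3) (comm_err B d (t r) n) (d ?n3) i j - mm (B ?n3) (?H n) (d ?n3) i j : q"
    using meq_mm_left[OF q h[of n], of "B ?n4" "d ?n3"] i j by (auto simp: meq_def)
  have c': "mm (B ?n1) (d n) (comm_err B d (t r) ?n1) i j =
     mm (B ?n2) (mm (B ?n1) (d n) (d ?n1)) (t r ?n2) i j - mm (B ?n1) (d n) (mm (B ?n3) (t r ?n1) (d ?n3)) i j"
    unfolding mm_assoc by (simp add: mm_def comm_err_def right_diff_distrib sum_subtractf)
  have e': "mm (B ?n3) (comm_err B d (t r) n) (d ?n3) i j =
     mm (B ?n1) (d n) (mm (B ?n3) (t r ?n1) (d ?n3)) i j - mm (B ?n2) (t r n) (mm (B ?n3) (d ?n2) (d ?n3)) i j"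
    unfolding mm_assoc[symmetric] by (simp add: mm_def comm_err_def left_diff_distrib sum_subtractf)
  define G where "G s = mm (B ?n2) (t s n) (t r ?n2) i j - mm (B ?n2) (t r n) (t s ?n2) i j
    - (mm (B ?n1) (d n) (h s ?n1) i j + mm (B ?n3) (h s n) (d ?n3) i j)" for s
  have S: "(\<Sum>s<r. f s * G s) = mm (B ?n2) (?T n) (t r ?n2) i j - mm (B ?n2) (t r n) (?T ?n2) i j
     - (mm (B ?n1) (d n) (?H ?n1) i j + mm (B ?n3) (?H n) (d ?n3) i j)"
    unfolding mm_sum_left mm_sum_right G_def
    by (simp add: algebra_simps sum_subtractf sum.distrib)
  have "(\<Sum>s<r. f s * G s) = (mm (B ?n1) (d n) (comm_err B d (t r) ?n1) i j - mm (B ?n1) (d n) (?H ?n1) i j)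
     + (mm (B ?n3) (comm_err B d (t r) n) (d ?n3) i j - mm (B ?n3) (?H n) (d ?n3) i j)
     - (mm (B ?n2) (mm (B ?n1) (d n) (d ?n1)) (t r ?n2) i j - mm (B ?n2) (?T n) (t r ?n2) i j)
     + (mm (B ?n2) (t r n) (mm (B ?n3) (d ?n2) (d ?n3)) i j - mm (B ?n2) (t r n) (?T ?n2) i j)"
    unfolding S c' e' by simp
  also have "... : q" by (intro rs.smod_add[OF q] rs.smod_diff[OF q] a b c e)
  finally have "G s : jr q f r" using reg_syzygy[OF q reg_mono[OF reg]] s by auto
  thus ?thesis by (simp add: G_def)
qed

text \<open>Disjoint unions are formed by prefixing \<open>0\<close> or \<open>1\<close>. Lists of
  naturals keep iterated cones inside one index type, as the induction on the number of equations
  requires.\<close>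

definition cone :: "nat list set => nat list set => nat list set"
  where "cone B P = Cons 0 ` B Un Cons 1 ` P"

definition blk :: "(nat list => nat list => 'r) => (nat list => nat list => 'r) => (nat list => nat list => 'r)
    => (nat list => nat list => 'r) => nat list => nat list => 'r"
  where "blk X Y Z U i j = (if hd i = 0 then (if hd j = 0 then X (tl i) (tl j) else Y (tl i) (tl j))
     else (if hd j = 0 then Z (tl i) (tl j) else U (tl i) (tl j)))"

lemma blk_simps [simp]:
  "blk X Y Z U (0 # i) (0 # j) = X i j" "blk X Y Z U (0 # i) (1 # j) = Y i j"
  "blk X Y Z U (1 # i) (0 # j) = Z i j" "blk X Y Z U (1 # i) (1 # j) = U i j"
  "blk X Y Z U (0 # i) (Suc 0 # j) = Y i j"
  "blk X Y Z U (Suc 0 # i) (0 # j) = Z i j" "blk X Y Z U (Suc 0 # i) (Suc 0 # j) = U i j"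
  by (simp_all add: blk_def)

lemma finite_cone: "finite B ==> finite P ==> finite (cone B P)"
  by (simp add: cone_def)

lemma cone_mem [simp]: "0 # i : cone B P \<longleftrightarrow> i : B" "Suc 0 # i : cone B P \<longleftrightarrow> i : P"
  by (auto simp: cone_def)

lemma ball_cone: "(ALL k:cone B P. Q k) \<longleftrightarrow> (ALL i:B. Q (0 # i)) & (ALL i:P. Q (Suc 0 # i))"
  by (auto simp: cone_def)

lemma sum_cone:
  assumes "finite B" "finite P"
  shows "sum F (cone B P) = (SUM i:B. F (0 # i)) + (SUM i:P. F (Suc 0 # i))"
  unfolding cone_def by (subst sum.union_disjoint) (auto simp: assms sum.reindex)

fun cB :: "(nat => nat list set) => nat => nat list set" where
  "cB B 0 = {}"
| "cB B (Suc n) = cone (B (Suc n)) (B n)"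

definition smat :: "'r::comm_ring_1 => 'k => 'k => 'r" where "smat c i j = (if i = j then c else 0)"

text \<open>For \<open>c = f r\<close> and \<open>t = t r\<close> the diagonal blocks of the square
  are those of \<open>d\<close> minus \<open>f r * t r\<close>, so one equation disappears.
  Truncation in \<open>n - 1\<close> is harmless since degree zero of the cone is empty.\<close>

definition cd :: "'r::comm_ring_1 => (nat => nat list => nat list => 'r) => (nat => nat list => nat list => 'r)
    => nat => nat list => nat list => 'r"
  where "cd c d t n = blk (d n) (smat c) (%i j. - t (n - 1) i j) (%i j. - d (n - 1) i j)"

definition ct :: "(nat => nat list => nat list => 'r::comm_ring_1) => (nat => nat list => nat list => 'r)
    => nat => nat list => nat list => 'r"
  where "ct t h n = blk (t n) (%_ _. 0) (h (n - 1)) (t (n - 1))"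

lemma smat_left: "finite B ==> i : B ==> (SUM l:B. smat c i l * Y l) = c * Y i"
  by (simp add: smat_def if_distrib[of "%x. x * _"] cong: if_cong)

lemma smat_right: "finite B ==> j : B ==> (SUM l:B. Y l * smat c l j) = c * Y j"
  by (simp add: smat_def if_distrib[of "%x. _ * x"] mult.commute cong: if_cong)

lemma smat_right': "finite B ==> j : B ==> (SUM l:B. smat c l j * Y l) = c * Y j"
  using smat_right[of B j Y c] by (simp add: mult.commute)

text \<open>In the diagonal blocks the term \<open>f r * t r\<close> cancels, one other block is
  zero, and the last one is the commutator of \<open>t r\<close> with \<open>d\<close>, which the
  homotopies express.\<close>

lemma cone_square:
  assumes q: "rs.smod q" and l: "lifted q f (Suc r) B d t"
    and h: "!!n. homot q f r B d t h n"
  shows "meq q (cB B n) (cB B (Suc (Suc n))) (mm (cB B (Suc n)) (cd (f r) d (t r) n) (cd (f r) d (t r) (Suc n)))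
    (%i j. \<Sum>s<r. f s * ct (t s) (h s) n i j)"
proof (cases n)
  case 0
  thus ?thesis by (simp add: meq_def)
next
  case (Suc m)
  have fin: "finite (B n)" for n using l by (simp add: lifted_def)
  have sq: "mm (B (Suc n)) (d n) (d (Suc n)) i j - ((\<Sum>s<r. f s * t s n i j) + f r * t r n i j) : q"
    if "i : B n" "j : B (Suc (Suc n))" for n i j
    using l that by (auto simp: lifted_def meq_def)
  show ?thesis unfolding meq_def Suc cB.simps ball_cone
  proof (intro conjI ballI)
    fix i j assume i: "i : B (Suc m)" and j: "j : B (Suc (Suc (Suc m)))"
    show "mm (cone (B (Suc (Suc m))) (B (Suc m))) (cd (f r) d (t r) (Suc m)) (cd (f r) d (t r) (Suc (Suc m))) (0 # i) (0 # j)
      - (\<Sum>s<r. f s * ct (t s) (h s) (Suc m) (0 # i) (0 # j)) : q"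
      using sq[OF i j]
      by (simp add: mm_def sum_cone fin cd_def ct_def sum_negf smat_left[OF fin i] algebra_simps)
  next
    fix i j assume i: "i : B (Suc m)" and j: "j : B (Suc (Suc m))"
    show "mm (cone (B (Suc (Suc m))) (B (Suc m))) (cd (f r) d (t r) (Suc m)) (cd (f r) d (t r) (Suc (Suc m))) (0 # i) (Suc 0 # j)
      - (\<Sum>s<r. f s * ct (t s) (h s) (Suc m) (0 # i) (Suc 0 # j)) : q"
      by (simp add: mm_def sum_cone fin cd_def ct_def sum_negf smat_left[OF fin i] smat_right[OF fin j] rs.smod_0[OF q])
  next
    fix i j assume i: "i : B m" and j: "j : B (Suc (Suc (Suc m)))"
    show "mm (cone (B (Suc (Suc m))) (B (Suc m))) (cd (f r) d (t r) (Suc m)) (cd (f r) d (t r) (Suc (Suc m))) (Suc 0 # i) (0 # j)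
      - (\<Sum>s<r. f s * ct (t s) (h s) (Suc m) (Suc 0 # i) (0 # j)) : q"
      using h[of m] i j
      by (simp add: meq_def comm_err_def mm_def sum_cone fin cd_def ct_def sum_negf)
  next
    fix i j assume i: "i : B m" and j: "j : B (Suc (Suc m))"
    show "mm (cone (B (Suc (Suc m))) (B (Suc m))) (cd (f r) d (t r) (Suc m)) (cd (f r) d (t r) (Suc (Suc m))) (Suc 0 # i) (Suc 0 # j)
      - (\<Sum>s<r. f s * ct (t s) (h s) (Suc m) (Suc 0 # i) (Suc 0 # j)) : q"
      using sq[OF i j]
      by (simp add: mm_def sum_cone fin cd_def ct_def sum_negf smat_right[OF fin j] smat_right'[OF fin j] algebra_simps)
  qed
qed

text \<open>The first part of a cycle is a cycle of the original complex modulo the larger ideal;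
  after subtracting a boundary it vanishes. The second part is then annihilated by
  \<open>f r\<close>, hence zero by regularity.\<close>

lemma cone_exact:
  assumes q: "rs.smod q" and l: "lifted q f (Suc r) B d t" and reg: "reg q f (Suc r)"
    and h: "!!n. homot q f r B d t h n"
  shows "exact (jr q f r) 1 (cB B) (cd (f r) d (t r))"
  unfolding exact_def
proof (intro allI impI)
  fix n :: nat and a assume "1 <= n" and a: "ALL i:cB B n. lapp (cB B (Suc n)) (cd (f r) d (t r) n) a i : jr q f r"
  then obtain m where n: "n = Suc m" by (cases n) auto
  define J where "J = jr q f r"
  have J: "rs.smod J" unfolding J_def by (rule jr_smod[OF q])
  have fin: "finite (B n)" for n using l by (simp add: lifted_def)
  define D where "D = cd (f r) d (t r)"
  define a0 where "a0 = (%i. a (0 # i))"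
  have top: "lapp (B (Suc n)) (d n) b0 i + f r * b1 i = lapp (cB B (Suc n)) (D n) b (0 # i)"
    if "i : B n" "b0 = (%i. b (0 # i))" "b1 = (%i. b (Suc 0 # i))" for b b0 b1 i
    unfolding that(2,3) lapp_def by (simp add: sum_cone fin D_def cd_def smat_left[OF fin that(1)])
  have "lapp (B (Suc n)) (d n) a0 i : jr q f (Suc r)" if i: "i : B n" for i
  proof -
    have "lapp (B (Suc n)) (d n) a0 i + f r * a (Suc 0 # i) : jr q f r"
      using a i top[OF i a0_def refl] unfolding D_def n by (simp add: ball_cone)
    hence "lapp (B (Suc n)) (d n) a0 i + f r * a (Suc 0 # i) : jr q f (Suc r)"
      using jr_mono[OF q, of r "Suc r" f] by auto
    moreover have "f r * a (Suc 0 # i) : jr q f (Suc r)" by (rule jr_gen[OF q]) simp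
    ultimately show ?thesis using rs.smod_diff[OF jr_smod[OF q]] by (metis add_diff_cancel_right')
  qed
  then obtain c0 where c0: "!!j. j : B (Suc n) ==> a0 j - lapp (B (Suc (Suc n))) (d (Suc n)) c0 j : jr q f (Suc r)"
    using l `1 <= n` unfolding lifted_def exact_def by blast
  have "ALL j. EX e. j : B (Suc n) --> a0 j - lapp (B (Suc (Suc n))) (d (Suc n)) c0 j - f r * e : J"
    using jr_SucE[OF c0] unfolding J_def by metis
  then obtain c1 where c1: "!!j. j : B (Suc n) ==> a0 j - lapp (B (Suc (Suc n))) (d (Suc n)) c0 j - f r * c1 j : J" by metis
  define c where "c k = (if hd k = 0 then c0 (tl k) else c1 (tl k))" for k
  have c: "c0 = (%i. c (0 # i))" "c1 = (%i. c (Suc 0 # i))" by (simp_all add: c_def)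
  define b where "b k = a k - lapp (cB B (Suc (Suc n))) (D (Suc n)) c k" for k
  have b0: "b (0 # j) : J" if "j : B (Suc n)" for j
  proof -
    have "lapp (cB B (Suc (Suc n))) (D (Suc n)) c (0 # j) = lapp (B (Suc (Suc n))) (d (Suc n)) c0 j + f r * c1 j"
      by (simp add: lapp_def sum_cone fin D_def cd_def c smat_left[OF fin that])
    hence "b (0 # j) = a0 j - lapp (B (Suc (Suc n))) (d (Suc n)) c0 j - f r * c1 j"
      by (simp add: b_def a0_def)
    thus ?thesis using c1[OF that] by simp
  qed
  have b1: "b (Suc 0 # i) : J" if i: "i : B n" for i
  proof -
    have ci: "0 # i : cB B n" using i n by simp
    have "meq J (cB B n) (cB B (Suc (Suc n))) (mm (cB B (Suc n)) (D n) (D (Suc n))) (%_ _. 0)"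
    proof -
      have z: "(\<Sum>s<r. f s * ct (t s) (h s) n i j) : J" for i j unfolding J_def by (rule jr_sum[OF q])
      have qJ: "q <= J" unfolding J_def using jr_mono[OF q, of 0 r f] by simp
      show ?thesis unfolding meq_def D_def
      proof (intro ballI)
        fix i j assume "i : cB B n" "j : cB B (Suc (Suc n))"
        hence "mm (cB B (Suc n)) (cd (f r) d (t r) n) (cd (f r) d (t r) (Suc n)) i j
          - (\<Sum>s<r. f s * ct (t s) (h s) n i j) : J"
          using cone_square[OF q l h, of n] qJ unfolding meq_def by blast
        from sgp_cancel[OF rs.smod_sgp[OF J] this z]
        show "mm (cB B (Suc n)) (cd (f r) d (t r) n) (cd (f r) d (t r) (Suc n)) i j - 0 : J" by simp
      qed
    qed
    from lapp_meq[OF J this ci, of c]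
    have "lapp (cB B (Suc n)) (D n) (lapp (cB B (Suc (Suc n))) (D (Suc n)) c) (0 # i) : J"
      unfolding lapp_mm by (simp add: lapp_def)
    moreover have "lapp (cB B (Suc n)) (D n) a (0 # i) : J" using a ci unfolding J_def D_def by blast
    ultimately have "lapp (cB B (Suc n)) (D n) b (0 # i) : J"
      unfolding b_def lapp_diff using rs.smod_diff[OF J] by blast
    hence "lapp (B (Suc n)) (d n) (%i. b (0 # i)) i + f r * b (Suc 0 # i) : J"
      using top[OF i refl refl, of b] by simp
    moreover have "lapp (B (Suc n)) (d n) (%i. b (0 # i)) i : J"
      unfolding lapp_def using b0 by (intro ideal_sum[OF J] ideal_mult[OF J])
    ultimately have "f r * b (Suc 0 # i) : J" using rs.smod_diff[OF J] by (metis add_diff_cancel_left')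
    thus ?thesis using reg unfolding reg_def J_def by blast
  qed
  have "ALL j:cB B (Suc n). b j : J" using b0 b1 by (simp add: ball_cone)
  thus "EX c. ALL j:cB B (Suc n). a j - lapp (cB B (Suc (Suc n))) (cd (f r) d (t r) (Suc n)) c j : jr q f r"
    unfolding b_def D_def J_def by blast
qed

lemma cone_lifted:
  assumes q: "rs.smod q" and l: "lifted q f (Suc r) B d t" and reg: "reg q f (Suc r)"
    and h: "!!n. homot q f r B d t h n"
  shows "lifted q f r (cB B) (cd (f r) d (t r)) (%s. ct (t s) (h s))"
proof -
  have "finite (cB B n)" for n using l by (cases n) (auto simp: lifted_def finite_cone)
  thus ?thesis unfolding lifted_def using cone_exact[OF assms] cone_square[OF q l h] by simp
qed

subsection \<open>Cochains\<close>

text \<open>A cochain with values in functions on \<open>'x\<close> is one function on pairs;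
  \<open>sl k\<close> is its value at the basis element \<open>k\<close>.\<close>

definition sl :: "'k => ('k \<times> 'x => 'r) => 'x => 'r" where "sl k v = (%x. v (k, x))"

text \<open>Precomposition with the map given by \<open>X\<close>, which is why products are
  reversed in \<open>capp_capp\<close>.\<close>

definition capp :: "'k set => ('k => 'k => 'r::comm_ring_1) => ('k \<times> 'x => 'r) => 'k \<times> 'x => 'r"
  where "capp B X v = (%p. SUM i:B. X i (fst p) * v (i, snd p))"

definition coch :: "'k set => ('x => 'r::comm_ring_1) set => ('k \<times> 'x => 'r) set"
  where "coch B L = {v. ALL k:B. sl k v : L}"

lemma sl_eqI: "(!!k. sl k u = sl k v) ==> u = v"
  by (auto simp: sl_def fun_eq_iff)

lemma sl_simps [simp]: "sl k (u + v) = sl k u + sl k v" "sl k (u - v) = sl k u - sl k (v :: _ => 'r::comm_ring_1)"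
  "sl k 0 = 0" "sl k (%p. c * v p) = (%x. c * sl k v x)"
  by (simp_all add: sl_def fun_eq_iff)

lemma sl_capp: "sl j (capp B X v) = (SUM i:B. (%x. X i j * sl i v x))"
  by (simp add: sl_def capp_def fun_eq_iff sum_fun)

lemma capp_add: "capp B X (u + v) = capp B X u + capp B X v"
  by (simp add: capp_def fun_eq_iff distrib_left sum.distrib)

lemma capp_diff: "capp B X (u - v) = capp B X u - capp B X v"
  by (simp add: capp_def fun_eq_iff right_diff_distrib sum_subtractf)

lemma capp_0 [simp]: "capp B X 0 = 0" by (simp add: capp_def fun_eq_iff)

lemma capp_sc: "capp B X (%p. c * v p) = (%p. c * capp B X v p)"
  by (simp add: capp_def fun_eq_iff sum_distrib_left mult.left_commute)

lemma capp_capp: "capp C Y (capp B X v) = capp B (mm C X Y) v"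
proof (intro ext)
  fix p :: "'a \<times> 'b"
  have "capp C Y (capp B X v) p = (SUM j:C. SUM i:B. X i j * Y j (fst p) * v (i, snd p))"
    by (simp add: capp_def sum_distrib_left ac_simps)
  also have "... = (SUM i:B. SUM j:C. X i j * Y j (fst p) * v (i, snd p))" by (rule sum.swap)
  finally show "capp C Y (capp B X v) p = capp B (mm C X Y) v p"
    by (simp add: capp_def mm_def sum_distrib_right)
qed

lemma capp_mat_diff: "capp B (%i j. X i j - Y i j) v = capp B X v - capp B Y v"
  by (simp add: capp_def fun_eq_iff left_diff_distrib sum_subtractf)

lemma capp_mat_add: "capp B (%i j. X i j + Y i j) v = capp B X v + capp B Y v"
  by (simp add: capp_def fun_eq_iff distrib_right sum.distrib)

lemma coch_smod: "vs.smod L ==> vs.smod (coch B L)"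
  by (rule vs.smodI, rule sgpI) (auto simp: coch_def vs.smod_0 vs.smod_diff vs.smod_sc)

lemma vs_sum: "vs.smod L ==> (!!i. i : S ==> f i : L) ==> sum f S : L"
  using vs.smod_sgp sgp_sum by blast

lemma capp_mem: "vs.smod L ==> v : coch B L ==> capp B X v : coch B' L"
  unfolding coch_def by (auto simp: sl_capp intro!: vs_sum vs.smod_sc)

lemma capp_kill:
  assumes "vs.killed J K L" "vs.smod K" "v : coch B L" "!!i j. i : B ==> j : B' ==> X i j : J"
  shows "capp B X v : coch B' K"
  using assms unfolding coch_def vs.killed_def by (auto simp: sl_capp intro!: vs_sum)

lemma capp_meq:
  assumes "vs.killed J K L" "vs.smod K" "v : coch B L" "meq J B B' X Y"
  shows "capp B X v - capp B Y v : coch B' K"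
  unfolding capp_mat_diff[symmetric]
  by (rule capp_kill[OF assms(1-3)]) (use assms(4) in "auto simp: meq_def")

lemma linear_sum:
  assumes "vs.linear_op w"
  shows "snd w i (SUM a:S. (%x. c a * u a x)) = (SUM a:S. (%x. c a * snd w i (u a) x))"
  using assms
  by (induction S rule: infinite_finite_induct)
    (auto simp: vs.linear_op_def additive_add additive_zero)

definition lift :: "('i, 'x => 'r::comm_ring_1) op => (nat \<times> 'i, 'k \<times> 'x => 'r) op"
  where "lift w = ((%(n, i). (n, fst w i)), (%(n, i) v p. snd w i (sl (fst p) v) (snd p)))"

definition chi :: "(nat => 'k set) => (nat => 'k => 'k => 'r::comm_ring_1) => (nat \<times> 'i, 'k \<times> 'x => 'r) op"
  where "chi B t = ((%(n, i). (Suc (Suc n), i)), (%(n, i) v. capp (B (Suc n)) (t (Suc n)) v))"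

lemma lift_simps [simp]: "fst (lift w) (n, i) = (n, fst w i)" "sl k (snd (lift w) (n, i) v) = snd w i (sl k v)"
  by (simp_all add: lift_def sl_def)

lemma chi_simps [simp]: "fst (chi B t) (n, i) = (Suc (Suc n), i)"
  "snd (chi B t) (n, i) v = capp (B (Suc n)) (t (Suc n)) v"
  by (simp_all add: chi_def)

lemma lift_linear: "vs.linear_op w ==> vs.linear_op (lift w)"
  unfolding vs.linear_op_def additive_op_def
  by (auto simp: lift_def fun_eq_iff)

lemma lift_additive: "vs.linear_op w ==> additive_op (lift w)"
  by (rule vs.linear_additive[OF lift_linear])

lemma chi_linear: "vs.linear_op (chi B t)"
  unfolding vs.linear_op_def additive_op_def by (auto simp: capp_add capp_sc)

lemma lift_capp: "vs.linear_op w ==> snd (lift w) (n, i) (capp B X v) = capp B X (snd (lift w) (m, i) v)"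
  by (rule sl_eqI) (simp add: sl_capp linear_sum)

text \<open>Cocycles with values in \<open>L i/K i\<close>. Modulo \<open>loE\<close>, the
  coboundaries plus the cochains with values in \<open>K i\<close>, they give \<open>Ext\<close> in
  degree \<open>n\<close>, which lives on \<open>B (Suc n)\<close> because of the shift.\<close>

definition hiE :: "(nat => 'k set) => (nat => 'k => 'k => 'r::comm_ring_1) => ('i => ('x => 'r) set) => ('i => ('x => 'r) set)
    => nat \<times> 'i => ('k \<times> 'x => 'r) set"
  where "hiE B d K L = (%(n, i). {v : coch (B (Suc n)) (L i).
     capp (B (Suc n)) (d (Suc n)) v : coch (B (Suc (Suc n))) (K i)})"

definition loE :: "(nat => 'k set) => (nat => 'k => 'k => 'r::comm_ring_1) => ('i => ('x => 'r) set) => ('i => ('x => 'r) set)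
    => nat \<times> 'i => ('k \<times> 'x => 'r) set"
  where "loE B d K L = (%(n, i). {v. EX w:coch (B n) (L i). v - capp (B n) (d n) w : coch (B (Suc n)) (K i)})"

lemma hiE_mem: "v : hiE B d K L (n, i) \<longleftrightarrow> v : coch (B (Suc n)) (L i) &
     capp (B (Suc n)) (d (Suc n)) v : coch (B (Suc (Suc n))) (K i)"
  by (simp add: hiE_def)

lemma loE_mem: "v : loE B d K L (n, i) \<longleftrightarrow> (EX w:coch (B n) (L i). v - capp (B n) (d n) w : coch (B (Suc n)) (K i))"
  by (simp add: loE_def)

lemma loE_eq: "loE B d K L (n, i) = capp (B n) (d n) ` coch (B n) (L i) + coch (B (Suc n)) (K i)"
proof (intro subset_antisym subsetI)
  fix v assume "v : loE B d K L (n, i)"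
  then obtain w where "w : coch (B n) (L i)" "v - capp (B n) (d n) w : coch (B (Suc n)) (K i)" by (auto simp: loE_mem)
  thus "v : capp (B n) (d n) ` coch (B n) (L i) + coch (B (Suc n)) (K i)" by (intro plus_split[OF imageI])
qed (force simp: loE_mem elim: plusE)

text \<open>A generalised inverse of \<open>d n\<close> modulo \<open>q\<close>: the image of
  \<open>d n\<close> is a direct summand.\<close>

definition splits :: "'r::comm_ring_1 set => (nat => 'k set) => (nat => 'k => 'k => 'r) => nat => bool"
  where "splits q B d n \<longleftrightarrow> (EX s. meq q (B n) (B (Suc n)) (mm (B n) (mm (B (Suc n)) (d n) s) (d n)) (d n))"

text \<open>One \<open>n0\<close> serves all complexes: a uniform bound on projective dimensions,
  phrased through splittings so that no modules are quantified over.\<close>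

definition fpd :: "'r::comm_ring_1 set => bool"
  where "fpd q \<longleftrightarrow> (EX n0. ALL (B :: nat => nat list set) d. (ALL n. finite (B n)) -->
     (ALL n. sqz q B d n) --> exact q 1 B d --> (ALL n>=n0. splits q B d n))"

text \<open>The coefficients form a family \<open>L i/K i\<close> that is Noetherian over the linear
  operators \<open>W\<close>. A single module is the case of one index; the Rees family is another
  instance.\<close>

locale coeff =
  fixes W :: "('i, 'x => 'r::comm_ring_1) op set" and K L :: "'i => ('x => 'r) set" and J :: "'r set"
  assumes noeth_KL: "noeth W K L" and sub_K: "subfam W K L K" and sub_L: "subfam W K L L"
    and smod_K: "!!i. vs.smod (K i)" and smod_L: "!!i. vs.smod (L i)"
    and lin: "!!w. w : W ==> vs.linear_op w"
    and J: "rs.smod J" and kill: "!!i. vs.killed J (K i) (L i)"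
begin

lemma KL: "K i <= L i" using subfamD(2)[OF sub_L] .

lemma coch_KL: "coch B (K i) <= coch B (L i)" using KL by (auto simp: coch_def)

definition cpx :: "(nat => 'k set) => (nat => 'k => 'k => 'r) => bool"
  where "cpx B d \<longleftrightarrow> (ALL n. finite (B n)) & (ALL n. sqz J B d n)"

lemma hiE_smod: "vs.smod (hiE B d K L p)"
proof (cases p)
  case (Pair n i)
  have "hiE B d K L (n, i) = coch (B (Suc n)) (L i) Int {v. capp (B (Suc n)) (d (Suc n)) v : coch (B (Suc (Suc n))) (K i)}"
    by (auto simp: hiE_def)
  thus ?thesis unfolding Pair by (simp only:) (intro vs.smod_Int coch_smod smod_lin_vimage smod_L smod_K capp_add capp_sc)
qed

lemma loE_smod: "vs.smod (loE B d K L p)"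
  by (cases p) (simp only: loE_eq, intro vs.smod_plus smod_lin_image coch_smod smod_L smod_K capp_add capp_sc)

lemma coch_loE: "v : coch (B (Suc n)) (K i) ==> v : loE B d K L (n, i)"
  unfolding loE_mem using vs.smod_0[OF coch_smod[OF smod_L]] by (intro bexI[of _ 0]) auto

lemma capp_loE: "w : coch (B n) (L i) ==> capp (B n) (d n) w : loE B d K L (n, i)"
  unfolding loE_mem using vs.smod_0[OF coch_smod[OF smod_K]] by (intro bexI[of _ w]) auto

lemma loE_hiE:
  assumes "cpx B d"
  shows "loE B d K L p <= hiE B d K L p"
proof (cases p)
  case (Pair n i)
  show ?thesis unfolding Pair
  proof
    fix v assume "v : loE B d K L (n, i)"
    then obtain w where w: "w : coch (B n) (L i)" "v - capp (B n) (d n) w : coch (B (Suc n)) (K i)"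
      unfolding loE_mem by blast
    have 1: "v : coch (B (Suc n)) (L i)"
      using sgp_cancel[OF vs.smod_sgp[OF coch_smod[OF smod_L]] subsetD[OF coch_KL w(2)]] capp_mem[OF smod_L w(1)] by blast
    have "capp (B (Suc n)) (d (Suc n)) (capp (B n) (d n) w) : coch (B (Suc (Suc n))) (K i)"
      unfolding capp_capp
      by (rule capp_kill[OF kill smod_K w(1)]) (use assms in "auto simp: cpx_def meq_def")
    moreover have "capp (B (Suc n)) (d (Suc n)) (v - capp (B n) (d n) w) : coch (B (Suc (Suc n))) (K i)"
      by (rule capp_mem[OF smod_K w(2)])
    ultimately have "capp (B (Suc n)) (d (Suc n)) v : coch (B (Suc (Suc n))) (K i)"
      unfolding capp_diff using sgp_cancel[OF vs.smod_sgp[OF coch_smod[OF smod_K]]] by blast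
    thus "v : hiE B d K L (n, i)" using 1 by (simp add: hiE_mem)
  qed
qed

lemma lift_coch: "w : W ==> v : coch B (L i) ==> snd (lift w) (n, i) v : coch B (L (fst w i))"
  "w : W ==> v : coch B (K i) ==> snd (lift w) (n, i) v : coch B (K (fst w i))"
  using stableD[OF subfamD(4)[OF sub_L]] stableD[OF subfamD(4)[OF sub_K]] by (auto simp: coch_def)

definition commuting :: "(nat => 'k set) => (nat => 'k => 'k => 'r) => (nat => 'k => 'k => 'r) => bool"
  where "commuting B d t \<longleftrightarrow> (ALL n. meq J (B n) (B (Suc (Suc (Suc n))))
      (mm (B (Suc n)) (d n) (t (Suc n))) (mm (B (Suc (Suc n))) (t n) (d (Suc (Suc n)))))"

definition opsE :: "(nat => 'k set) => (nat => 'k => 'k => 'r) set => (nat \<times> 'i, 'k \<times> 'x => 'r) op set"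
  where "opsE B T = lift ` W Un chi B ` T"

lemma opsE_linear: "w : opsE B T ==> vs.linear_op w"
  unfolding opsE_def using lift_linear[OF lin] chi_linear by blast

lemma opsE_stable:
  assumes "!!t. t : T ==> commuting B d t"
  shows "stable (opsE B T) (hiE B d K L)" "stable (opsE B T) (loE B d K L)"
proof -
  have sm: "sgp (coch C (K i))" "sgp (coch C (L i))" for C :: "'b set" and i
    using coch_smod[OF smod_K] coch_smod[OF smod_L] vs.smod_sgp by blast+
  show "stable (opsE B T) (hiE B d K L)"
  proof (rule stableI)
    fix w p v assume w: "w : opsE B T" and v: "v : hiE B d K L p"
    obtain n i where p: "p = (n, i)" by (cases p)
    from w show "snd w p v : hiE B d K L (fst w p)" unfolding opsE_def
    proof
      assume "w : lift ` W"
      then obtain u where u: "w = lift u" "u : W" by blast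
      have "capp (B (Suc n)) (d (Suc n)) (snd (lift u) (n, i) v) = snd (lift u) (n, i) (capp (B (Suc n)) (d (Suc n)) v)"
        by (rule lift_capp[OF lin[OF u(2)], symmetric])
      thus ?thesis using v unfolding u(1) p lift_simps hiE_mem
        by (simp add: lift_coch[OF u(2)])
    next
      assume "w : chi B ` T"
      then obtain t where t: "w = chi B t" "t : T" by blast
      note v' = v[unfolded p hiE_mem]
      have "capp (B (Suc n)) (mm (B (Suc (Suc (Suc n)))) (t (Suc n)) (d (Suc (Suc (Suc n))))) v : coch (B (Suc (Suc (Suc (Suc n))))) (K i)"
      proof (rule sgp_cancel'[OF sm(1)])
        show "capp (B (Suc n)) (mm (B (Suc (Suc n))) (d (Suc n)) (t (Suc (Suc n)))) v
          - capp (B (Suc n)) (mm (B (Suc (Suc (Suc n)))) (t (Suc n)) (d (Suc (Suc (Suc n))))) v : coch (B (Suc (Suc (Suc (Suc n))))) (K i)"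
          by (rule capp_meq[OF kill smod_K]) (use v' assms[OF t(2)] in "auto simp: commuting_def")
        show "capp (B (Suc n)) (mm (B (Suc (Suc n))) (d (Suc n)) (t (Suc (Suc n)))) v : coch (B (Suc (Suc (Suc (Suc n))))) (K i)"
          unfolding capp_capp[symmetric] by (rule capp_mem[OF smod_K]) (use v' in auto)
      qed
      thus ?thesis by (simp add: t p hiE_mem capp_capp capp_mem[OF smod_L conjunct1[OF v']])
    qed
  qed
  show "stable (opsE B T) (loE B d K L)"
  proof (rule stableI)
    fix w p v assume w: "w : opsE B T" and v: "v : loE B d K L p"
    obtain n i where p: "p = (n, i)" by (cases p)
    from v obtain e where e: "e : coch (B n) (L i)" "v - capp (B n) (d n) e : coch (B (Suc n)) (K i)"
      unfolding p loE_mem by blast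
    from w show "snd w p v : loE B d K L (fst w p)" unfolding opsE_def
    proof
      assume "w : lift ` W"
      then obtain u where u: "w = lift u" "u : W" by blast
      have "snd (lift u) (n, i) v - capp (B n) (d n) (snd (lift u) (n, i) e) = snd (lift u) (n, i) (v - capp (B n) (d n) e)"
        by (simp add: additive_diff[OF lift_additive[OF lin[OF u(2)]]] lift_capp[OF lin[OF u(2)], of n i _ _ _ n])
      thus ?thesis unfolding u(1) p lift_simps loE_mem
        using lift_coch(1)[OF u(2) e(1)] lift_coch(2)[OF u(2) e(2)] by metis
    next
      assume "w : chi B ` T"
      then obtain t where t: "w = chi B t" "t : T" by blast
      have te: "capp (B n) (t n) e : coch (B (Suc (Suc n))) (L i)" by (rule capp_mem[OF smod_L e(1)])
      have 1: "capp (B n) (mm (B (Suc n)) (d n) (t (Suc n))) e - capp (B n) (mm (B (Suc (Suc n))) (t n) (d (Suc (Suc n)))) e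
         : coch (B (Suc (Suc (Suc n)))) (K i)"
        by (rule capp_meq[OF kill smod_K e(1)]) (use assms[OF t(2)] in "auto simp: commuting_def")
      have 2: "capp (B (Suc n)) (t (Suc n)) (v - capp (B n) (d n) e) : coch (B (Suc (Suc (Suc n)))) (K i)"
        by (rule capp_mem[OF smod_K e(2)])
      have "capp (B (Suc n)) (t (Suc n)) v - capp (B (Suc (Suc n))) (d (Suc (Suc n))) (capp (B n) (t n) e) : coch (B (Suc (Suc (Suc n)))) (K i)"
        using sgp_add[OF sm(1) 1 2] unfolding capp_diff capp_capp by (simp add: algebra_simps)
      thus ?thesis using te by (auto simp: t p loE_mem)
    qed
  qed
qed

lemma subfam_E:
  assumes "cpx B d" "!!t. t : T ==> commuting B d t"
  shows "subfam (opsE B T) (loE B d K L) (hiE B d K L) (loE B d K L)"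
    "subfam (opsE B T) (loE B d K L) (hiE B d K L) (hiE B d K L)"
proof -
  note st = opsE_stable[where T = T and B = B and d = d, OF assms(2)]
  show "subfam (opsE B T) (loE B d K L) (hiE B d K L) (loE B d K L)"
    by (rule subfamI[OF vs.smod_sgp[OF loE_smod] subset_refl loE_hiE[OF assms(1)] st(2)])
  show "subfam (opsE B T) (loE B d K L) (hiE B d K L) (hiE B d K L)"
    by (rule subfamI[OF vs.smod_sgp[OF hiE_smod] loE_hiE[OF assms(1)] subset_refl st(1)])
qed

lemma noeth_vlift:
  assumes "finite B"
  shows "noeth ((%w. (fst w, %i. snd (lift w) (0, i))) ` W) (%i. coch B (K i)) (%i. coch B (L i))"
  using assms
proof (rule noeth_joint[where ph = "%k _. sl k", OF _ noeth_KL sub_K])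
  show "sgp (L i)" for i using vs.smod_sgp[OF smod_L] .
  show "additive_op w" if "w : W" for w using lin[OF that] by (simp add: vs.linear_op_def)
  show "additive_op w" if w: "w : (%w. (fst w, %i. snd (lift w) (0, i))) ` W" for w :: "('i, 'a \<times> 'x => 'r) op"
  proof -
    obtain u where u: "w = (fst u, %i. snd (lift u) (0, i))" "u : W" using w by blast
    have "additive_op (lift u :: (nat \<times> 'i, 'a \<times> 'x => 'r) op)"
      by (rule lift_additive[OF lin[OF u(2)]])
    thus ?thesis unfolding u(1) additive_op_def by simp
  qed
  show "subfam ((%w. (fst w, %i. snd (lift w) (0, i))) ` W) (%i. coch B (K i)) (%i. coch B (L i)) (%i. coch B (L i))"
  proof (rule subfamI)
    show "sgp (coch B (L i))" for i by (rule vs.smod_sgp[OF coch_smod[OF smod_L]])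
    show "stable ((%w. (fst w, %i. snd (lift w) (0, i))) ` W) (%i. coch B (L i))"
      using lift_coch(1) by (auto intro!: stableI)
  qed (use coch_KL in auto)
  show "EX w:(%w. (fst w, %i. snd (lift w) (0, i))) ` W. fst w = fst w' &
      (ALL i. ALL x:coch B (L i). ALL k:B. snd w' i (sl k x) = sl k (snd w i x))" if "w' : W" for w'
    using that by (intro bexI[of _ "(fst w', %i. snd (lift w') (0, i))"]) auto
  show "EX w':W. fst w = fst w' & (ALL i. ALL x:coch B (L i). ALL k:B. snd w' i (sl k x) = sl k (snd w i x))"
    if "w : (%w. (fst w, %i. snd (lift w) (0, i))) ` W" for w :: "('i, 'a \<times> 'x => 'r) op"
  proof -
    obtain u where "w = (fst u, %i. snd (lift u) (0, i))" "u : W"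
      using \<open>w : (%w. (fst w, %i. snd (lift w) (0, i))) ` W\<close> by blast
    thus ?thesis by (intro bexI[of _ u]) simp_all
  qed
qed (auto simp: coch_def)

lemma rnoE:
  assumes "cpx B d" "vs.rno (K i) (L i)"
  shows "vs.rno (loE B d K L (n, i)) (hiE B d K L (n, i))"
proof -
  have "vs.rno (coch (B (Suc n)) (K i)) (coch (B (Suc n)) (L i))"
    by (rule rno_joint[where F = sl and B = "B (Suc n)", OF vs.scal_axioms vs.scal_axioms _ assms(2) _ _ coch_smod[OF smod_L] smod_K smod_L KL])
      (use assms(1) coch_KL in "auto simp: cpx_def coch_def")
  thus ?thesis by (rule vs.rno_mono) (auto simp: hiE_mem intro: coch_loE)
qed

end

subsection \<open>Finite generation over the cohomology operators\<close>

text \<open>Extension by zero from the complex to its cone. On cohomology it goes from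
  \<open>Ext\<close> over the ring with one more equation to \<open>Ext\<close> over the ring with
  one less.\<close>

definition iota :: "(nat list \<times> 'x => 'r::comm_ring_1) => nat list \<times> 'x => 'r"
  where "iota v = (%p. if hd (fst p) = 0 then v (tl (fst p), snd p) else 0)"

lemma sl_iota: "sl k (iota v) = (if hd k = 0 then sl (tl k) v else 0)"
  by (auto simp: sl_def iota_def)

lemma sl_iota_simps [simp]: "sl (0 # k) (iota v) = sl k v" "sl (Suc 0 # k) (iota v) = 0"
  by (simp_all add: sl_iota)

lemma iota_add: "iota (u + v) = iota u + iota v"
  by (simp add: iota_def fun_eq_iff)

lemma coch_cone: "v : coch (cone B P) L \<longleftrightarrow> (ALL i:B. sl (0 # i) v : L) & (ALL i:P. sl (Suc 0 # i) v : L)"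
  by (simp add: coch_def ball_cone)

lemma sl_capp_cone:
  assumes "finite B" "finite P"
  shows "sl j (capp (cone B P) X v) = (SUM i:B. (%x. X (0 # i) j * sl (0 # i) v x)) + (SUM i:P. (%x. X (Suc 0 # i) j * sl (Suc 0 # i) v x))"
  by (simp add: sl_capp sum_cone assms)

lemma sum_smat:
  assumes "finite B" "j : B"
  shows "(SUM i:B. (%x. smat c i j * u i x)) = (%x. c * u j x)"
  by (rule ext) (simp add: sum_fun smat_right'[OF assms])

lemma vs_sum_neg: "(SUM i:B. (%x. - (X i * u i x))) = - (SUM i:B. (%x. X i * u i x :: 'r::comm_ring_1))"
  by (rule ext) (simp add: sum_fun sum_negf)

text \<open>The map \<open>1 - s d\<close> takes values in the kernel of \<open>d n\<close>, hence
  in the image of the next differential; this is a contracting homotopy at one place.\<close>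

lemma splits_decompose:
  assumes c: "!!n. finite (B n)" and q: "rs.smod q" and ex: "exact q n0 B d" and n: "n >= n0" and sp: "splits q B d n"
  shows "EX s U. meq q (B (Suc n)) (B (Suc n)) (smat 1) (%k j. mm (B n) s (d n) k j + mm (B (Suc (Suc n))) (d (Suc n)) U k j)"
proof -
  from sp obtain s where s: "meq q (B n) (B (Suc n)) (mm (B n) (mm (B (Suc n)) (d n) s) (d n)) (d n)"
    unfolding splits_def by blast
  let ?sd = "mm (B n) s (d n)"
  have ds: "lapp (B (Suc n)) (d n) (%k. smat 1 k j - ?sd k j) i : q" if "i : B n" "j : B (Suc n)" for i j
  proof -
    have "lapp (B (Suc n)) (d n) (%k. smat 1 k j - ?sd k j) i = d n i j - mm (B (Suc n)) (d n) ?sd i j"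
      unfolding lapp_diff using smat_right[OF c that(2), of "d n i" 1] by (simp add: lapp_def mm_def)
    moreover have "d n i j - mm (B n) (mm (B (Suc n)) (d n) s) (d n) i j : q"
      using meq_sym[OF q s] that by (simp add: meq_def)
    ultimately show ?thesis by (simp add: mm_assoc)
  qed
  have "EX u. ALL k:B (Suc n). smat 1 k j - ?sd k j - lapp (B (Suc (Suc n))) (d (Suc n)) u k : q" if "j : B (Suc n)" for j
    using ex n ds[OF _ that] unfolding exact_def by blast
  then obtain u where u: "!!j k. j : B (Suc n) ==> k : B (Suc n) ==>
      smat 1 k j - ?sd k j - lapp (B (Suc (Suc n))) (d (Suc n)) (u j) k : q" by metis
  define U where "U l j = u j l" for l j
  have "meq q (B (Suc n)) (B (Suc n)) (smat 1) (%k j. ?sd k j + mm (B (Suc (Suc n))) (d (Suc n)) U k j)"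
    using u unfolding meq_def U_def mm_def lapp_def by (auto simp: algebra_simps)
  thus ?thesis by blast
qed

lemma capp_one:
  assumes "finite B" "vs.smod K"
  shows "v - capp B (smat 1) v : coch B K"
  unfolding coch_def
proof (intro CollectI ballI)
  fix k assume k: "k : B"
  have "sl k (v - capp B (smat 1) v) = 0" by (simp add: sl_capp sum_smat[OF assms(1) k])
  thus "sl k (v - capp B (smat 1) v) : K" using vs.smod_0[OF assms(2)] by simp
qed

section \<open>Comparison of a complex with its cone\<close>

context coeff
begin

lemma smodule_coch: "vs.smod (coch C (K i))" "vs.smod (coch C (L i))"
  by (intro coch_smod smod_K smod_L)+

lemma lifted_cpx:
  assumes q: "rs.smod q" and l: "lifted q f r B d t" and sub: "jr q f r <= J"
  shows "cpx B d"
  unfolding cpx_def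
proof (intro conjI allI)
  show "finite (B n)" for n using l by (simp add: lifted_def)
  show "sqz J B d n" for n
    unfolding meq_def
  proof (intro ballI)
    fix i j assume "i : B n" "j : B (Suc (Suc n))"
    hence "mm (B (Suc n)) (d n) (d (Suc n)) i j - (\<Sum>s<r. f s * t s n i j) : q"
      using l by (simp add: lifted_def meq_def)
    hence "mm (B (Suc n)) (d n) (d (Suc n)) i j - (\<Sum>s<r. f s * t s n i j) : jr q f r"
      using jr_mono[OF q, of 0 r f] by auto
    from sgp_cancel[OF rs.smod_sgp[OF jr_smod[OF q]] this jr_sum[OF q]]
    show "mm (B (Suc n)) (d n) (d (Suc n)) i j - 0 : J" using sub by auto
  qed
qed

lemma lifted_commuting:
  assumes "rs.smod q" "lifted q f r B d t" "reg q f r" "s < r" "jr q f r <= J"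
  shows "commuting B d (t s)"
  using lifted_commutes[OF assms(1-4)] assms(5) unfolding commuting_def meq_def by blast

context
  fixes q f r and B :: "nat => nat list set" and d t h
  assumes q: "rs.smod q" and l: "lifted q f (Suc r) B d t" and reg: "reg q f (Suc r)"
    and JJ: "jr q f (Suc r) <= J"
    and h: "!!n. homot q f r B d t h n"
begin

abbreviation "D \<equiv> cd (f r) d (t r)"

lemma fin: "finite (B n)" and B0: "B 0 = {}" using l by (auto simp: lifted_def)

lemma frJ: "f r : J"
  using jr_gen[OF q, of r "Suc r" f 1] JJ by auto

lemma jrJ: "jr q f r <= J"
  using jr_mono[OF q, of r "Suc r" f] JJ by auto

lemma fr_kill: "x : L i ==> (%y. f r * x y) : K i"
  using kill[of i] frJ unfolding vs.killed_def by blast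

lemma iota_hi:
  assumes "v : hiE B d K L p"
  shows "iota v : hiE (cB B) D K L p"
proof (cases p)
  case (Pair n i)
  note v = assms[unfolded Pair hiE_mem]
  have 0: "0 : L i" "0 : K i" by (rule vs.smod_0, rule smod_L smod_K)+
  have vL: "sl j v : L i" if "j : B (Suc n)" for j using v that by (simp add: coch_def)
  have vK: "(SUM k:B (Suc n). (%x. d (Suc n) k j * sl k v x)) : K i" if "j : B (Suc (Suc n))" for j
    using v that by (simp add: coch_def sl_capp)
  have "iota v : coch (cB B (Suc n)) (L i)" using vL 0 by (simp add: coch_cone)
  moreover have "capp (cB B (Suc n)) (D (Suc n)) (iota v) : coch (cB B (Suc (Suc n))) (K i)"
    unfolding cB.simps coch_cone
  proof (intro conjI ballI)
    fix j assume "j : B (Suc (Suc n))"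
    thus "sl (0 # j) (capp (cone (B (Suc n)) (B n)) (D (Suc n)) (iota v)) : K i"
      using vK by (simp add: sl_capp_cone fin cd_def zero_fun_def[symmetric])
  next
    fix j assume j: "j : B (Suc n)"
    show "sl (Suc 0 # j) (capp (cone (B (Suc n)) (B n)) (D (Suc n)) (iota v)) : K i"
      using fr_kill[OF vL[OF j]] by (simp add: sl_capp_cone fin cd_def zero_fun_def[symmetric] sum_smat[OF fin j])
  qed
  ultimately show ?thesis by (simp add: Pair hiE_mem)
qed

text \<open>Exactness of the long sequence of the cone: a class that dies under \<open>iota\<close>
  is in the image of the last operator. For a bounding cochain with parts \<open>w0\<close> and
  \<open>w1\<close>, the lower block shows that \<open>w1\<close> is a cocycle, the upper one that
  the class is that of \<open>- t r\<close> applied to \<open>w1\<close>.\<close>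

lemma iota_lo:
  assumes v: "iota v : loE (cB B) D K L p"
  shows "v : addim (chi B (t r)) (hiE B d K L) (loE B d K L) p"
proof (cases p)
  case (Pair n i)
  from v obtain w where w: "w : coch (cB B n) (L i)" "iota v - capp (cB B n) (D n) w : coch (cB B (Suc n)) (K i)"
    unfolding Pair loE_mem by blast
  show ?thesis
  proof (cases n)
    case 0
    have "capp (cB B n) (D n) w = 0" by (simp add: 0 capp_def fun_eq_iff)
    hence "ALL j:B (Suc n). sl (0 # j) (iota v) : K i" using w(2) by (simp add: coch_cone)
    hence "v : coch (B (Suc n)) (K i)" by (simp add: coch_def)
    hence "v : loE B d K L (n, i)" by (rule coch_loE)
    thus ?thesis unfolding Pair by (rule addim_upperD)
  next
    case (Suc m)
    define w0 where "w0 = (%p. w (0 # fst p, snd p))"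
    define w1 where "w1 = (%p. w (Suc 0 # fst p, snd p))"
    have s0: "sl (0 # k) w = sl k w0" and s1: "sl (Suc 0 # k) w = sl k w1" for k
      by (simp_all add: sl_def w0_def w1_def)
    have "(ALL k:B n. sl (0 # k) w : L i) & (ALL k:B m. sl (Suc 0 # k) w : L i)"
      using w(1) by (simp add: Suc coch_cone)
    hence w0: "w0 : coch (B n) (L i)" and w1: "w1 : coch (B m) (L i)"
      by (simp_all add: coch_def s0 s1)
    have top: "v - capp (B n) (d n) w0 + capp (B m) (t r m) w1 : coch (B (Suc n)) (K i)"
      unfolding coch_def
    proof (intro CollectI ballI)
      fix j assume "j : B (Suc n)"
      hence "sl (0 # j) (iota v - capp (cB B n) (D n) w) : K i" using w(2) by (simp add: coch_cone)
      moreover have "sl (0 # j) (capp (cB B n) (D n) w) = sl j (capp (B n) (d n) w0) - sl j (capp (B m) (t r m) w1)"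
        by (simp add: Suc sl_capp_cone fin cd_def s0 s1) (simp add: sl_capp vs_sum_neg)
      ultimately show "sl j (v - capp (B n) (d n) w0 + capp (B m) (t r m) w1) : K i"
        by (simp add: algebra_simps)
    qed
    have bot: "capp (B m) (d m) w1 : coch (B n) (K i)"
      unfolding coch_def
    proof (intro CollectI ballI)
      fix j assume j: "j : B n"
      hence "sl (Suc 0 # j) (iota v - capp (cB B n) (D n) w) : K i" using w(2) by (simp add: coch_cone)
      moreover have "sl (Suc 0 # j) (capp (cB B n) (D n) w) = (%x. f r * sl j w0 x) - sl j (capp (B m) (d m) w1)"
        by (simp add: Suc sl_capp_cone fin cd_def s0 s1 sum_smat[OF fin j[unfolded Suc]]) (simp add: sl_capp vs_sum_neg)
      ultimately have 1: "sl j (capp (B m) (d m) w1) - (%x. f r * sl j w0 x) : K i"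
        by simp
      have "(%x. f r * sl j w0 x) : K i" using fr_kill w0 j by (simp add: coch_def)
      thus "sl j (capp (B m) (d m) w1) : K i" using sgp_cancel[OF vs.smod_sgp[OF smod_K] 1] by blast
    qed
    have lo0: "v + capp (B m) (t r m) w1 : loE B d K L (n, i)"
    proof -
      have "v - capp (B n) (d n) w0 + capp (B m) (t r m) w1 : loE B d K L (n, i)" using top by (rule coch_loE)
      moreover have "capp (B n) (d n) w0 : loE B d K L (n, i)" using w0 by (rule capp_loE)
      ultimately have "(v - capp (B n) (d n) w0 + capp (B m) (t r m) w1) + capp (B n) (d n) w0 : loE B d K L (n, i)"
        by (rule vs.smod_add[OF loE_smod])
      thus ?thesis by (simp add: algebra_simps)
    qed
    show ?thesis
    proof (cases m)
      case 0
      \<comment> \<open>In degree one the operator has no source; \<open>B 0\<close> is empty, so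
        the term vanishes.\<close>
      have "capp (B m) (t r m) w1 = 0" by (simp add: 0 B0 capp_def fun_eq_iff)
      hence "v : loE B d K L (n, i)" using lo0 by simp
      thus ?thesis unfolding Pair by (rule addim_upperD)
    next
      case m: (Suc l)
      have w1hi: "w1 : hiE B d K L (l, i)" using w1 bot by (simp add: hiE_mem m Suc)
      hence "- w1 : hiE B d K L (l, i)" using sgp_neg[OF vs.smod_sgp[OF hiE_smod]] by blast
      moreover have "fst (chi B (t r)) (l, i) = (n, i)" by (simp add: m Suc)
      moreover have "snd (chi B (t r)) (l, i) (- w1) = - capp (B m) (t r m) w1"
        using capp_diff[of "B m" "t r m" 0 w1] by (simp add: m)
      ultimately have e: "- capp (B m) (t r m) w1 : {0} Un {snd (chi B (t r)) j e | j e. fst (chi B (t r)) j = (n, i) & e : hiE B d K L j}"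
        by (intro UnI2 CollectI exI[of _ "(l, i)"] exI[of _ "- w1"]) simp
      show ?thesis unfolding Pair addim_def mem_plus
        by (rule bexI[OF _ lo0], rule bexI[OF _ e]) simp
    qed
  qed
qed

lemma iota_chi:
  assumes "s < r"
  shows "snd (chi (cB B) (ct (t s) (h s))) p (iota v) - iota (snd (chi B (t s)) p v) : loE (cB B) D K L (fst (chi B (t s)) p)"
proof (cases p)
  case (Pair n i)
  have z: "0 : K i" by (rule vs.smod_0[OF smod_K])
  have "capp (cB B (Suc n)) (ct (t s) (h s) (Suc n)) (iota v) - iota (capp (B (Suc n)) (t s (Suc n)) v)
    : coch (cB B (Suc (Suc (Suc n)))) (K i)"
    unfolding cB.simps coch_cone
    by (simp add: sl_capp_cone fin ct_def zero_fun_def[symmetric]) (simp add: sl_capp z)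
  hence "capp (cB B (Suc n)) (ct (t s) (h s) (Suc n)) (iota v) - iota (capp (B (Suc n)) (t s (Suc n)) v)
    : loE (cB B) D K L (Suc (Suc n), i)" by (rule coch_loE)
  thus ?thesis by (simp add: Pair)
qed

lemma iota_lift:
  assumes "w : W"
  shows "snd (lift w) p (iota v) = iota (snd (lift w) p v)"
proof (cases p)
  case (Pair n i)
  have "snd w i 0 = 0" using additive_zero[OF vs.linear_additive[OF lin[OF assms]]] .
  thus ?thesis unfolding Pair by (intro sl_eqI) (simp add: sl_iota)
qed

lemma iota_ops:
  assumes "w' : opsE (cB B) ((%s. ct (t s) (h s)) ` {..<r})"
  shows "EX w:opsE B (t ` {..<r}). fst w = fst w' &
     (ALL p. ALL v:hiE B d K L p. snd w' p (iota v) - iota (snd w p v) : loE (cB B) D K L (fst w p))"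
  using assms unfolding opsE_def
proof
  assume "w' : lift ` W"
  then obtain u where u: "w' = lift u" "u : W" by blast
  have z: "0 : loE (cB B) D K L p" for p by (rule vs.smod_0[OF loE_smod])
  show "EX w:lift ` W Un chi B ` t ` {..<r}. fst w = fst w' &
     (ALL p. ALL v:hiE B d K L p. snd w' p (iota v) - iota (snd w p v) : loE (cB B) D K L (fst w p))"
    by (rule bexI[of _ "lift u"]) (use u z in "auto simp: iota_lift lift_def[of u, THEN arg_cong[of _ _ fst]]")
next
  assume "w' : chi (cB B) ` (%s. ct (t s) (h s)) ` {..<r}"
  then obtain s where s: "w' = chi (cB B) (ct (t s) (h s))" "s < r" by blast
  show "EX w:lift ` W Un chi B ` t ` {..<r}. fst w = fst w' &
     (ALL p. ALL v:hiE B d K L p. snd w' p (iota v) - iota (snd w p v) : loE (cB B) D K L (fst w p))"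
  proof (rule bexI[of _ "chi B (t s)"])
    show "fst (chi B (t s)) = fst w' &
     (ALL p. ALL v:hiE B d K L p. snd w' p (iota v) - iota (snd (chi B (t s)) p v) : loE (cB B) D K L (fst (chi B (t s)) p))"
      using iota_chi[OF s(2)] unfolding s(1) by (simp add: chi_def)
  qed (use s in auto)
qed

text \<open>The operators commute on cohomology, by the homotopies \<open>h s\<close>: on cocycles
  one homotopy term has values in \<open>K i\<close> and the other is a coboundary.\<close>

lemma chi_commutes:
  assumes "w : opsE B (t ` {..<r})"
  shows "commutes w (chi B (t r)) (loE B d K L) (hiE B d K L)"
  using assms unfolding opsE_def
proof
  assume "w : lift ` W"
  then obtain u where u: "w = lift u" "u : W" by blast
  show ?thesis unfolding commutes_def
  proof (intro allI conjI ballI)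
    fix p v assume "v : hiE B d K L p"
    obtain n i where p: "p = (n, i)" by (cases p)
    have eq: "snd w (fst (chi B (t r)) p) (snd (chi B (t r)) p v) = snd (chi B (t r)) (fst w p) (snd w p v)"
      unfolding u(1) p by (simp add: lift_capp[OF lin[OF u(2)], of _ i _ _ _ n])
    show "snd w (fst (chi B (t r)) p) (snd (chi B (t r)) p v) - snd (chi B (t r)) (fst w p) (snd w p v)
        : loE B d K L (fst w (fst (chi B (t r)) p))"
      unfolding eq diff_self by (rule vs.smod_0[OF loE_smod])
  qed (simp add: u lift_def chi_def split: prod.splits)
next
  assume "w : chi B ` t ` {..<r}"
  then obtain s where s: "w = chi B (t s)" "s < r" by blast
  show ?thesis unfolding commutes_def
  proof (intro allI conjI ballI)
    fix p v assume v: "v : hiE B d K L p"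
    obtain n i where p: "p = (n, i)" by (cases p)
    let ?n1 = "Suc n" and ?n2 = "Suc (Suc n)" and ?n3 = "Suc (Suc (Suc n))" and ?n4 = "Suc (Suc (Suc (Suc n)))"
      and ?n5 = "Suc (Suc (Suc (Suc (Suc n))))"
    note v' = v[unfolded p hiE_mem]
    let ?X = "mm (B ?n3) (t s ?n1) (t r ?n3)" and ?Y = "mm (B ?n3) (t r ?n1) (t s ?n3)"
      and ?U = "mm (B ?n2) (d ?n1) (h s ?n2)" and ?V = "mm (B ?n4) (h s ?n1) (d ?n4)"
    have "capp (B ?n1) (%i j. ?X i j - ?Y i j) v - capp (B ?n1) (%i j. ?U i j + ?V i j) v : coch (B ?n5) (K i)"
    proof (rule capp_meq[OF kill smod_K conjunct1[OF v']])
      show "meq J (B ?n1) (B ?n5) (%i j. ?X i j - ?Y i j) (%i j. ?U i j + ?V i j)"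
        unfolding meq_def using homotopy_commutator[OF q l reg h s(2)] jrJ by blast
    qed
    hence 1: "capp (B ?n1) (%i j. ?X i j - ?Y i j) v - capp (B ?n1) (%i j. ?U i j + ?V i j) v : loE B d K L (?n4, i)"
      by (rule coch_loE)
    have "capp (B ?n1) ?U v : coch (B ?n5) (K i)"
      unfolding capp_capp[symmetric] by (rule capp_mem[OF smod_K conjunct2[OF v']])
    hence 2: "capp (B ?n1) ?U v : loE B d K L (?n4, i)" by (rule coch_loE)
    have 3: "capp (B ?n1) ?V v : loE B d K L (?n4, i)"
      unfolding capp_capp[symmetric] by (rule capp_loE, rule capp_mem[OF smod_L conjunct1[OF v']])
    have "capp (B ?n1) ?X v - capp (B ?n1) ?Y v : loE B d K L (?n4, i)"
      using sgp_cancel[OF vs.smod_sgp[OF loE_smod] 1] vs.smod_add[OF loE_smod 2 3]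
      unfolding capp_mat_diff capp_mat_add by blast
    hence "- (capp (B ?n1) ?X v - capp (B ?n1) ?Y v) : loE B d K L (?n4, i)"
      by (rule sgp_neg[OF vs.smod_sgp[OF loE_smod]])
    thus "snd w (fst (chi B (t r)) p) (snd (chi B (t r)) p v) - snd (chi B (t r)) (fst w p) (snd w p v)
        : loE B d K L (fst w (fst (chi B (t r)) p))"
      by (simp add: s(1) p capp_capp)
  qed (simp add: s chi_def split: prod.splits)
qed

lemma chi_inj: "inj (fst (chi B (t r)))"
  by (rule injI) (auto simp: chi_def split: prod.splits)

lemma opsE_Suc: "opsE B (t ` {..<Suc r}) = insert (chi B (t r)) (opsE B (t ` {..<r}))"
  by (auto simp: opsE_def lessThan_Suc)

text \<open>Modulo the image of the last operator, \<open>Ext\<close> embeds through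
  \<open>iota\<close> into \<open>Ext\<close> of the cone, which has one operator less. Hilbert's
  basis theorem then adjoins the last operator, of degree two.\<close>

lemma noeth_step:
  assumes n: "noeth (opsE (cB B) ((%s. ct (t s) (h s)) ` {..<r})) (loE (cB B) D K L) (hiE (cB B) D K L)"
  shows "noeth (opsE B (t ` {..<Suc r})) (loE B d K L) (hiE B d K L)"
proof -
  have lC: "lifted q f r (cB B) D (%s. ct (t s) (h s))" by (rule cone_lifted[OF q l reg h])
  have cC: "cpx (cB B) D" by (rule lifted_cpx[OF q lC jrJ])
  have comC: "commuting (cB B) D u" if "u : (%s. ct (t s) (h s)) ` {..<r}" for u
    using lifted_commuting[OF q lC reg_mono[OF reg] _ jrJ] that by auto
  have c: "cpx B d" by (rule lifted_cpx[OF q l JJ])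
  have com: "commuting B d u" if "u : t ` {..<Suc r}" for u
    using lifted_commuting[OF q l reg _ JJ] that by auto
  have sC: "subfam (opsE (cB B) ((%s. ct (t s) (h s)) ` {..<r})) (loE (cB B) D K L) (hiE (cB B) D K L) (loE (cB B) D K L)"
    by (rule subfam_E(1)[OF cC comC])
  have s: "subfam (opsE B (t ` {..<Suc r})) (loE B d K L) (hiE B d K L) (loE B d K L)"
    "subfam (opsE B (t ` {..<Suc r})) (loE B d K L) (hiE B d K L) (hiE B d K L)"
    by (rule subfam_E(1)[OF c com], assumption, rule subfam_E(2)[OF c com])
  have "noeth (opsE B (t ` {..<r})) (addim (chi B (t r)) (hiE B d K L) (loE B d K L)) (hiE B d K L)"
  proof (rule noeth_embed[where ph = "%_. iota", OF n sC])
    show "additive_op w" if "w : opsE (cB B) ((%s. ct (t s) (h s)) ` {..<r})" for w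
      using opsE_linear[OF that] by (rule vs.linear_additive)
    show "sgp (hiE (cB B) D K L p)" for p by (rule vs.smod_sgp[OF hiE_smod])
  qed (use iota_add iota_hi iota_lo iota_ops in auto)
  thus ?thesis unfolding opsE_Suc
  proof (rule noeth_hilbert[where deg = fst])
    show "subfam (insert (chi B (t r)) (opsE B (t ` {..<r}))) (loE B d K L) (hiE B d K L) (loE B d K L)"
      "subfam (insert (chi B (t r)) (opsE B (t ` {..<r}))) (loE B d K L) (hiE B d K L) (hiE B d K L)"
      using s unfolding opsE_Suc .
    show "additive_op w" if "w : opsE B (t ` {..<r})" for w using opsE_linear[OF that] by (rule vs.linear_additive)
    show "additive_op (chi B (t r))" by (rule vs.linear_additive[OF chi_linear])
    show "fst p < fst (fst (chi B (t r)) p)" for p by (cases p) simp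
  qed (rule chi_inj chi_commutes; assumption?)+
qed

end

text \<open>Applied to a cocycle, the contracting homotopy leaves a coboundary and a term with
  values in \<open>K i\<close>.\<close>

lemma exact_splits_zero:
  assumes c: "!!n. finite (B n)" and q: "rs.smod q" "q <= J"
    and ex: "exact q 1 B d" and n: "n >= 1" and sp: "splits q B d n"
  shows "hiE B d K L (n, i) <= loE B d K L (n, i)"
proof
  fix v assume "v : hiE B d K L (n, i)"
  note v = this[unfolded hiE_mem]
  obtain s U where "meq q (B (Suc n)) (B (Suc n)) (smat 1) (%k j. mm (B n) s (d n) k j + mm (B (Suc (Suc n))) (d (Suc n)) U k j)"
    using splits_decompose[OF c q(1) ex n sp] by blast
  hence m: "meq J (B (Suc n)) (B (Suc n)) (smat 1) (%k j. mm (B n) s (d n) k j + mm (B (Suc (Suc n))) (d (Suc n)) U k j)"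
    using q(2) unfolding meq_def by blast
  let ?sd = "mm (B n) s (d n)"
  have "capp (B (Suc n)) (smat 1) v - capp (B (Suc n)) (%k j. ?sd k j + mm (B (Suc (Suc n))) (d (Suc n)) U k j) v : coch (B (Suc n)) (K i)"
    by (rule capp_meq[OF kill smod_K conjunct1[OF v] m])
  moreover have "v - capp (B (Suc n)) (smat 1) v : coch (B (Suc n)) (K i)"
    by (rule capp_one[OF c smod_K])
  ultimately have 1: "v - (capp (B (Suc n)) ?sd v + capp (B (Suc n)) (mm (B (Suc (Suc n))) (d (Suc n)) U) v) : coch (B (Suc n)) (K i)"
    using sgp_trans[OF vs.smod_sgp[OF smodule_coch(1)]] unfolding capp_mat_add by blast
  have 2: "capp (B (Suc n)) (mm (B (Suc (Suc n))) (d (Suc n)) U) v : coch (B (Suc n)) (K i)"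
    unfolding capp_capp[symmetric] by (rule capp_mem[OF smod_K conjunct2[OF v]])
  have 3: "capp (B (Suc n)) ?sd v : loE B d K L (n, i)"
    unfolding capp_capp[symmetric] by (rule capp_loE, rule capp_mem[OF smod_L conjunct1[OF v]])
  have "v - capp (B (Suc n)) ?sd v - capp (B (Suc n)) (mm (B (Suc (Suc n))) (d (Suc n)) U) v : coch (B (Suc n)) (K i)"
    using 1 by (simp add: algebra_simps)
  from sgp_cancel[OF vs.smod_sgp[OF smodule_coch(1)] this 2]
  have "v - capp (B (Suc n)) ?sd v : loE B d K L (n, i)" by (rule coch_loE)
  from sgp_cancel[OF vs.smod_sgp[OF loE_smod] this 3] show "v : loE B d K L (n, i)" .
qed

lemma lifted_base:
  fixes B :: "nat => nat list set"
  assumes q: "rs.smod q" "q <= J" and l: "lifted q f 0 B d t" and fpd: "fpd q"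
  shows "EX n0. ALL n>=n0. ALL i. hiE B d K L (n, i) <= loE B d K L (n, i)"
proof -
  have c: "!!n. finite (B n)" "!!n. sqz q B d n" "exact q 1 B d"
    using l by (auto simp: lifted_def)
  from fpd c obtain n0 where n0: "!!n. n >= n0 ==> splits q B d n" unfolding fpd_def by blast
  have "hiE B d K L (n, i) <= loE B d K L (n, i)" if "n >= max n0 1" for n i
    by (rule exact_splits_zero[OF c(1) q c(3)]) (use that n0 in auto)
  thus ?thesis by blast
qed

text \<open>Only finitely many cohomological degrees are nonzero, and each is a subquotient of a
  finite power of the coefficient family.\<close>

lemma noeth_base:
  fixes B :: "nat => nat list set"
  assumes q: "rs.smod q" "q <= J" and l: "lifted q f 0 B d t" and fpd: "fpd q"
  shows "noeth (opsE B {}) (loE B d K L) (hiE B d K L)"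
proof -
  obtain n0 where n0: "!!n i. n >= n0 ==> hiE B d K L (n, i) <= loE B d K L (n, i)" using lifted_base[OF assms] by blast
  let ?V = "(%w. (fst w, %i. snd (lift w) (0, i))) ` W"
  have "noeth (slice_op ` ?V) (loE B d K L) (hiE B d K L)"
  proof (rule noeth_slices[where B = "{..<n0}"])
    show "noeth ?V (%i. loE B d K L (n, i)) (%i. hiE B d K L (n, i))" for n
    proof (rule noeth_mono[OF noeth_vlift[of "B (Suc n)"] subset_refl])
      show "finite (B (Suc n))" using l by (simp add: lifted_def)
      show "coch (B (Suc n)) (K i) <= loE B d K L (n, i)" for i using coch_loE by blast
      show "hiE B d K L (n, i) <= coch (B (Suc n)) (L i)" for i by (auto simp: hiE_mem)
    qed
  qed (use n0 in auto)
  moreover have "slice_op (fst w, %i. snd (lift w) (0, i)) = (lift w :: (nat \<times> 'i, nat list \<times> 'x => 'r) op)" for w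
    by (simp add: slice_op_def lift_def fun_eq_iff)
  hence "slice_op ` ?V = opsE B {}" by (simp add: opsE_def image_image)
  ultimately show ?thesis by simp
qed

text \<open>The complex varies in the induction, since each step passes to the cone; the
  coefficients stay the same and are killed by all equations.\<close>

theorem noeth_ext_family:
  fixes B :: "nat => nat list set"
  assumes q: "rs.smod q" and fpd: "fpd q"
  shows "lifted q f r B d t ==> reg q f r ==> jr q f r <= J ==>
    noeth (opsE B (t ` {..<r})) (loE B d K L) (hiE B d K L)"
proof (induction r arbitrary: B d t)
  case 0
  thus ?case using noeth_base[OF q _ 0(1) fpd] by simp
next
  case (Suc r)
  obtain h where h: "!!n. homot q f r B d t h n"
    using lifted_homotopy[OF q Suc.prems(1,2)] by blast
  have "jr q f r <= J" using jr_mono[OF q, of r "Suc r" f] Suc.prems(3) by auto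
  note JJ = this
  have "lifted q f r (cB B) (cd (f r) d (t r)) (%s. ct (t s) (h s))"
    by (rule cone_lifted[OF q Suc.prems(1,2)]) (rule h)
  from Suc.IH[OF this reg_mono[OF Suc.prems(2)] JJ]
  have "noeth (opsE (cB B) ((%s. ct (t s) (h s)) ` {..<r})) (loE (cB B) (cd (f r) d (t r)) K L) (hiE (cB B) (cd (f r) d (t r)) K L)"
    by simp
  thus ?case by (rule noeth_step[OF q Suc.prems, rotated]) (rule h)
qed

end

text \<open>Constant coefficients: the free module on \<open>'x\<close> modulo \<open>K\<close>,
  with a one-point index set.\<close>

definition hiC :: "(nat => 'k set) => (nat => 'k => 'k => 'r::comm_ring_1) => ('x => 'r) set => nat => ('k \<times> 'x => 'r) set"
  where "hiC B d K n = hiE B d (%_::unit. K) (%_. UNIV) (n, ())"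

definition loC :: "(nat => 'k set) => (nat => 'k => 'k => 'r::comm_ring_1) => ('x => 'r) set => nat => ('k \<times> 'x => 'r) set"
  where "loC B d K n = loE B d (%_::unit. K) (%_. UNIV) (n, ())"

lemma coch_UNIV: "coch C UNIV = UNIV" by (simp add: coch_def)

lemma hiC_eq: "hiC B d K n = {v. capp (B (Suc n)) (d (Suc n)) v : coch (B (Suc (Suc n))) K}"
  by (simp add: hiC_def hiE_def coch_UNIV)

lemma hiC_mem: "v : hiC B d K n \<longleftrightarrow> capp (B (Suc n)) (d (Suc n)) v : coch (B (Suc (Suc n))) K"
  by (simp add: hiC_eq)

lemma loC_mem: "v : loC B d K n \<longleftrightarrow> (EX w. v - capp (B n) (d n) w : coch (B (Suc n)) K)"
  by (simp add: loC_def loE_mem coch_UNIV)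

lemma loC_eq: "loC B d K n = range (capp (B n) (d n)) + coch (B (Suc n)) K"
  by (simp add: loC_def loE_eq coch_UNIV)

lemma hiC_smod: "vs.smod K ==> vs.smod (hiC B d K n)"
  unfolding hiC_eq by (intro coch_smod smod_lin_vimage capp_add capp_sc)

lemma loC_smod: "vs.smod K ==> vs.smod (loC B d K n)"
  unfolding loC_eq by (intro vs.smod_plus coch_smod smod_lin_image vs.smod_UNIV capp_add capp_sc)

lemma coch_loC: "v : coch (B (Suc n)) K ==> v : loC B d K n"
  unfolding loC_mem by (intro exI[of _ 0]) simp

lemma capp_capp_coch:
  assumes "vs.smod K" "vs.killed aa K UNIV" "sqz aa B d n"
  shows "capp (B (Suc n)) (d (Suc n)) (capp (B n) (d n) w) : coch (B (Suc (Suc n))) K"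
  unfolding capp_capp by (rule capp_kill[OF assms(2,1)]) (use assms(3) in "auto simp: meq_def coch_UNIV")

lemma loC_hiC:
  assumes "vs.smod K" "vs.killed aa K UNIV" "sqz aa B d n"
  shows "loC B d K n <= hiC B d K n"
proof
  fix v assume "v : loC B d K n"
  then obtain w where w: "v - capp (B n) (d n) w : coch (B (Suc n)) K" by (auto simp: loC_mem)
  from sgp_cancel[OF vs.smod_sgp[OF coch_smod[OF assms(1)]] capp_mem[OF assms(1) w, unfolded capp_diff] capp_capp_coch[OF assms]]
  show "v : hiC B d K n" unfolding hiC_mem .
qed

context coeff
begin

lemma killed_E:
  assumes "q <= J"
  shows "vs.killed q (loE B d K L p) (hiE B d K L p)"
  unfolding vs.killed_def
proof (intro ballI)
  fix c x assume c: "c : q" and x: "x : hiE B d K L p"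
  obtain n i where p: "p = (n, i)" by (cases p)
  have "(%y. c * x y) : coch (B (Suc n)) (K i)"
    using x c assms kill[of i] unfolding p hiE_mem coch_def vs.killed_def by auto
  thus "(%y. c * x y) : loE B d K L p" unfolding p by (rule coch_loE)
qed

end

subsection \<open>Regular local rings have finite projective dimension\<close>

lemma rno_vec:
  assumes "finite X" "rs.rno q UNIV" "rs.smod q"
  shows "vs.rno {v :: 'x => 'r::comm_ring_1. ALL x:X. v x : q} UNIV"
  by (rule rno_joint[where F = "%x v. v x", OF vs.scal_axioms rs.scal_axioms assms(1,2) _ _ vs.smod_UNIV assms(3) rs.smod_UNIV])
    auto

definition fld :: "'r::comm_ring_1 set => bool"
  where "fld m \<longleftrightarrow> (ALL c. c : m | (EX u. u * c - 1 : m))"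

text \<open>Columns are treated one at a time. If column \<open>c\<close> is not yet reproduced, a
  correction of rank one repairs it: \<open>u\<close> is its defect and \<open>i0\<close> a row
  where the defect is a unit. Earlier columns are kept because their defect in row \<open>i0\<close>
  is zero.\<close>

lemma field_generalised_inverse:
  assumes m: "rs.smod m" and fld: "fld m" and B: "finite B" and C: "finite C"
  shows "EX s. meq m B C (mm B (mm C X s) X) X"
proof -
  have "EX s. meq m B S (mm B (mm C X s) X) X" if "S <= C" "finite S" for S
    using that(2,1)
  proof (induction S)
    case empty
    thus ?case by (simp add: meq_def)
  next
    case (insert c S)
    then obtain s where s: "meq m B S (mm B (mm C X s) X) X" by auto
    define E where "E = mm C X s"
    define u where "u i = X i c - mm B E X i c" for i
    show ?case
    proof (cases "ALL i:B. u i : m")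
      case True
      hence "mm B E X i c - X i c : m" if "i : B" for i
        using that sgp_neg[OF rs.smod_sgp[OF m], of "u i"] by (simp add: u_def)
      thus ?thesis using s unfolding E_def by (intro exI[of _ s]) (auto simp: meq_def)
    next
      case False
      then obtain i0 where i0: "i0 : B" "u i0 ~: m" by blast
      then obtain w where w: "w * u i0 - 1 : m" using fld unfolding fld_def by blast
      define a where "a l = smat 1 l c - mm B s X l c" for l
      define rh where "rh i = smat 1 i0 i - E i0 i" for i
      define s' where "s' l i = s l i + a l * (w * rh i)" for l i
      have u: "u i = (SUM l:C. X i l * a l)" for i
      proof -
        have "(SUM l:C. X i l * a l) = (SUM l:C. X i l * smat 1 l c) - mm C X (mm B s X) i c"
          by (simp add: a_def mm_def right_diff_distrib sum_subtractf)
        thus ?thesis using smat_right[OF C, of c "X i" 1] insert.prems by (simp add: u_def E_def mm_assoc)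
      qed
      have E': "mm C X s' i j = E i j + u i * (w * rh j)" for i j
        by (simp add: mm_def s'_def distrib_left sum.distrib E_def u sum_distrib_right mult.assoc)
      have r: "(SUM i:B. rh i * X i j) = X i0 j - mm B E X i0 j" for j
        using smat_left[OF B i0(1), of 1 "%i. X i j"] by (simp add: rh_def left_diff_distrib sum_subtractf mm_def)
      have EX: "mm B (mm C X s') X i j = mm B E X i j + u i * (w * (X i0 j - mm B E X i0 j))" for i j
      proof -
        have "mm B (mm C X s') X i j = (SUM k:B. E i k * X k j + u i * w * (rh k * X k j))"
          by (simp add: mm_def[of B "mm C X s'"] E' distrib_right mult.assoc)
        also have "... = mm B E X i j + u i * w * (SUM k:B. rh k * X k j)"
          by (simp add: sum.distrib sum_distrib_left mm_def)
        finally show ?thesis unfolding r by (simp add: mult.assoc)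
      qed
      have "mm B (mm C X s') X i j - X i j : m" if i: "i : B" and j: "j : insert c S" for i j
      proof (cases "j = c")
        case True
        have "mm B (mm C X s') X i c - X i c = u i * (w * u i0 - 1)"
          unfolding EX by (simp add: u_def[of i] u_def[of i0] algebra_simps)
        thus ?thesis using ideal_mult[OF m w] True by simp
      next
        case False
        hence jS: "j : S" using j by simp
        have 1: "mm B E X i j - X i j : m" and 2: "mm B E X i0 j - X i0 j : m"
          using s jS i i0(1) by (auto simp: meq_def E_def)
        have eq: "mm B (mm C X s') X i j - X i j = (mm B E X i j - X i j) - u i * w * (mm B E X i0 j - X i0 j)"
          unfolding EX by (simp add: algebra_simps)
        show ?thesis unfolding eq by (rule rs.smod_diff[OF m 1 ideal_mult[OF m 2]])
      qed
      thus ?thesis unfolding meq_def by blast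
    qed
  qed
  thus ?thesis using C by blast
qed

text \<open>A cycle modulo \<open>x\<close> has differential \<open>x b\<close>. As \<open>x\<close>
  is a nonzerodivisor, \<open>b\<close> is a cycle, hence the differential of some \<open>e\<close>,
  and subtracting \<open>x e\<close> leaves a cycle modulo \<open>q\<close>. Two adjacent degrees
  are used, so one is lost.\<close>

lemma exact_mod_nzd:
  assumes q: "rs.smod q" and c: "!!n. finite (B n)"
    and sq: "!!n. sqz q B d n"
    and ex: "exact q n0 B d" and nzd: "!!y. x * y : q ==> y : q"
  shows "exact (q + range (%c. c * x)) (Suc n0) B d"
  unfolding exact_def
proof (intro allI impI)
  fix n a assume n: "Suc n0 <= n" and a: "ALL i:B n. lapp (B (Suc n)) (d n) a i : q + range (%c. c * x)"
  then obtain m where m: "n = Suc m" "m >= n0" by (cases n) auto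
  have "EX b. lapp (B (Suc n)) (d n) a i - x * b : q" if i: "i : B n" for i
  proof -
    have "lapp (B (Suc n)) (d n) a i : q + range (%c. c * x)" using a i by blast
    then obtain e b where "lapp (B (Suc n)) (d n) a i = e + b * x" "e : q" by (auto elim!: plusE)
    thus ?thesis by (intro exI[of _ b]) (simp add: mult.commute)
  qed
  then obtain b where b: "!!i. i : B n ==> lapp (B (Suc n)) (d n) a i - x * b i : q" by metis
  have "lapp (B n) (d m) b i : q" if i: "i : B m" for i
  proof -
    have "lapp (B n) (d m) (lapp (B (Suc n)) (d n) a) i - lapp (B n) (d m) (%k. x * b k) i : q"
      by (rule lapp_cong[OF q b])
    moreover have "lapp (B n) (d m) (lapp (B (Suc n)) (d n) a) i : q"
      using lapp_meq[OF q sq[of m] i, of a] unfolding lapp_mm m(1) by (simp add: lapp_def)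
    ultimately have "lapp (B n) (d m) (%k. x * b k) i : q" using sgp_cancel'[OF rs.smod_sgp[OF q]] by blast
    hence "x * lapp (B n) (d m) b i : q" by (simp add: lapp_def sum_distrib_left mult.left_commute)
    thus ?thesis by (rule nzd)
  qed
  then obtain e where e: "!!j. j : B n ==> b j - lapp (B (Suc n)) (d n) e j : q"
    using ex m unfolding exact_def by blast
  have "lapp (B (Suc n)) (d n) (%j. a j - x * e j) i : q" if i: "i : B n" for i
  proof -
    have "lapp (B (Suc n)) (d n) (%j. x * e j) i = x * lapp (B (Suc n)) (d n) e i"
      by (simp add: lapp_def sum_distrib_left mult.left_commute)
    hence "lapp (B (Suc n)) (d n) (%j. a j - x * e j) i
      = (lapp (B (Suc n)) (d n) a i - x * b i) + x * (b i - lapp (B (Suc n)) (d n) e i)"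
      unfolding lapp_diff by (simp add: algebra_simps)
    thus ?thesis using rs.smod_add[OF q b[OF i] ideal_mult[OF q e[OF i]]] by simp
  qed
  moreover have "n0 <= n" using m by simp
  ultimately obtain g where g: "!!j. j : B (Suc n) ==> a j - x * e j - lapp (B (Suc (Suc n))) (d (Suc n)) g j : q"
    using ex unfolding exact_def by blast
  have "a j - lapp (B (Suc (Suc n))) (d (Suc n)) g j : q + range (%c. c * x)" if "j : B (Suc n)" for j
    using plusI[OF g[OF that] rangeI[of "%c. c * x" "e j"]] by (simp add: algebra_simps)
  thus "EX c. ALL j:B (Suc n). a j - lapp (B (Suc (Suc n))) (d (Suc n)) c j : q + range (%c. c * x)" by blast
qed

text \<open>
  A splitting modulo a nonzerodivisor \<open>x\<close> in the radical lifts: by Nakayama's lemma the cohomology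
  with coefficients in the image of \<open>d n\<close> vanishes.
\<close>

lemma splits_lift:
  fixes B :: "nat => 'k set"
  assumes q: "rs.smod q" and rno: "rs.rno q UNIV" and c: "!!n. finite (B n)"
    and sq: "!!n. sqz q B d n"
    and ex: "exact (q + range (%c. c * x)) n0 B d" and n: "n >= n0" and nzd: "!!y. x * y : q ==> y : q"
    and sp: "splits (q + range (%c. c * x)) B d n" and jac: "jac q [x]"
  shows "splits q B d n"
proof -
  define K where "K = {z. ALL i:B n. z i : q}"
  let ?T = "lapp (B (Suc n)) (d n)"
  \<comment> \<open>The coefficients are the image of \<open>d n\<close> inside the free module on
    \<open>B n\<close>, and \<open>K\<close> represents zero.\<close>
  define L where "L = range ?T + K"
  have L_mem: "z : L \<longleftrightarrow> (EX a. ALL i:B n. z i - ?T a i : q)" for z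
  proof
    assume "z : L"
    then obtain a b where "z = ?T a + b" "b : K" unfolding L_def by (auto elim: plusE)
    thus "EX a. ALL i:B n. z i - ?T a i : q" by (intro exI[of _ a]) (simp add: K_def)
  next
    assume "EX a. ALL i:B n. z i - ?T a i : q"
    then obtain a where "ALL i:B n. z i - ?T a i : q" by blast
    thus "z : L" unfolding L_def by (intro plus_split[of "?T a"] rangeI) (simp add: K_def)
  qed
  have sK: "vs.smod K" unfolding K_def
    by (rule vs.smodI, rule sgpI) (auto simp: rs.smod_0[OF q] rs.smod_diff[OF q] ideal_mult[OF q])
  have sT: "vs.smod (range ?T)"
    by (intro smod_lin_image vs.smod_UNIV)
      (simp_all add: lapp_def fun_eq_iff distrib_left sum.distrib sum_distrib_left mult.left_commute)
  have sL: "vs.smod L" and KL: "K <= L" unfolding L_def by (intro vs.smod_plus sT sK, rule vs.upper2[OF sT])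
  have rKL: "vs.rno K L" using vs.rno_mono[OF rno_vec[OF c rno q] _ subset_UNIV, of n K L] by (simp add: K_def)
  interpret coeff "range vs.scop" "%_::unit. K" "%_. L" q
  proof
    show "noeth (range vs.scop) (%_::unit. K) (%_. L)" using rKL by (simp add: vs.rno_def)
    show "subfam (range vs.scop) (%_. K) (%_. L) (%_. K)" "subfam (range vs.scop) (%_. K) (%_. L) (%_. L)"
      using sK sL KL by (simp_all add: vs.subfam_scop)
    show "vs.killed q K L" unfolding vs.killed_def K_def by (auto intro: ideal_mult2[OF q])
  qed (use sK sL q vs.scop_linear in auto)
  have cx: "cpx B d" unfolding cpx_def using c sq by blast
  let ?K = "%_::unit. K" and ?L = "%_::unit. L"
  let ?hi = "hiE B d ?K ?L (n, ())" and ?lo = "loE B d ?K ?L (n, ())"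
  have q': "rs.smod (q + range (%c. c * x))" by (intro rs.smod_plus q rs.smod_range)
  obtain s U where sU: "meq (q + range (%c. c * x)) (B (Suc n)) (B (Suc n)) (smat 1)
      (%k j. mm (B n) s (d n) k j + mm (B (Suc (Suc n))) (d (Suc n)) U k j)"
    using splits_decompose[OF c q' ex n sp] by blast
  have "EX y. smat 1 k j - (mm (B n) s (d n) k j + mm (B (Suc (Suc n))) (d (Suc n)) U k j) - x * y : q"
    if "k : B (Suc n)" "j : B (Suc n)" for k j
  proof -
    have "smat 1 k j - (mm (B n) s (d n) k j + mm (B (Suc (Suc n))) (d (Suc n)) U k j) : q + range (%c. c * x)"
      using sU that by (simp add: meq_def)
    then obtain a b where "smat 1 k j - (mm (B n) s (d n) k j + mm (B (Suc (Suc n))) (d (Suc n)) U k j) = a + b * x" "a : q"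
      by (auto elim!: plusE)
    thus ?thesis by (intro exI[of _ b]) (simp add: mult.commute)
  qed
  then obtain Y where Y: "!!k j. k : B (Suc n) ==> j : B (Suc n) ==>
      smat 1 k j - (mm (B n) s (d n) k j + mm (B (Suc (Suc n))) (d (Suc n)) U k j) - x * Y k j : q" by metis
  have mY: "meq q (B (Suc n)) (B (Suc n)) (smat 1)
      (%k j. (mm (B n) s (d n) k j + mm (B (Suc (Suc n))) (d (Suc n)) U k j) + x * Y k j)"
    using Y by (simp add: meq_def algebra_simps)
  have "?hi <= ?lo + vs.lmul [x] ?hi"
  proof
    fix v assume vh: "v : ?hi"
    note v = vh[unfolded hiE_mem]
    let ?sd = "capp (B (Suc n)) (mm (B n) s (d n)) v" and ?dU = "capp (B (Suc n)) (mm (B (Suc (Suc n))) (d (Suc n)) U) v"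
      and ?y = "capp (B (Suc n)) Y v"
    have xy: "capp (B (Suc n)) (%k j. x * Y k j) v = (%p. x * ?y p)"
      by (simp add: capp_def sum_distrib_left mult.assoc)
    have "capp (B (Suc n)) (smat 1) v - (?sd + ?dU + (%p. x * ?y p)) : coch (B (Suc n)) K"
      using capp_meq[OF kill smod_K conjunct1[OF v] mY] unfolding capp_mat_add xy .
    from sgp_trans[OF vs.smod_sgp[OF smodule_coch(1)] capp_one[OF c smod_K] this]
    have 1: "v - (?sd + ?dU + (%p. x * ?y p)) : coch (B (Suc n)) K" .
    have 2: "?dU : coch (B (Suc n)) K"
      unfolding capp_capp[symmetric] by (rule capp_mem[OF smod_K conjunct2[OF v]])
    have s0: "capp (B (Suc n)) s v : coch (B n) L" by (rule capp_mem[OF smod_L conjunct1[OF v]])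
    have 3: "?sd : ?lo" unfolding capp_capp[symmetric] using s0 by (rule capp_loE)
    have yc: "?y : coch (B (Suc n)) L" by (rule capp_mem[OF smod_L conjunct1[OF v]])
    have "capp (B (Suc n)) (d (Suc n)) ?y : coch (B (Suc (Suc n))) K"
    proof -
      let ?D = "capp (B (Suc n)) (d (Suc n))"
      have a: "?D (v - (?sd + ?dU + (%p. x * ?y p))) : coch (B (Suc (Suc n))) K" by (rule capp_mem[OF smod_K 1])
      have b: "?D ?dU : coch (B (Suc (Suc n))) K" by (rule capp_mem[OF smod_K 2])
      have cc: "?D ?sd : coch (B (Suc (Suc n))) K"
        unfolding capp_capp[of "B n" "d n" "B (Suc n)" s v, symmetric] capp_capp[of _ _ "B n"]
        by (rule capp_kill[OF kill smod_K s0]) (use sq[of n] in "auto simp: meq_def")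
      have dv: "?D v : coch (B (Suc (Suc n))) K" using v by blast
      have e: "(%p. x * ?D ?y p) = ?D v - ?D ?sd - ?D ?dU - ?D (v - (?sd + ?dU + (%p. x * ?y p)))"
        by (simp add: capp_diff capp_add capp_sc)
      have "(%p. x * ?D ?y p) : coch (B (Suc (Suc n))) K"
        unfolding e using a b cc dv by (intro vs.smod_diff[OF smodule_coch(1)])
      thus ?thesis unfolding coch_def K_def by (auto simp: sl_def dest: nzd)
    qed
    hence yh: "?y : ?hi" using yc by (simp add: hiE_mem)
    have "v - (%p. x * ?y p) = (v - (?sd + ?dU + (%p. x * ?y p))) + ?dU + ?sd" by simp
    moreover have "... : ?lo" using 1 2 3 by (intro vs.smod_add[OF loE_smod]) (rule coch_loE, assumption)+
    ultimately have "v - (%p. x * ?y p) : ?lo" by simp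
    moreover have "(%p. x * ?y p) : vs.lmul [x] ?hi" by (rule vs.lmul_im[OF hiE_smod _ yh]) simp
    ultimately show "v : ?lo + vs.lmul [x] ?hi" by (rule plus_split')
  qed
  moreover obtain g where "vs.gen g ?lo ?hi"
    using vs.rno_gen[OF rnoE[OF cx rKL] loE_smod hiE_smod loE_hiE[OF cx]] by blast
  ultimately have hilo: "?hi <= ?lo" using vs.nakayama[OF _ loE_smod hiE_smod _ killed_E[OF subset_refl] jac] by blast
  \<comment> \<open>\<open>v0\<close> is \<open>d n\<close> itself as a cocycle with values in its
    image. A cochain bounding it is a map \<open>w\<close> to that image with
    \<open>w d = d\<close>; lifting \<open>w\<close> through \<open>d n\<close> gives the
    splitting.\<close>
  define v0 where "v0 p = d n (snd p) (fst p)" for p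
  have "v0 : ?hi" unfolding hiE_mem
  proof
    have "sl k v0 : L" if "k : B (Suc n)" for k
    proof -
      have "lapp (B (Suc n)) (d n) (%j. smat 1 j k) i = d n i k" for i
        using smat_right[OF c that, of "d n i" 1] by (simp add: lapp_def)
      thus ?thesis unfolding L_mem by (auto simp: sl_def v0_def rs.smod_0[OF q] intro!: exI[of _ "%j. smat 1 j k"])
    qed
    thus "v0 : coch (B (Suc n)) L" by (simp add: coch_def)
    show "capp (B (Suc n)) (d (Suc n)) v0 : coch (B (Suc (Suc n))) K"
      using sq[of n] by (simp add: coch_def K_def sl_def capp_def v0_def meq_def mm_def mult.commute)
  qed
  hence "v0 : ?lo" using hilo by blast
  then obtain w where w: "w : coch (B n) L" "v0 - capp (B n) (d n) w : coch (B (Suc n)) K" unfolding loE_mem by blast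
  have "EX a. ALL i:B n. w (k, i) - lapp (B (Suc n)) (d n) a i : q" if "k : B n" for k
    using w(1) that by (simp add: coch_def L_mem sl_def)
  then obtain a where a: "!!k i. k : B n ==> i : B n ==> w (k, i) - lapp (B (Suc n)) (d n) (a k) i : q" by metis
  define S where "S l k = a k l" for l k
  have "mm (B n) (mm (B (Suc n)) (d n) S) (d n) i j - d n i j : q" if i: "i : B n" and j: "j : B (Suc n)" for i j
  proof -
    have 1: "d n i j - (SUM k:B n. d n k j * w (k, i)) : q"
      using w(2) i j by (simp add: coch_def K_def sl_def capp_def v0_def)
    have "(SUM k:B n. d n k j * w (k, i)) - mm (B n) (mm (B (Suc n)) (d n) S) (d n) i j
      = (SUM k:B n. d n k j * (w (k, i) - lapp (B (Suc n)) (d n) (a k) i))"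
      by (simp add: mm_def[of "B n"] right_diff_distrib sum_subtractf mult.commute) (simp add: mm_def lapp_def S_def)
    also have "... : q" using a i by (intro ideal_sum[OF q] ideal_mult[OF q])
    finally have "d n i j - mm (B n) (mm (B (Suc n)) (d n) S) (d n) i j : q" using sgp_trans[OF rs.smod_sgp[OF q] 1] by blast
    from sgp_neg[OF rs.smod_sgp[OF q] this] show ?thesis by simp
  qed
  thus ?thesis unfolding splits_def meq_def by blast
qed

text \<open>Descending induction from the residue field, where every matrix has a generalised
  inverse. Each \<open>x s\<close> costs one degree in \<open>exact_mod_nzd\<close> and is lifted
  back by \<open>splits_lift\<close>; hence the bound \<open>1 + e\<close>.\<close>

theorem regular_fpd:
  assumes q: "rs.smod q" and rno: "rs.rno q UNIV" and reg: "reg q x e" and fld: "fld (jr q x e)"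
    and jac: "!!s. s < e ==> jac q [x s]"
  shows "fpd q"
proof -
  have "ALL (B :: nat => nat list set) d n0 n. (ALL n. finite (B n)) -->
     (ALL n. sqz (jr q x s) B d n) -->
     exact (jr q x s) n0 B d --> n >= n0 + (e - s) --> splits (jr q x s) B d n" if "s <= e" for s
    using that
  proof (induction s rule: inc_induct)
    case base
    show ?case unfolding splits_def
      using field_generalised_inverse[OF jr_smod[OF q] fld] by blast
  next
    case (step s)
    have js: "rs.smod (jr q x s)" by (rule jr_smod[OF q])
    have rs: "rs.rno (jr q x s) UNIV" by (rule rs.rno_mono[OF rno _ subset_refl]) (use jr_mono[OF q, of 0 s x] in simp)
    have nzd: "y : jr q x s" if "x s * y : jr q x s" for y using reg step.hyps that unfolding reg_def by blast
    have jacs: "jac (jr q x s) [x s]" using jac[OF step.hyps(2)] jr_mono[OF q, of 0 s x] unfolding jac_def by auto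
    show ?case
    proof (intro allI impI)
      fix B :: "nat => nat list set" and d n0 n
      assume c: "ALL n. finite (B n)"
        and sq: "ALL n. sqz (jr q x s) B d n"
        and ex: "exact (jr q x s) n0 B d" and n: "n0 + (e - s) <= n"
      have ex': "exact (jr q x (Suc s)) (Suc n0) B d"
        unfolding jr.simps by (rule exact_mod_nzd[OF js c[rule_format] sq[rule_format] ex nzd])
      have sq': "meq (jr q x (Suc s)) (B n) (B (Suc (Suc n))) (mm (B (Suc n)) (d n) (d (Suc n))) (%_ _. 0)" for n
        using sq jr_mono[OF q, of s "Suc s" x] unfolding meq_def by (meson le_SucI order_refl subsetD)
      have "splits (jr q x (Suc s)) B d n" using step.IH c sq' ex' n step.hyps by simp
      thus "splits (jr q x s) B d n"
        using splits_lift[OF js rs c[rule_format] sq[rule_format] ex'[unfolded jr.simps] _ nzd _ jacs] n step.hyps by simp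
    qed
  qed
  from this[of 0] show ?thesis unfolding fpd_def by (intro exI[of _ "1 + e"]) simp
qed

section \<open>Krull dimension and regular sequences\<close>

definition prim :: "'r::comm_ring_1 set => bool"
  where "prim p \<longleftrightarrow> rs.smod p & 1 ~: p & (ALL a b. a * b : p --> a : p | b : p)"

lemma prim_smod: "prim p ==> rs.smod p" by (simp add: prim_def)

abbreviation prin :: "'r::comm_ring_1 => 'r set" where "prin x \<equiv> range (%c. c * x)"

lemma prin_subset: "rs.smod J ==> x : J ==> prin x <= J"
  using ideal_mult by blast

lemma jr_shift: "jr J f (Suc s) = jr (J + prin (f 0)) (%n. f (Suc n)) s"
  by (induction s) simp_all

text \<open>The quotient by \<open>q\<close> is a Noetherian local ring whose maximal ideal is
  generated by \<open>as\<close>; \<open>nn\<close> is the preimage of that ideal.\<close>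

locale local_ring_data =
  fixes q :: "'r::comm_ring_1 set" and as :: "'r list"
  assumes q: "rs.smod q" and rno: "rs.rno q UNIV" and locl: "locl q as" and jac: "jac q as"
    and proper: "1 ~: q + rs.gspan as"
begin

definition nn :: "'r set" where "nn = q + rs.gspan as"

abbreviation pow :: "nat => 'r set" where "pow t \<equiv> rs.lpow as t UNIV"

lemma nn_smod: "rs.smod nn" unfolding nn_def by (intro rs.smod_plus q rs.gspan_smod)

lemma pow_smod: "rs.smod (pow t)" by (rule rs.lpow_smod[OF rs.smod_UNIV])

lemma q_nn: "q <= nn" unfolding nn_def by (rule rs.upper1[OF rs.gspan_smod])

lemma as_nn: "set as <= nn"
  using rs.gspan_base rs.upper2[OF q] unfolding nn_def by blast

lemma lmul_nn: "rs.lmul as UNIV <= nn"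
proof (rule rs.lmul_least)
  fix a x assume "a : set as"
  thus "a * x : nn" using as_nn ideal_mult2[OF nn_smod] by blast
qed (rule rs.smod_sgp[OF nn_smod])

lemma pow_nn: "t >= 1 ==> pow t <= nn"
  using rs.lpow_antimono[OF rs.smod_UNIV, of 1 t as] lmul_nn by (auto simp: rs.lpow_Suc)

lemma unit_or_nn: "c ~: nn ==> EX u. u * c - 1 : q"
  using locl unfolding locl_def nn_def by blast

lemma proper_subset_nn:
  assumes "rs.smod J" "q <= J" "1 ~: J"
  shows "J <= nn"
proof (rule ccontr)
  assume "~ ?thesis"
  then obtain c where c: "c : J" "c ~: nn" by blast
  then obtain u where u: "u * c - 1 : q" using unit_or_nn by blast
  have "u * c - (u * c - 1) : J" using rs.smod_diff[OF assms(1) ideal_mult[OF assms(1) c(1)]] u assms(2) by blast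
  thus False using assms(3) by simp
qed

lemma prim_nn: "prim p ==> q <= p ==> p <= nn"
  by (rule proper_subset_nn) (auto simp: prim_def)

lemma nn_prim: "prim nn"
  unfolding prim_def
proof (intro conjI allI impI nn_smod)
  show "1 ~: nn" using proper unfolding nn_def .
  fix a b assume ab: "a * b : nn"
  show "a : nn | b : nn"
  proof (rule ccontr)
    assume "~ ?thesis"
    then obtain u where u: "u * a - 1 : q" and b: "b ~: nn" using unit_or_nn by blast
    have "(u * a - 1) * b : nn" using ideal_mult2[OF nn_smod] u q_nn by blast
    moreover have "u * (a * b) : nn" by (rule ideal_mult[OF nn_smod ab])
    ultimately have "u * (a * b) - (u * a - 1) * b : nn" using rs.smod_diff[OF nn_smod] by blast
    thus False using b by (simp add: algebra_simps)
  qed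
qed

text \<open>
  The length of \<open>R/(J + \<nn>\<^sup>t)\<close> is \<open>O(t\<^bsup>e-1\<^esup>)\<close>; for \<open>e = 0\<close> this says that it vanishes for large \<open>t\<close>.
\<close>

definition og :: "nat => 'r set => bool"
  where "og e J \<longleftrightarrow> (EX C. ALL t n. rs.chain (pow t + J) n UNIV --> (t + 1) * n <= C * (t + 1) ^ e)"

section \<open>Growth and multiplication by an element\<close>

lemma og_mono: "og e J ==> J <= J' ==> og e J'"
  unfolding og_def using rs.chain_lo[OF _ plus_mono[OF subset_refl]] by meson

lemma smod_pJ: "rs.smod J ==> rs.smod (pow t + J)"
  by (intro rs.smod_plus pow_smod)

lemma og_zero_proper: "rs.smod J ==> J <= nn ==> ~ og 0 J"
proof
  assume J: "rs.smod J" and Jn: "J <= nn" and "og 0 J"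
  then obtain C where C: "!!t n. rs.chain (pow t + J) n UNIV ==> (t + 1) * n <= C" unfolding og_def by auto
  have "pow (C + 1) + J <= nn" by (intro plus_least rs.smod_sgp nn_smod Jn pow_nn) simp
  hence "pow (C + 1) + J \<subset> UNIV" using proper unfolding nn_def by blast
  hence "rs.chain (pow (C + 1) + J) (Suc 0) UNIV"
    by (intro rs.chain.step[OF rs.chain.base[OF smod_pJ[OF J] subset_refl] rs.smod_UNIV])
  from C[OF this] show False by simp
qed

text \<open>Multiplication by \<open>z\<close> maps the ring modulo \<open>A\<close> onto
  \<open>(J + (z))/J\<close>; submodules are pulled back along it.\<close>

lemma chain_pullback:
  assumes J: "rs.smod J" and A: "rs.smod A" and zA: "ALL a:A. z * a : J"
    and c: "rs.chain J n (J + prin z)"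
  shows "rs.chain A n UNIV"
proof -
  have "rs.chain A n {r. z * r : J + prin z}"
  proof (rule rs.chain_transfer[where F = "%H. {r. z * r : H}" and T = "J + prin z", OF c subset_refl])
    fix H assume H: "rs.smod H" "J <= H"
    have "rs.smod {r. z * r : H}"
      by (rule rs.smodI, rule sgpI)
        (auto simp: rs.smod_0[OF H(1)] right_diff_distrib rs.smod_diff[OF H(1)] mult.left_commute ideal_mult[OF H(1)])
    thus "rs.smod {r. z * r : H} & A <= {r. z * r : H}" using zA H(2) by blast
  next
    fix H H' assume H: "rs.smod H" "rs.smod H'" "J <= H" "H <= H'" "H' <= J + prin z"
    show "{r. z * r : H} <= {r. z * r : H'}" using H by blast
    assume sub: "{r. z * r : H'} <= {r. z * r : H}"
    show "H' <= H"
    proof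
      fix h assume h: "h : H'"
      then obtain j c where jc: "h = j + c * z" "j : J" using H(5) by (auto elim!: plusE dest!: subsetD)
      have "c * z : H'" using rs.smod_diff[OF H(2) h, of j] jc H(3,4) by auto
      hence "c * z : H" using sub by (auto simp: mult.commute)
      thus "h : H" using jc H(3) rs.smod_add[OF H(1)] by blast
    qed
  qed
  thus ?thesis by (rule rs.chain.weak[OF _ rs.smod_UNIV subset_UNIV])
qed

lemma chain_split_prin:
  assumes J: "rs.smod J" and A: "rs.smod A" and zA: "ALL a:A. z * a : J" and c: "rs.chain J n UNIV"
  shows "EX m k. n <= m + k & rs.chain A m UNIV & rs.chain (J + prin z) k UNIV"
proof -
  have sm: "rs.smod (J + prin z)" by (intro rs.smod_plus J rs.smod_range)
  have "J <= J + prin z" by (rule rs.upper1[OF rs.smod_range])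
  from rs.chain_split[OF c sm this] obtain m k where mk: "n <= m + k" "rs.chain J m (J + prin z)"
    "rs.chain (J + prin z) k (UNIV + (J + prin z))" by auto
  have "rs.chain A m UNIV" by (rule chain_pullback[OF J A zA mk(2)])
  moreover have "rs.chain (J + prin z) k UNIV" by (rule rs.chain.weak[OF mk(3) rs.smod_UNIV subset_UNIV])
  ultimately show ?thesis using mk(1) by blast
qed

lemma og_mult:
  assumes J: "rs.smod J" and A: "rs.smod A" and zA: "ALL a:A. z * a : J"
    and oA: "og e A" and oz: "og e (J + prin z)"
  shows "og e J"
proof -
  obtain C1 where C1: "!!t n. rs.chain (pow t + A) n UNIV ==> (t + 1) * n <= C1 * (t + 1) ^ e" using oA unfolding og_def by blast
  obtain C2 where C2: "!!t n. rs.chain (pow t + (J + prin z)) n UNIV ==> (t + 1) * n <= C2 * (t + 1) ^ e" using oz unfolding og_def by blast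
  have "(t + 1) * n <= (C1 + C2) * (t + 1) ^ e" if c: "rs.chain (pow t + J) n UNIV" for t n
  proof -
    have "ALL a:pow t + A. z * a : pow t + J"
    proof
      fix a assume "a : pow t + A"
      then obtain b d where "a = b + d" "b : pow t" "d : A" by (rule plusE)
      thus "z * a : pow t + J" using ideal_mult[OF pow_smod] zA by (auto simp: distrib_left intro!: plusI)
    qed
    from chain_split_prin[OF smod_pJ[OF J] smod_pJ[OF A] this c] obtain m k where
      mk: "n <= m + k" "rs.chain (pow t + A) m UNIV" "rs.chain (pow t + (J + prin z)) k UNIV" by (auto simp: add.assoc)
    have "(t + 1) * n <= (t + 1) * m + (t + 1) * k" using mk(1) by (metis add_mult_distrib2 mult_le_mono2)
    also have "... <= C1 * (t + 1) ^ e + C2 * (t + 1) ^ e" by (intro add_mono C1 C2 mk)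
    finally show ?thesis by (simp add: algebra_simps)
  qed
  thus ?thesis unfolding og_def by blast
qed

text \<open>With \<open>h\<close> bounding the lengths for \<open>J + (x)\<close>, the length for
  \<open>J\<close> at \<open>t\<close> is at most the sum of \<open>h s\<close> for
  \<open>s <= t\<close>, because \<open>x\<close> raises the power of the maximal ideal by one.
  Summation raises the order by one.\<close>

lemma og_sum:
  assumes J: "rs.smod J" and x: "x : set as" and o: "og e (J + prin x)"
  shows "og (Suc e) J"
proof -
  obtain C where C: "!!t n. rs.chain (pow t + (J + prin x)) n UNIV ==> (t + 1) * n <= C * (t + 1) ^ e"
    using o unfolding og_def by blast
  define h where "h s = C * (s + 1) ^ e div (s + 1)" for s :: nat
  have hC: "n <= h t" if "rs.chain (pow t + (J + prin x)) n UNIV" for t n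
    using C[OF that] unfolding h_def by (simp add: less_eq_div_iff_mult_less_eq mult.commute)
  have "n <= (SUM s<=t. h s)" if "rs.chain (pow t + J) n UNIV" for t n
    using that
  proof (induction t arbitrary: n)
    case 0
    have "UNIV <= pow 0 + J" using rs.upper1[OF J] by auto
    thus ?case using rs.chain_trivial[OF 0] by simp
  next
    case (Suc t)
    have "ALL a:pow t + J. x * a : pow (Suc t) + J"
    proof
      fix a assume "a : pow t + J"
      then obtain b d where bd: "a = b + d" "b : pow t" "d : J" by (rule plusE)
      have "x * b : pow (Suc t)" unfolding rs.lpow_Suc by (rule rs.lmul_im[OF pow_smod x bd(2)])
      thus "x * a : pow (Suc t) + J" using bd ideal_mult[OF J] by (auto simp: distrib_left intro!: plusI)
    qed
    from chain_split_prin[OF smod_pJ[OF J] smod_pJ[OF J] this Suc.prems] obtain m k where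
      mk: "n <= m + k" "rs.chain (pow t + J) m UNIV" "rs.chain (pow (Suc t) + (J + prin x)) k UNIV" by (auto simp: add.assoc)
    from Suc.IH[OF mk(2)] hC[OF mk(3)] mk(1) show ?case by simp
  qed
  note bound = this
  have "(SUM s<=t. h s) <= (C + C * C) * (t + 1) ^ e" for t
  proof (cases e)
    \<comment> \<open>For \<open>e = 0\<close> the function \<open>h\<close> vanishes from
      \<open>C\<close> on, so the sum is at most \<open>C * C\<close>.\<close>
    case 0
    have "(SUM s<=t. h s) <= (\<Sum>s<C. C)"
    proof -
      have "(SUM s<=t. h s) <= (SUM s<=t. if s : {..<C} then C else 0)"
        by (rule sum_mono) (auto simp: h_def 0 div_le_dividend)
      also have "... = (SUM s:{..t} Int {..<C}. C)" by (rule sum.inter_restrict[symmetric]) simp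
      also have "... <= (\<Sum>s<C. C)" by (rule sum_mono2) auto
      finally show ?thesis .
    qed
    thus ?thesis by (simp add: 0)
  next
    case (Suc e')
    have "h s <= C * (t + 1) ^ e'" if "s <= t" for s
    proof -
      have "C * (s + 1) ^ Suc e' = C * (s + 1) ^ e' * (s + 1)" by (simp only: power_Suc mult_ac)
      hence "h s = C * (s + 1) ^ e'" unfolding h_def Suc by (simp only: nonzero_mult_div_cancel_right)
      also have "... <= C * (t + 1) ^ e'" using that by (intro mult_le_mono power_mono) auto
      finally show ?thesis .
    qed
    hence "(SUM s<=t. h s) <= (SUM s<=t. C * (t + 1) ^ e')" by (intro sum_mono) auto
    also have "... = C * (t + 1) ^ e" by (simp add: Suc algebra_simps)
    also have "... <= (C + C * C) * (t + 1) ^ e" by (intro mult_le_mono) auto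
    finally show ?thesis .
  qed
  hence "(t + 1) * n <= (C + C * C) * (t + 1) ^ Suc e" if "rs.chain (pow t + J) n UNIV" for t n
    using mult_le_mono2[OF order_trans[OF bound[OF that]], of "(C + C * C) * (t + 1) ^ e" "t + 1"]
    by (simp add: algebra_simps)
  thus ?thesis unfolding og_def by blast
qed

text \<open>Multiplication by \<open>x\<close> is injective modulo the prime \<open>J\<close>, and
  by Artin-Rees it moves the filtration by at most a constant \<open>c\<close>. Hence
  \<open>k\<close> copies of a chain for \<open>J + (x)\<close> can be stacked to a chain for
  \<open>J\<close>.\<close>

lemma og_cut:
  assumes J: "prim J" and qJ: "q <= J" and x: "x ~: J"
  shows "EX c. ALL t n k. rs.chain (pow t + (J + prin x)) n UNIV --> rs.chain (pow (t + c * k) + J) (k * n) UNIV"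
proof -
  have sJ: "rs.smod J" using J by (rule prim_smod)
  have sJx: "rs.smod (J + prin x)" by (intro rs.smod_plus sJ rs.smod_range)
  have JJx: "J <= J + prin x" by (rule rs.upper1[OF rs.smod_range])
  obtain c where c: "!!m. (J + prin x) Int (pow (c + m) + J) <= rs.lpow as m (J + prin x) + J"
    using rs.artin_rees_single[OF rs.rno_mono[OF rno qJ subset_refl] sJ rs.smod_UNIV sJx JJx subset_UNIV, of as] by blast
  have colon: "y : pow m + J" if y: "x * y : pow (c + m) + J" for y m
  proof -
    have "x * y : J + prin x" using subsetD[OF rs.upper2[OF sJ]] by (auto simp: mult.commute)
    hence "x * y : rs.lpow as m (J + prin x) + J" using c y by blast
    also have "... <= (rs.lpow as m J + rs.lpow as m (prin x)) + J"
      by (intro plus_mono subset_refl rs.lpow_plus_subset sJ rs.smod_range)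
    finally obtain a b d where abd: "x * y = (a + b) + d" "a : rs.lpow as m J" "b : rs.lpow as m (prin x)" "d : J"
      by (auto elim!: plusE)
    have aJ: "a : J" using rs.lpow_subset[OF sJ] abd(2) by blast
    have "rs.lpow as m (prin x) <= (%z. z * x) ` pow m"
      by (rule lpow_linear_image[OF rs.scal_axioms rs.scal_axioms _ _ rs.smod_UNIV]) (simp_all add: distrib_right mult.assoc)
    then obtain z where z: "b = z * x" "z : pow m" using abd(3) by blast
    have "x * (y - z) = a + d" using abd(1) z(1) by (simp add: algebra_simps)
    also have "... : J" by (rule rs.smod_add[OF sJ aJ abd(4)])
    finally have "y - z : J" using J x unfolding prim_def by blast
    thus ?thesis using z(2) by (intro plus_split)
  qed
  have "rs.chain (pow (t + c * k) + J) (k * n) UNIV" if ch: "rs.chain (pow t + (J + prin x)) n UNIV" for t n k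
  proof (induction k)
    case 0
    thus ?case by (auto intro!: rs.chain.base rs.smod_UNIV)
  next
    case (Suc k)
    define s where "s = t + c * k"
    define X where "X = pow (c + s) + J"
    have sX: "rs.smod X" unfolding X_def by (rule smod_pJ[OF sJ])
    have smx: "rs.smod ((*) x ` H)" if "rs.smod H" for H :: "'r set" by (rule rs.smod_image[OF that])
    have "rs.chain X (k * n) ((*) x ` UNIV + X)"
    proof (rule rs.chain_transfer[where F = "%H. (*) x ` H + X" and T = UNIV, OF Suc.IH[folded s_def] subset_refl])
      fix H :: "'r set" assume H: "rs.smod H"
      show "rs.smod ((*) x ` H + X) & X <= (*) x ` H + X"
        using rs.smod_plus[OF smx[OF H] sX] rs.upper2[OF smx[OF H]] by blast
    next
      fix H H' :: "'r set" assume H: "rs.smod H" "rs.smod H'" "pow s + J <= H" "H <= H'"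
      show "(*) x ` H + X <= (*) x ` H' + X" by (rule plus_mono[OF image_mono[OF H(4)] subset_refl])
      assume sub: "(*) x ` H' + X <= (*) x ` H + X"
      show "H' <= H"
      proof
        fix h' assume h': "h' : H'"
        have "x * h' : (*) x ` H' + X" using rs.upper1[OF sX, of "(*) x ` H'"] h' by blast
        hence "x * h' : (*) x ` H + X" using sub by blast
        then obtain h a where ha: "x * h' = x * h + a" "h : H" "a : X" by (auto elim!: plusE)
        hence "x * (h' - h) : pow (c + s) + J" unfolding X_def[symmetric] by (simp add: right_diff_distrib)
        hence "h' - h : H" using colon H(3) by blast
        thus "h' : H" using sgp_cancel[OF rs.smod_sgp[OF H(1)]] ha(2) by blast
      qed
    qed
    moreover have "rs.chain ((*) x ` UNIV + X) n UNIV"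
    proof (rule rs.chain_lo[OF ch])
      have sm: "rs.smod (pow t + (J + prin x))" by (rule smod_pJ[OF sJx])
      have up: "J + prin x <= pow t + (J + prin x)" by (rule rs.upper2[OF pow_smod])
      show "(*) x ` UNIV + X <= pow t + (J + prin x)" unfolding X_def
      proof (intro plus_least rs.smod_sgp[OF sm])
        have "(*) x ` UNIV <= prin x" by (auto simp: mult.commute)
        thus "(*) x ` UNIV <= pow t + (J + prin x)"
          using up rs.upper2[OF sJ, of "prin x"] by blast
        have "pow (c + s) <= pow t" by (rule rs.lpow_antimono[OF rs.smod_UNIV]) (simp add: s_def)
        thus "pow (c + s) <= pow t + (J + prin x)" using rs.upper1[OF sJx, of "pow t"] by blast
        show "J <= pow t + (J + prin x)" using up JJx by blast
      qed
    qed
    ultimately have "rs.chain X (k * n + n) UNIV" using rs.chain_append by blast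
    moreover have "c + s = t + c * Suc k" by (simp add: s_def)
    ultimately show ?case unfolding X_def by (simp add: add.commute)
  qed
  thus ?thesis by blast
qed

text \<open>Stacking \<open>t + 1\<close> copies keeps the exponent of the maximal ideal linear in
  \<open>t\<close>; dividing by the number of copies lowers the order by one.\<close>

lemma og_prime:
  assumes J: "prim J" and qJ: "q <= J" and x: "x ~: J" and o: "og (Suc e) J"
  shows "og e (J + prin x)"
proof -
  obtain c where c: "!!t n k. rs.chain (pow t + (J + prin x)) n UNIV ==> rs.chain (pow (t + c * k) + J) (k * n) UNIV"
    using og_cut[OF J qJ x] by blast
  obtain C where C: "!!t n. rs.chain (pow t + J) n UNIV ==> (t + 1) * n <= C * (t + 1) ^ Suc e" using o unfolding og_def by blast
  have "(t + 1) * n <= (C * (c + 1) ^ e) * (t + 1) ^ e" if "rs.chain (pow t + (J + prin x)) n UNIV" for t n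
  proof -
    define u where "u = t + c * (t + 1) + 1"
    have "u * ((t + 1) * n) <= C * u ^ Suc e" using C[OF c[OF that, of "t + 1"]] by (simp add: u_def)
    hence "u * ((t + 1) * n) <= u * (C * u ^ e)" by (simp add: algebra_simps)
    moreover have "0 < u" by (simp add: u_def)
    ultimately have "(t + 1) * n <= C * u ^ e" by (simp only: nat_mult_le_cancel1)
    also have "u = (c + 1) * (t + 1)" by (simp add: u_def)
    finally show ?thesis by (simp only: power_mult_distrib mult.assoc)
  qed
  thus ?thesis unfolding og_def by blast
qed

text \<open>Each strict inclusion of primes lowers the order of growth by one, and order zero is
  impossible for a proper ideal. This is the bound of the Krull dimension by the order of the
  Hilbert-Samuel function.\<close>

lemma og_prime_chain:
  assumes "!!i. i <= n ==> prim (P i)" "!!i. i < n ==> P i \<subset> P (Suc i)" "rs.smod J" "q <= J" "J <= P 0" "og e J"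
  shows "n < e"
  using assms
proof (induction n arbitrary: P J e)
  case 0
  have qP: "q <= P 0" using 0 by blast
  have "~ og 0 (P 0)" by (rule og_zero_proper[OF prim_smod prim_nn[OF _ qP]]) (use 0 in auto)
  hence "~ og 0 J" using og_mono[OF _ 0(5)] by blast
  thus ?case using 0(6) by (cases e) auto
next
  case (Suc n)
  have qP: "q <= P 0" using Suc.prems by blast
  have p0: "prim (P 0)" using Suc.prems by simp
  have "~ og 0 (P 0)" by (rule og_zero_proper[OF prim_smod[OF p0] prim_nn[OF p0 qP]])
  hence "~ og 0 J" using og_mono[OF _ Suc.prems(5)] by blast
  then obtain e' where e: "e = Suc e'" using Suc.prems(6) by (cases e) auto
  obtain x where x: "x : P 1" "x ~: P 0" using Suc.prems(2)[of 0] by auto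
  have s1: "rs.smod (P 1)" using Suc.prems(1)[of 1] prim_smod by simp
  have P01: "P 0 <= P 1" using Suc.prems(2)[of 0] by auto
  have "og (Suc e') (P 0)" using og_mono[OF _ Suc.prems(5)] Suc.prems(6) e by blast
  hence o: "og e' (P 0 + prin x)" by (rule og_prime[OF p0 qP x(2)])
  have "n < e'"
  proof (rule Suc.IH[of "%i. P (Suc i)"])
    show "rs.smod (P 0 + prin x)" by (intro rs.smod_plus prim_smod[OF p0] rs.smod_range)
    show "q <= P 0 + prin x" using qP rs.upper1[OF rs.smod_range, of "P 0"] by blast
    show "P 0 + prin x <= P (Suc 0)" using P01 prin_subset[OF s1 x(1)] by (intro plus_least rs.smod_sgp) (use s1 in auto)
  qed (use Suc.prems o in auto)
  thus ?case by (simp add: e)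
qed

text \<open>Each generator raises the order by at most one, starting from the residue field. The
  successor appears because order \<open>e\<close> stands for the exponent
  \<open>e - 1\<close>.\<close>

lemma og_gens:
  assumes "rs.smod J" "q <= J" "set xs <= set as" "nn <= J + rs.gspan xs"
  shows "og (Suc (length xs)) J"
  using assms
proof (induction xs arbitrary: J)
  case Nil
  hence nJ: "nn <= J" by simp
  have "n <= 1" if "rs.chain (pow t + J) n UNIV" for t n
  proof (rule rs.chain_le_gen[where as = as and q = q, OF _ Nil(1) rs.smod_UNIV subset_UNIV _ _ locl])
    have "x : rs.gspan [1]" for x using ideal_mult[OF rs.gspan_smod rs.gspan_base, of 1 "[1]" x] by simp
    hence "UNIV <= J + rs.gspan [1]" using rs.upper2[OF Nil(1), of "rs.gspan [1]"] by blast
    thus "rs.gen 1 J UNIV" unfolding rs.gen_def by (intro exI[of _ "[1]"]) simp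
    show "rs.lmul as UNIV <= J" using lmul_nn nJ by blast
    show "rs.killed q J UNIV" unfolding rs.killed_def using ideal_mult2[OF Nil(1)] Nil(2) by blast
    show "rs.chain J n UNIV" by (rule rs.chain_lo[OF that rs.upper2[OF pow_smod]])
  qed
  hence "(t + 1) * n <= 1 * (t + 1) ^ Suc 0" if "rs.chain (pow t + J) n UNIV" for t n
    using that by (metis mult_le_mono2 nat_mult_1 nat_mult_1_right power_Suc0_right)
  thus ?case unfolding og_def by (metis list.size(3))
next
  case (Cons x xs)
  have "og (Suc (length xs)) (J + prin x)"
  proof (rule Cons.IH)
    show "rs.smod (J + prin x)" by (intro rs.smod_plus Cons.prems rs.smod_range)
    show "q <= J + prin x" using Cons.prems(2) rs.upper1[OF rs.smod_range, of J] by blast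
    show "nn <= J + prin x + rs.gspan xs" using Cons.prems(4) by (simp add: add.assoc)
  qed (use Cons.prems in auto)
  from og_sum[OF Cons.prems(1) _ this] show ?case using Cons.prems(3) by simp
qed

text \<open>
  A ring whose maximal ideal has \<open>d\<close> generators and whose growth has the largest possible order
  is a domain: if \<open>y z = 0\<close>, its growth is bounded by that of \<open>R/y\<close> and \<open>R/z\<close>.
\<close>

lemma maximal_growth_regular:
  assumes "rs.smod J" "q <= J" "J <= nn" "set xs <= set as" "nn <= J + rs.gspan xs" "~ og (length xs) J"
  shows "prim J & reg J (nth xs) (length xs)"
  using assms
proof (induction xs arbitrary: J)
  case Nil
  hence "J = nn" by auto
  thus ?case using nn_prim by (simp add: reg_def)
next
  case (Cons x xs)
  note J = Cons.prems(1) and qJ = Cons.prems(2)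
  define d where "d = length xs"
  define J' where "J' = J + prin x"
  have xa: "x : set as" using Cons.prems(4) by simp
  have J': "rs.smod J'" unfolding J'_def by (intro rs.smod_plus J rs.smod_range)
  have JJ': "J <= J'" unfolding J'_def by (rule rs.upper1[OF rs.smod_range])
  have qJ': "q <= J'" using qJ JJ' by blast
  have gJ': "nn <= J' + rs.gspan xs" using Cons.prems(5) by (simp add: J'_def add.assoc)
  have nd: "~ og (Suc d) J" using Cons.prems(6) by (simp add: d_def)
  have "~ og d J'" using og_sum[OF J xa, of d] nd unfolding J'_def by blast
  moreover have "J' <= nn" unfolding J'_def
    using as_nn xa prin_subset[OF nn_smod] by (intro plus_least rs.smod_sgp nn_smod Cons.prems(3)) blast
  ultimately have IH: "prim J'" "reg J' (nth xs) d" using Cons.IH[OF J' qJ' _ _ gJ'] Cons.prems(4) unfolding d_def by auto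
  have oJ': "og (Suc d) J'" unfolding d_def by (rule og_gens[OF J' qJ' _ gJ']) (use Cons.prems in simp)
  have xJ: "x ~: J"
  proof
    assume "x : J"
    hence "J' <= J" unfolding J'_def using prin_subset[OF J] by (intro plus_least rs.smod_sgp J subset_refl) auto
    thus False using og_mono[OF oJ'] nd by blast
  qed
  \<comment> \<open>Adding any \<open>y\<close> outside \<open>J\<close> lowers the growth. If
    \<open>y\<close> is not in \<open>J + (x)\<close>, this comes from the prime
    \<open>J + (x)\<close>. Otherwise \<open>y\<close> is \<open>c x\<close> modulo \<open>J\<close>
    with \<open>c\<close> one power less deep, and the growth is bounded by those of
    \<open>J + (c)\<close> and \<open>J + (x)\<close>.\<close>
  have oy: "og (Suc d) (J + prin y)" if "y ~: pow k + J" for y k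
    using that
  proof (induction k arbitrary: y)
    case 0
    have "UNIV <= pow 0 + J" using rs.upper1[OF J] by auto
    thus ?case using 0 by blast
  next
    case (Suc k)
    have sy: "rs.smod (J + prin y)" by (intro rs.smod_plus J rs.smod_range)
    show ?case
    proof (cases "y : J'")
      case False
      have "og d (J' + prin y)" by (rule og_prime[OF IH(1) qJ' False oJ'])
      moreover have "J' + prin y = (J + prin y) + prin x" by (simp add: J'_def ac_simps)
      ultimately show ?thesis using og_sum[OF sy xa] by simp
    next
      case True
      then obtain j c where jc: "y = j + c * x" "j : J" unfolding J'_def by (auto elim!: plusE)
      have "c ~: pow k + J"
      proof
        assume "c : pow k + J"
        then obtain a b where ab: "c = a + b" "a : pow k" "b : J" by (rule plusE)
        have "x * a : pow (Suc k)" unfolding rs.lpow_Suc by (rule rs.lmul_im[OF pow_smod xa ab(2)])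
        moreover have "j + b * x : J" using rs.smod_add[OF J jc(2) ideal_mult2[OF J ab(3)]] .
        ultimately have "x * a + (j + b * x) : pow (Suc k) + J" by (rule plusI)
        moreover have "x * a + (j + b * x) = y" using jc ab by (simp add: algebra_simps)
        ultimately show False using Suc.prems by simp
      qed
      hence oc: "og (Suc d) (J + prin c)" by (rule Suc.IH)
      show ?thesis
      proof (rule og_mult[where z = x, OF sy _ _ oc], goal_cases)
        case 1
        show "rs.smod (J + prin c)" by (intro rs.smod_plus J rs.smod_range)
      next
        case 2
        show ?case
        proof
        fix a assume "a : J + prin c"
        then obtain b e where be: "a = b + e * c" "b : J" by (auto elim!: plusE)
        have "x * b - e * j : J" using rs.smod_diff[OF J ideal_mult[OF J be(2)] ideal_mult[OF J jc(2)]] .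
        hence "(x * b - e * j) + e * y : J + prin y" by (intro plusI) auto
        moreover have "(x * b - e * j) + e * y = x * a" using be jc by (simp add: algebra_simps)
        ultimately show "x * a : J + prin y" by simp
        qed
      next
        case 3
        have "J' <= J + prin y + prin x" unfolding J'_def
          by (rule plus_mono[OF rs.upper1[OF rs.smod_range] subset_refl])
        thus "og (Suc d) (J + prin y + prin x)" by (rule og_mono[OF oJ'])
      qed
    qed
  qed
  have oy': "og (Suc d) (J + prin y)" if "y ~: J" for y
  proof -
    have "EX k. y ~: pow k + J"
    proof (rule ccontr)
      assume "~ ?thesis"
      hence "y : J"
        by (intro rs.krull_intersection[where q = q and as = as, OF rs.rno_mono[OF rno qJ subset_refl] J rs.smod_UNIV subset_UNIV _ jac])
          (use qJ ideal_mult2[OF J] in "auto simp: rs.killed_def")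
      thus False using that by blast
    qed
    thus ?thesis using oy by blast
  qed
  have pJ: "prim J" unfolding prim_def
  proof (intro conjI allI impI J)
    show "1 ~: J" using Cons.prems(3) proper unfolding nn_def by blast
    fix a b assume ab: "a * b : J"
    show "a : J | b : J"
    proof (rule ccontr)
      assume "~ ?thesis"
      hence na: "a ~: J" and nb: "b ~: J" by auto
      have "og (Suc d) J"
      proof (rule og_mult[where z = b and A = "J + prin a", OF J _ _ oy'[OF na] oy'[OF nb]], goal_cases)
        case 1
        show "rs.smod (J + prin a)" by (intro rs.smod_plus J rs.smod_range)
      next
        case 2
        show ?case
        proof
        fix w assume "w : J + prin a"
        then obtain j e where je: "w = j + e * a" "j : J" by (auto elim!: plusE)
        have "b * j + e * (a * b) : J" by (intro rs.smod_add[OF J] ideal_mult[OF J] je ab)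
        thus "b * w : J" using je by (simp add: algebra_simps)
        qed
      qed
      thus False using nd by blast
    qed
  qed
  moreover have "reg J (nth (x # xs)) (length (x # xs))"
    unfolding reg_def
  proof (intro allI impI)
    fix s y assume s: "s < length (x # xs)" and y: "(x # xs) ! s * y : jr J (nth (x # xs)) s"
    show "y : jr J (nth (x # xs)) s"
    proof (cases s)
      case 0
      thus ?thesis using y pJ xJ unfolding prim_def by auto
    next
      case (Suc s')
      have "jr J (nth (x # xs)) s = jr J' (nth xs) s'" unfolding Suc jr_shift by (simp add: J'_def)
      thus ?thesis using y s IH(2) unfolding Suc reg_def d_def by auto
    qed
  qed
  ultimately show ?case by blast
qed

text \<open>A chain of primes as long as the list of generators excludes the order
  \<open>length as\<close>, so the growth is maximal.\<close>

theorem regular_of_prime_chain: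
  assumes "!!i. i <= length as ==> prim (P i)" "!!i. i < length as ==> P i \<subset> P (Suc i)" "q <= P 0"
  shows "reg q (nth as) (length as)"
proof -
  have "~ og (length as) q"
    using og_prime_chain[OF assms(1,2) q subset_refl assms(3)] by blast
  thus ?thesis using maximal_growth_regular[OF q subset_refl q_nn subset_refl] by (simp add: nn_def)
qed

end

section \<open>Asymptotic growth\<close>

text \<open>The number of generators is \<open>O(n^(b-1))\<close>. The factor \<open>n + 1\<close>
  avoids the negative exponent at \<open>b = 0\<close>, and using \<open>n + 1\<close> in place of
  \<open>n\<close> avoids an exception at \<open>n = 0\<close>.\<close>

definition grow :: "nat => (nat => ('x => 'r::comm_ring_1) set) => (nat => ('x => 'r) set) => bool"
  where "grow b lo hi \<longleftrightarrow> (EX C. ALL n. EX g. vs.gen g (lo n) (hi n) & (n + 1) * g <= C * (n + 1) ^ b)"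

lemma grow_ext:
  assumes "grow b lo mid" "grow b mid hi" "!!n. mid n <= hi n"
  shows "grow b lo hi"
proof -
  obtain C1 where C1: "!!n. EX g. vs.gen g (lo n) (mid n) & (n + 1) * g <= C1 * (n + 1) ^ b" using assms(1) unfolding grow_def by blast
  obtain C2 where C2: "!!n. EX g. vs.gen g (mid n) (hi n) & (n + 1) * g <= C2 * (n + 1) ^ b" using assms(2) unfolding grow_def by blast
  have "EX g. vs.gen g (lo n) (hi n) & (n + 1) * g <= (C1 + C2) * (n + 1) ^ b" for n
  proof -
    obtain g h where g: "vs.gen g (lo n) (mid n)" "(n + 1) * g <= C1 * (n + 1) ^ b"
      and h: "vs.gen h (mid n) (hi n)" "(n + 1) * h <= C2 * (n + 1) ^ b" using C1 C2 by blast
    have "vs.gen (g + h) (lo n) (hi n)" by (rule vs.gen_ext[OF g(1) h(1) assms(3)])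
    moreover have "(n + 1) * (g + h) <= (C1 + C2) * (n + 1) ^ b"
      using add_mono[OF g(2) h(2)] by (simp only: distrib_left distrib_right)
    ultimately show ?thesis by blast
  qed
  thus ?thesis unfolding grow_def by blast
qed

lemma grow_mult:
  assumes "!!n g. vs.gen g (lo n) (hi n) ==> vs.gen (M * g) (lo' n) (hi' n)" "grow b lo hi"
  shows "grow b lo' hi'"
proof -
  obtain C where C: "!!n. EX g. vs.gen g (lo n) (hi n) & (n + 1) * g <= C * (n + 1) ^ b" using assms(2) unfolding grow_def by blast
  have "EX g. vs.gen g (lo' n) (hi' n) & (n + 1) * g <= (M * C) * (n + 1) ^ b" for n
  proof -
    obtain g where g: "vs.gen g (lo n) (hi n)" "(n + 1) * g <= C * (n + 1) ^ b" using C by blast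
    have "M * ((n + 1) * g) <= M * (C * (n + 1) ^ b)" by (rule mult_le_mono2[OF g(2)])
    hence "(n + 1) * (M * g) <= (M * C) * (n + 1) ^ b" by (simp only: mult_ac)
    thus ?thesis using assms(1)[OF g(1)] by blast
  qed
  thus ?thesis unfolding grow_def by blast
qed

lemma grow_transfer:
  assumes "!!n g. vs.gen g (lo n) (hi n) ==> vs.gen g (lo' n) (hi' n)" "grow b lo hi"
  shows "grow b lo' hi'"
  by (rule grow_mult[where M = 1, OF _ assms(2)]) (use assms(1) in simp)

lemma grow_le: "grow b lo hi ==> b <= b' ==> grow b' lo hi"
  unfolding grow_def using power_increasing[of b b'] by (meson le_add2 mult_le_mono2 order_trans)

section \<open>Stabilisation of sets of exponents\<close>

lemma increasing_finite_stabilises: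
  fixes A :: "nat => 'a set"
  assumes "finite F" "!!j. j >= k ==> A j <= F" "!!j. j >= k ==> A j <= A (Suc j)"
  shows "EX j0>=k. ALL j>=j0. A j = A j0"
proof -
  have mono: "A i <= A j" if "k <= i" "i <= j" for i j
    using that(2)
  proof (induction rule: dec_induct)
    case (step n)
    show ?case by (rule subset_trans[OF step.IH assms(3)]) (use that(1) step.hyps in simp)
  qed simp
  define m where "m = (GREATEST m. EX j>=k. card (A j) = m)"
  have bound: "y <= card F" if "EX j>=k. card (A j) = y" for y using that card_mono[OF assms(1) assms(2)] by auto
  have "EX j>=k. card (A j) = m" unfolding m_def
    by (rule GreatestI_nat[where k = "card (A k)" and b = "card F"]) (use bound in auto)
  then obtain j0 where j0: "j0 >= k" "card (A j0) = m" by blast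
  have "A j = A j0" if "j >= j0" for j
  proof (rule card_seteq[symmetric])
    show "finite (A j)" using assms(1,2) j0 that by (meson finite_subset order_trans)
    show "A j0 <= A j" by (rule mono[OF j0(1) that])
    show "card (A j) <= card (A j0)" unfolding j0(2) m_def
      by (rule Greatest_le_nat[where b = "card F"]) (use bound that j0(1) order_trans in blast)+
  qed
  thus ?thesis using j0 by blast
qed

text \<open>Once some \<open>b1\<close> belongs to a member it belongs to all later ones, and only
  the finitely many numbers below \<open>b1\<close> can still be added.\<close>

lemma upward_increasing_stabilises:
  fixes S :: "nat => nat set"
  assumes up: "!!j b b'. b : S j ==> b <= b' ==> b' : S j" and inc: "!!j. j >= k ==> S j <= S (Suc j)"
  shows "EX j0>=k. ALL j>=j0. S j = S j0"
proof (cases "EX j>=k. S j ~= {}")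
  case False
  thus ?thesis by (intro exI[of _ k]) auto
next
  case True
  then obtain j1 b1 where j1: "j1 >= k" "b1 : S j1" by blast
  have b1: "b1 : S j" if "j >= j1" for j
    using that
  proof (induction rule: dec_induct)
    case (step n)
    show ?case by (rule subsetD[OF inc step.IH]) (use j1(1) step.hyps in simp)
  qed (rule j1(2))
  have "EX j0>=j1. ALL j>=j0. S j Int {..<b1} = S j0 Int {..<b1}"
    by (rule increasing_finite_stabilises[of "{..<b1}"], simp, simp, rule Int_mono[OF inc[OF order_trans[OF j1(1)]] subset_refl])
  then obtain j0 where j0: "j0 >= j1" "!!j. j >= j0 ==> S j Int {..<b1} = S j0 Int {..<b1}" by blast
  have "S j = S j0" if "j >= j0" for j
  proof (rule Set.set_eqI)
    fix b
    have "b : S j Int {..<b1} \<longleftrightarrow> b : S j0 Int {..<b1}" using j0(2)[OF that] by simp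
    moreover have "b : S j & b : S j0" if "b1 <= b"
      using up[OF b1 that] j0(1) `j >= j0` by simp
    ultimately show "b : S j \<longleftrightarrow> b : S j0" by (cases "b1 <= b") simp_all
  qed
  thus ?thesis by (intro exI[of _ j0] conjI order_trans[OF j1(1) j0(1)] allI impI)
qed

lemma vs_gen_shift:
  assumes "vs.gen n lo hi" "lo <= lo'" "vs.smod lo'" "vs.smod lo"
  shows "vs.gen n lo' (hi + lo')"
proof -
  have "vs.gen n lo' ((%v. v) ` hi + lo')"
    by (rule gen_lin_image[OF _ _ assms(1) _ assms(3,4)]) (use assms(2) in auto)
  thus ?thesis by simp
qed

lemma vs_gen_unshift:
  assumes "vs.gen n lo' (hi + lo')" "vs.smod hi" "vs.smod lo'" "hi Int lo' <= lo"
  shows "vs.gen n lo hi"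
  by (rule gen_lin_pullback[where ph = "%v. v", OF _ _ assms(1) _ _ assms(2,3)])
    (use assms(4) vs.upper1[OF assms(3), of hi] in auto)

text \<open>The layer of degree \<open>t\<close> is generated by the products of the top generators
  with the \<open>length gs ^ t\<close> words in \<open>gs\<close>.\<close>

lemma vs_gen_lpow_quotient:
  assumes g: "vs.gen g (vs.lmul gs X + lo) X" and lo: "vs.smod lo" and X: "vs.smod X" and lX: "lo <= X"
  shows "vs.gen ((\<Sum>t<j. length gs ^ t) * g) (vs.lpow gs j X + lo) X"
proof (induction j)
  case 0
  have "X <= X + lo" by (rule vs.upper1[OF lo])
  thus ?case unfolding vs.gen_def by (intro exI[of _ "[]"]) (simp add: set_zero_plus2 flip: set_zero)
next
  case (Suc j)
  have sm: "vs.smod (vs.lpow gs t X + lo)" for t by (intro vs.smod_plus vs.lpow_smod X lo)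
  have "vs.gen (length gs ^ j * g) (vs.lpow gs j (vs.lmul gs X + lo)) (vs.lpow gs j X)"
  proof (induction j)
    case (Suc j)
    show ?case unfolding vs.lpow_Suc power_Suc mult.assoc
      by (rule vs.gen_lmul_lo[OF Suc]) (intro vs.lpow_smod vs.smod_plus vs.lmul_smod X lo)+
  qed (use g in simp)
  moreover have "vs.lpow gs j (vs.lmul gs X + lo) <= vs.lpow gs (Suc j) X + lo"
    unfolding vs.lpow_Suc2
    by (rule subset_trans[OF vs.lpow_plus_subset plus_mono]) (intro vs.lmul_smod X lo vs.lpow_subset subset_refl)+
  ultimately have "vs.gen (length gs ^ j * g) (vs.lpow gs (Suc j) X + lo) (vs.lpow gs j X + (vs.lpow gs (Suc j) X + lo))"
    by (rule vs_gen_shift[OF _ _ sm]) (intro vs.lpow_smod vs.smod_plus vs.lmul_smod X lo)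
  moreover have "vs.lpow gs j X + (vs.lpow gs (Suc j) X + lo) = vs.lpow gs j X + lo"
  proof (rule subset_antisym)
    show "vs.lpow gs j X + (vs.lpow gs (Suc j) X + lo) <= vs.lpow gs j X + lo"
      by (intro plus_least vs.smod_sgp[OF sm] plus_mono vs.lpow_antimono X subset_refl plus_upper1 vs.smod_0[OF lo]) simp
    show "vs.lpow gs j X + lo <= vs.lpow gs j X + (vs.lpow gs (Suc j) X + lo)"
      by (intro plus_mono subset_refl plus_upper2 vs.smod_0[OF vs.lpow_smod[OF X]])
  qed
  ultimately have "vs.gen (length gs ^ j * g) (vs.lpow gs (Suc j) X + lo) (vs.lpow gs j X + lo)" by simp
  from vs.gen_ext[OF this Suc.IH] show ?case
    by (simp add: distrib_right add.commute plus_least[OF vs.smod_sgp[OF X]] vs.lpow_subset X lX)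
qed

text \<open>The ring modulo \<open>q\<close> plays the role of \<open>Q\<close> and the ring modulo
  \<open>jr q f c\<close> that of the complete intersection. \<open>N\<close> is the free module on
  \<open>X\<close> modulo \<open>K\<close>, \<open>M\<close> enters through its resolution, and
  \<open>gs\<close> generates the ideal \<open>I\<close>.\<close>

locale asymptotic = local_ring_data q as
  for q :: "'r::comm_ring_1 set" and as +
  fixes f :: "nat => 'r" and c :: nat and B :: "nat => nat list set" and d :: "nat => nat list => nat list => 'r"
    and X :: "'x set" and K :: "('x => 'r) set" and gs :: "'r list"
  assumes fpd: "fpd q" and reg: "reg q f c"
    and finB: "!!n. finite (B n)" and B0: "B 0 = {}"
    and sq: "!!n. sqz (jr q f c) B d n"
    and ex: "exact (jr q f c) 1 B d"
    and finX: "finite X" and K: "vs.smod K" and KX: "!!v. (ALL x:X. v x : jr q f c) ==> v : K"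
begin

abbreviation "J \<equiv> jr q f c"

lemma J_smod: "rs.smod J" by (rule jr_smod[OF q])

lemma q_J: "q <= J" using jr_mono[OF q, of 0 c f] by simp

lemma kill_J: "K <= K' ==> vs.killed J K' L"
  unfolding vs.killed_def by (intro ballI, erule subsetD, rule KX, intro ballI, rule ideal_mult2[OF J_smod])

lemma rno_K: "K <= K' ==> vs.rno K' UNIV"
  by (rule vs.rno_mono[OF rno_vec[OF finX rs.rno_mono[OF rno q_J subset_refl] J_smod]])
    (erule order_trans[rotated], use KX in auto)

lemma lifted_ex: "EX t. lifted q f c B d t"
proof -
  have "ALL n i j. EX g. i : B n --> j : B (Suc (Suc n)) --> mm (B (Suc n)) (d n) (d (Suc n)) i j - (\<Sum>s<c. f s * g s) : q"
    using sq jr_repr[of _ q f c] by (simp add: meq_def)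
  then obtain g where "!!n i j. i : B n ==> j : B (Suc (Suc n)) ==>
    mm (B (Suc n)) (d n) (d (Suc n)) i j - (\<Sum>s<c. f s * g n i j s) : q" by metis
  hence "lifted q f c B d (%s n i j. g n i j s)"
    unfolding lifted_def meq_def using finB B0 ex by blast
  thus ?thesis by blast
qed

lemma coeff_const:
  assumes "vs.smod K'" "K <= K'"
  shows "coeff (range vs.scop) (%_::unit. K') (%_. UNIV) J"
proof
  show "noeth (range vs.scop) (%_::unit. K') (%_. UNIV)" using rno_K[OF assms(2)] unfolding vs.rno_def .
  show "subfam (range vs.scop) (%_. K') (%_. UNIV) (%_. K')"
    "subfam (range vs.scop) (%_. K') (%_. UNIV) (%_. UNIV)"
    unfolding vs.subfam_scop using assms(1) vs.smod_UNIV by simp_all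
  show "vs.linear_op w" if "w : range vs.scop" for w :: "(unit, 'x => 'r) op"
    using that by (elim rangeE) (simp only: vs.scop_linear)
qed (use kill_J[OF assms(2)] assms J_smod vs.smod_UNIV in "simp_all")

abbreviation "hiN \<equiv> hiC B d"
abbreviation "loN \<equiv> loC B d"

text \<open>The preimage of \<open>I^j N\<close> in the free module; \<open>hiN (KI j)\<close>
  modulo \<open>loN (KI j)\<close> is \<open>Ext(M, N/I^j N)\<close>.\<close>

abbreviation "KI j \<equiv> vs.lpow gs j UNIV + K"

lemma KI: "vs.smod (KI j)" "K <= KI j"
  using vs.upper2[OF vs.lpow_smod[OF vs.smod_UNIV]] by (auto intro: vs.smod_plus vs.lpow_smod vs.smod_UNIV K)

lemma dd_coch: "vs.smod K' ==> K <= K' ==> capp (B (Suc n)) (d (Suc n)) (capp (B n) (d n) w) : coch (B (Suc (Suc n))) K'"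
  by (rule capp_capp_coch[OF _ kill_J sq[of n]])

lemma coch_mono: "A <= A' ==> coch C A <= coch C A'"
  unfolding coch_def by (rule Collect_mono, intro impI ballI, drule (1) bspec, erule (1) subsetD)

lemma loN_hiN: "vs.smod K' ==> K <= K' ==> loN K' n <= hiN K' n"
  by (rule loC_hiC[OF _ kill_J sq[of n]])

text \<open>The image of \<open>Ext(M, N)\<close> is stable under the cohomology operators, so one
  Artin-Rees exponent serves all \<open>n\<close>, and \<open>gen_submodule\<close> bounds its
  generators by a constant multiple of those of the whole.\<close>

lemma grow_submodule:
  assumes K': "vs.smod K'" "K <= K'" and g: "grow b (loN K') (hiN K')"
  shows "grow b (loN K') (%n. hiN K n + loN K' n)"
proof -
  interpret X: coeff "range vs.scop" "%_::unit. K" "%_. UNIV" J by (rule coeff_const[OF K subset_refl])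
  interpret Y: coeff "range vs.scop" "%_::unit. K'" "%_. UNIV" J by (rule coeff_const[OF K'])
  obtain t where t: "lifted q f c B d t" using lifted_ex by blast
  let ?T = "t ` {..<c}"
  have cX: "X.cpx B d" by (rule X.lifted_cpx[OF q t subset_refl])
  have cY: "Y.cpx B d" by (rule Y.lifted_cpx[OF q t subset_refl])
  have comX: "X.commuting B d u" if "u : ?T" for u using X.lifted_commuting[OF q t reg _ subset_refl] that by auto
  have comY: "Y.commuting B d u" if "u : ?T" for u using Y.lifted_commuting[OF q t reg _ subset_refl] that by auto
  let ?lo = "loE B d (%_::unit. K') (%_. UNIV)" and ?hi = "hiE B d (%_::unit. K') (%_. UNIV)"
    and ?h0 = "hiE B d (%_::unit. K) (%_. UNIV)"
  let ?mid = "%p. ?h0 p + ?lo p"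
  have n: "noeth (Y.opsE B ?T) ?lo ?hi" by (rule Y.noeth_ext_family[OF q fpd t reg subset_refl])
  have sY: "subfam (Y.opsE B ?T) ?lo ?hi ?lo" "subfam (Y.opsE B ?T) ?lo ?hi ?hi"
    by (rule Y.subfam_E(1)[OF cY comY], assumption, rule Y.subfam_E(2)[OF cY comY])
  have smid: "vs.smod (?mid p)" for p by (intro vs.smod_plus X.hiE_smod Y.loE_smod)
  have lm: "?lo p <= ?mid p" for p by (rule vs.upper2[OF X.hiE_smod])
  have h0: "?h0 p <= ?hi p" for p using subsetD[OF coch_mono[OF K'(2)]] by (cases p) (auto simp: hiE_mem coch_UNIV)
  have mh: "?mid p <= ?hi p" for p by (rule plus_least[OF vs.smod_sgp[OF Y.hiE_smod] h0 Y.loE_hiE[OF cY]])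
  have sub: "subfam (Y.opsE B ?T) ?lo ?hi ?mid"
  proof (rule subfamI[OF vs.smod_sgp[OF smid] lm mh], rule stableI)
    fix w p x assume w: "w : Y.opsE B ?T" and x: "x : ?mid p"
    from x obtain a b where ab: "x = a + b" "a : ?h0 p" "b : ?lo p" by (rule plusE)
    have "snd w p a : ?h0 (fst w p)" by (rule stableD[OF X.opsE_stable(1)[OF comX] w ab(2)])
    moreover have "snd w p b : ?lo (fst w p)" by (rule stableD[OF subfamD(4)[OF sY(1)] w ab(3)])
    ultimately show "snd w p x : ?mid (fst w p)"
      unfolding ab(1) additive_add[OF vs.linear_additive[OF Y.opsE_linear[OF w]]] by (rule plusI)
  qed
  obtain k where k: "!!m p. ?mid p Int (vs.lpow as (k + m) (?hi p) + ?lo p) <= vs.lpow as m (?mid p) + ?lo p"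
    using vs.artin_rees[OF n sY sub Y.loE_smod Y.hiE_smod smid, of as] Y.opsE_linear by blast
  show ?thesis
  proof (rule grow_mult[OF _ g])
    fix n g assume g: "vs.gen g (loN K' n) (hiN K' n)"
    have r: "vs.rno (?lo (n, ())) (?mid (n, ()))"
      by (rule vs.rno_mono[OF Y.rnoE[OF cY rno_K[OF K'(2)]] subset_refl mh])
    obtain n0 where n0: "vs.gen n0 (?lo (n, ())) (?mid (n, ()))"
      using vs.rno_gen[OF r Y.loE_smod smid lm] by blast
    have "vs.gen ((\<Sum>t<Suc k. length as ^ t) * g) (?lo (n, ())) (?mid (n, ()))"
    proof (rule vs.gen_submodule[OF g[unfolded loC_def hiC_def] Y.loE_smod smid Y.hiE_smod lm mh _ Y.killed_E[OF q_J] locl jac n0])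
      show "?mid (n, ()) Int (vs.lpow as (Suc k) (?hi (n, ())) + ?lo (n, ())) <= vs.lmul as (?mid (n, ())) + ?lo (n, ())"
        using k[of "(n, ())" 1] by (simp add: vs.lpow_Suc)
    qed
    thus "vs.gen ((\<Sum>t<Suc k. length as ^ t) * g) (loN K' n) (hiN K n + loN K' n)"
      unfolding loC_def hiC_def .
  qed
qed

text \<open>Cocycles for \<open>Ext(M, I^j N)\<close>, where \<open>I^j N\<close> is
  \<open>KI j\<close> modulo \<open>K\<close>. The coboundaries are \<open>loR\<close>, and
  \<open>kerR\<close> gives the kernel of the map to \<open>Ext(M, N)\<close>.\<close>

definition hiR :: "nat => nat => (nat list \<times> 'x => 'r) set"
  where "hiR j n = {v : coch (B (Suc n)) (KI j). capp (B (Suc n)) (d (Suc n)) v : coch (B (Suc (Suc n))) K}"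

definition loR :: "nat => nat => (nat list \<times> 'x => 'r) set"
  where "loR j n = {v. EX w:coch (B n) (KI j). v - capp (B n) (d n) w : coch (B (Suc n)) K}"

definition kerR :: "nat => nat => (nat list \<times> 'x => 'r) set"
  where "kerR j n = hiR j n Int loN K n"

text \<open>The groups \<open>Ext(M, I^j N)\<close> for all \<open>j\<close> are the
  \<open>Ext\<close> with coefficients in the Rees family. Generation in bounded Rees degree gives
  the recursion, for the whole of \<open>Ext\<close> if \<open>L\<close> is \<open>UNIV\<close> and
  for the kernels if \<open>L = loN K\<close>.\<close>

lemma rees_generated: "L = (%_. UNIV) | L = loN K ==>
    EX k. ALL j n. j >= k --> hiR (Suc j) n Int L n <= vs.lmul gs (hiR j n Int L n) + loR (Suc j) n"
  and R_smod: "vs.smod (hiR j n)" "vs.smod (loR j n)" "loR j n <= hiR j n"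
  and lmul_loR: "vs.lmul gs (loR j n) <= loR (Suc j) n"
proof -
  interpret X: coeff "range vs.scop" "%_::unit. K" "%_. UNIV" J by (rule coeff_const[OF K subset_refl])
  have lin0: "ALL w:range vs.scop. vs.linear_op (w :: (unit, 'x => 'r) op)" by (intro ballI X.lin)
  let ?W = "slice_op ` range vs.scop Un set (map vs.yop gs) :: (nat \<times> unit, 'x => 'r) op set"
    and ?K = "%(j::nat, i::unit). K" and ?L = "%(j, i::unit). KI j"
  note R = vs.noeth_rees[where as = gs, OF X.noeth_KL X.sub_K X.sub_L X.smod_K X.smod_L lin0]
  interpret R: coeff ?W ?K ?L J
  proof
    show "noeth ?W ?K ?L" "subfam ?W ?K ?L ?K" "subfam ?W ?K ?L ?L" by (rule R(1), rule R(2), rule R(3))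
    show "vs.smod (?K i)" "vs.smod (?L i)" "vs.killed J (?K i) (?L i)" for i
      using K KI kill_J[OF subset_refl] by (cases i, simp)+
    show "vs.linear_op w" if "w : ?W" for w by (rule R(4)[OF that])
  qed (rule J_smod)
  obtain t where t: "lifted q f c B d t" using lifted_ex by blast
  let ?T = "t ` {..<c}"
  have cX: "X.cpx B d" by (rule X.lifted_cpx[OF q t subset_refl])
  have cR: "R.cpx B d" by (rule R.lifted_cpx[OF q t subset_refl])
  have comX: "X.commuting B d u" if "u : ?T" for u using X.lifted_commuting[OF q t reg _ subset_refl] that by auto
  have comR: "R.commuting B d u" if "u : ?T" for u using R.lifted_commuting[OF q t reg _ subset_refl] that by auto
  let ?lo = "loE B d ?K ?L" and ?hi = "hiE B d ?K ?L"
  have hiR: "?hi (n, (j, ())) = hiR j n" and loR: "?lo (n, (j, ())) = loR j n" for n j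
    by (auto simp: hiE_def loE_def hiR_def loR_def)
  show sR: "vs.smod (hiR j n)" "vs.smod (loR j n)" for j n
    using R.hiE_smod[of B d "(n, (j, ()))"] R.loE_smod[of B d "(n, (j, ()))"] unfolding hiR loR .
  show lh: "loR j n <= hiR j n" for j n using R.loE_hiE[OF cR, of "(n, (j, ()))"] unfolding hiR loR .
  have sfR: "subfam (R.opsE B ?T) ?lo ?hi ?lo" "subfam (R.opsE B ?T) ?lo ?hi ?hi"
    by (rule R.subfam_E(1)[OF cR comR], assumption, rule R.subfam_E(2)[OF cR comR])
  define V :: "(nat \<times> nat \<times> unit, nat list \<times> 'x => 'r) op set" where "V = lift ` slice_op ` range vs.scop Un chi B ` ?T"
  define ys :: "(nat \<times> nat \<times> unit, nat list \<times> 'x => 'r) op list" where "ys = map (%a. lift (vs.yop a)) gs"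
  \<comment> \<open>The multiplications by \<open>gs\<close> are separated from the operators that
    keep the Rees degree; generation is counted with respect to the former.\<close>
  have ops: "R.opsE B ?T = V Un set ys" unfolding R.opsE_def V_def ys_def by (simp add: image_Un image_image Un_ac)
  have yop: "fst (lift (vs.yop a)) (n, (j, i)) = (n, (Suc j, i))" "snd (lift (vs.yop a)) p v = (%x. a * v x)"
    for a :: 'r and n j and i :: unit and p :: "nat \<times> nat \<times> unit" and v :: "nat list \<times> 'x => 'r"
    by (auto simp: lift_def sl_def vs.yop_def split: prod.splits)
  show lmlo: "vs.lmul gs (loR j n) <= loR (Suc j) n" for j n
  proof (rule vs.lmul_least[OF vs.smod_sgp[OF sR(2)]])
    fix a v assume a: "a : set gs" and v: "v : loR j n"
    have w: "lift (vs.yop a) : R.opsE B ?T" using a unfolding ops ys_def by auto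
    from stableD[OF subfamD(4)[OF sfR(1)] w, of v "(n, (j, ()))"] v
    show "(%x. a * v x) : loR (Suc j) n" unfolding loR yop by simp
  qed
  assume L: "L = (%_. UNIV) | L = loN K"
  define mid where "mid p = ?hi p Int L (fst p)" for p
  have mid: "mid (n, (j, ())) = hiR j n Int L n" for n j by (simp add: mid_def hiR)
  have slo: "vs.smod (L n)" for n using L vs.smod_UNIV loC_smod[OF K] by auto
  have smid: "vs.smod (mid p)" for p unfolding mid_def by (intro vs.smod_Int R.hiE_smod slo)
  have lm: "?lo p <= mid p" for p
    using R.loE_hiE[OF cR, of p] L by (cases p) (auto simp: mid_def loE_mem loC_mem)
  have sub: "subfam (R.opsE B ?T) ?lo ?hi mid"
  proof (rule subfamI[OF vs.smod_sgp[OF smid] lm], goal_cases)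
    case (1 i)
    show ?case by (auto simp: mid_def)
  next
    case 2
    show ?case
    proof (rule stableI)
      fix w p x assume w: "w : R.opsE B ?T" and x: "x : mid p"
      obtain n j where p: "p = (n, (j, ()))" by (cases p) auto
      have "snd w p x : ?hi (fst w p)" by (rule stableD[OF subfamD(4)[OF sfR(2)] w]) (use x in "simp add: mid_def")
      moreover have "snd w p x : L (fst (fst w p))"
      proof -
        have xl: "x : L n" using x p by (simp add: mid_def)
        from w[unfolded ops V_def ys_def] consider (s) e where "w = lift (slice_op (vs.scop e))" | (y) a where "w = lift (vs.yop a)"
          | (c) u where "u : ?T" "w = chi B u"
          by auto
        thus ?thesis
        proof cases
          case s
          have "snd w p x = (%y. e * x y)" by (auto simp: s p lift_def sl_def)
          moreover have "fst (fst w p) = n" by (simp add: s p)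
          ultimately show ?thesis using vs.smod_sc[OF slo xl] by simp
        next
          case y
          thus ?thesis using vs.smod_sc[OF slo xl] by (simp add: p yop)
        next
          case c
          have "chi B u : X.opsE B ?T" using c(1) by (simp add: X.opsE_def)
          from stableD[OF X.opsE_stable(2)[OF comX] this, of x "(n, ())"] xl L
          show ?thesis by (auto simp: c(2) p loC_def)
        qed
      qed
      ultimately show "snd w p x : mid (fst w p)" by (simp add: mid_def)
    qed
  qed
  have n: "noeth (V Un set ys) ?lo ?hi" using R.noeth_ext_family[OF q fpd t reg subset_refl] unfolding ops .
  have linR: "vs.linear_op w" if "w : V Un set ys" for w
    by (rule R.opsE_linear[where T = ?T and B = B]) (unfold ops, rule that)
  have "EX k. ALL p. fst (snd p) > k --> mid p <= addims ys mid ?lo p"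
  proof (rule noeth_generated[where deg = "%p. fst (snd p)", OF n])
    show "subfam (V Un set ys) ?lo ?hi mid" "subfam (V Un set ys) ?lo ?hi ?lo" using sub sfR(1) unfolding ops .
    show "additive_op w" if "w : V Un set ys" for w by (rule vs.linear_additive[OF linR[OF that]])
    show "inj (fst y)" if y: "y : set ys" for y
    proof -
      obtain a where a: "y = lift (vs.yop a)" using y by (auto simp: ys_def)
      show ?thesis unfolding a by (rule injI) (auto simp: yop)
    qed
    show "fst (snd (fst y p)) = Suc (fst (snd p))" if "y : set ys" for y p
      using that by (cases p) (auto simp: ys_def yop)
    show "fst (snd (fst w p)) = fst (snd p)" if "w : V" for w p
      using that by (cases p) (auto simp: V_def)
    show "commutes w y ?lo mid" if w: "w : V" and y: "y : set ys" for w y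
    proof -
      obtain a where a: "y = lift (vs.yop a)" using y by (auto simp: ys_def)
      have lw: "vs.linear_op w" using w by (intro linR) simp
      have idx: "fst w (fst y p) = fst y (fst w p)" for p
        using w unfolding a by (cases p) (auto simp: V_def yop)
      have val: "snd w (fst y p) v = snd w p v" for p v
        using w unfolding a by (cases p) (auto simp: V_def yop lift_def)
      show ?thesis unfolding commutes_def
      proof (intro allI conjI ballI idx)
        fix p x assume "x : mid p"
        have "snd w (fst y p) (snd y p x) = snd y (fst w p) (snd w p x)"
          unfolding val unfolding a yop using lw unfolding vs.linear_op_def by (elim conjE allE) assumption
        thus "snd w (fst y p) (snd y p x) - snd y (fst w p) (snd w p x) : ?lo (fst w (fst y p))"
          using vs.smod_0[OF R.loE_smod] by simp
      qed
    qed
  qed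
  then obtain k where k: "!!p. fst (snd p) > k ==> mid p <= addims ys mid ?lo p" by blast
  have "hiR (Suc j) n Int L n <= vs.lmul gs (hiR j n Int L n) + loR (Suc j) n" if "j >= k" for j n
  proof -
    have skj: "vs.smod (hiR j n Int L n)" using smid[of "(n, (j, ()))"] unfolding mid .
    have "addims ys mid ?lo (n, (Suc j, ())) <= vs.lmul gs (hiR j n Int L n) + loR (Suc j) n"
    proof (rule addims_least)
      show "sgp (vs.lmul gs (hiR j n Int L n) + loR (Suc j) n)" by (intro vs.smod_sgp vs.smod_plus vs.lmul_smod skj sR)
      show "?lo (n, (Suc j, ())) <= vs.lmul gs (hiR j n Int L n) + loR (Suc j) n"
        unfolding loR by (rule vs.upper2[OF vs.lmul_smod[OF skj]])
      fix y p e assume y: "y : set ys" and p: "fst y p = (n, (Suc j, ()))" and e: "e : mid p"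
      obtain a where a: "y = lift (vs.yop a)" "a : set gs" using y by (auto simp: ys_def)
      have "p = (n, (j, ()))" using p unfolding a by (cases p) (auto simp: yop)
      hence "(%x. a * e x) : vs.lmul gs (hiR j n Int L n)" using vs.lmul_im[OF skj a(2)] e mid by simp
      thus "snd y p e : vs.lmul gs (hiR j n Int L n) + loR (Suc j) n"
        unfolding a yop using vs.upper1[OF sR(2)] by blast
    qed
    thus ?thesis using k[of "(n, (Suc j, ()))"] that unfolding mid by auto
  qed
  thus "EX k. ALL j n. j >= k --> hiR (Suc j) n Int L n <= vs.lmul gs (hiR j n Int L n) + loR (Suc j) n" by blast
qed

section \<open>Growth of the kernels and images\<close>

lemma kerR_smod: "vs.smod (kerR j n)"
  unfolding kerR_def by (intro vs.smod_Int R_smod loC_smod K subset_refl)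

lemma loR_kerR: "loR j n <= kerR j n"
  using R_smod(3) unfolding kerR_def by (auto simp: loR_def loC_mem)

text \<open>By the recursion, generators of the next kernel are products of \<open>gs\<close> with
  those of the previous one; a factor \<open>length gs\<close> does not affect the order. The
  degrees are \<open>Suc n\<close> because of the connecting homomorphism.\<close>

lemma grow_kernel_Suc: "EX k. ALL j>=k. ALL b. grow b (%n. loR j (Suc n)) (%n. kerR j (Suc n))
    --> grow b (%n. loR (Suc j) (Suc n)) (%n. kerR (Suc j) (Suc n))"
proof -
  obtain k where k: "!!j n. j >= k ==> kerR (Suc j) n <= vs.lmul gs (kerR j n) + loR (Suc j) n"
    using rees_generated[of "loN K"] unfolding kerR_def by auto
  have gen: "vs.gen (length gs * g) (loR (Suc j) n) (kerR (Suc j) n)"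
    if "j >= k" "vs.gen g (loR j n) (kerR j n)" for j n g
  proof -
    have "vs.gen (length gs * g) (vs.lmul gs (loR j n)) (vs.lmul gs (kerR j n))"
      by (rule vs.gen_lmul_lo[OF that(2) R_smod(2) kerR_smod])
    hence "vs.gen (length gs * g) (loR (Suc j) n) (vs.lmul gs (kerR j n) + loR (Suc j) n)"
      by (rule vs_gen_shift[OF _ lmul_loR R_smod(2) vs.lmul_smod[OF R_smod(2)]])
    moreover have "vs.lmul gs (kerR j n) + loR (Suc j) n = kerR (Suc j) n"
    proof (rule subset_antisym[OF _ k[OF that(1)]])
      have "vs.lmul gs (kerR j n) <= kerR (Suc j) n"
      proof (rule vs.lmul_least[OF vs.smod_sgp[OF kerR_smod]])
        fix a v assume a: "a : set gs" and v: "v : kerR j n"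
        have "sl k (%x. a * v x) : KI (Suc j)" if "k : B (Suc n)" for k
        proof -
          have "sl k v : KI j" using v that by (simp add: kerR_def hiR_def coch_def)
          then obtain y z where yz: "sl k v = y + z" "y : vs.lpow gs j UNIV" "z : K" by (rule plusE)
          have "(%x. a * y x) : vs.lpow gs (Suc j) UNIV"
            unfolding vs.lpow_Suc by (rule vs.lmul_im[OF vs.lpow_smod[OF vs.smod_UNIV] a yz(2)])
          moreover have "(%x. a * z x) : K" by (rule vs.smod_sc[OF K yz(3)])
          moreover have "sl k (%x. a * v x) = (%x. a * y x) + (%x. a * z x)"
            by (simp add: yz(1) fun_eq_iff distrib_left)
          ultimately show ?thesis by (metis plusI)
        qed
        moreover have "capp (B (Suc n)) (d (Suc n)) (%x. a * v x) : coch (B (Suc (Suc n))) K"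
          using v vs.smod_sc[OF coch_smod[OF K]] unfolding capp_sc by (auto simp: kerR_def hiR_def)
        moreover have "(%x. a * v x) : loN K n"
          using v vs.smod_sc[OF loC_smod[OF K], of _ B d n] by (simp add: kerR_def)
        ultimately show "(%x. a * v x) : kerR (Suc j) n" by (simp add: kerR_def hiR_def coch_def)
      qed
      thus "vs.lmul gs (kerR j n) + loR (Suc j) n <= kerR (Suc j) n"
        by (rule plus_least[OF vs.smod_sgp[OF kerR_smod] _ loR_kerR])
    qed
    ultimately show ?thesis by simp
  qed
  show ?thesis
  proof (intro exI[of _ k] allI impI)
    fix j b assume "k <= j" "grow b (%n. loR j (Suc n)) (%n. kerR j (Suc n))"
    thus "grow b (%n. loR (Suc j) (Suc n)) (%n. kerR (Suc j) (Suc n))"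
      by (intro grow_mult[where M = "length gs", OF gen[OF `k <= j`]])
  qed
qed

definition imR :: "nat => nat => (nat list \<times> 'x => 'r) set"
  where "imR j n = hiR j n + loN K n"

lemma loN_mono: "K' <= K'' ==> loN K' n <= loN K'' n"
  unfolding loC_mem subset_iff[of "loN K' n"] by (intro allI impI, erule exE, rule exI, erule subsetD[OF coch_mono, rotated])

text \<open>Exactness at \<open>Ext(M, N)\<close>: a class vanishes in
  \<open>Ext(M, N/I^j N)\<close> exactly if it comes from \<open>Ext(M, I^j N)\<close>.\<close>

lemma imR_eq: "hiN K n Int loN (KI j) n <= imR j n" "imR j n <= loN (KI j) n"
proof -
  show "hiN K n Int loN (KI j) n <= imR j n"
  proof
    fix x assume x: "x : hiN K n Int loN (KI j) n"
    then obtain w where w: "x - capp (B n) (d n) w : coch (B (Suc n)) (KI j)" by (auto simp: loC_mem)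
    have "capp (B (Suc n)) (d (Suc n)) (x - capp (B n) (d n) w) : coch (B (Suc (Suc n))) K"
      unfolding capp_diff using x by (intro vs.smod_diff[OF coch_smod[OF K]] dd_coch[OF K subset_refl]) (simp add: hiC_mem)
    hence "x - capp (B n) (d n) w : hiR j n" using w by (simp add: hiR_def)
    moreover have "capp (B n) (d n) w : loN K n"
      unfolding loC_mem using vs.smod_0[OF coch_smod[OF K]] by (intro exI[of _ w]) simp
    ultimately show "x : imR j n" unfolding imR_def by (rule plus_split')
  qed
  show "imR j n <= loN (KI j) n" unfolding imR_def
    by (rule plus_least[OF vs.smod_sgp[OF loC_smod[OF KI(1)]] _ loN_mono[OF KI(2)]])
      (auto simp: hiR_def intro: coch_loC)
qed

lemma hiN_mono: "K' <= K'' ==> hiN K' n <= hiN K'' n"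
  using subsetD[OF coch_mono] by (auto simp: hiC_mem)

text \<open>
  The exact sequence \<open>0 \<rightarrow> Ext(M,N)/im Ext(M,I\<^sup>jN) \<rightarrow> Ext(M,N/I\<^sup>jN) \<rightarrow> ker(Ext(M,I\<^sup>jN) \<rightarrow> Ext(M,N)) \<rightarrow> 0\<close>,
  where the last map raises the degree by one.
\<close>

lemma grow_quotient_iff:
  "grow b (loN (KI j)) (hiN (KI j)) \<longleftrightarrow> grow b (imR j) (hiN K) & grow b (%n. loR j (Suc n)) (%n. kerR j (Suc n))"
proof -
  let ?mid = "%n. hiN K n + loN (KI j) n"
  have sm: "vs.smod (?mid n)" for n by (intro vs.smod_plus hiC_smod loC_smod K subset_refl KI)
  have mh: "?mid n <= hiN (KI j) n" for n
    by (rule plus_least[OF vs.smod_sgp[OF hiC_smod[OF KI(1)]] hiN_mono[OF KI(2)] loN_hiN[OF KI]])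
  have simR: "vs.smod (imR j n)" for n unfolding imR_def by (intro vs.smod_plus R_smod loC_smod K subset_refl)
  have eq1: "vs.gen g (imR j n) (hiN K n) \<longleftrightarrow> vs.gen g (loN (KI j) n) (?mid n)" for g n
    by (rule iffI, rule vs_gen_shift[OF _ imR_eq(2) loC_smod[OF KI(1)] simR], assumption,
      rule vs_gen_unshift[OF _ hiC_smod[OF K] loC_smod[OF KI(1)] imR_eq(1)])
  \<comment> \<open>The connecting homomorphism: the differential of a cocycle modulo
    \<open>I^j N\<close> has values in \<open>I^j N\<close>.\<close>
  define ph :: "nat => (nat list \<times> 'x => 'r) => nat list \<times> 'x => 'r" where "ph n = capp (B (Suc n)) (d (Suc n))" for n
  have lin: "ph n (u + v) = ph n u + ph n v" "ph n (%x. e * v x) = (%x. e * ph n v x)"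
    for n e and u v :: "nat list \<times> 'x => 'r" by (simp_all add: ph_def capp_add capp_sc)
  have im1: "ph n ` hiN (KI j) n <= kerR j (Suc n)" for n
  proof
    fix y assume "y : ph n ` hiN (KI j) n"
    then obtain v where v: "y = capp (B (Suc n)) (d (Suc n)) v" "v : hiN (KI j) n" by (auto simp: ph_def)
    have "y : loN K (Suc n)" unfolding loC_mem v(1) using vs.smod_0[OF coch_smod[OF K]] by (intro exI[of _ v]) simp
    moreover have "y : hiR j (Suc n)" using v dd_coch[OF K subset_refl] by (auto simp: hiR_def hiC_mem)
    ultimately show "y : kerR j (Suc n)" by (simp add: kerR_def)
  qed
  have im2: "kerR j (Suc n) <= ph n ` hiN (KI j) n + loR j (Suc n)" for n
  proof
    fix y assume y: "y : kerR j (Suc n)"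
    then obtain w where w: "y - capp (B (Suc n)) (d (Suc n)) w : coch (B (Suc (Suc n))) K" by (auto simp: kerR_def loC_mem)
    have yk: "y : coch (B (Suc (Suc n))) (KI j)" using y by (simp add: kerR_def hiR_def)
    have "y - capp (B (Suc n)) (d (Suc n)) w : coch (B (Suc (Suc n))) (KI j)" using w KI(2) by (auto simp: coch_def)
    from sgp_cancel'[OF vs.smod_sgp[OF coch_smod[OF KI(1)]] this yk]
    have "w : hiN (KI j) n" by (simp add: hiC_mem)
    moreover have "y - ph n w : loR j (Suc n)"
      unfolding loR_def ph_def using w vs.smod_0[OF coch_smod[OF KI(1)]] by (intro CollectI bexI[of _ 0]) auto
    ultimately show "y : ph n ` hiN (KI j) n + loR j (Suc n)" by (intro plus_split[OF imageI])
  qed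
  have im: "ph n ` hiN (KI j) n + loR j (Suc n) = kerR j (Suc n)" for n
    by (rule subset_antisym[OF plus_least[OF vs.smod_sgp[OF kerR_smod] im1 loR_kerR] im2])
  have ker: "ph n ` ?mid n <= loR j (Suc n)" for n
  proof
    fix y assume "y : ph n ` ?mid n"
    then obtain a b where ab: "y = ph n a + ph n b" "a : hiN K n" "b : loN (KI j) n"
      by (auto simp: lin elim!: plusE)
    have cl: "v : coch (B (Suc (Suc n))) K ==> v : loR j (Suc n)" for v
      unfolding loR_def using vs.smod_0[OF coch_smod[OF KI(1)]] by (intro CollectI bexI[of _ 0]) auto
    have "ph n a : loR j (Suc n)" using ab(2) by (intro cl) (simp add: hiC_mem ph_def)
    moreover have "ph n b : loR j (Suc n)"
    proof -
      obtain w where w: "b - capp (B n) (d n) w : coch (B (Suc n)) (KI j)" using ab(3) by (auto simp: loC_mem)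
      have "ph n (b - capp (B n) (d n) w) : loR j (Suc n)"
        unfolding loR_def ph_def using w vs.smod_0[OF coch_smod[OF K]] by (intro CollectI bexI[OF _ w]) auto
      moreover have "ph n (capp (B n) (d n) w) : loR j (Suc n)"
        unfolding ph_def by (rule cl, rule dd_coch[OF K subset_refl])
      ultimately have "ph n (b - capp (B n) (d n) w) + ph n (capp (B n) (d n) w) : loR j (Suc n)" by (rule vs.smod_add[OF R_smod(2)])
      thus ?thesis unfolding lin(1)[symmetric] by simp
    qed
    ultimately show "y : loR j (Suc n)" unfolding ab(1) by (rule vs.smod_add[OF R_smod(2)])
  qed
  have gK: "vs.gen g (loR j (Suc n)) (kerR j (Suc n))" if "vs.gen g (?mid n) (hiN (KI j) n)" for g n
    using gen_lin_image[where ph = "ph n", OF lin that ker R_smod(2) sm] unfolding im .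
  have gK': "vs.gen g (?mid n) (hiN (KI j) n)" if "vs.gen g (loR j (Suc n)) (kerR j (Suc n))" for g n
  proof (rule gen_lin_pullback[where ph = "ph n", OF lin that im2 im1 hiC_smod[OF KI(1)] R_smod(2)])
    fix x assume x: "x : hiN (KI j) n" "ph n x : loR j (Suc n)"
    then obtain w where w: "w : coch (B (Suc n)) (KI j)" "ph n x - capp (B (Suc n)) (d (Suc n)) w : coch (B (Suc (Suc n))) K"
      by (auto simp: loR_def)
    have "x - w : hiN K n" using w(2) by (simp add: hiC_mem ph_def capp_diff)
    moreover have "w : loN (KI j) n" by (rule coch_loC, rule w(1))
    ultimately show "x : ?mid n" by (rule plus_split')
  qed
  show ?thesis
  proof (intro iffI conjI)
    assume g: "grow b (loN (KI j)) (hiN (KI j))"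
    \<comment> \<open>Only here does a bound pass to a submodule; the other implications concern
      quotients, extensions and isomorphisms.\<close>
    show "grow b (imR j) (hiN K)"
      by (rule grow_transfer[OF _ grow_submodule[OF KI g]]) (use eq1 in blast)
    have "grow b ?mid (hiN (KI j))"
      by (rule grow_transfer[OF _ g], rule vs.gen_mono_lo) (assumption, rule vs.upper2[OF hiC_smod[OF K]])
    thus "grow b (%n. loR j (Suc n)) (%n. kerR j (Suc n))" by (rule grow_transfer[rotated]) (rule gK)
  next
    assume "grow b (imR j) (hiN K) & grow b (%n. loR j (Suc n)) (%n. kerR j (Suc n))"
    hence a: "grow b (imR j) (hiN K)" and k: "grow b (%n. loR j (Suc n)) (%n. kerR j (Suc n))" by auto
    have "grow b (loN (KI j)) ?mid" by (rule grow_transfer[OF _ a]) (use eq1 in blast)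
    moreover have "grow b ?mid (hiN (KI j))" by (rule grow_transfer[OF _ k]) (rule gK')
    ultimately show "grow b (loN (KI j)) (hiN (KI j))" by (rule grow_ext[OF _ _ mh])
  qed
qed

text \<open>For large \<open>j\<close> the image lies between \<open>I^j H\<close> and
  \<open>I H\<close>, where \<open>H = Ext(M, N)\<close>. The numbers of generators of the two
  quotients of \<open>H\<close> differ by a factor depending only on \<open>j\<close> and
  \<open>gs\<close>.\<close>

lemma grow_image_iff: "EX k. ALL j>=k. ALL b. grow b (imR j) (hiN K)
    \<longleftrightarrow> grow b (%n. vs.lmul gs (hiN K n) + loN K n) (hiN K)"
proof -
  obtain k where k: "!!j n. j >= k ==> hiR (Suc j) n <= vs.lmul gs (hiR j n) + loR (Suc j) n"
    using rees_generated[of "%_. UNIV"] by auto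
  note hi = hiC_smod[OF K] and lo = loC_smod[OF K]
  have 1: "imR (Suc j) n <= vs.lmul gs (hiN K n) + loN K n" if "j >= k" for j n
  proof -
    have "hiR j n <= hiN K n" "loR (Suc j) n <= loN K n" by (auto simp: hiR_def loR_def hiC_mem loC_mem)
    hence "hiR (Suc j) n <= vs.lmul gs (hiN K n) + loN K n"
      by (intro subset_trans[OF k[OF that] plus_mono] vs.lmul_mono)
    thus ?thesis unfolding imR_def
      by (intro plus_least vs.smod_sgp vs.smod_plus vs.lmul_smod hi lo plus_upper2 vs.smod_0)
  qed
  have 2: "vs.lpow gs j (hiN K n) + loN K n <= imR j n" for j n
    unfolding imR_def
  proof (rule plus_mono[OF _ subset_refl], rule subsetI)
    fix v assume v: "v : vs.lpow gs j (hiN K n)"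
    have "sl k v : KI j" if "k : B (Suc n)" for k
    proof -
      have "sl k v : vs.lpow gs j UNIV"
        by (rule subsetD[OF lpow_linear[OF vs.scal_axioms vs.scal_axioms _ _ subset_UNIV vs.smod_UNIV] imageI[OF v]]) (simp_all add: sl_def fun_eq_iff)
      thus ?thesis by (rule subsetD[OF vs.upper1[OF K]])
    qed
    moreover have "v : hiN K n" by (rule subsetD[OF vs.lpow_subset[OF hi] v])
    ultimately show "v : hiR j n" by (simp add: hiR_def hiC_mem coch_def)
  qed
  show ?thesis
  proof (intro exI[of _ "Suc k"] allI impI iffI)
    fix j b assume "Suc k <= j" and g: "grow b (imR j) (hiN K)"
    then obtain i where i: "j = Suc i" "k <= i" by (cases j) auto
    show "grow b (%n. vs.lmul gs (hiN K n) + loN K n) (hiN K)"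
      by (rule grow_transfer[OF _ g], erule vs.gen_mono_lo, unfold i(1), rule 1[OF i(2)])
  next
    fix j b assume "grow b (%n. vs.lmul gs (hiN K n) + loN K n) (hiN K)"
    thus "grow b (imR j) (hiN K)"
    proof (rule grow_mult[rotated])
      fix n g assume "vs.gen g (vs.lmul gs (hiN K n) + loN K n) (hiN K n)"
      thus "vs.gen ((\<Sum>t<j. length gs ^ t) * g) (imR j n) (hiN K n)"
        by (intro vs.gen_mono_lo[OF vs_gen_lpow_quotient 2] hi lo loN_hiN[OF K subset_refl])
    qed
  qed
qed

theorem growth_stabilises: "EX j0. ALL j>=j0. ALL b. grow b (loN (KI j)) (hiN (KI j)) \<longleftrightarrow> grow b (loN (KI j0)) (hiN (KI j0))"
proof -
  define S where "S j = {b. grow b (%n. loR j (Suc n)) (%n. kerR j (Suc n))}" for j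
  obtain k where "!!j. j >= k ==> S j <= S (Suc j)" using grow_kernel_Suc unfolding S_def by blast
  hence "EX j0>=k. ALL j>=j0. S j = S j0"
    by (intro upward_increasing_stabilises) (auto simp: S_def intro: grow_le)
  then obtain j1 where j1: "!!j. j >= j1 ==> S j = S j1" by blast
  obtain j2 where j2: "!!j b. j >= j2 ==> grow b (imR j) (hiN K) \<longleftrightarrow> grow b (%n. vs.lmul gs (hiN K n) + loN K n) (hiN K)"
    using grow_image_iff by blast
  define j0 where "j0 = max j1 j2"
  have "grow b (imR j) (hiN K) \<longleftrightarrow> grow b (imR j0) (hiN K)" "S j = S j0" if "j >= j0" for j b
    using j1[of j] j1[of j0] j2[of j] j2[of j0] that by (auto simp: j0_def)
  hence "grow b (loN (KI j)) (hiN (KI j)) \<longleftrightarrow> grow b (loN (KI j0)) (hiN (KI j0))" if "j >= j0" for j b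
    using that unfolding grow_quotient_iff S_def by blast
  thus ?thesis by blast
qed

end

section \<open>Faithful flatness of the completion\<close>

text \<open>Coordinates outside \<open>Y\<close> are unconstrained, so the functions on the whole
  type modulo \<open>vk Y q\<close> form the free module on \<open>Y\<close> over the quotient by
  \<open>q\<close>.\<close>

definition vk :: "'x set => 'r::comm_ring_1 set => ('x => 'r) set"
  where "vk Y q = {v. ALL y:Y. v y : q}"

lemma vk_smod: "rs.smod q ==> vs.smod (vk Y q)"
  by (rule vs.smodI, rule sgpI) (auto simp: vk_def rs.smod_0 rs.smod_diff rs.smod_sc)

lemma vk_mono: "q <= q' ==> vk Y q <= vk Y q'"
  by (auto simp: vk_def)

lemma lpow_coord: "v : vs.lpow as n UNIV ==> v y : rs.lpow as n UNIV"
  using lpow_linear[OF vs.scal_axioms rs.scal_axioms _ _ subset_UNIV rs.smod_UNIV, where F = "%v. v y" and H = UNIV] by auto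

lemma lpow_single:
  assumes "r : rs.lpow as n UNIV"
  shows "(%x. if x = y then r else 0) : vs.lpow as n UNIV"
proof -
  have "(%r x. if x = y then r else 0) ` rs.lpow as n UNIV <= vs.lpow as n UNIV"
    by (rule lpow_linear[OF rs.scal_axioms vs.scal_axioms _ _ subset_UNIV vs.smod_UNIV]) (auto simp: fun_eq_iff)
  thus ?thesis using assms by blast
qed

lemma vk_lpow:
  assumes "finite Y" "rs.smod q"
  shows "vk Y (rs.lpow as n UNIV + q) = vs.lpow as n UNIV + vk Y q"
proof (rule subset_antisym)
  show "vs.lpow as n UNIV + vk Y q <= vk Y (rs.lpow as n UNIV + q)"
  proof
    fix v assume "v : vs.lpow as n UNIV + vk Y q"
    then obtain a b where ab: "v = a + b" "a : vs.lpow as n UNIV" "b : vk Y q" by (rule plusE)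
    have "a y + b y : rs.lpow as n UNIV + q" if "y : Y" for y
      using ab(2,3) that by (intro plusI lpow_coord) (auto simp: vk_def)
    thus "v : vk Y (rs.lpow as n UNIV + q)" by (simp add: vk_def ab(1))
  qed
  show "vk Y (rs.lpow as n UNIV + q) <= vs.lpow as n UNIV + vk Y q"
  proof
    fix v assume v: "v : vk Y (rs.lpow as n UNIV + q)"
    have "EX l. l : rs.lpow as n UNIV & v y - l : q" if "y : Y" for y
    proof -
      have "v y : rs.lpow as n UNIV + q" using v that by (simp add: vk_def)
      then obtain a b where "v y = a + b" "a : rs.lpow as n UNIV" "b : q" by (rule plusE)
      thus ?thesis by (intro exI[of _ a]) simp
    qed
    then obtain l where l: "!!y. y : Y ==> l y : rs.lpow as n UNIV & v y - l y : q" by metis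
    define u where "u = (SUM y:Y. (%x. if x = y then l y else 0))"
    have u: "u : vs.lpow as n UNIV"
      unfolding u_def by (rule vs_sum[OF vs.lpow_smod[OF vs.smod_UNIV]], rule lpow_single) (simp add: l)
    have "u y = l y" if "y : Y" for y
      using that assms(1) by (simp add: u_def sum_fun)
    hence "v - u : vk Y q" using l by (simp add: vk_def)
    with u show "v : vs.lpow as n UNIV + vk Y q" by (rule plus_split)
  qed
qed

lemma vk_loC: "vk X q <= K ==> vk (B (Suc n) \<times> X) q <= loC B d K n"
  by (intro subsetI coch_loC) (auto simp: coch_def vk_def sl_def)

text \<open>Both rings are quotients of one ring, by \<open>aa\<close> and by \<open>J\<close>, and
  \<open>Ph\<close> induces the map between them. By \<open>dense\<close> and \<open>embed\<close>
  it is an isomorphism modulo every power of the ideal of \<open>as\<close>.\<close>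

locale flat_extension =
  fixes Ph :: "'r::comm_ring_1 => 'r" and aa J :: "'r set" and as :: "'r list"
  assumes Ph_add: "Ph (x + y) = Ph x + Ph y" and Ph_mult: "Ph (x * y) = Ph x * Ph y" and Ph_1: "Ph 1 = 1"
    and aa: "rs.smod aa" "rs.rno aa UNIV" "jac aa as"
    and J: "rs.smod J" "rs.rno J UNIV" "jac J (map Ph as)"
    and dense: "EX y. x - Ph y : rs.lpow (map Ph as) n UNIV + J"
    and embed: "Ph x : rs.lpow (map Ph as) n UNIV + J ==> x : rs.lpow as n UNIV + aa"
    and aa_J: "x : aa ==> Ph x : J"
begin

abbreviation "pA n \<equiv> rs.lpow as n UNIV + aa"
abbreviation "pB n \<equiv> rs.lpow (map Ph as) n UNIV + J"
abbreviation fm :: "('x => 'r) => 'x => 'r" where "fm v \<equiv> (%x. Ph (v x))"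

lemma Ph_0: "Ph 0 = 0" using Ph_add[of 0 0] by simp

lemma Ph_diff: "Ph (x - y) = Ph x - Ph y" using Ph_add[of "x - y" y] by (simp add: algebra_simps)

lemma fm_simps: "fm (u + v) = fm u + fm v" "fm (u - v) = fm u - fm v" "fm 0 = 0"
  by (simp_all add: fun_eq_iff Ph_add Ph_diff Ph_0)

lemma fm_zero: "(%x. Ph 0) = 0" by (simp add: fun_eq_iff Ph_0)

lemma Ph_sum: "Ph (sum f S) = (SUM i:S. Ph (f i))"
  by (induction S rule: infinite_finite_induct) (auto simp: Ph_add Ph_0)

lemma pB_smod: "rs.smod (pB n)" by (intro rs.smod_plus rs.lpow_smod rs.smod_UNIV J)

lemma pB_antimono: "m <= n ==> pB n <= pB m" by (intro plus_mono rs.lpow_antimono rs.smod_UNIV subset_refl)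

lemma J_pB: "J <= pB n" by (rule rs.upper2[OF rs.lpow_smod[OF rs.smod_UNIV]])

lemma Ph_pA: "x : pA n ==> Ph x : pB n"
proof -
  assume "x : pA n"
  then obtain a b where ab: "x = a + b" "a : rs.lpow as n UNIV" "b : aa" by (rule plusE)
  have "Ph ` rs.lpow as n UNIV <= rs.lpow (map Ph as) n UNIV"
    by (rule lpow_semilinear[OF rs.scal_axioms rs.scal_axioms Ph_add Ph_mult subset_UNIV rs.smod_UNIV])
  hence "Ph a + Ph b : pB n" using ab(2) aa_J[OF ab(3)] by (intro plusI) auto
  thus "Ph x : pB n" by (simp add: ab(1) Ph_add)
qed

lemma dense_vec: "EX u. v - fm u : vk Y (pB n)"
proof -
  have "ALL y. EX z. v y - Ph z : pB n" using dense by blast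
  then obtain u where "!!y. v y - Ph (u y) : pB n" by metis
  thus ?thesis by (intro exI[of _ u]) (simp add: vk_def)
qed

lemma vkB_smod: "vs.smod (vk Y (pB n))" by (rule vk_smod[OF pB_smod])

text \<open>Submodules are closed in the adic topology, by Krull's intersection theorem over the
  extension ring.\<close>

lemma closed:
  assumes "finite Y" "vs.smod H" "vk Y J <= H" "!!n. EX h:H. v - h : vk Y (pB n)"
  shows "v : H"
proof (rule vs.krull_intersection[OF _ assms(2) vs.smod_UNIV subset_UNIV _ J(3) UNIV_I])
  show "vs.rno H UNIV"
    by (rule vs.rno_mono[OF rno_vec[OF assms(1) J(2,1)] _ subset_refl]) (use assms(3) in "simp add: vk_def")
  show "vs.killed J H UNIV"
    unfolding vs.killed_def using ideal_mult2[OF J(1)] by (intro ballI subsetD[OF assms(3)]) (simp add: vk_def)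
  fix n
  obtain h where h: "h : H" "v - h : vk Y (pB n)" using assms(4) by blast
  from h(2) obtain a b where ab: "v - h = a + b" "a : vs.lpow (map Ph as) n UNIV" "b : vk Y J"
    unfolding vk_lpow[OF assms(1) J(1)] by (rule plusE)
  have "a + (b + h) : vs.lpow (map Ph as) n UNIV + H"
    by (intro plusI ab(2) vs.smod_add[OF assms(2)] subsetD[OF assms(3) ab(3)] h(1))
  moreover have "v = a + (b + h)" using ab(1) by (simp add: diff_eq_eq add.assoc)
  ultimately show "v : vs.lpow (map Ph as) n UNIV + H" by simp
qed

text \<open>The closure of the image of \<open>Z\<close> represents the extension of scalars of \<open>Z\<close>.\<close>

definition cl :: "'y set => ('y => 'r) set => ('y => 'r) set"
  where "cl Y Z = {v. ALL n. EX z:Z. v - fm z : vk Y (pB n)}"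

lemma clD: "v : cl Y Z ==> EX z:Z. v - fm z : vk Y (pB n)" by (simp add: cl_def)

lemma cl_base: "z : Z ==> fm z : cl Y Z"
  unfolding cl_def using vs.smod_0[OF vkB_smod] by (auto intro!: bexI[of _ z])

lemma cl_mono: "Z <= Z' ==> cl Y Z <= cl Y Z'"
  unfolding cl_def by blast

lemma cl_J: "0 : Z ==> vk Y J <= cl Y Z"
  unfolding cl_def using subsetD[OF vk_mono[OF J_pB]] by (auto simp: fm_zero intro!: bexI[of _ 0])

lemma cl_near: "w : cl Y Z ==> v - w : vk Y (pB n) ==> EX z:Z. v - fm z : vk Y (pB n)"
  using clD[of w Y Z n] sgp_trans[OF vs.smod_sgp[OF vkB_smod]] by blast

lemma cl_smod: assumes Z: "vs.smod Z" shows "vs.smod (cl Y Z)"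
proof (rule vs.smodI, rule sgpI)
  show "0 : cl Y Z" using cl_base[OF vs.smod_0[OF Z], of Y] by (simp add: fm_zero)
  fix u v assume "u : cl Y Z" "v : cl Y Z"
  have "EX z:Z. (u - v) - fm z : vk Y (pB n)" for n
  proof -
    obtain y z where yz: "y : Z" "u - fm y : vk Y (pB n)" "z : Z" "v - fm z : vk Y (pB n)"
      using clD[OF `u : cl Y Z`] clD[OF `v : cl Y Z`] by metis
    have "(u - v) - fm (y - z) = (u - fm y) - (v - fm z)" unfolding fm_simps by (simp add: algebra_simps)
    also have "... : vk Y (pB n)" by (rule vs.smod_diff[OF vkB_smod yz(2,4)])
    finally show ?thesis by (rule bexI[OF _ vs.smod_diff[OF Z yz(1,3)]])
  qed
  thus "u - v : cl Y Z" by (simp add: cl_def)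
next
  fix c u assume u: "u : cl Y Z"
  have "EX z:Z. (%x. c * u x) - fm z : vk Y (pB n)" for n
  proof -
    obtain z where z: "z : Z" "u - fm z : vk Y (pB n)" using clD[OF u] by blast
    obtain e where e: "c - Ph e : pB n" using dense by blast
    have "(%x. c * u x) - fm (%x. e * z x) = (%x. c * (u - fm z) x) + (%x. (c - Ph e) * Ph (z x))"
      by (simp add: fun_eq_iff Ph_mult algebra_simps)
    also have "... : vk Y (pB n)"
      by (rule vs.smod_add[OF vkB_smod vs.smod_sc[OF vkB_smod z(2)]]) (simp add: vk_def ideal_mult2[OF pB_smod e])
    finally show ?thesis by (rule bexI[OF _ vs.smod_sc[OF Z z(1)]])
  qed
  thus "(%x. c * u x) : cl Y Z" by (simp add: cl_def)
qed

lemma cl_least: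
  assumes "finite Y" "vs.smod H" "vk Y J <= H" "!!z. z : Z ==> fm z : H"
  shows "cl Y Z <= H"
proof
  fix v assume v: "v : cl Y Z"
  show "v : H" by (rule closed[OF assms(1-3)]) (use clD[OF v] assms(4) in blast)
qed

lemma cl_vk: "finite Y ==> cl Y (vk Y aa) = vk Y J"
  by (intro subset_antisym cl_least vk_smod J cl_J vs.smod_0[OF vk_smod[OF aa(1)]] subset_refl)
    (auto simp: vk_def aa_J)

lemma embed_vec: "fm v : vk Y (pB n) ==> v : vk Y (pA n)"
  using embed by (auto simp: vk_def)

lemma rnoA: "finite Y ==> vk Y aa <= Z ==> vs.rno Z UNIV"
  by (rule vs.rno_mono[OF rno_vec[OF _ aa(2,1)] _ subset_refl]) (simp_all add: vk_def)

lemma killedA: "vk Y aa <= Z ==> vs.killed aa Z H"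
  unfolding vs.killed_def using ideal_mult2[OF aa(1)] by (intro ballI, elim subsetD) (simp add: vk_def)

context
  fixes Y :: "'y set"
  assumes Y: "finite Y"
begin

lemma vkA_sub: "vs.smod Z ==> vk Y aa <= Z ==> vk Y (pA n) <= vs.lpow as n UNIV + Z"
  unfolding vk_lpow[OF Y aa(1)] by (intro plus_mono subset_refl)

text \<open>This is flatness: kernels commute with the extension. An approximate solution of
  \<open>T u : Z\<close> is corrected to an exact one by Artin-Rees.\<close>

lemma cl_vimage:
  fixes T T' :: "('x => 'r) => 'y => 'r"
  assumes T: "!!u v. T (u + v) = T u + T v" "!!c v. T (%x. c * v x) = (%x. c * T v x)"
    and T': "!!u v. T' (u - v) = T' u - T' v" and TT': "!!v. T' (fm v) = fm (T v)"
    and cont: "!!n v. v : vk X (pB n) ==> T' v : vk Y (pB n)"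
    and Z: "vs.smod Z" "vk Y aa <= Z"
  shows "cl X {v. T v : Z} = {v. T' v : cl Y Z}"
proof (intro subset_antisym subsetI CollectI)
  fix v assume v: "v : cl X {v. T v : Z}"
  have "EX z:Z. T' v - fm z : vk Y (pB n)" for n
  proof -
    obtain z where z: "T z : Z" "v - fm z : vk X (pB n)" using clD[OF v] by blast
    thus ?thesis using cont[OF z(2)] unfolding T' TT' by blast
  qed
  thus "T' v : cl Y Z" by (simp add: cl_def)
next
  fix v assume "v : {v. T' v : cl Y Z}"
  hence v: "T' v : cl Y Z" by simp
  let ?mid = "range T + Z"
  have sr: "vs.smod (range T)" by (rule smod_lin_image[OF T vs.smod_UNIV])
  have smid: "vs.smod ?mid" by (intro vs.smod_plus sr Z)
  have Zm: "Z <= ?mid" by (rule vs.upper2[OF sr])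
  obtain k where k: "!!m. ?mid Int (vs.lpow as (k + m) UNIV + Z) <= vs.lpow as m ?mid + Z"
    using vs.artin_rees_single[OF rnoA[OF Y Z(2)] Z(1) vs.smod_UNIV smid Zm subset_UNIV] by blast
  have "EX z:{v. T v : Z}. v - fm z : vk X (pB n)" for n
  proof -
    \<comment> \<open>The approximation has order \<open>k + n\<close>, since the correction costs
      \<open>k\<close> and order \<open>n\<close> has to remain.\<close>
    obtain u where u: "v - fm u : vk X (pB (k + n))" using dense_vec by blast
    obtain z where z: "z : Z" "T' v - fm z : vk Y (pB (k + n))" using clD[OF v] by blast
    have "fm (T u - z) = (T' v - fm z) - T' (v - fm u)" unfolding T' TT' fm_simps by simp
    also have "... : vk Y (pB (k + n))" by (rule vs.smod_diff[OF vkB_smod z(2) cont[OF u]])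
    finally have "T u - z : vs.lpow as (k + n) UNIV + Z" by (intro subsetD[OF vkA_sub[OF Z]] embed_vec)
    moreover have "z : vs.lpow as (k + n) UNIV + Z"
      by (rule subsetD[OF plus_upper2 z(1)]) (rule vs.smod_0[OF vs.lpow_smod[OF vs.smod_UNIV]])
    moreover have "vs.smod (vs.lpow as (k + n) UNIV + Z)" by (intro vs.smod_plus vs.lpow_smod vs.smod_UNIV Z)
    ultimately have "T u : vs.lpow as (k + n) UNIV + Z" using sgp_cancel[OF vs.smod_sgp] by blast
    moreover have "T u : ?mid" by (rule subsetD[OF vs.upper1[OF Z(1)]]) simp
    ultimately have "T u : vs.lpow as n ?mid + Z" using k by blast
    also have "... <= (vs.lpow as n (range T) + vs.lpow as n Z) + Z"
      by (intro plus_mono vs.lpow_plus_subset sr Z subset_refl)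
    also have "... <= (T ` vs.lpow as n UNIV + Z) + Z"
      by (intro plus_mono lpow_linear_image[OF vs.scal_axioms vs.scal_axioms] T vs.lpow_subset vs.smod_UNIV Z subset_refl)
    also have "... <= T ` vs.lpow as n UNIV + Z"
      unfolding add.assoc by (intro plus_mono subset_refl plus_least vs.smod_sgp Z)
    finally obtain b a where ba: "T u = b + a" "b : T ` vs.lpow as n UNIV" "a : Z" by (rule plusE)
    then obtain u' where u': "T u = T u' + a" "u' : vs.lpow as n UNIV" by blast
    have "T (u - u') + T u' = T u" unfolding T(1)[symmetric] by simp
    hence "T (u - u') : Z" using u'(1) ba(3) by (metis add.commute add_left_cancel)
    moreover have "v - fm (u - u') : vk X (pB n)"
    proof -
      have "v - fm (u - u') = (v - fm u) + fm u'" unfolding fm_simps by simp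
      moreover have "v - fm u : vk X (pB n)" using vk_mono[OF pB_antimono] u by (meson le_add2 subsetD)
      moreover have "u' x : pA n" for x
        by (rule subsetD[OF rs.upper1[OF aa(1)] lpow_coord[OF u'(2)]])
      hence "fm u' : vk X (pB n)" by (simp add: vk_def Ph_pA)
      ultimately show ?thesis using vs.smod_add[OF vkB_smod] by metis
    qed
    ultimately show ?thesis by blast
  qed
  thus "v : cl X {v. T v : Z}" by (simp add: cl_def)
qed

text \<open>Right exactness of the extension: closedness gives one inclusion, density the
  other.\<close>

lemma cl_range_plus:
  fixes T T' :: "('x => 'r) => 'y => 'r"
  assumes T': "!!u v. T' (u + v) = T' u + T' v" "!!c v. T' (%x. c * v x) = (%x. c * T' v x)"
    and TT': "!!v. T' (fm v) = fm (T v)" and cont: "!!n v. v : vk X (pB n) ==> T' v : vk Y (pB n)"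
    and Z: "vs.smod Z"
  shows "cl Y (range T + Z) = range T' + cl Y Z"
proof (rule subset_antisym)
  have sr: "vs.smod (range T')" by (rule smod_lin_image[OF T' vs.smod_UNIV])
  show "cl Y (range T + Z) <= range T' + cl Y Z"
  proof (rule cl_least[OF Y])
    show "vs.smod (range T' + cl Y Z)" by (intro vs.smod_plus sr cl_smod Z)
    show "vk Y J <= range T' + cl Y Z"
      by (rule subset_trans[OF cl_J[OF vs.smod_0[OF Z]] vs.upper2[OF sr]])
    fix z assume "z : range T + Z"
    then obtain a b where ab: "z = a + b" "a : range T" "b : Z" by (rule plusE)
    then obtain w where w: "a = T w" by blast
    show "fm z : range T' + cl Y Z" unfolding ab(1) fm_simps w TT'[symmetric]
      by (intro plusI rangeI cl_base ab(3))
  qed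
  show "range T' + cl Y Z <= cl Y (range T + Z)"
  proof
    fix v assume "v : range T' + cl Y Z"
    then obtain a b where ab: "v = a + b" "a : range T'" "b : cl Y Z" by (rule plusE)
    then obtain w where w: "a = T' w" by blast
    have "EX z:range T + Z. v - fm z : vk Y (pB n)" for n
    proof -
      obtain u where u: "w - fm u : vk X (pB n)" using dense_vec by blast
      obtain z where z: "z : Z" "b - fm z : vk Y (pB n)" using clD[OF ab(3)] by blast
      have "T' w = T' (w - fm u) + T' (fm u)" unfolding T'(1)[symmetric] by simp
      hence "v - fm (T u + z) = T' (w - fm u) + (b - fm z)" unfolding ab(1) w fm_simps TT' by (simp add: algebra_simps)
      hence "v - fm (T u + z) : vk Y (pB n)" using vs.smod_add[OF vkB_smod cont[OF u] z(2)] by simp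
      moreover have "T u + z : range T + Z" by (intro plusI rangeI z(1))
      ultimately show ?thesis by blast
    qed
    thus "v : cl Y (range T + Z)" by (simp add: cl_def)
  qed
qed

lemma lmul_cl:
  assumes "vs.smod Z"
  shows "vs.lmul (map Ph gs) (cl Y Z) <= cl Y (vs.lmul gs Z)"
proof (rule vs.lmul_least[OF vs.smod_sgp[OF cl_smod[OF vs.lmul_smod[OF assms]]]])
  fix a x assume "a : set (map Ph gs)" and x: "x : cl Y Z"
  then obtain g where g: "a = Ph g" "g : set gs" by auto
  have "EX z:vs.lmul gs Z. (%y. a * x y) - fm z : vk Y (pB n)" for n
  proof -
    obtain z where z: "z : Z" "x - fm z : vk Y (pB n)" using clD[OF x] by blast
    have "(%y. a * x y) - fm (%y. g * z y) = (%y. a * (x - fm z) y)" by (simp add: fun_eq_iff g(1) Ph_mult algebra_simps)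
    hence "(%y. a * x y) - fm (%y. g * z y) : vk Y (pB n)" using vs.smod_sc[OF vkB_smod z(2)] by simp
    thus ?thesis by (rule bexI[OF _ vs.lmul_im[OF assms g(2) z(1)]])
  qed
  thus "(%y. a * x y) : cl Y (vs.lmul gs Z)" by (simp add: cl_def)
qed

lemma fm_lpow: "fm ` vs.lpow gs j UNIV <= vs.lpow (map Ph gs) j UNIV"
  by (rule lpow_semilinear[OF vs.scal_axioms vs.scal_axioms _ _ subset_UNIV vs.smod_UNIV]) (simp_all add: Ph_add Ph_mult fun_eq_iff)

lemma cl_lpow_plus:
  assumes "vs.smod K"
  shows "cl Y (vs.lpow gs j UNIV + K) = vs.lpow (map Ph gs) j UNIV + cl Y K"
proof (rule subset_antisym)
  note sA = vs.lpow_smod[OF vs.smod_UNIV, of gs j] and sB = vs.lpow_smod[OF vs.smod_UNIV, of "map Ph gs" j]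
  show "cl Y (vs.lpow gs j UNIV + K) <= vs.lpow (map Ph gs) j UNIV + cl Y K"
  proof (rule cl_least[OF Y])
    show "vs.smod (vs.lpow (map Ph gs) j UNIV + cl Y K)" by (intro vs.smod_plus sB cl_smod assms)
    show "vk Y J <= vs.lpow (map Ph gs) j UNIV + cl Y K"
      by (rule subset_trans[OF cl_J[OF vs.smod_0[OF assms]] vs.upper2[OF sB]])
    fix z :: "'y => 'r" assume "z : vs.lpow gs j UNIV + K"
    then obtain a b where ab: "z = a + b" "a : vs.lpow gs j UNIV" "b : K" by (rule plusE)
    show "fm z : vs.lpow (map Ph gs) j UNIV + cl Y K" unfolding ab(1) fm_simps
      by (intro plusI cl_base ab(3) subsetD[OF fm_lpow] imageI ab(2))
  qed
  have "vs.lpow (map Ph gs) j UNIV <= cl Y (vs.lpow gs j UNIV)"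
  proof (induction j)
    case 0
    have "v : cl Y UNIV" for v using dense_vec by (auto simp: cl_def)
    thus ?case by auto
  next
    case (Suc j)
    show ?case unfolding vs.lpow_Suc
      by (rule subset_trans[OF vs.lmul_mono[OF Suc] lmul_cl[OF vs.lpow_smod[OF vs.smod_UNIV]]])
  qed
  also have "... <= cl Y (vs.lpow gs j UNIV + K)" by (rule cl_mono[OF vs.upper1[OF assms]])
  finally show "vs.lpow (map Ph gs) j UNIV + cl Y K <= cl Y (vs.lpow gs j UNIV + K)"
    by (rule plus_least[OF vs.smod_sgp[OF cl_smod[OF vs.smod_plus[OF sA assms]]] _ cl_mono[OF vs.upper2[OF sA]]])
qed

text \<open>Faithful flatness for numbers of generators. Generators of the closure are approximated
  by elements of \<open>hi\<close> to order \<open>k + 1\<close>; Artin-Rees moves the error into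
  \<open>(as) hi + lo\<close>, and Nakayama's lemma shows that the approximations generate.\<close>

lemma gen_cl_iff:
  assumes lo: "vs.smod lo" and hi: "vs.smod hi" and lh: "lo <= hi" and aalo: "vk Y aa <= lo"
  shows "vs.gen n (cl Y lo) (cl Y hi) \<longleftrightarrow> vs.gen n lo hi"
proof
  assume "vs.gen n lo hi"
  then obtain gs where gs: "length gs = n" "set gs <= hi" "hi <= lo + vs.gspan gs" by (auto simp: vs.gen_def)
  define hs where "hs = map fm gs"
  have sg: "fm ` vs.gspan gs <= vs.gspan hs" unfolding hs_def
    by (rule gspan_semilinear[where f = Ph, OF vs.scal_axioms vs.scal_axioms]) (simp_all add: Ph_add Ph_mult fun_eq_iff)
  have "cl Y hi <= cl Y lo + vs.gspan hs"
  proof (rule cl_least[OF Y])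
    show "vs.smod (cl Y lo + vs.gspan hs)" by (intro vs.smod_plus cl_smod lo vs.gspan_smod)
    show "vk Y J <= cl Y lo + vs.gspan hs"
      by (rule subset_trans[OF cl_J[OF vs.smod_0[OF lo]] vs.upper1[OF vs.gspan_smod]])
    fix z assume "z : hi"
    hence "z : lo + vs.gspan gs" using gs(3) by blast
    then obtain a b where ab: "z = a + b" "a : lo" "b : vs.gspan gs" by (rule plusE)
    show "fm z : cl Y lo + vs.gspan hs" unfolding ab(1) fm_simps by (intro plusI cl_base ab(2) subsetD[OF sg] imageI ab(3))
  qed
  moreover have "set hs <= cl Y hi" using gs(2) cl_base by (auto simp: hs_def)
  ultimately show "vs.gen n (cl Y lo) (cl Y hi)" unfolding vs.gen_def using gs(1) by (intro exI[of _ hs]) (simp add: hs_def)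
next
  assume "vs.gen n (cl Y lo) (cl Y hi)"
  then obtain hs where hs: "length hs = n" "set hs <= cl Y hi" "cl Y hi <= cl Y lo + vs.gspan hs" by (auto simp: vs.gen_def)
  obtain k where k: "!!m. hi Int (vs.lpow as (k + m) UNIV + lo) <= vs.lpow as m hi + lo"
    using vs.artin_rees_single[OF rnoA[OF Y aalo] lo vs.smod_UNIV hi lh subset_UNIV] by blast
  define N where "N = k + 1"
  have "EX z. z : hi & h - fm z : vk Y (pB N)" if "h : set hs" for h
    using clD[of h Y hi N] hs(2) that by blast
  then obtain ze where ze: "!!h. h : set hs ==> ze h : hi & h - fm (ze h) : vk Y (pB N)" by metis
  define gs where "gs = map ze hs"
  define L where "L = lo + vs.gspan gs"
  have L: "vs.smod L" unfolding L_def by (intro vs.smod_plus lo vs.gspan_smod)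
  have loL: "lo <= L" unfolding L_def by (rule vs.upper1[OF vs.gspan_smod])
  have Lhi: "L <= hi" unfolding L_def
    by (intro plus_least vs.smod_sgp hi lh vs.gspan_least) (use ze in "auto simp: gs_def")
  have hsL: "h : cl Y L + vk Y (pB N)" if "h : set hs" for h
  proof -
    have "ze h : L" unfolding L_def
      by (rule subsetD[OF vs.upper2[OF lo]], rule vs.gspan_base) (use that in "simp add: gs_def")
    thus ?thesis by (rule plus_split[OF cl_base conjunct2[OF ze[OF that]]])
  qed
  have sLV: "vs.smod (cl Y L + vk Y (pB N))" by (intro vs.smod_plus cl_smod L vkB_smod)
  have "cl Y hi <= cl Y L + vk Y (pB N)"
  proof (rule subset_trans[OF hs(3)], rule plus_least[OF vs.smod_sgp[OF sLV]])
    show "cl Y lo <= cl Y L + vk Y (pB N)"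
      by (rule subset_trans[OF cl_mono[OF loL] vs.upper1[OF vkB_smod]])
    show "vs.gspan hs <= cl Y L + vk Y (pB N)" by (rule vs.gspan_least[OF sLV]) (use hsL in blast)
  qed
  note clhi = this
  have "hi <= L + vs.lmul as hi"
  proof
    fix x assume x: "x : hi"
    have "fm x : cl Y L + vk Y (pB N)" using clhi cl_base[OF x] by blast
    then obtain a b where ab: "fm x = a + b" "a : cl Y L" "b : vk Y (pB N)" by (rule plusE)
    have "fm x - a : vk Y (pB N)" using ab(1,3) by simp
    then obtain l where l: "l : L" "fm x - fm l : vk Y (pB N)" using cl_near[OF ab(2)] by blast
    have "x - l : vs.lpow as N UNIV + lo"
      by (intro subsetD[OF vkA_sub[OF lo aalo]] embed_vec) (use l(2) in "simp only: fm_simps")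
    moreover have "x - l : hi" using vs.smod_diff[OF hi x] Lhi l(1) by blast
    ultimately have "x - l : vs.lpow as 1 hi + lo" using k[of 1] unfolding N_def by blast
    then obtain b c where bc: "x - l = b + c" "b : vs.lmul as hi" "c : lo"
      by (auto simp: vs.lpow_Suc elim: plusE)
    have "(c + l) + b : L + vs.lmul as hi" by (intro plusI bc(2) vs.smod_add[OF L] l(1) subsetD[OF loL bc(3)])
    moreover have "x = (c + l) + b" using bc(1) by (simp add: algebra_simps)
    ultimately show "x : L + vs.lmul as hi" by simp
  qed
  moreover obtain m where "vs.gen m L hi"
    using vs.rno_gen[OF vs.rno_mono[OF rnoA[OF Y subset_trans[OF aalo loL]] subset_refl subset_UNIV] L hi Lhi] by blast
  ultimately have "hi <= L"
    by (intro vs.nakayama[OF _ L hi _ killedA[OF subset_trans[OF aalo loL]] aa(3)])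
  thus "vs.gen n lo hi" unfolding vs.gen_def L_def using hs(1) ze
    by (intro exI[of _ gs]) (auto simp: gs_def)
qed

end

section \<open>Base change of complexes and their cohomology\<close>

lemma capp_fm: "capp B (%i j. Ph (d i j)) (fm v) = fm (capp B d v)"
  by (simp add: capp_def fun_eq_iff Ph_sum Ph_mult)

lemma capp_cont: "v : vk (B \<times> X) (pB n) ==> capp B d v : vk (C \<times> X) (pB n)"
  unfolding vk_def capp_def by (auto intro!: ideal_sum[OF pB_smod] ideal_mult[OF pB_smod])

lemma cl_coch:
  assumes "vs.smod K"
  shows "cl (C \<times> X) (coch C K) = coch C (cl X K)"
proof (intro subset_antisym subsetI)
  fix v assume v: "v : cl (C \<times> X) (coch C K)"
  have "EX z:K. sl k v - fm z : vk X (pB n)" if "k : C" for k n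
  proof -
    obtain z where "z : coch C K" "v - fm z : vk (C \<times> X) (pB n)" using clD[OF v] by blast
    thus ?thesis using that by (intro bexI[of _ "sl k z"]) (auto simp: vk_def sl_def coch_def)
  qed
  thus "v : coch C (cl X K)" by (simp add: coch_def cl_def)
next
  fix v assume "v : coch C (cl X K)"
  hence v: "!!k. k : C ==> sl k v : cl X K" by (simp add: coch_def)
  have "EX z:coch C K. v - fm z : vk (C \<times> X) (pB n)" for n
  proof -
    have "ALL k. EX z. k : C --> z : K & sl k v - fm z : vk X (pB n)" using clD[OF v] by blast
    then obtain z where z: "!!k. k : C ==> z k : K & sl k v - fm (z k) : vk X (pB n)" by metis
    show ?thesis
      using z by (intro bexI[of _ "%(k, x). z k x"]) (auto simp: vk_def sl_def coch_def)
  qed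
  thus "v : cl (C \<times> X) (coch C K)" by (simp add: cl_def)
qed

lemma cl_hiE:
  assumes "finite (B (Suc (Suc n)))" "finite X" "vs.smod K" "vk X aa <= K"
  shows "cl (B (Suc n) \<times> X) (hiC B d K n) = hiC B (%n i j. Ph (d n i j)) (cl X K) n"
proof -
  have "vk (B (Suc (Suc n)) \<times> X) aa <= coch (B (Suc (Suc n))) K"
    using subsetD[OF assms(4)] by (auto simp: vk_def coch_def sl_def)
  note sub = this
  have "cl (B (Suc n) \<times> X) {v. capp (B (Suc n)) (d (Suc n)) v : coch (B (Suc (Suc n))) K}
    = {v. capp (B (Suc n)) (%i j. Ph (d (Suc n) i j)) v : cl (B (Suc (Suc n)) \<times> X) (coch (B (Suc (Suc n))) K)}"
    by (rule cl_vimage[OF _ _ _ _ _ _ coch_smod[OF assms(3)] sub])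
      (simp_all only: assms finite_cartesian_product capp_add capp_sc capp_diff capp_fm capp_cont)
  thus ?thesis unfolding cl_coch[OF assms(3)] hiC_eq .
qed

lemma cl_loE:
  fixes K :: "('x => 'r) set"
  assumes "finite (B (Suc n))" "finite X" "vs.smod K"
  shows "cl (B (Suc n) \<times> X) (loC B d K n) = loC B (%n i j. Ph (d n i j)) (cl X K) n"
proof -
  have "cl (B (Suc n) \<times> X) (range (capp (B n) (d n)) + coch (B (Suc n)) K)
      = range (capp (B n) (%i j. Ph (d n i j))) + cl (B (Suc n) \<times> X) (coch (B (Suc n)) K)"
    by (rule cl_range_plus[where X = "B n \<times> X"]) (simp_all add: assms capp_add capp_sc capp_fm capp_cont coch_smod)
  thus ?thesis unfolding loC_eq cl_coch[OF assms(3)] .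
qed

text \<open>Exactness compares a kernel with an image, and the closure commutes with both.\<close>

lemma exact_cl:
  assumes "!!n. finite (B n)" "exact aa n0 B d"
  shows "exact J n0 B (%n i j. Ph (d n i j))"
  unfolding exact_def
proof (intro allI impI)
  let ?T = "%n. lapp (B (Suc n)) (d n)" and ?T' = "%n. lapp (B (Suc n)) (%i j. Ph (d n i j))"
  have lin: "lapp C X (u + v) = lapp C X u + lapp C X v" "lapp C X (u - v) = lapp C X u - lapp C X v"
    "lapp C X (%x. e * v x) = (%x. e * lapp C X v x)" for C X e u v
    by (simp_all add: lapp_def fun_eq_iff algebra_simps sum.distrib sum_subtractf sum_distrib_left)
  have fm: "?T' n (fm v) = fm (?T n v)" for n v by (simp add: lapp_def fun_eq_iff Ph_sum Ph_mult)
  have cont: "v : vk C (pB n) ==> lapp C X v : vk R (pB n)" for C X R v n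
    unfolding vk_def lapp_def by (auto intro!: ideal_sum[OF pB_smod] ideal_mult[OF pB_smod])
  fix n and a assume n: "n0 <= n" and a: "ALL i:B n. ?T' n a i : J"
  have "a : {v. ?T' n v : cl (B n) (vk (B n) aa)}" using a unfolding cl_vk[OF assms(1)] by (simp add: vk_def)
  also have "... = cl (B (Suc n)) {v. ?T n v : vk (B n) aa}"
    by (rule cl_vimage[symmetric, OF assms(1)]) (simp_all only: lin fm cont vk_smod[OF aa(1)] subset_refl)
  also have "... <= cl (B (Suc n)) (range (?T (Suc n)) + vk (B (Suc n)) aa)"
  proof (rule cl_mono, rule subsetI)
    fix v assume "v : {v. ?T n v : vk (B n) aa}"
    then obtain c where "ALL j:B (Suc n). v j - ?T (Suc n) c j : aa"
      using assms(2) n unfolding exact_def vk_def by blast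
    hence "?T (Suc n) c + (v - ?T (Suc n) c) : range (?T (Suc n)) + vk (B (Suc n)) aa"
      by (intro plusI rangeI) (simp add: vk_def)
    thus "v : range (?T (Suc n)) + vk (B (Suc n)) aa" by simp
  qed
  also have "... = range (?T' (Suc n)) + cl (B (Suc n)) (vk (B (Suc n)) aa)"
    by (rule cl_range_plus[where X = "B (Suc (Suc n))", OF assms(1)]) (simp_all only: lin fm cont vk_smod[OF aa(1)])
  finally obtain x y where xy: "a = x + y" "x : range (?T' (Suc n))" "y : vk (B (Suc n)) J"
    unfolding cl_vk[OF assms(1)] by (rule plusE)
  then obtain w where w: "x = ?T' (Suc n) w" by blast
  show "EX c. ALL j:B (Suc n). a j - ?T' (Suc n) c j : J"
    by (rule exI[of _ w]) (use xy(3) in "simp add: xy(1) w vk_def")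
qed

end

text \<open>Cocycles and coboundaries commute with the extension and numbers of generators do not
  change, so the growth can be read off over the completion.\<close>

theorem growth_stabilises_below_completion:
  fixes K :: "('x => 'r::comm_ring_1) set" and B :: "nat => nat list set"
    and d :: "nat => nat list => nat list => 'r" and gs :: "'r list"
  assumes "flat_extension Ph aa (jr q f c) as" and "local_ring_data q bs" and "fpd q" and "reg q f c"
    and fin: "!!n. finite (B n)" and B0: "B 0 = {}"
    and sqA: "!!n. sqz aa B d n"
    and ex: "exact aa 1 B d"
    and X: "finite X" and sK: "vs.smod K" and subK: "vk X aa <= K"
  defines "lo \<equiv> %j. loC B d (vs.lpow gs j UNIV + K)" and "hi \<equiv> %j. hiC B d (vs.lpow gs j UNIV + K)"
  shows "EX j0. ALL j>=j0. ALL b. grow b (lo j) (hi j) \<longleftrightarrow> grow b (lo j0) (hi j0)"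
proof -
  interpret flat_extension Ph aa "jr q f c" as by fact
  interpret local_ring_data q bs by fact
  let ?d = "%n i j. Ph (d n i j)"
  interpret asymptotic q bs f c B ?d X "cl X K" "map Ph gs"
  proof
    show "sqz (jr q f c) B ?d n" for n
      using sqA[of n] aa_J by (simp add: meq_def mm_def flip: Ph_mult Ph_sum)
    show "exact (jr q f c) 1 B ?d" by (rule exact_cl[OF fin ex])
    show "vs.smod (cl X K)" by (rule cl_smod[OF sK])
    show "v : cl X K" if "ALL x:X. v x : jr q f c" for v
      by (rule subsetD[OF cl_J[OF vs.smod_0[OF sK]]]) (use that in "simp add: vk_def")
  qed (use assms in auto)
  have KI': "vs.smod (vs.lpow gs j UNIV + K)" "vk X aa <= vs.lpow gs j UNIV + K" for j
  proof -
    show "vs.smod (vs.lpow gs j UNIV + K)" by (intro vs.smod_plus vs.lpow_smod vs.smod_UNIV sK)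
    show "vk X aa <= vs.lpow gs j UNIV + K"
      by (rule subset_trans[OF subK vs.upper2[OF vs.lpow_smod[OF vs.smod_UNIV]]])
  qed
  have lo: "loN (KI j) n = cl (B (Suc n) \<times> X) (lo j n)" and hi: "hiN (KI j) n = cl (B (Suc n) \<times> X) (hi j n)" for j n
    unfolding lo_def hi_def cl_lpow_plus[OF X sK, symmetric]
    by (rule cl_loE[symmetric, OF fin X KI'(1)], rule cl_hiE[symmetric, OF fin X KI'])
  have "vs.gen g (loN (KI j) n) (hiN (KI j) n) \<longleftrightarrow> vs.gen g (lo j n) (hi j n)" for g j n
    unfolding lo hi
  proof (rule gen_cl_iff)
    have kill: "vs.killed aa (vs.lpow gs j UNIV + K) UNIV" by (rule killedA[OF KI'(2)])
    show "finite (B (Suc n) \<times> X)" using fin X by simp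
    show "vs.smod (lo j n)" "vs.smod (hi j n)" "lo j n <= hi j n"
      unfolding lo_def hi_def by (rule loC_smod[OF KI'(1)], rule hiC_smod[OF KI'(1)], rule loC_hiC[OF KI'(1) kill sqA[of n]])
    show "vk (B (Suc n) \<times> X) aa <= lo j n" unfolding lo_def by (rule vk_loC[OF KI'(2)])
  qed
  hence "grow b (loN (KI j)) (hiN (KI j)) \<longleftrightarrow> grow b (lo j) (hi j)" for b j by (simp add: grow_def)
  thus ?thesis using growth_stabilises by simp
qed

section \<open>Presentation of abstract rings by a free commutative ring\<close>

text \<open>Terms in the language of rings. With the elements of \<open>A\<close> and
  \<open>Q\<close> as variables, one ring of terms maps onto both rings and replaces their carriers
  by a type.\<close>

datatype 'v rexp = RVar 'v | RZero | ROne | RNeg "'v rexp" | RAdd "'v rexp" "'v rexp" | RMul "'v rexp" "'v rexp"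

primrec ev :: "('x, 'm) ring_scheme => ('v => 'x) => 'v rexp => 'x" where
  "ev R rh (RVar v) = rh v"
| "ev R rh RZero = \<zero>\<^bsub>R\<^esub>"
| "ev R rh ROne = \<one>\<^bsub>R\<^esub>"
| "ev R rh (RNeg e) = \<ominus>\<^bsub>R\<^esub> ev R rh e"
| "ev R rh (RAdd e e') = ev R rh e \<oplus>\<^bsub>R\<^esub> ev R rh e'"
| "ev R rh (RMul e e') = ev R rh e \<otimes>\<^bsub>R\<^esub> ev R rh e'"

lemma ev_closed: "cring R ==> range rh <= carrier R ==> ev R rh e : carrier R"
  by (induction e) (auto simp: cring.cring_simprules)

definition agree :: "('x, 'm) ring_scheme => 'v rexp => 'v rexp => bool"
  where "agree R e e' \<longleftrightarrow> (ALL rh. range rh <= carrier R --> ev R rh e = ev R rh e')"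

text \<open>
  HOL cannot quantify over all rings at once; rings over the element types \<open>'a\<close> and \<open>'q\<close> are the
  only ones needed, and the integers ensure that \<open>0 \<noteq> 1\<close>.
\<close>

definition rexp_eq :: "('a + 'q) rexp => ('a + 'q) rexp => bool"
  where "rexp_eq e e' \<longleftrightarrow> (ALL R :: 'a ring. cring R --> agree R e e') & (ALL R :: 'q ring. cring R --> agree R e e')
    & agree int_ring e e'"

lemma rexp_eqI:
  assumes "!!(R :: 'a ring) rh. cring R ==> range rh <= carrier R ==> ev R rh e = ev R rh e'"
    and "!!(R :: 'q ring) rh. cring R ==> range rh <= carrier R ==> ev R rh e = ev R rh e'"
    and "!!rh. cring int_ring ==> range rh <= carrier int_ring ==> ev int_ring rh e = ev int_ring rh e'"
  shows "rexp_eq e (e' :: ('a + 'q) rexp)"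
  using assms int_is_cring unfolding rexp_eq_def agree_def by blast

lemma rexp_eqD:
  "rexp_eq e e' ==> cring R ==> range rh <= carrier R ==> ev R rh e = ev (R :: 'a ring) rh (e' :: ('a + 'q) rexp)"
  "rexp_eq e e' ==> cring S ==> range si <= carrier S ==> ev S si e = ev (S :: 'q ring) si (e' :: ('a + 'q) rexp)"
  "rexp_eq e e' ==> range ta <= carrier int_ring ==> ev int_ring ta e = ev int_ring ta e'"
  unfolding rexp_eq_def agree_def by blast+

quotient_type ('a, 'q) fring = "('a + 'q) rexp" / rexp_eq
  by (rule equivpI, rule reflpI, simp add: rexp_eq_def agree_def,
      rule sympI, simp add: rexp_eq_def agree_def, rule transpI, simp add: rexp_eq_def agree_def)

instantiation fring :: (type, type) comm_ring_1
begin

lift_definition zero_fring :: "('a, 'q) fring" is RZero .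
lift_definition one_fring :: "('a, 'q) fring" is ROne .
lift_definition uminus_fring :: "('a, 'q) fring => ('a, 'q) fring" is RNeg
  by (simp add: rexp_eq_def agree_def)
lift_definition plus_fring :: "('a, 'q) fring => ('a, 'q) fring => ('a, 'q) fring" is RAdd
  by (simp add: rexp_eq_def agree_def)
lift_definition times_fring :: "('a, 'q) fring => ('a, 'q) fring => ('a, 'q) fring" is RMul
  by (simp add: rexp_eq_def agree_def)
definition minus_fring :: "('a, 'q) fring => ('a, 'q) fring => ('a, 'q) fring" where "minus_fring x y = x + - y"

instance
proof
  fix a b c :: "('a, 'q) fring"
  show "a * b * c = a * (b * c)" by transfer (rule rexp_eqI; simp add: ev_closed cring.cring_simprules)
  show "a * b = b * a" by transfer (rule rexp_eqI; simp add: ev_closed cring.cring_simprules)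
  show "1 * a = a" by transfer (rule rexp_eqI; simp add: ev_closed cring.cring_simprules)
  show "a + b + c = a + (b + c)" by transfer (rule rexp_eqI; simp add: ev_closed cring.cring_simprules)
  show "a + b = b + a" by transfer (rule rexp_eqI; simp add: ev_closed cring.cring_simprules)
  show "0 + a = a" by transfer (rule rexp_eqI; simp add: ev_closed cring.cring_simprules)
  show "- a + a = 0" by transfer (rule rexp_eqI; simp only: ev.simps ev_closed cring.cring_simprules)
  show "(a + b) * c = a * c + b * c" by transfer (rule rexp_eqI; simp only: ev.simps ev_closed cring.cring_simprules)
  show "(0 :: ('a, 'q) fring) ~= 1"
    by transfer (auto simp: rexp_eq_def agree_def)
qed (simp add: minus_fring_def)

end

lift_definition fvar :: "'a + 'q => ('a, 'q) fring" is RVar .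

text \<open>Outside commutative rings and valuations into the carrier, equivalent terms may have
  different values; hence the default.\<close>

lift_definition evl :: "'a ring => ('a + 'q => 'a) => ('a, 'q) fring => 'a"
  is "%R rh e. if cring R & range rh <= carrier R then ev R rh e else undefined"
  using rexp_eqD(1) by auto

lift_definition evr :: "'q ring => ('a + 'q => 'q) => ('a, 'q) fring => 'q"
  is "%R rh e. if cring R & range rh <= carrier R then ev R rh e else undefined"
  using rexp_eqD(2) by auto

primrec dropr :: "('a + 'q) rexp => ('a + 'q) rexp" where
  "dropr (RVar v) = (case v of Inl a => RVar (Inl a) | Inr q => RZero)"
| "dropr RZero = RZero"
| "dropr ROne = ROne"
| "dropr (RNeg e) = RNeg (dropr e)"
| "dropr (RAdd e e') = RAdd (dropr e) (dropr e')"
| "dropr (RMul e e') = RMul (dropr e) (dropr e')"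

lemma ev_dropr: "ev R rh (dropr e) = ev R (case_sum (%a. rh (Inl a)) (%q. \<zero>\<^bsub>R\<^esub>)) e"
  by (induction e) (auto split: sum.splits)

text \<open>The endomorphism that sends the variables from \<open>Q\<close> to \<open>0\<close> and
  keeps those from \<open>A\<close>. It will induce the map from \<open>A\<close> to its
  completion.\<close>

lift_definition sub0 :: "('a, 'q) fring => ('a, 'q) fring" is dropr
proof -
  fix e e' :: "('a + 'q) rexp" assume e: "rexp_eq e e'"
  show "rexp_eq (dropr e) (dropr e')"
  proof (rule rexp_eqI, unfold ev_dropr)
    fix R :: "'a ring" and rh :: "'a + 'q => 'a" assume R: "cring R" "range rh <= carrier R"
    show "ev R (case_sum (%a. rh (Inl a)) (%q. \<zero>\<^bsub>R\<^esub>)) e = ev R (case_sum (%a. rh (Inl a)) (%q. \<zero>\<^bsub>R\<^esub>)) e'"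
      by (rule rexp_eqD(1)[OF e R(1)])
        (use subsetD[OF R(2) rangeI] cring.cring_simprules(2)[OF R(1)] in "auto split: sum.splits")
  next
    fix R :: "'q ring" and rh :: "'a + 'q => 'q" assume R: "cring R" "range rh <= carrier R"
    show "ev R (case_sum (%a. rh (Inl a)) (%q. \<zero>\<^bsub>R\<^esub>)) e = ev R (case_sum (%a. rh (Inl a)) (%q. \<zero>\<^bsub>R\<^esub>)) e'"
      by (rule rexp_eqD(2)[OF e R(1)])
        (use subsetD[OF R(2) rangeI] cring.cring_simprules(2)[OF R(1)] in "auto split: sum.splits")
  qed (rule rexp_eqD(3)[OF e], simp)
qed

lemma sub0_simps: "sub0 (x + y) = sub0 x + sub0 y" "sub0 (x * y) = sub0 x * sub0 y" "sub0 1 = 1"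
  "sub0 (fvar (Inl a)) = fvar (Inl a)" "sub0 (fvar (Inr q)) = 0"
  by (transfer, simp add: rexp_eq_def agree_def)+

lemma fring_induct [case_names var zero one uminus plus times]:
  assumes "!!v. P (fvar v)" "P 0" "P 1" "!!x. P x ==> P (- x)" "!!x y. P x ==> P y ==> P (x + y)"
    "!!x y. P x ==> P y ==> P (x * y)"
  shows "P (x :: ('a, 'q) fring)"
proof (induction x rule: fring.abs_induct)
  case (1 e)
  show ?case
    by (induction e)
      (use assms in "simp_all add: fvar.abs_eq zero_fring.abs_eq one_fring.abs_eq uminus_fring.abs_eq[symmetric]
        plus_fring.abs_eq[symmetric] times_fring.abs_eq[symmetric]")
qed

subsection \<open>Homomorphisms to abstract rings\<close>

locale ring_map = cring R for R :: "('x, 'm) ring_scheme" (structure) +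
  fixes h :: "'r::comm_ring_1 => 'x"
  assumes h_closed [simp]: "h x : carrier R"
    and h_add: "h (x + y) = h x \<oplus> h y" and h_mult: "h (x * y) = h x \<otimes> h y" and h_one: "h 1 = \<one>"
begin

lemma h_zero: "h 0 = \<zero>"
  using h_add[of 0 0] by (metis add.l_cancel_one' add_0 h_closed)

lemma h_uminus: "h (- x) = \<ominus> h x"
  using h_add[of "- x" x] by (metis ab_group_add_class.ab_left_minus h_closed h_zero minus_equality)

lemma h_diff: "h (x - y) = h x \<ominus> h y"
  using h_add[of x "- y"] by (simp add: h_uminus minus_eq)

lemma h_eq_iff: "h x = h y \<longleftrightarrow> h (x - y) = \<zero>"
  by (simp add: h_diff r_right_minus_eq)

definition ker :: "'r set" where "ker = {x. h x = \<zero>}"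

lemma smod_vimage:
  assumes "ideal I R" shows "rs.smod {x. h x : I}"
proof -
  interpret I: ideal I R by fact
  show ?thesis
    by (rule rs.smodI, rule sgpI)
      (auto simp: h_zero h_diff h_mult minus_eq intro: I.I_l_closed I.a_closed I.a_inv_closed)
qed

lemma ker_smod: "rs.smod ker"
  using smod_vimage[OF zeroideal] by (simp add: ker_def)

lemma ker_vimage: "ideal I R ==> ker <= {x. h x : I}"
  using additive_subgroup.zero_closed[OF ideal.axioms(1)] by (auto simp: ker_def)

end

text \<open>The abstract ring is the ambient ring modulo \<open>ker\<close>, and its ideals
  correspond to the ideals containing \<open>ker\<close>.\<close>

locale presentation = ring_map R h for R :: "('x, 'm) ring_scheme" (structure) and h :: "'r::comm_ring_1 => 'x" +
  assumes surj: "h ` UNIV = carrier R"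
begin

lemma surjE: assumes "y : carrier R" obtains x where "y = h x"
  using assms surj by (metis imageE)

lemma ideal_image:
  assumes "rs.smod H" shows "ideal (h ` H) R"
proof (rule idealI[OF ring_axioms])
  show "subgroup (h ` H) (add_monoid R)"
  proof (rule subgroup.intro)
    show "h ` H <= carrier (add_monoid R)" by auto
    show "x \<otimes>\<^bsub>add_monoid R\<^esub> y : h ` H" if "x : h ` H" "y : h ` H" for x y
      using that rs.smod_add[OF assms] by (auto simp: h_add[symmetric])
    show "\<one>\<^bsub>add_monoid R\<^esub> : h ` H" using rs.smod_0[OF assms] h_zero by (metis add.one_closed imageI monoid.select_convs(2))
    show "inv\<^bsub>add_monoid R\<^esub> x : h ` H" if "x : h ` H" for x
      using that rs.smod_diff[OF assms rs.smod_0[OF assms]] h_uminus by (auto simp: a_inv_def[symmetric]) (metis diff_0 imageI)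
  qed
  show "x \<otimes> a : h ` H" if a: "a : h ` H" and x: "x : carrier R" for a x
  proof -
    obtain u v where "x = h u" "a = h v" "v : H" using a surjE[OF x] by blast
    thus ?thesis using rs.smod_sc[OF assms, of v u] by (auto simp: h_mult[symmetric])
  qed
  thus "a \<otimes> x : h ` H" if "a : h ` H" "x : carrier R" for a x
    using that by (metis h_closed imageE m_comm)
qed

lemma image_vimage: "rs.smod H ==> ker <= H ==> {x. h x : h ` H} = H"
proof (intro subset_antisym subsetI)
  fix x assume H: "rs.smod H" "ker <= H" and "x : {x. h x : h ` H}"
  then obtain y where y: "h x = h y" "y : H" by auto
  hence "x - y : H" using H(2) h_eq_iff by (auto simp: ker_def)
  thus "x : H" using sgp_cancel[OF rs.smod_sgp[OF H(1)]] y(2) by blast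
qed auto

lemma vimage_Idl:
  "{x. h x : Idl\<^bsub>R\<^esub> (h ` set xs)} = ker + rs.gspan xs"
proof -
  have sm: "rs.smod (ker + rs.gspan xs)" by (intro rs.smod_plus ker_smod rs.gspan_smod)
  have k: "ker <= ker + rs.gspan xs" by (rule rs.upper1[OF rs.gspan_smod])
  have g: "rs.gspan xs <= ker + rs.gspan xs" by (rule rs.upper2[OF ker_smod])
  have id: "ideal (Idl (h ` set xs)) R" by (rule genideal_ideal) auto
  have self: "h ` set xs <= Idl (h ` set xs)" by (rule genideal_self) auto
  have "{x. h x : Idl (h ` set xs)} <= {x. h x : h ` (ker + rs.gspan xs)}"
    by (intro Collect_mono impI, erule subsetD[rotated], intro genideal_minimal[OF ideal_image[OF sm]] image_mono)
      (use g rs.gspan_base in blast)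
  moreover have "ker + rs.gspan xs <= {x. h x : Idl (h ` set xs)}"
    by (rule plus_least[OF rs.smod_sgp[OF smod_vimage[OF id]] ker_vimage[OF id] rs.gspan_least[OF smod_vimage[OF id]]])
      (use self in auto)
  ultimately show ?thesis unfolding image_vimage[OF sm k] by (rule subset_antisym)
qed

lemma fin_gen_vimage:
  assumes "ideal I R" "S <= carrier R" "finite S" "I = Idl S"
  obtains xs where "{x. h x : I} = ker + rs.gspan xs" "length xs = card S" "h ` set xs = S"
proof -
  obtain ys where ys: "set ys = S" "length ys = card S" using assms(3) by (metis distinct_card finite_distinct_list)
  define xs where "xs = map (%y. SOME x. y = h x) ys"
  have "h (SOME x. y = h x) = y" if "y : S" for y
    using someI_ex[of "%x. y = h x"] assms(2) that surjE by (metis subsetD)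
  hence "h ` set xs = S" by (force simp: xs_def ys(1)[symmetric] image_image)
  thus ?thesis using that[of xs] vimage_Idl[of xs] assms(4) ys(2) by (simp add: xs_def)
qed

text \<open>The union of an ascending chain maps to a finitely generated ideal, and preimages of its
  generators lie in one member of the chain.\<close>

lemma noetherian_rno:
  assumes "noetherian_ring R" shows "rs.rno ker UNIV"
  unfolding rs.rno_def
proof (rule noethI)
  interpret N: noetherian_ring R by fact
  fix H :: "nat => unit => 'r set"
  assume sub: "!!k. subfam (range rs.scop) (%_. ker) (%_. UNIV) (H k)" and inc: "!!k i. H k i <= H (Suc k) i"
  define F where "F k = H k ()" for k
  have HF: "H k = (%_. F k)" for k by (auto simp: F_def)
  have F: "rs.smod (F k)" "ker <= F k" for k using sub[of k] unfolding HF rs.subfam_scop by auto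
  have mono: "F i <= F j" if "i <= j" for i j using lift_Suc_mono_le[of F, OF _ that] inc by (simp add: F_def)
  define U where "U = (\<Union>k. F k)"
  have U: "rs.smod U"
  proof (rule rs.smodI, rule sgpI)
    show "0 : U" unfolding U_def using rs.smod_0[OF F(1)] by blast
    fix x y assume "x : U" "y : U"
    then obtain i j where "x : F i" "y : F j" by (auto simp: U_def)
    hence "x : F (max i j)" "y : F (max i j)" using mono[of i "max i j"] mono[of j "max i j"] by auto
    thus "x - y : U" unfolding U_def using rs.smod_diff[OF F(1)] by blast
  next
    show "c * x : U" if "x : U" for c x using that rs.smod_sc[OF F(1)] unfolding U_def by blast
  qed
  obtain S where S: "S <= carrier R" "finite S" "h ` U = Idl S" using N.finetely_gen[OF ideal_image[OF U]] by blast
  obtain xs where xs: "{x. h x : h ` U} = ker + rs.gspan xs" "length xs = card S" "h ` set xs = S" by (rule fin_gen_vimage[OF ideal_image[OF U] S])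
  have kU: "ker <= U" using F(2) by (auto simp: U_def)
  have U2: "U = ker + rs.gspan xs" using xs(1) image_vimage[OF U kU] by simp
  have "EX k. set ys <= F k" if "set ys <= U" for ys
    using that
  proof (induction ys)
    case (Cons y ys)
    then obtain i j where "set ys <= F i" "y : F j" by (auto simp: U_def)
    hence "set (y # ys) <= F (max i j)" using mono[of i "max i j"] mono[of j "max i j"] by auto
    thus ?case by blast
  qed simp
  moreover have "set xs <= U" unfolding U2
    by (rule subset_trans[OF _ rs.upper2[OF ker_smod]]) (use rs.gspan_base in blast)
  ultimately obtain k where k: "set xs <= F k" by blast
  have "U <= F k" unfolding U2 by (intro plus_least rs.smod_sgp F rs.gspan_least k)
  hence "F l = F k" if "l >= k" for l using mono[OF that] by (auto simp: U_def)
  thus "EX k. ALL l>=k. H l = H k" unfolding HF by (intro exI[of _ k] allI impI ext)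
qed

end

section \<open>Presentation of abstract modules\<close>

text \<open>\<open>pr\<close> identifies \<open>hi/lo\<close> with \<open>E\<close>. The laws of
  \<open>E\<close> that are used are transported from \<open>hi/lo\<close>.\<close>

locale pmod = presentation R h for R :: "('x, 'm) ring_scheme" (structure) and h :: "'r::comm_ring_1 => 'x" +
  fixes E :: "('x, 'e, 's) module_scheme" and pr :: "('v => 'r) => 'e" and lo hi :: "('v => 'r) set"
  assumes lo: "vs.smod lo" and hi: "vs.smod hi" and lohi: "lo <= hi"
    and car: "carrier E = pr ` hi"
    and eq: "u : hi ==> v : hi ==> pr u = pr v \<longleftrightarrow> u - v : lo"
    and plus: "u : hi ==> v : hi ==> pr u \<oplus>\<^bsub>E\<^esub> pr v = pr (u + v)"
    and scal: "v : hi ==> h c \<odot>\<^bsub>E\<^esub> pr v = pr (%x. c * v x)"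
    and null: "\<zero>\<^bsub>E\<^esub> = pr 0"
begin

lemma hi_simps: "0 : hi" "u : hi ==> v : hi ==> u + v : hi" "u : hi ==> v : hi ==> u - v : hi"
  "u : hi ==> (%x. c * u x) : hi" "u : hi ==> - u : hi"
  using vs.smod_0[OF hi] vs.smod_add[OF hi] vs.smod_diff[OF hi] vs.smod_sc[OF hi] sgp_neg[OF vs.smod_sgp[OF hi]] by auto

lemma comm_group_E: "comm_group (add_monoid E)"
proof (rule comm_groupI)
  show "EX y:carrier (add_monoid E). y \<otimes>\<^bsub>add_monoid E\<^esub> x = \<one>\<^bsub>add_monoid E\<^esub>" if x: "x : carrier (add_monoid E)" for x
  proof -
    obtain u where u: "x = pr u" "u : hi" using x by (auto simp: car)
    hence "pr (- u) \<oplus>\<^bsub>E\<^esub> x = \<zero>\<^bsub>E\<^esub>" using plus[OF hi_simps(5)[OF u(2)] u(2)] by (simp add: null)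
    thus ?thesis using hi_simps(5)[OF u(2)] by (auto simp: car)
  qed
qed (auto simp: car plus null hi_simps add_ac)

lemma inv_E: "u : hi ==> inv\<^bsub>add_monoid E\<^esub> pr u = pr (- u)"
  by (rule group.inv_equality[OF comm_group.axioms(2)[OF comm_group_E]])
    (simp_all add: car plus null hi_simps)

lemma submodule_image:
  assumes "vs.smod mid" "mid <= hi" shows "submodule (pr ` mid) R E"
proof (rule submodule.intro)
  have h: "!!v. v : mid ==> v : hi" using assms(2) by blast
  show "subgroup (pr ` mid) (add_monoid E)"
  proof (rule subgroup.intro)
    show "inv\<^bsub>add_monoid E\<^esub> x : pr ` mid" if "x : pr ` mid" for x
      using that sgp_neg[OF vs.smod_sgp[OF assms(1)]] by (auto simp: inv_E h)
  qed (use vs.smod_0[OF assms(1)] vs.smod_add[OF assms(1)] in "auto simp: car plus null h")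
  show "submodule_axioms (pr ` mid) R E"
  proof (rule submodule_axioms.intro)
    fix a x assume "a : carrier R" "x : pr ` mid"
    then obtain c v where "a = h c" "x = pr v" "v : mid" using surjE by blast
    thus "a \<odot>\<^bsub>E\<^esub> x : pr ` mid" using vs.smod_sc[OF assms(1)] by (simp add: scal h)
  qed
qed

lemma submodule_vimage:
  assumes "submodule H R E"
  shows "vs.smod {v : hi. pr v : H}" "lo <= {v : hi. pr v : H}" "H = pr ` {v : hi. pr v : H}"
proof -
  interpret H: submodule H R E by fact
  have z: "pr 0 : H" using H.one_closed by (simp add: null)
  have a: "pr (u + v) : H" if "pr u : H" "pr v : H" "u : hi" "v : hi" for u v
    using H.m_closed[OF that(1,2)] that(3,4) by (simp add: plus)
  have i: "pr (- u) : H" if "pr u : H" "u : hi" for u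
    using H.m_inv_closed[OF that(1)] by (simp add: inv_E that(2))
  show "vs.smod {v : hi. pr v : H}"
  proof (rule vs.smodI, rule sgpI)
    show "u - v : {v : hi. pr v : H}" if "u : {v : hi. pr v : H}" "v : {v : hi. pr v : H}" for u v
      using that a[of u "- v"] i[of v] by (simp add: hi_simps)
    show "(%x. c * v x) : {v : hi. pr v : H}" if "v : {v : hi. pr v : H}" for c v
      using that H.smult_closed[OF h_closed, of "pr v" c] by (simp add: hi_simps scal)
  qed (simp add: hi_simps z)
  show "lo <= {v : hi. pr v : H}"
  proof
    fix x assume x: "x : lo"
    hence "x : hi" using lohi by blast
    thus "x : {v : hi. pr v : H}" using eq[of x 0] hi_simps(1) x z by simp
  qed
  show "H = pr ` {v : hi. pr v : H}"
    using H.subset by (auto simp: car)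
qed

lemma mod_span_eqI:
  assumes mid: "vs.smod mid" "mid <= hi" and sub: "S <= pr ` mid"
    and least: "!!H. vs.smod H ==> lo <= H ==> (!!v. v : hi ==> pr v : S ==> v : H) ==> mid <= H"
  shows "mod_span R E S = pr ` mid"
proof (rule subset_antisym)
  show "mod_span R E S <= pr ` mid"
    unfolding mod_span_def using submodule_image[OF mid] sub by blast
  show "pr ` mid <= mod_span R E S"
    unfolding mod_span_def
  proof (rule Inter_greatest)
    fix H assume "H : {H. submodule H R E & S <= H}"
    hence H: "submodule H R E" "S <= H" by auto
    have "mid <= {v : hi. pr v : H}"
      by (rule least[OF submodule_vimage(1,2)[OF H(1)]]) (use H(2) in blast)
    thus "pr ` mid <= H" by blast
  qed
qed

lemma mod_span_image:
  assumes "set gs <= hi" shows "mod_span R E (pr ` set gs) = pr ` (lo + vs.gspan gs)"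
proof (rule mod_span_eqI)
  show "vs.smod (lo + vs.gspan gs)" by (intro vs.smod_plus lo vs.gspan_smod)
  show "lo + vs.gspan gs <= hi" by (intro plus_least vs.smod_sgp hi lohi vs.gspan_least assms)
  have "set gs <= lo + vs.gspan gs"
    by (rule subset_trans[OF _ vs.upper2[OF lo]]) (auto intro: vs.gspan_base)
  thus "pr ` set gs <= pr ` (lo + vs.gspan gs)" by (rule image_mono)
  fix H assume H: "vs.smod H" "lo <= H" "!!v. v : hi ==> pr v : pr ` set gs ==> v : H"
  have "set gs <= H" using H(3) assms by blast
  thus "lo + vs.gspan gs <= H" by (intro plus_least vs.smod_sgp H(1,2) vs.gspan_least)
qed

lemma gen_iff: "vs.gen n lo hi \<longleftrightarrow> (EX gs. length gs = n & set gs <= hi & mod_span R E (pr ` set gs) = carrier E)"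
proof -
  have "hi <= lo + vs.gspan gs \<longleftrightarrow> pr ` (lo + vs.gspan gs) = pr ` hi" if gs: "set gs <= hi" for gs
  proof -
    have sm: "vs.smod (lo + vs.gspan gs)" by (intro vs.smod_plus lo vs.gspan_smod)
    have sub: "lo + vs.gspan gs <= hi" by (intro plus_least vs.smod_sgp hi lohi vs.gspan_least gs)
    have low: "lo <= lo + vs.gspan gs" by (rule vs.upper1[OF vs.gspan_smod])
    show ?thesis
    proof
      assume "hi <= lo + vs.gspan gs"
      hence "lo + vs.gspan gs = hi" by (rule subset_antisym[OF sub])
      thus "pr ` (lo + vs.gspan gs) = pr ` hi" by (rule arg_cong)
    next
      assume e: "pr ` (lo + vs.gspan gs) = pr ` hi"
      show "hi <= lo + vs.gspan gs"
      proof
        fix x assume x: "x : hi"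
        hence "pr x : pr ` (lo + vs.gspan gs)" unfolding e by (rule imageI)
        then obtain y where y: "pr x = pr y" "y : lo + vs.gspan gs" by (rule imageE)
        have "x - y : lo + vs.gspan gs" using eq[OF x subsetD[OF sub y(2)]] y(1) subsetD[OF low] by simp
        thus "x : lo + vs.gspan gs" by (rule sgp_cancel[OF vs.smod_sgp[OF sm] _ y(2)])
      qed
    qed
  qed
  hence "(length gs = n & set gs <= hi & hi <= lo + vs.gspan gs) \<longleftrightarrow>
      (length gs = n & set gs <= hi & mod_span R E (pr ` set gs) = carrier E)" for gs
    by (cases "set gs <= hi") (simp_all only: mod_span_image car simp_thms)
  thus ?thesis unfolding vs.gen_def by (simp only:)
qed

lemma span_list:
  assumes "finite S" "S <= carrier E"
  obtains gs where "length gs = card S" "set gs <= hi" "pr ` set gs = S"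
proof -
  obtain ys where ys: "set ys = S" "length ys = card S" using assms(1) by (metis distinct_card finite_distinct_list)
  have "ALL y:S. EX v. v : hi & pr v = y" using assms(2) car by (metis imageE subsetD)
  then obtain g where g: "!!y. y : S ==> g y : hi & pr (g y) = y" by metis
  have "pr ` set (map g ys) = S" using g by (force simp: ys(1) image_image)
  thus ?thesis using that[of "map g ys"] g ys by auto
qed

text \<open>\<open>min_gens\<close> counts sets and \<open>gen\<close> counts lists. A list with
  repetitions gives a smaller set, which is why only the minimum is compared.\<close>

lemma min_gens_gen:
  assumes "vs.gen n lo hi"
  shows "vs.gen (min_gens R E) lo hi" "min_gens R E <= n"
proof -
  let ?P = "%n. EX S. finite S & card S = n & S <= carrier E & mod_span R E S = carrier E"
  have 1: "vs.gen k lo hi" if "?P k" for k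
  proof -
    obtain S where S: "finite S" "card S = k" "S <= carrier E" "mod_span R E S = carrier E" using `?P k` by blast
    obtain gs where "length gs = card S" "set gs <= hi" "pr ` set gs = S" by (rule span_list[OF S(1,3)])
    thus ?thesis unfolding gen_iff using S(2,4) by (intro exI[of _ gs]) simp
  qed
  have 2: "EX k<=m. ?P k" if "vs.gen m lo hi" for m
  proof -
    obtain gs where gs: "length gs = m" "set gs <= hi" "mod_span R E (pr ` set gs) = carrier E"
      using `vs.gen m lo hi` unfolding gen_iff by blast
    have "card (pr ` set gs) <= m" using order_trans[OF card_image_le[OF finite_set] card_length[of gs]] gs(1) by simp
    thus ?thesis using gs(2,3) car by (intro exI[of _ "card (pr ` set gs)"]) auto
  qed
  obtain k where "k <= n & ?P k" using 2[OF assms] by (rule exE)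
  note k = conjunct1[OF this] conjunct2[OF this]
  show "vs.gen (min_gens R E) lo hi" unfolding min_gens_def by (rule 1[OF LeastI[of ?P, OF k(2)]])
  show "min_gens R E <= n" unfolding min_gens_def by (rule order_trans[OF Least_le[of ?P, OF k(2)] k(1)])
qed

lemma pmod_sub:
  assumes "vs.smod mid" "lo <= mid" "mid <= hi" "carrier E' = pr ` mid" "add E' = add E" "smult E' = smult E" "zero E' = zero E"
  shows "pmod R h E' pr lo mid"
  by unfold_locales (use assms eq plus scal null lo subsetD[OF assms(3)] in auto)

lemma coset: "mid <= hi ==> v : hi ==> pr ` mid +>\<^bsub>E\<^esub> pr v = pr ` ((%m. m + v) ` mid)"
  unfolding a_r_coset_def' by (auto simp: plus image_image subset_iff)

lemma pmod_quot:
  assumes mid: "vs.smod mid" "lo <= mid" "mid <= hi"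
  shows "pmod R h (quot_module E (pr ` mid)) (%v. pr ` mid +>\<^bsub>E\<^esub> pr v) mid hi"
proof
  let ?c = "%v. pr ` mid +>\<^bsub>E\<^esub> pr v"
  have h: "!!v. v : mid ==> v : hi" using mid(3) by blast
  have memI: "pr w : ?c v" if "w - v : mid" "v : hi" for v w
    unfolding coset[OF mid(3) that(2)] using that(1) by (intro imageI image_eqI[of _ _ "w - v"]) auto
  have mem: "pr w : ?c v \<longleftrightarrow> w - v : mid" if w: "w : hi" and v: "v : hi" for v w
  proof
    assume "pr w : ?c v"
    then obtain m where m: "m : mid" "pr w = pr (m + v)" unfolding coset[OF mid(3) v] by auto
    hence "w - (m + v) : mid" using eq[OF w] mid(2) by (auto simp: hi_simps h v)
    hence "(w - (m + v)) + m : mid" by (rule vs.smod_add[OF mid(1) _ m(1)])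
    thus "w - v : mid" by (simp add: algebra_simps)
  qed (rule memI[OF _ v])
  have sub: "?c v <= pr ` hi" if "v : hi" for v unfolding coset[OF mid(3) that] by (auto simp: hi_simps h that)
  show e: "?c u = ?c v \<longleftrightarrow> u - v : mid" if "u : hi" "v : hi" for u v
  proof
    assume "?c u = ?c v"
    thus "u - v : mid" using mem[OF that] mem[OF that(1,1)] vs.smod_0[OF mid(1)] by simp
  next
    assume uv: "u - v : mid"
    have "pr w : ?c u \<longleftrightarrow> pr w : ?c v" if w: "w : hi" for w
      unfolding mem[OF w `u : hi`] mem[OF w `v : hi`]
      using vs.smod_add[OF mid(1) _ uv, of "w - u"] vs.smod_diff[OF mid(1) _ uv, of "w - v"] by (auto simp: algebra_simps)
    thus "?c u = ?c v" using sub[OF that(1)] sub[OF that(2)] by blast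
  qed
  show "carrier (quot_module E (pr ` mid)) = ?c ` hi"
    by (auto simp: quot_module_def A_RCOSETS_def' car)
  show "?c u \<oplus>\<^bsub>quot_module E (pr ` mid)\<^esub> ?c v = ?c (u + v)" if u: "u : hi" and v: "v : hi" for u v
  proof -
    have "(UN x:?c u. UN y:?c v. {x \<oplus>\<^bsub>E\<^esub> y}) = ?c (u + v)"
    proof (intro subset_antisym subsetI)
      fix x assume "x : (UN x:?c u. UN y:?c v. {x \<oplus>\<^bsub>E\<^esub> y})"
      then obtain m n where mn: "m : mid" "n : mid" "x = pr (m + u) \<oplus>\<^bsub>E\<^esub> pr (n + v)"
        unfolding coset[OF mid(3) u] coset[OF mid(3) v] by auto
      have "(m + u) + (n + v) - (u + v) = m + n" by simp
      thus "x : ?c (u + v)" unfolding mn(3)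
        by (simp add: plus hi_simps h mn u v mem vs.smod_add[OF mid(1) mn(1,2)])
    next
      fix x assume "x : ?c (u + v)"
      then obtain m where m: "m : mid" "x = pr (m + (u + v))" unfolding coset[OF mid(3) hi_simps(2)[OF u v]] by auto
      have "x = pr (m + u) \<oplus>\<^bsub>E\<^esub> pr v" by (simp add: plus m hi_simps h u v add.assoc)
      moreover have "pr (m + u) : ?c u" "pr v : ?c v" by (rule memI; simp add: m u v vs.smod_0[OF mid(1)])+
      ultimately show "x : (UN x:?c u. UN y:?c v. {x \<oplus>\<^bsub>E\<^esub> y})" by blast
    qed
    thus ?thesis by (simp add: quot_module_def set_add_def')
  qed
  show "h k \<odot>\<^bsub>quot_module E (pr ` mid)\<^esub> ?c v = ?c (%x. k * v x)" if v: "v : hi" for v k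
  proof -
    have "pr ` mid +>\<^bsub>E\<^esub> (h k \<odot>\<^bsub>E\<^esub> x) = ?c (%x. k * v x)" if x: "x : ?c v" for x
    proof -
      obtain m where m: "m : mid" "x = pr (m + v)" using x unfolding coset[OF mid(3) v] by auto
      have "(%x. k * (m + v) x) - (%x. k * v x) = (%x. k * m x)" by (simp add: fun_eq_iff algebra_simps)
      thus ?thesis unfolding m(2)
        using vs.smod_sc[OF mid(1) m(1), of k] by (subst scal) (simp_all add: hi_simps h m v e del: plus_fun_apply)
    qed
    moreover have "pr v : ?c v" by (rule memI) (simp_all add: v vs.smod_0[OF mid(1)])
    ultimately show ?thesis by (auto simp: quot_module_def)
  qed
  show "\<zero>\<^bsub>quot_module E (pr ` mid)\<^esub> = ?c 0"
    unfolding coset[OF mid(3) hi_simps(1)] by (simp add: quot_module_def)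
qed (use mid hi in auto)

end

section \<open>Free resolutions and Ext\<close>

definition unit_vec :: "nat => nat => 'r::comm_ring_1" where "unit_vec j = (%i. if i = j then 1 else 0)"

text \<open>Singleton lists give the resolution the index type of iterated cones.\<close>

definition basis :: "nat => nat list set" where "basis m = (%i. [i]) ` {..<m}"

definition lincomb :: "nat => (nat => 'y => 'r::comm_ring_1) => (nat => 'r) => 'y => 'r"
  where "lincomb m w v = (\<Sum>j<m. (%x. v j * w j x))"

lemma lincomb_add: "lincomb m w (u + v) = lincomb m w u + lincomb m w v"
  and lincomb_diff: "lincomb m w (u - v) = lincomb m w u - lincomb m w v"
  and lincomb_sc: "lincomb m w (%j. c * v j) = (%x. c * lincomb m w v x)"
  and lincomb_add_right: "lincomb m (%j. w j + z j) v = lincomb m w v + lincomb m z v"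
  and lincomb_sc_right: "lincomb m (%j x. c * w j x) v = (%x. c * lincomb m w v x)"
  by (simp_all add: lincomb_def fun_eq_iff sum_fun algebra_simps sum.distrib sum_subtractf sum_distrib_left)

lemma lincomb_unit: "j < m ==> lincomb m w (unit_vec j) = w j"
  by (simp add: lincomb_def fun_eq_iff sum_fun unit_vec_def if_distrib[of "%c. c * _"] cong: if_cong)

lemma lincomb_mem: "vs.smod H ==> (!!j. j < m ==> w j : H) ==> lincomb m w v : H"
  unfolding lincomb_def by (rule vs_sum) (auto intro: vs.smod_sc)

lemma lincomb_unit_vec: "i < m ==> lincomb m unit_vec v i = v i"
  by (simp add: lincomb_def sum_fun unit_vec_def if_distrib[of "%c. _ * c"] cong: if_cong)

lemma gspan_lincomb: "vs.gspan gs = range (lincomb (length gs) (nth gs))"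
proof (rule subset_antisym)
  have "vs.smod (range (lincomb (length gs) (nth gs)))"
    by (rule smod_lin_image[OF lincomb_add lincomb_sc vs.smod_UNIV])
  thus "vs.gspan gs <= range (lincomb (length gs) (nth gs))"
  proof (rule vs.gspan_least, intro subsetI)
    fix g assume "g : set gs"
    then obtain i where "i < length gs" "g = gs ! i" by (metis in_set_conv_nth)
    thus "g : range (lincomb (length gs) (nth gs))" using lincomb_unit[of i "length gs" "nth gs"] by (metis rangeI)
  qed
  show "range (lincomb (length gs) (nth gs)) <= vs.gspan gs"
    by (intro image_subsetI lincomb_mem vs.gspan_smod vs.gspan_base nth_mem)
qed

lemma coch_basis: "v : coch (basis m) L \<longleftrightarrow> (ALL i<m. sl [i] v : L)"
  by (auto simp: coch_def basis_def)

context presentation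
begin

definition sec :: "'x => 'r" where "sec a = (SOME x. h x = a)"

lemma h_sec [simp]: "a : carrier R ==> h (sec a) = a"
  unfolding sec_def by (rule someI_ex) (metis surjE)

definition frp :: "nat => (nat => 'r) => nat => 'x" where "frp n v = (\<lambda>i\<in>{..<n}. h (v i))"

lemma frp_eq: "frp n u = frp n v \<longleftrightarrow> (ALL i<n. h (u i) = h (v i))"
  by (auto simp: frp_def fun_eq_iff restrict_def)

lemma free_carrier: "carrier (free_module R n) = range (frp n)"
proof (intro subset_antisym subsetI)
  fix x assume "x : carrier (free_module R n)"
  hence x: "x : {..<n} \<rightarrow>\<^sub>E carrier R" by (simp add: free_module_def)
  hence "x = frp n (%i. sec (x i))" by (auto simp: frp_def fun_eq_iff restrict_def PiE_def Pi_def extensional_def)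
  thus "x : range (frp n)" by blast
qed (auto simp: frp_def free_module_def split: if_splits)

lemma free_pmod: "pmod R h (free_module R n) (frp n) (vk {..<n} ker) UNIV"
proof
  show "frp n u = frp n v \<longleftrightarrow> u - v : vk {..<n} ker" for u v
    unfolding frp_eq by (auto simp: vk_def ker_def h_eq_iff)
  show "carrier (free_module R n) = frp n ` UNIV" by (rule free_carrier)
qed (auto simp: vk_smod ker_smod vs.smod_UNIV free_module_def frp_def h_add h_mult h_zero fun_eq_iff restrict_def)

end

context pmod
begin

lemma killed_ker: "vs.killed ker lo hi"
  unfolding vs.killed_def
proof (intro ballI)
  fix c v assume c: "c : ker" and v: "v : hi"
  have "h c = h 0" using c by (simp add: ker_def h_zero)
  hence "pr (%x. c * v x) = pr (%x. 0 * v x)" using scal[OF v, of c] scal[OF v, of 0] by simp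
  moreover have "(%x. 0 * v x) = 0" by (simp add: fun_eq_iff)
  ultimately show "(%x. c * v x) : lo" using eq[OF hi_simps(4)[OF v, of c] hi_simps(1)] by (simp only: diff_zero)
qed

lemma lincomb_ker:
  assumes "!!j. j < m ==> w j : hi" "frp m u = frp m v"
  shows "pr (lincomb m w u) = pr (lincomb m w v)"
proof -
  have "lincomb m w (u - v) : lo" unfolding lincomb_def
  proof (rule vs_sum[OF lo])
    fix j assume "j : {..<m}"
    hence "(u - v) j : ker" "w j : hi" using assms unfolding frp_eq by (auto simp: ker_def h_eq_iff[symmetric])
    thus "(%x. (u - v) j * w j x) : lo" using killed_ker unfolding vs.killed_def by blast
  qed
  thus ?thesis using eq lincomb_mem[OF hi assms(1)] by (simp add: lincomb_diff)
qed

text \<open>The linear map sending the \<open>j\<close>-th basis vector to \<open>pr (w j)\<close>,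
  made extensional. Coordinates are lifted by \<open>sec\<close>; other lifts give the same value by
  \<open>lincomb_ker\<close>.\<close>

definition hom_of :: "nat => (nat => 'v => 'r) => (nat => 'x) => 'e"
  where "hom_of m w = (\<lambda>x\<in>carrier (free_module R m). pr (lincomb m w (%j. sec (x j))))"

lemma hom_of_frp:
  assumes "!!j. j < m ==> w j : hi"
  shows "hom_of m w (frp m v) = pr (lincomb m w v)"
proof -
  have "frp m (%j. sec (frp m v j)) = frp m v" unfolding frp_eq by (simp add: frp_def)
  from lincomb_ker[OF assms this] show ?thesis by (simp add: hom_of_def free_carrier)
qed

lemma hom_of_mem:
  assumes "!!j. j < m ==> w j : hi"
  shows "hom_of m w : mod_hom R (free_module R m) E"
proof -
  interpret F: pmod R h "free_module R m" "frp m" "vk {..<m} ker" UNIV by (rule free_pmod)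
  note hw = hom_of_frp[of m w, OF assms] and m = lincomb_mem[OF hi assms]
  have "hom_of m w (x \<oplus>\<^bsub>free_module R m\<^esub> y) = hom_of m w x \<oplus>\<^bsub>E\<^esub> hom_of m w y"
    if "x : carrier (free_module R m)" "y : carrier (free_module R m)" for x y
    using that unfolding free_carrier by (auto simp: F.plus hw lincomb_add plus m)
  moreover have "hom_of m w (a \<odot>\<^bsub>free_module R m\<^esub> x) = a \<odot>\<^bsub>E\<^esub> hom_of m w x"
    if a: "a : carrier R" and x: "x : carrier (free_module R m)" for a x
  proof -
    obtain c v where "a = h c" "x = frp m v" using surjE[OF a] x unfolding free_carrier by blast
    thus ?thesis by (simp add: F.scal hw lincomb_sc scal m)
  qed
  moreover have "hom_of m w : carrier (free_module R m) \<rightarrow>\<^sub>E carrier E"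
    using m unfolding hom_of_def car by auto
  ultimately show ?thesis unfolding mod_hom_def by blast
qed

lemma hom_carrier: "f : mod_hom R (free_module R m) E ==> f (frp m v) : carrier E"
  unfolding mod_hom_def free_carrier by (auto simp: PiE_def)

lemma hom_expand:
  assumes f: "f : mod_hom R (free_module R m) E"
    and w: "!!j. j < m ==> w j : hi" "!!j. j < m ==> f (frp m (unit_vec j)) = pr (w j)"
  shows "f (frp m v) = pr (lincomb m w v)"
proof -
  interpret F: pmod R h "free_module R m" "frp m" "vk {..<m} ker" UNIV by (rule free_pmod)
  have add: "f (frp m (u + v)) = f (frp m u) \<oplus>\<^bsub>E\<^esub> f (frp m v)" for u v
    using f unfolding mod_hom_def free_carrier by (auto simp: F.plus[symmetric])
  have scl: "f (frp m (%j. c * v j)) = h c \<odot>\<^bsub>E\<^esub> f (frp m v)" for c v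
    using f unfolding mod_hom_def free_carrier by (auto simp: F.scal[symmetric])
  note car_f = hom_carrier[OF f]
  have f0: "f (frp m 0) = pr 0"
  proof -
    obtain u where u: "f (frp m 0) = pr u" "u : hi" using car_f[of 0] by (auto simp: car)
    thus ?thesis using scl[of 0 0] scal[OF u(2), of 0] by (simp flip: zero_fun_def)
  qed
  have "f (frp m (\<Sum>j<k. (%i. v j * unit_vec j i))) = pr (\<Sum>j<k. (%x. v j * w j x))" if "k <= m" for k
    using that
  proof (induction k)
    case (Suc k)
    have "(\<Sum>j<k. (%x. v j * w j x)) : hi" by (rule vs_sum[OF hi]) (use w(1) Suc.prems in "auto intro: hi_simps")
    thus ?case using Suc
      unfolding sum.lessThan_Suc add scl by (simp only: w Suc_le_lessD Suc_leD scal plus hi_simps)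
  qed (simp add: f0)
  from this[of m] have "f (frp m (lincomb m unit_vec v)) = pr (lincomb m w v)" by (simp add: lincomb_def)
  moreover have "frp m (lincomb m unit_vec v) = frp m v" unfolding frp_eq by (simp add: lincomb_unit_vec)
  ultimately show ?thesis by simp
qed

subsection \<open>Homomorphisms out of free modules\<close>

definition hmap :: "nat => (nat list \<times> 'v => 'r) => (nat => 'x) => 'e"
  where "hmap m v = hom_of m (%i. sl [i] v)"

text \<open>A homomorphism out of a free module is determined by the images of the basis, so
  \<open>Hom\<close> is presented by cochains on the singleton lists.\<close>

lemma hmap_pmod:
  assumes "hi = UNIV"
  shows "pmod R h (Hom_module R (free_module R m) E) (hmap m) (coch (basis m) lo) UNIV"
proof
  have hf: "hmap m v (frp m u) = pr (lincomb m (%i. sl [i] v) u)" for v u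
    unfolding hmap_def by (rule hom_of_frp) (simp add: assms)
  have eqI: "f = g" if "f : mod_hom R (free_module R m) E" "g : mod_hom R (free_module R m) E"
    "!!u. f (frp m u) = g (frp m u)" for f g
  proof (rule extensionalityI[of _ "carrier (free_module R m)"])
    show "f x = g x" if "x : carrier (free_module R m)" for x using that `!!u. f (frp m u) = g (frp m u)` unfolding free_carrier by auto
  qed (use that in "auto simp: mod_hom_def PiE_def")
  have mem: "hmap m v : mod_hom R (free_module R m) E" for v unfolding hmap_def by (rule hom_of_mem) (simp add: assms)
  show "vs.smod (coch (basis m) lo)" by (rule coch_smod[OF lo])
  show "carrier (Hom_module R (free_module R m) E) = hmap m ` UNIV"
  proof (intro subset_antisym subsetI)
    fix f assume "f : carrier (Hom_module R (free_module R m) E)"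
    hence f: "f : mod_hom R (free_module R m) E" by (simp add: Hom_module_def)
    have "EX w. f (frp m (unit_vec j)) = pr w" for j
      using hom_carrier[OF f] unfolding car by blast
    then obtain w where w: "!!j. f (frp m (unit_vec j)) = pr (w j)" by metis
    have "f = hmap m (%(l, x). w (hd l) x)"
      by (rule eqI[OF f mem]) (simp add: hf hom_expand[OF f, of w] w assms sl_def)
    thus "f : range (hmap m)" by blast
  qed (auto simp: Hom_module_def mem)
  show "hmap m u = hmap m v \<longleftrightarrow> u - v : coch (basis m) lo" for u v
  proof
    assume e: "hmap m u = hmap m v"
    have "sl [i] u - sl [i] v : lo" if "i < m" for i
      using fun_cong[OF e, of "frp m (unit_vec i)"] that unfolding hf by (simp add: lincomb_unit eq assms)
    thus "u - v : coch (basis m) lo" by (simp add: coch_basis)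
  next
    assume "u - v : coch (basis m) lo"
    hence d: "sl [i] u - sl [i] v : lo" if "i < m" for i using that by (simp add: coch_basis)
    show "hmap m u = hmap m v"
    proof (rule eqI[OF mem mem], unfold hf)
      fix c
      have "lincomb m (%i. sl [i] u) c - lincomb m (%i. sl [i] v) c = lincomb m (%i. sl [i] u - sl [i] v) c"
        by (simp add: lincomb_def fun_eq_iff sum_fun algebra_simps sum_subtractf)
      thus "pr (lincomb m (%i. sl [i] u) c) = pr (lincomb m (%i. sl [i] v) c)"
        using lincomb_mem[OF lo d, where v = c] by (subst eq) (simp_all add: assms)
    qed
  qed
  have r: "restrict f (carrier (free_module R m)) = g" if "g : mod_hom R (free_module R m) E" "!!u. f (frp m u) = g (frp m u)" for f g
    by (rule extensionalityI[of _ "carrier (free_module R m)"]) (use that in "auto simp: mod_hom_def PiE_def free_carrier")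
  show "hmap m u \<oplus>\<^bsub>Hom_module R (free_module R m) E\<^esub> hmap m v = hmap m (u + v)" for u v
    unfolding Hom_module_def by (simp, rule r[OF mem]) (simp add: hf plus assms lincomb_add_right)
  show "h c \<odot>\<^bsub>Hom_module R (free_module R m) E\<^esub> hmap m v = hmap m (%p. c * v p)" for c v
    unfolding Hom_module_def by (simp, rule r[OF mem]) (simp add: hf scal assms lincomb_sc_right)
  show "\<zero>\<^bsub>Hom_module R (free_module R m) E\<^esub> = hmap m 0"
    unfolding Hom_module_def by (simp, rule r[OF mem]) (simp add: hf null lincomb_def flip: zero_fun_def)
qed (auto simp: vs.smod_UNIV)

end

section \<open>Finitely generated modules and their resolutions\<close>

context presentation
begin

lemma module_pmod:
  assumes "module R M" "fin_gen R M"
  shows "EX nu pr K. pmod R h M (pr :: (nat => 'r) => _) K UNIV & vk {..<nu} ker <= K"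
proof -
  interpret M: module R M by fact
  obtain S where S: "finite S" "S <= carrier M" "mod_span R M S = carrier M" using assms(2) by (auto simp: fin_gen_def)
  obtain ms where ms: "set ms = S" using finite_list[OF S(1)] by blast
  define nu where "nu = length ms"
  define pr where "pr v = (\<Oplus>\<^bsub>M\<^esub>i\<in>{..<nu}. h (v i) \<odot>\<^bsub>M\<^esub> (ms ! i))" for v
  have mi: "ms ! i : carrier M" if "i < nu" for i using that S(2) ms nth_mem[of i ms] by (auto simp: nu_def)
  have cl: "pr v : carrier M" for v unfolding pr_def by (rule M.finsum_closed) (use mi in auto)
  have plus: "pr u \<oplus>\<^bsub>M\<^esub> pr v = pr (u + v)" for u v
  proof -
    have "pr u \<oplus>\<^bsub>M\<^esub> pr v = (\<Oplus>\<^bsub>M\<^esub>i\<in>{..<nu}. h (u i) \<odot>\<^bsub>M\<^esub> (ms ! i) \<oplus>\<^bsub>M\<^esub> h (v i) \<odot>\<^bsub>M\<^esub> (ms ! i))"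
      unfolding pr_def by (rule M.finsum_addf[symmetric]) (use mi in auto)
    also have "... = pr (u + v)"
      unfolding pr_def by (rule M.finsum_cong') (use mi in "auto simp: h_add M.smult_l_distr")
    finally show ?thesis .
  qed
  have scal: "h c \<odot>\<^bsub>M\<^esub> pr v = pr (%i. c * v i)" for c v
  proof -
    have "h c \<odot>\<^bsub>M\<^esub> pr v = (\<Oplus>\<^bsub>M\<^esub>i\<in>{..<nu}. h c \<odot>\<^bsub>M\<^esub> (h (v i) \<odot>\<^bsub>M\<^esub> (ms ! i)))"
      unfolding pr_def by (rule M.finsum_smult_ldistr) (use mi in auto)
    also have "... = pr (%i. c * v i)"
      unfolding pr_def by (rule M.finsum_cong') (use mi in "auto simp: h_mult M.smult_assoc1")
    finally show ?thesis .
  qed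
  have unit: "pr (unit_vec i) = ms ! i" if "i < nu" for i
  proof -
    have "pr (unit_vec i) = (\<Oplus>\<^bsub>M\<^esub>j\<in>{..<nu}. if i = j then ms ! j else \<zero>\<^bsub>M\<^esub>)"
      unfolding pr_def by (rule M.finsum_cong') (use mi in "auto simp: unit_vec_def h_one h_zero")
    also have "... = ms ! i" by (rule M.finsum_singleton) (use that mi in auto)
    finally show ?thesis .
  qed
  have zero: "pr 0 = \<zero>\<^bsub>M\<^esub>" using scal[of 0 0] cl[of 0] by (simp add: h_zero flip: zero_fun_def)
  have surj: "carrier M = range pr"
  proof (rule subset_antisym)
    have "submodule (range pr) R M"
    proof (rule M.submoduleI)
      show "\<ominus>\<^bsub>M\<^esub> a : range pr" if a: "a : range pr" for a
      proof -
        obtain v where v: "a = pr v" using a by blast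
        have "pr (- v) \<oplus>\<^bsub>M\<^esub> pr v = \<zero>\<^bsub>M\<^esub>" by (simp add: plus zero)
        hence "\<ominus>\<^bsub>M\<^esub> a = pr (- v)" unfolding v by (rule M.minus_equality[OF _ cl cl])
        thus ?thesis by blast
      qed
      show "a \<odot>\<^bsub>M\<^esub> x : range pr" if a: "a : carrier R" and x: "x : range pr" for a x
      proof -
        obtain c v where "a = h c" "x = pr v" using x surjE[OF a] by blast
        thus ?thesis by (simp add: scal)
      qed
      show "range pr <= carrier M" using cl by blast
      show "\<zero>\<^bsub>M\<^esub> : range pr" unfolding zero[symmetric] by (rule rangeI)
      show "a \<oplus>\<^bsub>M\<^esub> b : range pr" if "a : range pr" "b : range pr" for a b using that plus by auto
    qed
    moreover have "S <= range pr"
    proof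
      fix x assume "x : S"
      then obtain i where "i < nu" "x = ms ! i" unfolding ms[symmetric] nu_def by (metis in_set_conv_nth)
      thus "x : range pr" using unit by (metis rangeI)
    qed
    ultimately show "carrier M <= range pr" unfolding S(3)[symmetric] mod_span_def by blast
  qed (use cl in auto)
  define K where "K = {v. pr v = \<zero>\<^bsub>M\<^esub>}"
  have eq: "pr u = pr v \<longleftrightarrow> u - v : K" for u v
    using M.add.r_cancel_one[OF cl cl, of "u - v" v] by (simp add: plus K_def)
  have "pmod R h M pr K UNIV"
  proof
    show "vs.smod K"
    proof (rule vs.smodI, rule sgpI)
      show "x - y : K" if "x : K" "y : K" for x y using that eq[of x y] by (simp add: K_def)
      show "(%i. c * x i) : K" if "x : K" for c x
        using that scal[of c x] by (simp add: K_def)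
    qed (simp add: K_def zero)
  qed (use eq plus scal surj zero vs.smod_UNIV in auto)
  moreover have "vk {..<nu} ker <= K"
  proof
    fix v assume "v : vk {..<nu} ker"
    hence "pr v = (\<Oplus>\<^bsub>M\<^esub>i\<in>{..<nu}. \<zero>\<^bsub>M\<^esub>)" unfolding pr_def
      by (intro M.finsum_cong') (use mi in "auto simp: vk_def ker_def")
    thus "v : K" by (simp add: K_def)
  qed
  ultimately show ?thesis by blast
qed

end

context pmod
begin

lemma hom_kernel:
  assumes "f : mod_hom R (free_module R m) E"
  shows "a_kernel (free_module R m) E f = frp m ` {v. f (frp m v) = \<zero>\<^bsub>E\<^esub>}"
  unfolding a_kernel_def' free_carrier by auto

end

text \<open>\<open>Ext\<close> is defined by a choice, so existence is needed to know that the
  chosen pair is a resolution. The state \<open>st n\<close> holds a rank and the module of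
  relations, and \<open>nx\<close> picks finitely many generators of the latter.\<close>

lemma (in presentation) free_resolution_exists:
  assumes "pmod R h M pr K UNIV" and K: "vk {..<nu} ker <= (K :: (nat => 'r) set)" and rno: "rs.rno ker UNIV"
  shows "EX bt d ep. free_resolution R M bt d ep"
proof -
  interpret M: pmod R h M pr K UNIV by fact
  define nx where "nx s = (SOME gs. set gs <= snd s & snd s <= vk {..<fst s} ker + vs.gspan gs)" for s :: "nat \<times> (nat => 'r) set"
  define st where "st n = ((%s. (length (nx s), {v. lincomb (length (nx s)) (nth (nx s)) v : vk {..<fst s} ker})) ^^ n) (nu, K)" for n
  define bt where "bt n = fst (st n)" for n
  define Z where "Z n = snd (st n)" for n
  define w where "w n = nth (nx (st n))" for n
  have st0: "bt 0 = nu" "Z 0 = K" by (simp_all add: st_def bt_def Z_def)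
  have stS: "bt (Suc n) = length (nx (st n))" "Z (Suc n) = {v. lincomb (bt (Suc n)) (w n) v : vk {..<bt n} ker}" for n
    by (simp_all add: st_def bt_def Z_def w_def)
  have Z: "vs.smod (Z n)" "vk {..<bt n} ker <= Z n" for n
  proof -
    show "vs.smod (Z n)"
      by (cases n) (simp_all add: st0 stS M.lo smod_lin_vimage[OF lincomb_add lincomb_sc] vk_smod ker_smod)
    show "vk {..<bt n} ker <= Z n"
    proof (cases n)
      case (Suc k)
      have "lincomb (bt n) (w k) v : vk {..<bt k} ker" if "v : vk {..<bt n} ker" for v
        using that ideal_mult2[OF ker_smod] unfolding lincomb_def
        by (intro vs_sum vk_smod ker_smod) (auto simp: vk_def)
      thus ?thesis using Suc by (auto simp: stS)
    qed (simp add: st0 K)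
  qed
  have nx: "set (nx (st n)) <= Z n" "Z n <= vk {..<bt n} ker + vs.gspan (nx (st n))" for n
  proof -
    have "vs.rno (vk {..<bt n} ker) (Z n)"
      by (rule vs.rno_mono[OF rno_vec[OF finite_lessThan[of "bt n"] rno ker_smod] _ subset_UNIV]) (simp add: vk_def)
    then obtain m where "vs.gen m (vk {..<bt n} ker) (Z n)"
      using vs.rno_gen[OF _ vk_smod[OF ker_smod] Z] by blast
    hence "EX gs. set gs <= snd (st n) & snd (st n) <= vk {..<fst (st n)} ker + vs.gspan gs"
      unfolding vs.gen_def bt_def Z_def by blast
    from someI_ex[OF this] show "set (nx (st n)) <= Z n" "Z n <= vk {..<bt n} ker + vs.gspan (nx (st n))"
      unfolding nx_def[symmetric] bt_def Z_def by auto
  qed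
  have img: "frp (bt n) ` Z n = range (%v. frp (bt n) (lincomb (bt (Suc n)) (w n) v))" for n
  proof (intro subset_antisym subsetI)
    interpret F: pmod R h "free_module R (bt n)" "frp (bt n)" "vk {..<bt n} ker" UNIV by (rule free_pmod)
    fix x assume "x : frp (bt n) ` Z n"
    then obtain z where z: "x = frp (bt n) z" "z : Z n" by blast
    hence "z : vk {..<bt n} ker + vs.gspan (nx (st n))" using nx(2) by blast
    then obtain a b where ab: "z = a + b" "a : vk {..<bt n} ker" "b : vs.gspan (nx (st n))" by (rule plusE)
    then obtain v where v: "b = lincomb (bt (Suc n)) (w n) v" unfolding gspan_lincomb w_def[symmetric] stS(1)[symmetric] by blast
    have "x = frp (bt n) b" unfolding z(1) using F.eq[of z b] ab(1,2) by simp
    thus "x : range (%v. frp (bt n) (lincomb (bt (Suc n)) (w n) v))" unfolding v by blast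
  next
    fix x assume "x : range (%v. frp (bt n) (lincomb (bt (Suc n)) (w n) v))"
    moreover have "lincomb (bt (Suc n)) (w n) v : Z n" for v
      by (rule lincomb_mem[OF Z(1)]) (simp add: stS w_def subsetD[OF nx(1)])
    ultimately show "x : frp (bt n) ` Z n" by blast
  qed
  define d where "d n = pmod.hom_of R h (frp (bt n)) (bt (Suc n)) (w n)" for n
  have d: "d n : mod_hom R (free_module R (bt (Suc n))) (free_module R (bt n))"
    "d n (frp (bt (Suc n)) v) = frp (bt n) (lincomb (bt (Suc n)) (w n) v)" for n v
    unfolding d_def by (rule pmod.hom_of_mem[OF free_pmod] pmod.hom_of_frp[OF free_pmod]; simp)+
  have im_d: "d n ` carrier (free_module R (bt (Suc n))) = frp (bt n) ` Z n" for n
    unfolding img free_carrier by (simp add: image_image d(2))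
  define ep where "ep = M.hom_of nu unit_vec"
  have ep: "ep : mod_hom R (free_module R nu) M" "ep (frp nu v) = pr v" for v
  proof -
    show "ep : mod_hom R (free_module R nu) M" unfolding ep_def by (rule M.hom_of_mem) simp
    have "v - lincomb nu unit_vec v : vk {..<nu} ker"
      using rs.smod_0[OF ker_smod] by (simp add: vk_def lincomb_unit_vec)
    thus "ep (frp nu v) = pr v"
      unfolding ep_def using K M.eq[of v "lincomb nu unit_vec v"] by (subst M.hom_of_frp) auto
  qed
  have "free_resolution R M bt d ep"
    unfolding free_resolution_def
  proof (intro conjI allI)
    show "ep : mod_hom R (free_module R (bt 0)) M" unfolding st0 by (rule ep)
    show "ep ` carrier (free_module R (bt 0)) = carrier M" unfolding st0 free_carrier M.car by (simp add: image_image ep)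
    have "pr v = \<zero>\<^bsub>M\<^esub> \<longleftrightarrow> v : K" for v using M.eq[of v 0] by (simp add: M.null)
    hence "{v. ep (frp nu v) = \<zero>\<^bsub>M\<^esub>} = Z 0" by (simp add: ep st0)
    thus "d 0 ` carrier (free_module R (bt 1)) = a_kernel (free_module R (bt 0)) M ep"
      using im_d[of 0] M.hom_kernel[OF ep(1)] by (simp add: st0)
    show "d n : mod_hom R (free_module R (bt (Suc n))) (free_module R (bt n))" for n by (rule d)
    show "d (Suc n) ` carrier (free_module R (bt (Suc (Suc n)))) = a_kernel (free_module R (bt (Suc n))) (free_module R (bt n)) (d n)" for n
    proof -
      interpret F: pmod R h "free_module R (bt n)" "frp (bt n)" "vk {..<bt n} ker" UNIV by (rule free_pmod)
      have "d n (frp (bt (Suc n)) v) = \<zero>\<^bsub>free_module R (bt n)\<^esub> \<longleftrightarrow> v : Z (Suc n)" for v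
        unfolding d(2) F.null F.eq[OF UNIV_I UNIV_I] by (simp add: stS)
      thus ?thesis unfolding im_d F.hom_kernel[OF d(1)] by simp
    qed
  qed
  thus ?thesis by blast
qed

definition resB :: "(nat => nat) => nat => nat list set"
  where "resB bt n = (case n of 0 => {} | Suc k => basis (bt k))"

lemma resB_simps [simp]: "resB bt 0 = {}" "resB bt (Suc n) = basis (bt n)"
  by (simp_all add: resB_def)

lemma finite_basis: "finite (basis m)" by (simp add: basis_def)

lemma finite_resB: "finite (resB bt n)" by (cases n) (simp_all add: finite_basis)

lemma sum_basis: "(SUM p:basis m. f p) = (\<Sum>i<m. f [i])"
  unfolding basis_def by (subst sum.reindex) (auto simp: inj_on_def)

locale presented_resolution = presentation R h for R :: "('x, 'm) ring_scheme" (structure) and h :: "'r::comm_ring_1 => 'x" +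
  fixes M :: "('x, 'b, 's) module_scheme" and bt d ep
  assumes res: "free_resolution R M bt d ep"
begin

definition mat :: "nat => nat => nat => 'r"
  where "mat n j i = sec (d n (frp (bt (Suc n)) (unit_vec j)) i)"

text \<open>\<open>mat n j\<close> is the image of the \<open>j\<close>-th basis vector, so rows and
  columns are exchanged here. The numbering is shifted by one, and \<open>dd 0\<close> has no rows
  since \<open>resB bt 0\<close> is empty.\<close>

definition dd :: "nat => nat list => nat list => 'r"
  where "dd n p q = (case n of 0 => 0 | Suc k => mat k (hd q) (hd p))"

abbreviation "FM n \<equiv> free_module R (bt n)"
abbreviation "VK n \<equiv> vk {..<bt n} ker"
abbreviation "frb n \<equiv> frp (bt n)"
abbreviation "mlin n \<equiv> lincomb (bt (Suc n)) (mat n)"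

lemma d_hom: "d n : mod_hom R (FM (Suc n)) (FM n)"
  using res by (simp add: free_resolution_def)

lemma d_frp: "d n (frb (Suc n) v) = frb n (mlin n v)"
proof -
  interpret F: pmod R h "FM n" "frb n" "VK n" UNIV by (rule free_pmod)
  show ?thesis
  proof (rule F.hom_expand[OF d_hom])
    fix j
    have "d n (frb (Suc n) (unit_vec j)) : carrier (FM n)" by (rule F.hom_carrier[OF d_hom])
    then obtain u where u: "d n (frb (Suc n) (unit_vec j)) = frb n u" unfolding free_carrier by blast
    hence "frb n u i = h (mat n j i)" if "i < bt n" for i using that by (simp add: mat_def frp_def)
    thus "d n (frb (Suc n) (unit_vec j)) = frb n (mat n j)"
      unfolding u frp_eq by (simp add: frp_def)
  qed simp
qed

lemma d_zero: "d n (frb (Suc n) v) = \<zero>\<^bsub>FM n\<^esub> \<longleftrightarrow> mlin n v : VK n"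
proof -
  interpret F: pmod R h "FM n" "frb n" "VK n" UNIV by (rule free_pmod)
  show ?thesis unfolding d_frp F.null F.eq[OF UNIV_I UNIV_I] by simp
qed

lemma d_exact: "mlin n v : VK n \<longleftrightarrow>
    (EX c. v - mlin (Suc n) c : VK (Suc n))"
proof -
  interpret F: pmod R h "FM n" "frb n" "VK n" UNIV by (rule free_pmod)
  interpret G: pmod R h "FM (Suc n)" "frb (Suc n)" "VK (Suc n)" UNIV by (rule free_pmod)
  have "d (Suc n) ` carrier (FM (Suc (Suc n))) = a_kernel (FM (Suc n)) (FM n) (d n)"
    using res by (simp add: free_resolution_def)
  hence e: "range (%c. frb (Suc n) (mlin (Suc n) c))
      = frb (Suc n) ` {v. mlin n v : VK n}"
    unfolding free_carrier F.hom_kernel[OF d_hom] d_zero by (simp add: image_image d_frp)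
  have "mlin n v : VK n \<longleftrightarrow>
      frb (Suc n) v : frb (Suc n) ` {v. mlin n v : VK n}"
    unfolding d_zero[symmetric]
  proof
    assume "frb (Suc n) v : frb (Suc n) ` {v. d n (frb (Suc n) v) = \<zero>\<^bsub>FM n\<^esub>}"
    then obtain z where z: "frb (Suc n) v = frb (Suc n) z" "d n (frb (Suc n) z) = \<zero>\<^bsub>FM n\<^esub>"
      by blast
    show "d n (frb (Suc n) v) = \<zero>\<^bsub>FM n\<^esub>" unfolding z(1) by (rule z(2))
  qed simp
  thus ?thesis unfolding e[symmetric] by (auto simp: G.eq image_iff)
qed

lemma lapp_dd: "lapp (basis (bt (Suc n))) (dd (Suc n)) a [i] = mlin n (%j. a [j]) i"
  by (simp add: lapp_def sum_basis dd_def lincomb_def sum_fun mult.commute)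

lemma dd_exact: "exact ker 1 (resB bt) dd"
  unfolding exact_def
proof (intro allI impI)
  fix n and a :: "nat list => 'r"
  assume "1 <= n" and a: "ALL i:resB bt n. lapp (resB bt (Suc n)) (dd n) a i : ker"
  then obtain k where n: "n = Suc k" by (cases n) auto
  have "mlin k (%j. a [j]) : VK k"
    using a unfolding n by (auto simp: basis_def[of "bt k"] lapp_dd vk_def)
  then obtain c where "(%j. a [j]) - mlin (Suc k) c : VK (Suc k)"
    unfolding d_exact by blast
  thus "EX c. ALL j:resB bt (Suc n). a j - lapp (resB bt (Suc (Suc n))) (dd (Suc n)) c j : ker"
    unfolding n by (intro exI[of _ "%p. c (hd p)"]) (auto simp: basis_def[of "bt (Suc k)"] lapp_dd vk_def)
qed

lemma dd_square: "sqz ker (resB bt) dd n"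
proof (cases n)
  case (Suc k)
  have "mm (basis (bt (Suc k))) (dd (Suc k)) (dd (Suc (Suc k))) [i] [j] : ker" if "i < bt k" "j < bt (Suc (Suc k))" for i j
  proof -
    have "mlin k (mat (Suc k) j) : VK k"
      unfolding d_exact
    proof (rule exI[of _ "unit_vec j"])
      show "mat (Suc k) j - mlin (Suc k) (unit_vec j) : VK (Suc k)"
        using lincomb_unit[OF that(2), of "mat (Suc k)"] vs.smod_0[OF vk_smod[OF ker_smod]] by simp
    qed
    thus ?thesis using that(1) by (simp add: vk_def mm_def sum_basis dd_def lincomb_def sum_fun mult.commute)
  qed
  thus ?thesis by (auto simp: Suc meq_def basis_def[of "bt k"] basis_def[of "bt (Suc (Suc k))"])
qed (simp add: meq_def)

text \<open>Under the presentation of \<open>Hom\<close>, composition with \<open>d k\<close>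
  becomes \<open>capp\<close> with \<open>dd (Suc k)\<close>; cocycles and coboundaries then match
  those of the matrix complex.\<close>

lemma cohomology_pmod:
  assumes "pmod R h N pr K UNIV" and ker: "vs.killed ker K UNIV"
  shows "EX rh. pmod R h (dual_cohomology R bt d N n) rh (loC (resB bt) dd K n) (hiC (resB bt) dd K n)"
proof -
  interpret N: pmod R h N pr K UNIV by fact
  let ?lo = "loC (resB bt) dd K n" and ?hi = "hiC (resB bt) dd K n"
  let ?H = "%n. Hom_module R (FM n) N"
  note hp = N.hmap_pmod[OF refl]
  interpret H: pmod R h "?H n" "N.hmap (bt n)" "coch (basis (bt n)) K" UNIV by (rule hp)
  interpret H': pmod R h "?H (Suc n)" "N.hmap (bt (Suc n))" "coch (basis (bt (Suc n))) K" UNIV by (rule hp)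
  have hf: "N.hmap m v (frp m u) = pr (lincomb m (%i. sl [i] v) u)" for m v u
    unfolding N.hmap_def by (rule N.hom_of_frp) simp
  have cmp: "compose (carrier (FM (Suc k))) (N.hmap (bt k) v) (d k)
      = N.hmap (bt (Suc k)) (capp (basis (bt k)) (dd (Suc k)) v)" for k v
  proof (rule extensionalityI[of _ "carrier (FM (Suc k))"])
    show "N.hmap (bt (Suc k)) (capp (basis (bt k)) (dd (Suc k)) v) : extensional (carrier (FM (Suc k)))"
      by (simp add: N.hmap_def N.hom_of_def)
    fix x assume "x : carrier (FM (Suc k))"
    then obtain c where c: "x = frb (Suc k) c" unfolding free_carrier by blast
    have "lincomb (bt k) (%i. sl [i] v) (mlin k c)
        = lincomb (bt (Suc k)) (%j. sl [j] (capp (basis (bt k)) (dd (Suc k)) v)) c"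
    proof (rule ext)
      fix x
      have "lincomb (bt k) (%i. sl [i] v) (mlin k c) x
          = (\<Sum>i<bt k. \<Sum>j<bt (Suc k). c j * (mat k j i * v ([i], x)))"
        by (simp add: lincomb_def sum_fun sl_def sum_distrib_right mult.assoc)
      also have "... = (\<Sum>j<bt (Suc k). \<Sum>i<bt k. c j * (mat k j i * v ([i], x)))" by (rule sum.swap)
      also have "... = lincomb (bt (Suc k)) (%j. sl [j] (capp (basis (bt k)) (dd (Suc k)) v)) c x"
        by (simp add: lincomb_def sum_fun sl_def capp_def sum_basis dd_def sum_distrib_left)
      finally show "lincomb (bt k) (%i. sl [i] v) (mlin k c) x
        = lincomb (bt (Suc k)) (%j. sl [j] (capp (basis (bt k)) (dd (Suc k)) v)) c x" .
    qed
    thus "compose (carrier (FM (Suc k))) (N.hmap (bt k) v) (d k) x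
        = N.hmap (bt (Suc k)) (capp (basis (bt k)) (dd (Suc k)) v) x"
      unfolding c hf by (simp add: compose_def free_carrier d_frp hf)
  qed (simp add: compose_def)
  have cocyc: "dual_cocycles R bt d N n = N.hmap (bt n) ` ?hi"
  proof -
    have "N.hmap (bt (Suc n)) v = \<zero>\<^bsub>?H (Suc n)\<^esub> \<longleftrightarrow> v : coch (basis (bt (Suc n))) K" for v
      unfolding H'.null H'.eq[OF UNIV_I UNIV_I] by simp
    thus ?thesis
      unfolding dual_cocycles_def a_kernel_def' H.car by (auto simp: cmp hiC_mem)
  qed
  have cobd: "dual_coboundaries R bt d N n = N.hmap (bt n) ` ?lo"
  proof (cases n)
    \<comment> \<open>In degree zero the coboundaries are zero by definition; this agrees with
      \<open>loC\<close> because \<open>resB bt 0\<close> is empty.\<close>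
    case 0
    have "N.hmap (bt n) v = \<zero>\<^bsub>?H n\<^esub> \<longleftrightarrow> v : coch (basis (bt n)) K" for v
      unfolding H.null H.eq[OF UNIV_I UNIV_I] by simp
    moreover have "?lo = coch (basis (bt n)) K" using 0 by (auto simp: loC_mem capp_def simp flip: zero_fun_def)
    ultimately show ?thesis using vs.smod_0[OF H.lo] H.null 0 by (auto intro!: image_eqI[where x = 0])
  next
    case (Suc k)
    have "N.hmap (bt n) ` ?lo = range (%w. N.hmap (bt n) (capp (basis (bt k)) (dd n) w))"
    proof (intro subset_antisym subsetI)
      fix x assume "x : N.hmap (bt n) ` ?lo"
      then obtain v w where "x = N.hmap (bt n) v" "v - capp (basis (bt k)) (dd n) w : coch (basis (bt n)) K"
        by (auto simp: loC_mem Suc)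
      thus "x : range (%w. N.hmap (bt n) (capp (basis (bt k)) (dd n) w))"
        using H.eq[OF UNIV_I UNIV_I, of v "capp (basis (bt k)) (dd n) w"] by blast
    next
      fix x assume "x : range (%w. N.hmap (bt n) (capp (basis (bt k)) (dd n) w))"
      then obtain w where w: "x = N.hmap (bt n) (capp (basis (bt k)) (dd n) w)" by blast
      have "capp (basis (bt k)) (dd n) w : ?lo"
        unfolding loC_mem using vs.smod_0[OF H.lo] by (intro exI[of _ w]) (simp add: Suc)
      thus "x : N.hmap (bt n) ` ?lo" unfolding w by (rule imageI)
    qed
    thus ?thesis
      using pmod.car[OF hp, of "bt k"] by (simp add: Suc cmp image_image)
  qed
  note lo = loC_smod[OF N.lo, of "resB bt" dd n] and hi = hiC_smod[OF N.lo, of "resB bt" dd n]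
  note lohi = loC_hiC[OF N.lo ker dd_square[of n]]
  have loz: "coch (basis (bt n)) K <= ?lo" by (intro subsetI coch_loC) simp
  have "pmod R h ((?H n)\<lparr>carrier := dual_cocycles R bt d N n\<rparr>) (N.hmap (bt n)) (coch (basis (bt n)) K) ?hi"
    by (rule H.pmod_sub[OF hi subset_trans[OF loz lohi] subset_UNIV]) (simp_all add: cocyc)
  from pmod.pmod_quot[OF this lo loz lohi] show ?thesis
    unfolding dual_cohomology_def cobd by blast
qed

end

section \<open>Local rings and completions\<close>

text \<open>A nonunit generates a proper ideal, which Zorn's lemma places in a maximal ideal; by
  uniqueness that ideal is \<open>\<mm>\<close>.\<close>

lemma (in noetherian_local_ring) unit_outside:
  assumes x: "x : carrier R" "x ~: \<mm>"
  shows "EX u:carrier R. u \<otimes> x = \<one>"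
proof (rule ccontr)
  assume n: "~ ?thesis"
  let ?A = "{I. ideal I R & x : I & \<one> ~: I}"
  have "EX M:?A. ALL X:?A. M <= X --> X = M"
  proof (rule subset_Zorn_nonempty)
    have "PIdl x : ?A" using n x cgenideal_ideal cgenideal_self by (auto simp: cgenideal_def)
    thus "?A ~= {}" by blast
    fix C assume C: "C ~= {}" "subset.chain ?A C"
    have "subset.chain {I. ideal I R} C" using C(2) by (auto simp: subset.chain_def)
    hence "\<Union>C : C" by (rule ideal_chain_is_trivial[OF C(1)])
    thus "\<Union>C : ?A" using C(2) by (auto simp: subset.chain_def)
  qed
  then obtain I where I: "ideal I R" "x : I" "\<one> ~: I" "!!X. X : ?A ==> I <= X ==> X = I" by blast
  have "maximalideal I R"
  proof (rule maximalidealI[OF I(1)])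
    show "carrier R ~= I" using I(3) one_closed by auto
    fix J assume J: "ideal J R" "I <= J" "J <= carrier R"
    show "J = I | J = carrier R"
      using I(2,4) J ideal.one_imp_carrier[OF J(1)] by (cases "\<one> : J") auto
  qed
  thus False using maximal_unique I(2) x(2) by blast
qed

section \<open>Local rings and regular sequences through a presentation\<close>

lemma jr_gspan: "jr q f i = q + rs.gspan (map f (rev [0..<i]))"
  by (induction i) (auto simp: ac_simps)

lemma jr_nth: "jr q (nth xs) (length xs) = q + rs.gspan xs"
proof -
  have "set (map (nth xs) (rev [0..<length xs])) = set xs" by (auto simp: in_set_conv_nth)
  hence "rs.gspan (map (nth xs) (rev [0..<length xs])) = rs.gspan xs"
    by (intro subset_antisym rs.gspan_least[OF rs.gspan_smod]) (use rs.gspan_base in blast)+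
  thus ?thesis unfolding jr_gspan by (rule arg_cong)
qed

context presentation
begin

lemma local_units:
  assumes "noetherian_local_ring R \<mm>" "h c ~: \<mm>"
  shows "EX u. u * c - 1 : ker"
proof -
  interpret L: noetherian_local_ring R \<mm> by fact
  obtain u where "u : carrier R" "u \<otimes> h c = \<one>" using L.unit_outside[OF h_closed assms(2)] by blast
  then obtain v where "h (v * c) = h 1" using surjE by (metis h_mult h_one)
  thus ?thesis unfolding h_eq_iff ker_def by blast
qed

lemma local_ideal:
  assumes "noetherian_local_ring R \<mm>"
  shows "rs.smod {x. h x : \<mm>}" "ker <= {x. h x : \<mm>}" "h 1 ~: \<mm>"
proof -
  interpret L: noetherian_local_ring R \<mm> by fact
  show "rs.smod {x. h x : \<mm>}" "ker <= {x. h x : \<mm>}"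
    by (rule smod_vimage[OF L.is_ideal], rule ker_vimage[OF L.is_ideal])
  show "h 1 ~: \<mm>" using L.one_imp_carrier L.I_notcarr by (auto simp: h_one)
qed

lemma local_data:
  assumes L: "noetherian_local_ring R \<mm>" and xs: "{x. h x : \<mm>} = ker + rs.gspan xs"
  shows "local_ring_data ker xs"
proof
  interpret L: noetherian_local_ring R \<mm> by fact
  note mI = local_ideal[OF L]
  show "rs.smod ker" by (rule ker_smod)
  show "rs.rno ker UNIV" by (rule noetherian_rno) unfold_locales
  show "locl ker xs" unfolding locl_def xs[symmetric] using local_units[OF L] by blast
  show "jac ker xs" unfolding jac_def
  proof
    fix c assume "c : rs.gspan xs"
    hence c: "c : {x. h x : \<mm>}" unfolding xs by (rule subsetD[OF rs.upper2[OF ker_smod]])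
    have "1 - c ~: {x. h x : \<mm>}"
      using rs.smod_add[OF mI(1) _ c, of "1 - c"] mI(3) by auto
    thus "EX u. u * (1 - c) - 1 : ker" using local_units[OF L, of "1 - c"] by simp
  qed
  show "1 ~: ker + rs.gspan xs" unfolding xs[symmetric] using mI(3) by simp
qed

lemma quot_eq: "ideal I R ==> I +> h x = I +> h y \<longleftrightarrow> h (x - y) : I"
  unfolding h_diff by (rule quotient_eq_iff_same_a_r_cos[symmetric]) simp_all

lemma quot_presentation:
  assumes "ideal I R"
  shows "presentation (R Quot I) (%x. I +> h x)" "ring_map.ker (R Quot I) (%x. I +> h x) = {x. h x : I}"
proof -
  interpret I: ideal I R by fact
  interpret Q: cring "R Quot I" by (rule I.quotient_is_cring) (rule cring_axioms)
  note hom = ring_hom_mult[OF I.rcos_ring_hom] ring_hom_add[OF I.rcos_ring_hom] ring_hom_one[OF I.rcos_ring_hom]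
    ring_hom_closed[OF I.rcos_ring_hom]
  interpret B: presentation "R Quot I" "%x. I +> h x"
  proof
    show "range (%x. I +> h x) = carrier (R Quot I)"
      using surj by (auto simp: FactRing_def A_RCOSETS_def' simp flip: surj)
  qed (simp_all add: hom h_add h_mult h_one)
  show "presentation (R Quot I) (%x. I +> h x)" by (rule B.presentation_axioms)
  have "I +> h x = \<zero>\<^bsub>R Quot I\<^esub> \<longleftrightarrow> h x : I" for x
    using quot_eq[OF assms, of x 0] a_rcos_zero[OF assms, of "h 0"] I.zero_closed by (simp add: FactRing_def h_zero)
  thus "B.ker = {x. h x : I}" by (simp add: B.ker_def)
qed

text \<open>Links powers in the monoid of ideals to \<open>lpow\<close>: the generators of
  \<open>I\<close> are lifted to the ambient ring, and powers are compared modulo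
  \<open>ker\<close>.\<close>

lemma vimage_ideal_pow:
  assumes I: "ideal I R" and xs: "{x. h x : I} = ker + rs.gspan xs"
  shows "ideal (ideal_pow R I n) R" "{x. h x : ideal_pow R I n} = rs.lpow xs n UNIV + ker"
proof -
  have pow: "ideal_pow R I 0 = carrier R" "ideal_pow R I (Suc k) = ideal_pow R I k \<cdot> I" for k
    by (simp_all add: ideals_set_def)
  have id: "ideal (ideal_pow R I k) R" for k
    by (induction k) (use pow oneideal ideal_prod_is_ideal[OF _ I] in auto)
  thus "ideal (ideal_pow R I n) R" .
  show "{x. h x : ideal_pow R I n} = rs.lpow xs n UNIV + ker"
  proof (induction n)
    case 0
    show ?case using rs.upper1[OF ker_smod, of UNIV] unfolding pow(1) by auto
  next
    case (Suc n)
    note sl = rs.lpow_smod[OF rs.smod_UNIV]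
    have sm: "rs.smod (rs.lpow xs (Suc n) UNIV + ker)" by (intro rs.smod_plus sl ker_smod)
    have low: "ker <= rs.lpow xs (Suc n) UNIV + ker" by (rule rs.upper2[OF sl])
    have lp: "rs.lpow xs (Suc n) UNIV <= rs.lpow xs (Suc n) UNIV + ker" by (rule rs.upper1[OF ker_smod])
    have idI: "ideal (h ` (rs.lpow xs (Suc n) UNIV + ker)) R" by (rule ideal_image[OF sm])
    have prod: "a * b : rs.lpow xs (Suc n) UNIV + ker" if a: "h a : ideal_pow R I n" and b: "h b : I" for a b
    proof -
      have "a : rs.lpow xs n UNIV + ker" using a unfolding Suc.IH[symmetric] by simp
      then obtain a1 a2 where a12: "a = a1 + a2" "a1 : rs.lpow xs n UNIV" "a2 : ker" by (rule plusE)
      have "b : ker + rs.gspan xs" using b unfolding xs[symmetric] by simp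
      then obtain b1 b2 where b12: "b = b1 + b2" "b1 : ker" "b2 : rs.gspan xs" by (rule plusE)
      have "rs.gspan xs <= {b. a1 * b : rs.lpow xs (Suc n) UNIV}"
      proof (rule rs.gspan_least)
        show "rs.smod {b. a1 * b : rs.lpow xs (Suc n) UNIV}"
          by (rule rs.smodI, rule sgpI)
            (simp_all add: rs.smod_0[OF sl] right_diff_distrib rs.smod_diff[OF sl] mult.left_commute[of a1] rs.smod_sc[OF sl])
        show "set xs <= {b. a1 * b : rs.lpow xs (Suc n) UNIV}"
          using rs.lmul_im[OF sl _ a12(2)] by (auto simp: rs.lpow_Suc mult.commute)
      qed
      hence "a1 * b2 : rs.lpow xs (Suc n) UNIV + ker" using b12(3) lp by blast
      moreover have "a1 * b1 + a2 * b : rs.lpow xs (Suc n) UNIV + ker"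
        by (intro subsetD[OF low] rs.smod_add[OF ker_smod] ideal_mult[OF ker_smod] ideal_mult2[OF ker_smod] b12 a12)
      ultimately have "a1 * b2 + (a1 * b1 + a2 * b) : rs.lpow xs (Suc n) UNIV + ker" by (rule rs.smod_add[OF sm])
      moreover have "a * b = a1 * b2 + (a1 * b1 + a2 * b)" by (simp add: a12(1) b12(1) algebra_simps)
      ultimately show ?thesis by simp
    qed
    have "ideal_pow R I n <#> I <= h ` (rs.lpow xs (Suc n) UNIV + ker)"
    proof
      fix y assume "y : ideal_pow R I n <#> I"
      then obtain u v where uv: "y = u \<otimes> v" "u : ideal_pow R I n" "v : I" by (auto simp: set_mult_def)
      obtain a b where ab: "u = h a" "v = h b"
        using surjE[OF ideal.Icarr[OF id uv(2)]] surjE[OF ideal.Icarr[OF I uv(3)]] by metis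
      show "y : h ` (rs.lpow xs (Suc n) UNIV + ker)"
        unfolding uv(1) ab h_mult[symmetric] by (intro imageI prod) (use uv(2,3) ab in auto)
    qed
    hence "ideal_pow R I (Suc n) <= h ` (rs.lpow xs (Suc n) UNIV + ker)"
      unfolding pow(2) ideal_prod_eq_genideal[OF id I] by (rule genideal_minimal[OF idI])
    hence "{x. h x : ideal_pow R I (Suc n)} <= {x. h x : h ` (rs.lpow xs (Suc n) UNIV + ker)}"
      by (intro Collect_mono impI) (rule subsetD)
    moreover have "rs.lpow xs (Suc n) UNIV <= {x. h x : ideal_pow R I (Suc n)}"
      unfolding rs.lpow_Suc
    proof (rule rs.lmul_least[OF rs.smod_sgp[OF smod_vimage[OF id]]])
      fix a x assume a: "a : set xs" and x: "x : rs.lpow xs n UNIV"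
      have "x : rs.lpow xs n UNIV + ker" by (rule subsetD[OF rs.upper1[OF ker_smod] x])
      hence "h x : ideal_pow R I n" unfolding Suc.IH[symmetric] by simp
      moreover have "a : ker + rs.gspan xs" by (rule subsetD[OF rs.upper2[OF ker_smod] rs.gspan_base[OF a]])
      hence "h a : I" unfolding xs[symmetric] by simp
      ultimately have "h x \<otimes> h a : ideal_pow R I (Suc n)" unfolding pow(2) by (rule ideal_prod.prod)
      thus "a * x : {x. h x : ideal_pow R I (Suc n)}" by (simp add: h_mult[symmetric] mult.commute)
    qed
    hence "rs.lpow xs (Suc n) UNIV + ker <= {x. h x : ideal_pow R I (Suc n)}"
      by (rule plus_least[OF rs.smod_sgp[OF smod_vimage[OF id]] _ ker_vimage[OF id]])
    ultimately show ?case unfolding image_vimage[OF sm low] by (intro subset_antisym)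
  qed
qed

lemma regular_sequence_reg:
  assumes "regular_sequence R fs" and f: "!!s. s < length fs ==> h (f s) = fs ! s"
  shows "reg ker f (length fs)" "{x. h x : Idl (set fs)} = jr ker f (length fs)"
proof -
  have fsc: "set fs <= carrier R" using assms(1) by (simp add: regular_sequence_def)
  have J: "{x. h x : Idl (set (take i fs))} = jr ker f i" if "i <= length fs" for i
  proof -
    have e: "set (take i fs) = h ` set (map f (rev [0..<i]))"
    proof -
      have "set (take i fs) = nth fs ` {0..<i}" by (rule nth_image[symmetric, OF that])
      also have "... = (%s. h (f s)) ` {0..<i}" by (rule image_cong) (use that in "simp_all add: f")
      finally show ?thesis by (simp add: image_image)
    qed
    show ?thesis unfolding jr_gspan e by (rule vimage_Idl)
  qed
  show "{x. h x : Idl (set fs)} = jr ker f (length fs)" using J[OF order_refl] unfolding take_all[OF order_refl] .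
  show "reg ker f (length fs)"
    unfolding reg_def
  proof (intro allI impI)
    fix s y assume s: "s < length fs" and fy: "f s * y : jr ker f s"
    let ?I = "Idl (set (take s fs))"
    have I: "ideal ?I R" by (rule genideal_ideal[OF subset_trans[OF set_take_subset fsc]])
    interpret B: presentation "R Quot ?I" "%x. ?I +> h x" by (rule quot_presentation[OF I])
    have k: "B.ker = jr ker f s" unfolding quot_presentation(2)[OF I] by (rule J) (use s in simp)
    have "nonzerodivisor (R Quot ?I) (?I +> h (f s))" using assms(1) s f[OF s] by (simp add: regular_sequence_def)
    moreover have "(?I +> h (f s)) \<otimes>\<^bsub>R Quot ?I\<^esub> (?I +> h y) = \<zero>\<^bsub>R Quot ?I\<^esub>"
      unfolding B.h_mult[symmetric] using fy unfolding k[symmetric] B.ker_def by simp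
    ultimately have "?I +> h y = \<zero>\<^bsub>R Quot ?I\<^esub>" unfolding nonzerodivisor_def by simp
    thus "y : jr ker f s" unfolding k[symmetric] B.ker_def by simp
  qed
qed

text \<open>The minimal number of generators of the maximal ideal is the Krull dimension, so some
  chain of primes is as long as a minimal list of generators. This list is then a regular sequence,
  which gives \<open>fpd\<close>.\<close>

lemma regular_presentation:
  assumes "regular_local_ring R \<nn>"
  shows "EX xs. local_ring_data ker xs & {x. h x : \<nn>} = ker + rs.gspan xs & fpd ker"
proof -
  interpret L: regular_local_ring R \<nn> by fact
  have L: "noetherian_local_ring R \<nn>" by unfold_locales
  \<comment> \<open>The maximal ideal is presented as a module of functions of which only the value
    at \<open>0\<close> matters.\<close>
  let ?E = "(self_module R)\<lparr>carrier := \<nn>\<rparr>" and ?hi = "{v :: nat => 'r. h (v 0) : \<nn>}" and ?lo = "vk {0 :: nat} ker"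
  have lin: "vs.smod {v :: nat => 'r. v 0 : H}" if "rs.smod H" for H
    by (rule vs.smodI, rule sgpI) (simp_all add: rs.smod_0[OF that] rs.smod_diff[OF that] rs.smod_sc[OF that])
  interpret E: pmod R h ?E "%v :: nat => 'r. h (v 0)" ?lo ?hi
  proof
    show "vs.smod ?lo" by (rule vk_smod[OF ker_smod])
    show "vs.smod ?hi" using lin[OF local_ideal(1)[OF L]] by simp
    show "carrier ?E = (%v. h (v 0)) ` ?hi"
    proof (intro subset_antisym subsetI)
      fix y assume "y : carrier ?E"
      hence y: "y : \<nn>" by (simp add: self_module_def)
      obtain x where "y = h x" by (rule surjE[OF L.Icarr[OF y]])
      thus "y : (%v. h (v 0)) ` ?hi" using y by (intro image_eqI[of _ _ "%_. x"]) auto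
    qed (auto simp: self_module_def)
    show "?lo <= ?hi" using L.zero_closed by (auto simp: vk_def ker_def)
    show "h (u 0) = h (v 0) \<longleftrightarrow> u - v : ?lo" for u v :: "nat => 'r"
      by (simp add: vk_def ker_def h_eq_iff)
  qed (simp_all add: self_module_def h_add h_mult h_zero)
  obtain S where S: "S <= carrier R" "finite S" "\<nn> = Idl S" using L.finetely_gen[OF L.is_ideal] by blast
  obtain zs where zs: "{x. h x : \<nn>} = ker + rs.gspan zs" "length zs = card S" "h ` set zs = S"
    by (rule fin_gen_vimage[OF L.is_ideal S])
  have gen: "vs.gen (length ys) ?lo ?hi" if ys: "{x. h x : \<nn>} = ker + rs.gspan ys" for ys
  proof -
    let ?gs = "map (%y (_ :: nat). y) ys"
    note sg = vs.gspan_smod[of ?gs]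
    have "rs.gspan ys <= {g. (%_. g) : vs.gspan ?gs}"
    proof (rule rs.gspan_least)
      show "rs.smod {g. (%_. g) : vs.gspan ?gs}"
        by (rule rs.smodI, rule sgpI)
          (use vs.smod_0[OF sg] vs.smod_diff[OF sg] vs.smod_sc[OF sg] in "simp_all add: zero_fun_def fun_diff_def")
    qed (auto intro!: vs.gspan_base)
    note sub = this
    have "?hi <= ?lo + vs.gspan ?gs"
    proof
      fix v assume "v : ?hi"
      hence "v 0 : ker + rs.gspan ys" unfolding ys[symmetric] by simp
      then obtain a b where ab: "v 0 = a + b" "a : ker" "b : rs.gspan ys" by (rule plusE)
      have "(v - (%_. b)) + (%_. b) : ?lo + vs.gspan ?gs"
        by (rule plusI) (use ab sub in "auto simp: vk_def")
      thus "v : ?lo + vs.gspan ?gs" by simp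
    qed
    moreover have "set ys <= {x. h x : \<nn>}" unfolding ys
      by (rule subset_trans[OF _ rs.upper2[OF ker_smod]]) (use rs.gspan_base in blast)
    hence "set ?gs <= ?hi" by auto
    ultimately show ?thesis unfolding vs.gen_def by (intro exI[of _ ?gs]) simp
  qed
  have gens: "EX ys. length ys = n & {x. h x : \<nn>} = ker + rs.gspan ys" if gen: "vs.gen n ?lo ?hi" for n
  proof -
    obtain gs where gs: "length gs = n" "set gs <= ?hi" "?hi <= ?lo + vs.gspan gs" using gen by (auto simp: vs.gen_def)
    let ?ys = "map (%v. v 0) gs"
    have sub: "vs.gspan gs <= {b. b 0 : rs.gspan ?ys}"
      by (rule vs.gspan_least[OF lin[OF rs.gspan_smod]]) (auto intro!: rs.gspan_base)
    have "{x. h x : \<nn>} <= ker + rs.gspan ?ys"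
    proof
      fix x assume "x : {x. h x : \<nn>}"
      hence "(%_. x) : ?lo + vs.gspan gs" using gs(3) by auto
      then obtain a b where ab: "(%_. x) = a + b" "a : ?lo" "b : vs.gspan gs" by (rule plusE)
      have "a 0 + b 0 : ker + rs.gspan ?ys" by (rule plusI) (use ab sub in "auto simp: vk_def")
      moreover have "x = a 0 + b 0" using fun_cong[OF ab(1), of 0] by simp
      ultimately show "x : ker + rs.gspan ?ys" by simp
    qed
    moreover have "ker + rs.gspan ?ys <= {x. h x : \<nn>}"
      by (rule plus_least[OF rs.smod_sgp[OF local_ideal(1)[OF L]] local_ideal(2)[OF L] rs.gspan_least[OF local_ideal(1)[OF L]]])
        (use gs(2) in auto)
    ultimately show ?thesis using gs(1) by (intro exI[of _ ?ys] conjI subset_antisym) simp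
  qed
  obtain xs where xs: "length xs = min_gens R ?E" "{x. h x : \<nn>} = ker + rs.gspan xs"
    using gens[OF E.min_gens_gen(1)[OF gen[OF zs(1)]]] by blast
  interpret D: local_ring_data ker xs by (rule local_data[OF L xs(2)])
  have "EX P. (ALL i<=length xs. primeideal (P i) R) & (ALL i<length xs. P i \<subset> P (Suc i))"
  proof (cases "length xs")
    case 0
    show ?thesis using maximalideal_prime[OF L.is_maximalideal] unfolding 0 by (intro exI[of _ "%_. \<nn>"]) simp
  next
    case (Suc k)
    let ?D = "{n. EX P. (ALL i<=n. primeideal (P i) R) & (ALL i<n. P i \<subset> P (Suc i))}"
    \<comment> \<open>The supremum is \<open>k + 1\<close>, so some chain is longer than
      \<open>k\<close>; its beginning has the required length.\<close>
    have "EX n:?D. k < n"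
    proof (rule ccontr)
      assume a: "~ (EX n:?D. k < n)"
      have S1: "Sup (enat ` ?D) <= enat k"
      proof (rule Sup_least)
        fix x assume "x : enat ` ?D"
        then obtain n where "x = enat n" "n : ?D" by (rule imageE)
        with a have "n <= k" by (meson bexI not_less)
        thus "x <= enat k" unfolding `x = enat n` by (rule enat_ord_simps(1)[THEN iffD2])
      qed
      have "Sup (enat ` ?D) = enat (Suc k)" using L.regular unfolding krull_dim_def xs(1)[symmetric] Suc .
      with S1 have "enat (Suc k) <= enat k" by (elim subst)
      thus False by simp
    qed
    then obtain n where n: "n : ?D" "k < n" by (rule bexE)
    from CollectD[OF n(1)] obtain P where P: "(ALL i<=n. primeideal (P i) R) & (ALL i<n. P i \<subset> P (Suc i))" by (rule exE)
    show ?thesis unfolding Suc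
    proof (intro exI[of _ P] conjI allI impI)
      show "primeideal (P i) R" if "i <= Suc k" for i using conjunct1[OF P] n(2) that by simp
      show "P i \<subset> P (Suc i)" if "i < Suc k" for i using conjunct2[OF P, rule_format, of i] n(2) that by linarith
    qed
  qed
  then obtain P where "(ALL i<=length xs. primeideal (P i) R) & (ALL i<length xs. P i \<subset> P (Suc i))" by (rule exE)
  note P = conjunct1[OF this, rule_format] conjunct2[OF this, rule_format]
  have reg: "reg ker (nth xs) (length xs)"
  proof (rule D.regular_of_prime_chain)
    let ?P = "%i. {x. h x : P i}"
    show "prim (?P i)" if "i <= length xs" for i
    proof -
      interpret I: primeideal "P i" R by (rule P(1)[OF that])
      show ?thesis unfolding prim_def
        using smod_vimage[OF I.is_ideal] I.I_notcarr I.one_imp_carrier I.I_prime by (auto simp: h_one h_mult)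
    qed
    show "?P i \<subset> ?P (Suc i)" if i: "i < length xs" for i
    proof -
      interpret I: primeideal "P (Suc i)" R by (rule P(1)) (use i in simp)
      obtain y where y: "y : P (Suc i)" "y ~: P i" using P(2)[OF i] by blast
      obtain x where "y = h x" by (rule surjE[OF I.Icarr[OF y(1)]])
      thus ?thesis using P(2)[OF i] y by blast
    qed
    show "ker <= ?P 0" by (rule ker_vimage[OF primeideal.axioms(1)[OF P(1)]]) simp
  qed
  have "fpd ker"
  proof (rule regular_fpd[OF ker_smod D.rno reg])
    have "EX u. u * c - 1 : {x. h x : \<nn>}" if "c ~: {x. h x : \<nn>}" for c
      using local_units[OF L] local_ideal(2)[OF L] that by blast
    thus "fld (jr ker (nth xs) (length xs))" unfolding jr_nth xs(2)[symmetric] fld_def by blast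
    show "jac ker [xs ! s]" if "s < length xs" for s
    proof -
      have "rs.gspan [xs ! s] <= rs.gspan xs"
        by (rule rs.gspan_least[OF rs.gspan_smod]) (simp add: rs.gspan_base that)
      thus ?thesis using D.jac unfolding jac_def by blast
    qed
  qed
  thus ?thesis using D.local_ring_data_axioms xs(2) by blast
qed

end

subsection \<open>The completion as an extension of the free ring\<close>

primrec monlist :: "'r::comm_ring_1 list => nat => 'r list" where
  "monlist as 0 = [1]"
| "monlist as (Suc n) = concat (map (%a. map ((*) a) (monlist as n)) as)"

lemma lpow_mon: "rs.lpow as n UNIV = rs.gspan (monlist as n)"
proof (induction n)
  case (Suc n)
  have "rs.lmul as (rs.gspan (monlist as n)) <= rs.gspan (monlist as (Suc n))" unfolding monlist.simps by (rule rs.lmul_gspan)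
  moreover have "rs.gspan (monlist as (Suc n)) <= rs.lmul as (rs.gspan (monlist as n))"
  proof (rule rs.gspan_least[OF rs.lmul_smod[OF rs.gspan_smod]], rule subsetI)
    fix x assume "x : set (monlist as (Suc n))"
    then obtain a m where "a : set as" "m : set (monlist as n)" "x = a * m" by auto
    thus "x : rs.lmul as (rs.gspan (monlist as n))" using rs.lmul_im[OF rs.gspan_smod] rs.gspan_base by blast
  qed
  ultimately show ?case unfolding rs.lpow_Suc Suc by (rule subset_antisym)
qed (use rs.smod_sc[OF rs.smod_UNIV] in "force simp: image_iff set_plus_def")

lemma map_mon: "(!!x y. Ph (x * y) = Ph x * Ph y) ==> Ph 1 = 1 ==> map Ph (monlist as n) = monlist (map Ph as) n"
proof (induction n)
  case (Suc n)
  thus ?case by (simp add: Suc.IH[OF Suc.prems, symmetric] map_concat comp_def)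
qed simp

lemma lpow_gspan_repr:
  assumes "z : rs.lpow as k (rs.gspan ms)"
  shows "EX e. (ALL i. e i : rs.lpow as k UNIV) & z = (\<Sum>i<length ms. e i * ms ! i)"
proof -
  define W where "W k = {z. EX e. (ALL i. e i : rs.lpow as k UNIV) & z = (\<Sum>i<length ms. e i * ms ! i)}" for k
  note sm = rs.lpow_smod[OF rs.smod_UNIV]
  have W: "rs.smod (W k)" for k
  proof (rule rs.smodI, rule sgpI)
    show "0 : W k" unfolding W_def using rs.smod_0[OF sm] by (intro CollectI exI[of _ "%_. 0"]) simp
    show "x - y : W k" if "x : W k" "y : W k" for x y
    proof -
      obtain e e' where "ALL i. e i : rs.lpow as k UNIV" "x = (\<Sum>i<length ms. e i * ms ! i)"
        "ALL i. e' i : rs.lpow as k UNIV" "y = (\<Sum>i<length ms. e' i * ms ! i)" using `x : W k` `y : W k` unfolding W_def by blast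
      thus ?thesis unfolding W_def
        by (intro CollectI exI[of _ "%i. e i - e' i"]) (simp add: rs.smod_diff[OF sm] left_diff_distrib sum_subtractf)
    qed
    show "c * x : W k" if "x : W k" for c x
    proof -
      obtain e where "ALL i. e i : rs.lpow as k UNIV" "x = (\<Sum>i<length ms. e i * ms ! i)" using `x : W k` unfolding W_def by blast
      thus ?thesis unfolding W_def
        by (intro CollectI exI[of _ "%i. c * e i"]) (simp add: rs.smod_sc[OF sm] sum_distrib_left mult.assoc)
    qed
  qed
  have "rs.lpow as k (rs.gspan ms) <= W k"
  proof (induction k)
    case 0
    show ?case unfolding rs.lpow_0
    proof (rule rs.gspan_least[OF W], rule subsetI)
      fix x assume "x : set ms"
      then obtain i where "i < length ms" "x = ms ! i" by (metis in_set_conv_nth)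
      thus "x : W 0" unfolding W_def
        by (intro CollectI exI[of _ "unit_vec i"]) (simp add: unit_vec_def if_distrib[of "%c. c * _"] cong: if_cong)
    qed
  next
    case (Suc k)
    show ?case unfolding rs.lpow_Suc
    proof (rule rs.lmul_least[OF rs.smod_sgp[OF W]])
      fix a x assume a: "a : set as" and "x : rs.lpow as k (rs.gspan ms)"
      then obtain e where "ALL i. e i : rs.lpow as k UNIV" "x = (\<Sum>i<length ms. e i * ms ! i)" using Suc unfolding W_def by blast
      thus "a * x : W (Suc k)" unfolding W_def
        by (intro CollectI exI[of _ "%i. a * e i"]) (simp add: rs.lpow_Suc rs.lmul_im[OF sm a] sum_distrib_left mult.assoc)
    qed
  qed
  thus ?thesis using assms unfolding W_def by blast
qed

text \<open>An element of \<open>bb n\<close> is approximated by \<open>Ph (y k)\<close>. Successive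
  differences are combinations of the finitely many monomials of degree \<open>n\<close>, with
  coefficients in higher and higher powers; by completeness the coefficients converge, and their
  limits express the element.\<close>

lemma completion_filtration:
  fixes Ph :: "'r::comm_ring_1 => 'r" and aa J :: "'r set" and as :: "'r list" and bb :: "nat => 'r set"
  assumes Ph: "!!x y. Ph (x + y) = Ph x + Ph y" "!!x y. Ph (x * y) = Ph x * Ph y" "Ph 1 = 1"
    and aa: "!!x. x : aa ==> Ph x : J" and J: "rs.smod J"
    and bb: "!!n. rs.smod (bb n)" "!!n. J <= bb n" "!!m n. m <= n ==> bb n <= bb m" "!!x. (!!n. x : bb n) ==> x : J"
    and embed: "!!x n. Ph x : bb n \<longleftrightarrow> x : rs.lpow as n UNIV + aa" and dense: "!!x n. EX y. x - Ph y : bb n"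
    and complete: "!!s. (!!n. s (Suc n) - s n : rs.lpow as n UNIV + aa) ==> EX c. ALL n. c - Ph (s n) : bb n"
    and zero: "0 : aa"
  shows "bb n = rs.lpow (map Ph as) n UNIV + J"
proof (rule subset_antisym)
  have Ph0: "Ph 0 = 0" using Ph(1)[of 0 0] by simp
  have Phd: "Ph (x - y) = Ph x - Ph y" for x y using Ph(1)[of "x - y" y] by (simp add: algebra_simps)
  have Phs: "Ph (sum f S) = (SUM i:S. Ph (f i))" for f and S :: "nat set"
    by (induction S rule: infinite_finite_induct) (auto simp: Ph(1) Ph0)
  note pow = lpow_mon[of "map Ph as" n, folded map_mon[of Ph, OF Ph(2,3)]]
  have "set (map Ph (monlist as n)) <= bb n"
  proof
    fix x assume "x : set (map Ph (monlist as n))"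
    then obtain m where m: "x = Ph m" "m : set (monlist as n)" by auto
    have "m : rs.lpow as n UNIV + aa"
      by (rule subsetD[OF plus_upper1[OF zero]]) (simp add: lpow_mon rs.gspan_base[OF m(2)])
    thus "x : bb n" unfolding m(1) embed .
  qed
  thus "rs.lpow (map Ph as) n UNIV + J <= bb n"
    unfolding pow by (intro plus_least rs.smod_sgp bb rs.gspan_least)
  show "bb n <= rs.lpow (map Ph as) n UNIV + J"
  proof
    fix x assume x: "x : bb n"
    let ?ms = "monlist as n"
    define y where "y k = (SOME y. x - Ph y : bb (n + k))" for k
    have y: "x - Ph (y k) : bb (n + k)" for k unfolding y_def by (rule someI_ex[OF dense])
    have rep: "EX e. (ALL i. e i : rs.lpow as k UNIV) & z - (\<Sum>i<length ?ms. e i * ?ms ! i) : aa" if "Ph z : bb (n + k)" for z k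
    proof -
      have "z : rs.lpow as (k + n) UNIV + aa" using that unfolding embed by (simp add: add.commute)
      then obtain a b where ab: "z = a + b" "a : rs.lpow as (k + n) UNIV" "b : aa" by (rule plusE)
      have "a : rs.lpow as k (rs.gspan ?ms)" using ab(2) unfolding rs.lpow_add lpow_mon[of as n] .
      from lpow_gspan_repr[OF this] obtain e where "ALL i. e i : rs.lpow as k UNIV" "a = (\<Sum>i<length ?ms. e i * ?ms ! i)" by blast
      thus ?thesis using ab(1,3) by (intro exI[of _ e]) simp
    qed
    have "Ph (y 0) : bb (n + 0)" using rs.smod_diff[OF bb(1) x y[of 0, simplified]] by simp
    from rep[OF this] obtain e0 where e0: "y 0 - (\<Sum>i<length ?ms. e0 i * ?ms ! i) : aa" by blast
    have "EX e. (ALL i. e i : rs.lpow as k UNIV) & (y (Suc k) - y k) - (\<Sum>i<length ?ms. e i * ?ms ! i) : aa" for k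
    proof (rule rep)
      have "x - Ph (y (Suc k)) : bb (n + k)" by (rule subsetD[OF bb(3) y]) simp
      from rs.smod_diff[OF bb(1) y this] show "Ph (y (Suc k) - y k) : bb (n + k)" by (simp add: Phd)
    qed
    then obtain e where e: "!!k i. e k i : rs.lpow as k UNIV"
      "!!k. (y (Suc k) - y k) - (\<Sum>i<length ?ms. e k i * ?ms ! i) : aa" by metis
    \<comment> \<open>Partial sums of the coefficients; the increment \<open>e k i\<close> lies in
      the \<open>k\<close>-th power, so each sequence has a limit.\<close>
    define s where "s k i = e0 i + (\<Sum>l<k. e l i)" for k i
    have ys: "Ph (y k) - (\<Sum>i<length ?ms. Ph (s k i) * Ph (?ms ! i)) : J" for k
    proof (induction k)
      case 0
      show ?case using aa[OF e0] by (simp add: s_def Phd Phs Ph(2))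
    next
      case (Suc k)
      from rs.smod_add[OF J Suc aa[OF e(2)[of k]]] show ?case
        by (simp add: s_def Phd Phs Ph algebra_simps sum.distrib)
    qed
    have "s (Suc k) i - s k i : rs.lpow as k UNIV + aa" for k i
      by (rule subsetD[OF plus_upper1[OF zero]]) (simp add: s_def e(1))
    hence "EX c. ALL k. c - Ph (s k i) : bb k" for i by (rule complete[of "%k. s k i"])
    then obtain c where c: "!!i k. c i - Ph (s k i) : bb k" by metis
    let ?S = "\<Sum>i<length ?ms. c i * Ph (?ms ! i)"
    have "x - ?S : J"
    proof (rule bb(4))
      fix k
      have 1: "(\<Sum>i<length ?ms. (c i - Ph (s k i)) * Ph (?ms ! i)) : bb k"
        by (intro ideal_sum[OF bb(1)] ideal_mult2[OF bb(1)] c)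
      have 2: "x - Ph (y k) : bb k" by (rule subsetD[OF bb(3) y]) simp
      have "(x - Ph (y k)) + (Ph (y k) - (\<Sum>i<length ?ms. Ph (s k i) * Ph (?ms ! i)))
          - (\<Sum>i<length ?ms. (c i - Ph (s k i)) * Ph (?ms ! i)) : bb k"
        by (rule rs.smod_diff[OF bb(1) rs.smod_add[OF bb(1) 2 subsetD[OF bb(2) ys]] 1])
      thus "x - ?S : bb k" by (simp add: left_diff_distrib sum_subtractf)
    qed
    moreover have "?S : rs.lpow (map Ph as) n UNIV"
      unfolding pow
      by (rule ideal_sum[OF rs.gspan_smod], rule ideal_mult[OF rs.gspan_smod], rule rs.gspan_base) simp
    ultimately have "?S + (x - ?S) : rs.lpow (map Ph as) n UNIV + J" by (intro plusI)
    thus "x : rs.lpow (map Ph as) n UNIV + J" by simp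
  qed
qed

section \<open>The completion as a quotient of the free ring\<close>

lemma evl_map:
  assumes "cring (R :: 'a ring)" "range rh <= carrier R"
  shows "ring_map R (evl R rh :: ('a, 'q) fring => 'a)" "evl R rh (fvar v) = rh v"
proof -
  interpret cring R by fact
  show "ring_map R (evl R rh :: ('a, 'q) fring => 'a)"
  proof
    fix x y :: "('a, 'q) fring"
    show "evl R rh x : carrier R" using assms by transfer (simp add: ev_closed)
    show "evl R rh (x + y) = evl R rh x \<oplus>\<^bsub>R\<^esub> evl R rh y" using assms by transfer simp
    show "evl R rh (x * y) = evl R rh x \<otimes>\<^bsub>R\<^esub> evl R rh y" using assms by transfer simp
    show "evl R rh (1 :: ('a, 'q) fring) = \<one>\<^bsub>R\<^esub>" using assms by transfer simp
  qed
  show "evl R rh (fvar v) = rh v" using assms by transfer simp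
qed

lemma evr_map:
  assumes "cring (R :: 'q ring)" "range rh <= carrier R"
  shows "ring_map R (evr R rh :: ('a, 'q) fring => 'q)" "evr R rh (fvar v) = rh v"
proof -
  interpret cring R by fact
  show "ring_map R (evr R rh :: ('a, 'q) fring => 'q)"
  proof
    fix x y :: "('a, 'q) fring"
    show "evr R rh x : carrier R" using assms by transfer (simp add: ev_closed)
    show "evr R rh (x + y) = evr R rh x \<oplus>\<^bsub>R\<^esub> evr R rh y" using assms by transfer simp
    show "evr R rh (x * y) = evr R rh x \<otimes>\<^bsub>R\<^esub> evr R rh y" using assms by transfer simp
    show "evr R rh (1 :: ('a, 'q) fring) = \<one>\<^bsub>R\<^esub>" using assms by transfer simp
  qed
  show "evr R rh (fvar v) = rh v" using assms by transfer simp
qed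

lemma ring_map_unique:
  assumes "ring_map S f" "ring_map S g" "!!v. f (fvar v) = g (fvar v)"
  shows "f x = g (x :: ('a, 'q) fring)"
proof -
  interpret f: ring_map S f by fact
  interpret g: ring_map S g by fact
  show ?thesis
    by (induction x rule: fring_induct)
      (simp_all add: assms(3) f.h_add g.h_add f.h_mult g.h_mult f.h_one g.h_one f.h_zero g.h_zero f.h_uminus g.h_uminus)
qed

lemma completion_closed:
  assumes R: "cring R" and I: "ideal I R"
    and x: "x : carrier (adic_completion R I)" and y: "y : carrier (adic_completion R I)"
  shows "x \<oplus>\<^bsub>adic_completion R I\<^esub> y : carrier (adic_completion R I)" "x \<otimes>\<^bsub>adic_completion R I\<^esub> y : carrier (adic_completion R I)"
proof -
  interpret cring R by fact
  have pow: "ideal (ideal_pow R I n) R" "ideal_pow R I (Suc n) <= ideal_pow R I n" for n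
  proof -
    have S: "ideal_pow R I (Suc k) = ideal_pow R I k \<cdot>\<^bsub>R\<^esub> I" for k by (simp add: ideals_set_def)
    show id: "ideal (ideal_pow R I n) R" for n
    proof (induction n)
      case 0
      show ?case using oneideal by (simp add: ideals_set_def)
    qed (unfold S, rule ideal_prod_is_ideal[OF _ I])
    show "ideal_pow R I (Suc n) <= ideal_pow R I n" unfolding S using ideal_prod_inter[OF id I] by blast
  qed
  have q: "cring (R Quot ideal_pow R I n)" for n by (rule ideal.quotient_is_cring[OF pow(1) R])
  show "x \<oplus>\<^bsub>adic_completion R I\<^esub> y : carrier (adic_completion R I)"
    using x y cring.cring_simprules(1)[OF q] unfolding adic_completion_def
    by (simp add: FactRing_def set_add_def') blast
  show "x \<otimes>\<^bsub>adic_completion R I\<^esub> y : carrier (adic_completion R I)"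
  proof -
    have "x (Suc n) \<otimes>\<^bsub>R Quot ideal_pow R I (Suc n)\<^esub> y (Suc n) <= x n \<otimes>\<^bsub>R Quot ideal_pow R I n\<^esub> y n" for n
    proof -
      have "x (Suc n) <= x n" "y (Suc n) <= y n" using x y by (auto simp: adic_completion_def)
      thus ?thesis using pow(2)[of n] by (simp add: FactRing_def rcoset_mult_def a_r_coset_def' del: nat_pow_Suc) blast
    qed
    thus ?thesis using x y cring.cring_simprules(5)[OF q] by (simp add: adic_completion_def del: nat_pow_Suc)
  qed
qed

text \<open>\<open>evl\<close> takes plain ring records, whereas \<open>A\<close> may carry
  additional fields.\<close>

lemma cring_truncate:
  assumes "cring (A :: ('a, 'r) ring_scheme)"
  defines "A' \<equiv> \<lparr>carrier = carrier A, mult = mult A, one = one A, zero = zero A, add = add A\<rparr> :: 'a ring"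
  shows "cring A'"
proof -
  interpret cring A by fact
  show ?thesis
  proof (rule cringI, rule abelian_groupI)
    show "EX y:carrier A'. y \<oplus>\<^bsub>A'\<^esub> x = \<zero>\<^bsub>A'\<^esub>" if "x : carrier A'" for x
      using that by (intro bexI[of _ "\<ominus>\<^bsub>A\<^esub> x"]) (simp_all add: A'_def l_neg)
  qed (auto simp: A'_def a_assoc a_comm a_lcomm m_assoc m_comm m_lcomm l_distr r_distr intro!: comm_monoidI)
qed

text \<open>The free ring is evaluated by \<open>al\<close> in \<open>A\<close> and by
  \<open>ka\<close> in \<open>Q\<close>; \<open>th\<close> sends it on to the completion through the
  isomorphism with the quotient of \<open>Q\<close>. The canonical map from \<open>A\<close> to its
  completion then becomes \<open>sub0\<close>.\<close>

lemma complete_intersection_presentation: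
  assumes "local_complete_intersection TYPE('q) (A :: ('a, 'r) ring_scheme) \<mm>"
  shows "EX (al :: ('a, 'q) fring => 'a) q f c as bs. presentation A al & noetherian_ring A &
    flat_extension sub0 (ring_map.ker A al) (jr q f c) as & local_ring_data q bs & fpd q & reg q f c"
proof -
  obtain Q :: "'q ring" and \<nn> fs where L: "noetherian_local_ring A \<mm>" and Q: "regular_local_ring Q \<nn>"
    and fs: "regular_sequence Q fs" and iso: "adic_completion A \<mm> \<simeq> Q Quot Idl\<^bsub>Q\<^esub> (set fs)"
    using assms unfolding local_complete_intersection_def by blast
  interpret A: noetherian_local_ring A \<mm> by fact
  interpret Q: regular_local_ring Q \<nn> by fact
  have LQ: "noetherian_local_ring Q \<nn>" by unfold_locales
  let ?A' = "\<lparr>carrier = carrier A, mult = mult A, one = one A, zero = zero A, add = add A\<rparr> :: 'a ring"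
  let ?If = "Idl\<^bsub>Q\<^esub> (set fs)" and ?C = "adic_completion A \<mm>"
  have fsc: "set fs <= carrier Q" using fs by (simp add: regular_sequence_def)
  have If: "ideal ?If Q" by (rule Q.genideal_ideal[OF fsc])
  obtain ps where ps: "ps : ring_hom ?C (Q Quot ?If)" and bij: "bij_betw ps (carrier ?C) (carrier (Q Quot ?If))"
    using iso unfolding is_ring_iso_def ring_iso_def by blast
  \<comment> \<open>Variables from \<open>A\<close> denote themselves. Elements outside the carrier
    and variables from \<open>Q\<close> go to zero, so the valuation stays in the carrier.\<close>
  define rhA :: "'a + 'q => 'a" where "rhA = case_sum (%a. if a : carrier A then a else \<zero>\<^bsub>A\<^esub>) (%_. \<zero>\<^bsub>A\<^esub>)"
  define al :: "('a, 'q) fring => 'a" where "al = evl ?A' rhA"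
  have rA: "range rhA <= carrier ?A'" by (auto simp: rhA_def split: sum.splits)
  note A' = cring_truncate[OF A.is_cring]
  have alv: "al (fvar v) = rhA v" for v unfolding al_def by (rule evl_map(2)[OF A' rA])
  interpret al: presentation A al
  proof -
    interpret r: ring_map ?A' al unfolding al_def by (rule evl_map(1)[OF A' rA])
    have 1: "al x : carrier A" "al (x + y) = al x \<oplus>\<^bsub>A\<^esub> al y" "al (x * y) = al x \<otimes>\<^bsub>A\<^esub> al y" "al 1 = \<one>\<^bsub>A\<^esub>" for x y
      using r.h_closed[of x] r.h_add[of x y] r.h_mult[of x y] r.h_one by simp_all
    have "a : range al" if "a : carrier A" for a
      using alv[of "Inl a"] that by (intro range_eqI[of _ _ "fvar (Inl a)"]) (simp add: rhA_def)
    thus "presentation A al" by unfold_locales (use 1 in auto)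
  qed
  obtain S where S: "S <= carrier A" "finite S" "\<mm> = Idl\<^bsub>A\<^esub> S" using A.finetely_gen[OF A.is_ideal] by blast
  obtain as where as: "{x. al x : \<mm>} = al.ker + rs.gspan as" "length as = card S" "al ` set as = S"
    by (rule al.fin_gen_vimage[OF A.is_ideal S])
  interpret DA: local_ring_data al.ker as by (rule al.local_data[OF L as(1)])
  note pow = al.vimage_ideal_pow[OF A.is_ideal as(1)]
  let ?m = "%n. ideal_pow A \<mm> n"
  let ?pA = "%n. rs.lpow as n UNIV + al.ker"
  have mem: "al x : ?m n \<longleftrightarrow> x : ?pA n" for x n using pow(2)[of n, symmetric] by simp
  define io where "io s n = ?m n +>\<^bsub>A\<^esub> al (s n)" for s :: "nat => ('a, 'q) fring" and n
  have cos: "?m n +>\<^bsub>A\<^esub> al x = ?m n +>\<^bsub>A\<^esub> al y \<longleftrightarrow> x - y : ?pA n" for x y n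
    unfolding al.quot_eq[OF pow(1)] by (rule mem)
  note p0 = rs.smod_0[OF rs.smod_plus[OF rs.lpow_smod[OF rs.smod_UNIV] al.ker_smod]]
  have io: "io s : carrier ?C" if s: "!!n. s (Suc n) - s n : ?pA n" for s
  proof -
    have "?m (Suc n) <= ?m n" for n
    proof -
      have "?pA (Suc n) <= ?pA n" by (intro plus_mono rs.lpow_antimono rs.smod_UNIV subset_refl) simp
      note sub = this
      show ?thesis
      proof
        fix a assume a: "a : ?m (Suc n)"
        obtain x where x: "a = al x" by (rule al.surjE[OF ideal.Icarr[OF pow(1) a]])
        show "a : ?m n" using subsetD[OF sub] a unfolding x mem by simp
      qed
    qed
    hence "?m (Suc n) +>\<^bsub>A\<^esub> al (s (Suc n)) <= ?m n +>\<^bsub>A\<^esub> al (s n)" for n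
      unfolding cos[THEN iffD2, OF s[of n], symmetric] by (auto simp: a_r_coset_def' simp del: nat_pow_Suc)
    thus ?thesis
      unfolding adic_completion_def io_def by (auto simp: FactRing_def A_RCOSETS_def' simp del: nat_pow_Suc)
  qed
  \<comment> \<open>A variable from \<open>A\<close> goes to a lift in \<open>Q\<close> of its image
    in the completion, which is what makes \<open>thPh\<close> true on variables.\<close>
  define rhQ :: "'a + 'q => 'q" where "rhQ = case_sum
    (%a. if a : carrier A then SOME z. z : carrier Q & ?If +>\<^bsub>Q\<^esub> z = ps (io (%_. fvar (Inl a))) else \<zero>\<^bsub>Q\<^esub>)
    (%z. if z : carrier Q then z else \<zero>\<^bsub>Q\<^esub>)"
  have exQ: "EX z. z : carrier Q & ?If +>\<^bsub>Q\<^esub> z = ps (io (%_. x))" for x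
  proof -
    have "io (%_. x) : carrier ?C" using p0 by (intro io) simp
    hence "ps (io (%_. x)) : carrier (Q Quot ?If)" using ring_hom_closed[OF ps] by blast
    thus ?thesis by (auto simp: FactRing_def A_RCOSETS_def')
  qed
  define ka :: "('a, 'q) fring => 'q" where "ka = evr Q rhQ"
  have rQ: "range rhQ <= carrier Q" using someI_ex[OF exQ] by (auto simp: rhQ_def split: sum.splits)
  have kav: "ka (fvar v) = rhQ v" for v unfolding ka_def by (rule evr_map(2)[OF Q.is_cring rQ])
  interpret ka: presentation Q ka
  proof -
    interpret ring_map Q ka unfolding ka_def by (rule evr_map(1)[OF Q.is_cring rQ])
    have "z : range ka" if "z : carrier Q" for z
      using kav[of "Inr z"] that by (intro range_eqI[of _ _ "fvar (Inr z)"]) (simp add: rhQ_def)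
    thus "presentation Q ka" by unfold_locales auto
  qed
  define f where "f s = (SOME x. ka x = fs ! s)" for s
  have f: "ka (f s) = fs ! s" if "s < length fs" for s
  proof -
    have "fs ! s : carrier Q" using fsc nth_mem[OF that] by blast
    hence "EX x. ka x = fs ! s" by (metis ka.surjE)
    thus ?thesis unfolding f_def by (rule someI_ex)
  qed
  let ?J = "jr ka.ker f (length fs)"
  note reg = ka.regular_sequence_reg[OF fs f]
  obtain bs where bs: "local_ring_data ka.ker bs" "fpd ka.ker" using ka.regular_presentation[OF Q] by blast
  interpret DQ: local_ring_data ka.ker bs by (rule bs)
  let ?bt = "%x. ?If +>\<^bsub>Q\<^esub> ka x"
  interpret B: presentation "Q Quot ?If" ?bt by (rule ka.quot_presentation[OF If])
  have kB: "B.ker = ?J" unfolding ka.quot_presentation(2)[OF If] by (rule reg(2))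
  have J: "rs.smod ?J" by (rule jr_smod[OF ka.ker_smod])
  have kJ: "ka.ker <= ?J" using jr_mono[OF ka.ker_smod, of 0 "length fs" f] by simp
  define th where "th x = inv_into (carrier ?C) ps (?bt x)" for x
  have th: "th x : carrier ?C" "ps (th x) = ?bt x" for x
  proof -
    have "?bt x : ps ` carrier ?C" using bij B.h_closed unfolding bij_betw_def by blast
    thus "th x : carrier ?C" "ps (th x) = ?bt x" unfolding th_def by (rule inv_into_into, rule f_inv_into_f)
  qed
  have inj: "x = y" if "x : carrier ?C" "y : carrier ?C" "ps x = ps y" for x y
    using bij that unfolding bij_betw_def by (blast dest: inj_onD)
  note cl = completion_closed[OF A.is_cring A.is_ideal]
  have add: "th (x + y) = th x \<oplus>\<^bsub>?C\<^esub> th y" and mult: "th (x * y) = th x \<otimes>\<^bsub>?C\<^esub> th y" for x y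
    by (rule inj[OF th(1)]; simp add: cl th ring_hom_add[OF ps] ring_hom_mult[OF ps] B.h_add B.h_mult)+
  have one: "th 1 = \<one>\<^bsub>?C\<^esub>"
  proof (rule inj[OF th(1)])
    have "io (%_. 1) : carrier ?C" using p0 by (intro io) simp
    moreover have "io (%_. 1) = \<one>\<^bsub>?C\<^esub>" by (simp add: io_def fun_eq_iff adic_completion_def FactRing_def al.h_one)
    ultimately show "\<one>\<^bsub>?C\<^esub> : carrier ?C" by simp
  qed (simp add: th ring_hom_one[OF ps] B.h_one)
  have T: "ring_map (A Quot ?m n) (%x. th x n)" for n
  proof -
    interpret q: cring "A Quot ?m n" by (rule ideal.quotient_is_cring[OF pow(1) A.is_cring])
    show ?thesis
      by unfold_locales (use th(1) in "simp_all add: add mult one adic_completion_def")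
  qed
  \<comment> \<open>Two ring maps from the free ring agree if they agree on variables. For elements
    of \<open>A\<close> this is the choice of \<open>rhQ\<close>; all other variables give zero on
    both sides.\<close>
  have thPh: "th (sub0 x) n = ?m n +>\<^bsub>A\<^esub> al x" for x n
  proof -
    interpret T: ring_map "A Quot ?m n" "%x. th x n" by (rule T)
    interpret P: presentation "A Quot ?m n" "%x. ?m n +>\<^bsub>A\<^esub> al x" by (rule al.quot_presentation[OF pow(1)])
    show ?thesis
    proof (rule ring_map_unique[of "A Quot ?m n" "%x. th (sub0 x) n"])
      show "ring_map (A Quot ?m n) (%x. th (sub0 x) n)"
        by unfold_locales (simp_all add: sub0_simps T.h_add T.h_mult T.h_one)
      show "ring_map (A Quot ?m n) (%x. ?m n +>\<^bsub>A\<^esub> al x)" by unfold_locales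
      fix v :: "'a + 'q"
      have z: "th (sub0 (fvar v)) n = ?m n +>\<^bsub>A\<^esub> al (fvar v)" if "sub0 (fvar v) = 0 | ?bt (sub0 (fvar v)) = ?bt 0" "al (fvar v) = \<zero>\<^bsub>A\<^esub>"
      proof -
        have "th (sub0 (fvar v)) = th 0" using that(1) by (auto simp: th_def)
        thus ?thesis using T.h_zero P.h_zero al.h_zero that(2) by simp
      qed
      show "th (sub0 (fvar v)) n = ?m n +>\<^bsub>A\<^esub> al (fvar v)"
      proof (cases v)
        case (Inr b)
        thus ?thesis by (intro z) (simp_all add: sub0_simps alv rhA_def)
      next
        case (Inl a)
        show ?thesis
        proof (cases "a : carrier A")
          case False
          thus ?thesis using Inl by (intro z) (simp_all add: sub0_simps alv kav rhA_def rhQ_def ka.h_zero)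
        next
          case True
          have "?bt (fvar (Inl a)) = ps (io (%_. fvar (Inl a)))"
            using someI_ex[OF exQ[of "fvar (Inl a)"]] True by (simp add: kav rhQ_def)
          hence "th (fvar (Inl a)) = io (%_. fvar (Inl a))"
            using p0
            by (intro inj[OF th(1)] io) (simp_all add: th)
          thus ?thesis by (simp add: Inl sub0_simps io_def)
        qed
      qed
    qed
  qed
  define bb where "bb n = ring_map.ker (A Quot ?m n) (%x. th x n)" for n
  have bb: "x - y : bb n \<longleftrightarrow> th x n = th y n" for x y n
    unfolding bb_def ring_map.ker_def[OF T] ring_map.h_eq_iff[OF T] by simp
  have th0: "x : bb n \<longleftrightarrow> th x n = th 0 n" for x n using bb[of x 0 n] by simp
  have bsm: "rs.smod (bb n)" for n unfolding bb_def by (rule ring_map.ker_smod[OF T])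
  have J0: "x : ?J \<longleftrightarrow> th x = th 0" for x
  proof
    assume "x : ?J"
    hence "?bt x = ?bt 0" unfolding kB[symmetric] B.h_eq_iff by (simp add: B.ker_def)
    thus "th x = th 0" by (simp add: th_def)
  next
    assume "th x = th 0"
    hence "?bt x = ?bt 0" using th(2) by metis
    thus "x : ?J" unfolding kB[symmetric] B.h_eq_iff by (simp add: B.ker_def)
  qed
  have Jb: "?J <= bb n" for n using J0 th0 by auto
  have "sub0 (0 :: ('a, 'q) fring) = 0" using sub0_simps(1)[of "0 :: ('a, 'q) fring" 0] by simp
  hence t0: "th 0 n = ?m n +>\<^bsub>A\<^esub> al 0" for n using thPh[of 0 n] by simp
  have emb: "sub0 x : bb n \<longleftrightarrow> x : ?pA n" for x n
    unfolding th0 t0 thPh cos by simp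
  have dns: "EX y. x - sub0 y : bb n" for x n
  proof -
    have "th x n : carrier (A Quot ?m n)" using th(1)[of x] by (simp add: adic_completion_def)
    then obtain a where a: "a : carrier A" "th x n = ?m n +>\<^bsub>A\<^esub> a" by (auto simp: FactRing_def A_RCOSETS_def')
    obtain y where "a = al y" by (rule al.surjE[OF a(1)])
    thus ?thesis unfolding bb thPh using a(2) by auto
  qed
  have ker: "sub0 x : ?J" if "x : al.ker" for x
  proof -
    have "x : ?pA n" for n by (rule subsetD[OF rs.upper2[OF rs.lpow_smod[OF rs.smod_UNIV]] that])
    hence "th (sub0 x) n = th 0 n" for n unfolding th0[symmetric] emb .
    thus ?thesis unfolding J0 by blast
  qed
  have filt: "bb n = rs.lpow (map sub0 as) n UNIV + ?J" for n
  proof (rule completion_filtration[OF sub0_simps(1-3) _ J bsm Jb _ _ emb dns])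
    show "sub0 x : ?J" if "x : al.ker" for x by (rule ker[OF that])
    have "bb (Suc n) <= bb n" for n
    proof
      fix x assume x: "x : bb (Suc n)"
      obtain y where y: "x - sub0 y : bb n" using dns by blast
      have "th x (Suc n) = ?m (Suc n) +>\<^bsub>A\<^esub> al 0"
        using x unfolding th0 t0 .
      \<comment> \<open>Compatibility of components is inclusion of cosets, so membership of
        \<open>0\<close> passes from component \<open>n + 1\<close> to component
        \<open>n\<close>.\<close>
      moreover have "al 0 : ?m (Suc n) +>\<^bsub>A\<^esub> al 0"
        by (rule abelian_subgroup.a_rcos_self[OF abelian_subgroupI3[OF ideal.axioms(1)[OF pow(1)] A.is_abelian_group]]) simp
      ultimately have "al 0 : th x n" using th(1)[of x] by (auto simp: adic_completion_def)
      hence "al 0 : ?m n +>\<^bsub>A\<^esub> al y" using y unfolding bb thPh by simp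
      hence "?m n +>\<^bsub>A\<^esub> al y = ?m n +>\<^bsub>A\<^esub> al 0"
        by (rule abelian_subgroup.a_repr_independence'[OF abelian_subgroupI3[OF ideal.axioms(1)[OF pow(1)] A.is_abelian_group]]) simp
      hence "y : ?pA n" unfolding cos by simp
      hence "sub0 y : bb n" unfolding emb .
      thus "x : bb n" by (rule sgp_cancel[OF rs.smod_sgp[OF bsm] y])
    qed
    thus "bb n <= bb m" if "m <= n" for m n by (rule lift_Suc_antimono_le[OF _ that])
    show "x : ?J" if "!!n. x : bb n" for x using that unfolding J0 th0 by blast
    show "EX c. ALL n. c - sub0 (s n) : bb n" if s: "!!n. s (Suc n) - s n : ?pA n" for s
    proof -
      have c: "io s : carrier ?C" by (rule io[OF s])
      obtain x where x: "ps (io s) = ?bt x" by (rule B.surjE[OF ring_hom_closed[OF ps c]])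
      have "th x = io s" by (rule inj[OF th(1) c]) (simp add: th x)
      thus ?thesis unfolding bb thPh by (intro exI[of _ x]) (simp add: io_def)
    qed
    show "0 : al.ker" by (rule rs.smod_0[OF al.ker_smod])
  qed
  \<comment> \<open>Otherwise \<open>x\<close> would be a unit modulo \<open>ka.ker\<close>, and
    \<open>1\<close> would vanish in the quotient of \<open>A\<close> by its maximal ideal.\<close>
  have b1: "ka x : \<nn>" if x: "x : bb 1" for x
  proof (rule ccontr)
    assume "ka x ~: \<nn>"
    then obtain u where "u * x - 1 : ka.ker" using ka.local_units[OF LQ] by blast
    hence "u * x - 1 : bb 1" using kJ Jb by blast
    hence "sub0 1 : bb 1" unfolding sub0_simps(3) using sgp_cancel'[OF rs.smod_sgp[OF bsm] _ ideal_mult[OF bsm x]] by blast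
    hence "al 1 : ?m 1" unfolding emb mem .
    moreover have "?m 1 <= \<mm>"
      using ideal.Icarr[OF A.is_ideal] A.ideal_prod_inter[OF A.oneideal A.is_ideal] by (simp add: ideals_set_def)
    ultimately show False using al.local_ideal(3)[OF L] by blast
  qed
  have "flat_extension sub0 al.ker ?J as"
  proof
    show "rs.rno ?J UNIV" by (rule rs.rno_mono[OF DQ.rno kJ subset_refl])
    show "jac ?J (map sub0 as)" unfolding jac_def
    proof
      fix c assume "c : rs.gspan (map sub0 as)"
      hence "c : rs.lpow (map sub0 as) 1 UNIV" using lpow_mon[of "map sub0 as" 1] by (simp add: comp_def)
      hence "c : bb 1" unfolding filt by (rule subsetD[OF rs.upper1[OF J]])
      hence c: "c : {x. ka x : \<nn>}" using b1 by blast
      have "1 - c ~: {x. ka x : \<nn>}"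
        using rs.smod_add[OF ka.local_ideal(1)[OF LQ] _ c, of "1 - c"] ka.local_ideal(3)[OF LQ] by auto
      thus "EX u. u * (1 - c) - 1 : ?J" using ka.local_units[OF LQ, of "1 - c"] kJ by blast
    qed
    show "EX y. x - sub0 y : rs.lpow (map sub0 as) n UNIV + ?J" for x n unfolding filt[symmetric] by (rule dns)
    show "x : ?pA n" if "sub0 x : rs.lpow (map sub0 as) n UNIV + ?J" for x n using that unfolding filt[symmetric] emb .
    show "sub0 x : ?J" if "x : al.ker" for x by (rule ker[OF that])
  qed (simp_all add: sub0_simps al.ker_smod DA.rno DA.jac J)
  thus ?thesis 
    by (intro exI conjI) (rule al.presentation_axioms A.noetherian_ring_axioms bs reg(1) | assumption)+
qed

section \<open>Complexity\<close>

text \<open>For \<open>n >= 1\<close> the quotient equals \<open>n * mu n / n ^ b\<close>. Passing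
  between \<open>n\<close> and \<open>n + 1\<close> costs the factors \<open>2\<close> and
  \<open>2 ^ b\<close>, and the initial terms are absorbed into the constant.\<close>

lemma limsup_finite_iff:
  fixes mu :: "nat => nat"
  shows "limsup (%n. ereal (real (mu n) / real n powi (int b - 1))) < \<infinity> \<longleftrightarrow> (EX C. ALL n. (n + 1) * mu n <= C * (n + 1) ^ b)"
proof -
  have q: "real (mu n) / real n powi (int b - 1) = real (n * mu n) / real (n ^ b)" if "n >= 1" for n
    using that by (simp add: power_int_diff)
  show ?thesis
  proof
    assume "limsup (%n. ereal (real (mu n) / real n powi (int b - 1))) < \<infinity>"
    then obtain r where "limsup (%n. ereal (real (mu n) / real n powi (int b - 1))) < ereal r"
      unfolding less_le[of _ "\<infinity>"] less_PInf_Ex_of_nat by blast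
    hence "eventually (%n. ereal (real (mu n) / real n powi (int b - 1)) < ereal r) sequentially" by (rule Limsup_lessD)
    then obtain N where N: "!!n. n >= N ==> real (mu n) / real n powi (int b - 1) < r" by (auto simp: eventually_sequentially)
    define C where "C = nat \<lceil>2 * \<bar>r\<bar>\<rceil> + (SUM n<=N. (n + 1) * mu n)"
    have "(n + 1) * mu n <= C * (n + 1) ^ b" for n
    proof (cases "n <= N")
      case True
      have "(n + 1) * mu n <= (SUM n<=N. (n + 1) * mu n)" by (rule member_le_sum) (use True in auto)
      also have "... <= C * 1" by (simp add: C_def)
      also have "... <= C * (n + 1) ^ b" by (intro mult_le_mono2 one_le_power) simp
      finally show ?thesis .
    next
      case False
      hence n: "n >= N" "n >= 1" by auto
      have "real (n * mu n) < r * real (n ^ b)" using N[OF n(1)] n(2) unfolding q[OF n(2)] by (simp add: divide_less_eq)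
      also have "... <= \<bar>r\<bar> * real ((n + 1) ^ b)" by (intro mult_mono) (auto intro: power_mono)
      finally have "real ((n + 1) * mu n) <= 2 * \<bar>r\<bar> * real ((n + 1) ^ b)"
        using n(2) mult_right_mono[of 1 "real n" "real (mu n)"] by (simp add: algebra_simps)
      also have "... <= real C * real ((n + 1) ^ b)"
      proof (rule mult_right_mono)
        have "real (nat \<lceil>2 * \<bar>r\<bar>\<rceil>) <= real C" unfolding C_def of_nat_le_iff by (rule le_add1)
        thus "2 * \<bar>r\<bar> <= real C" by (rule order_trans[OF real_nat_ceiling_ge])
      qed simp
      finally show ?thesis by (metis of_nat_le_iff of_nat_mult)
    qed
    thus "EX C. ALL n. (n + 1) * mu n <= C * (n + 1) ^ b" by blast
  next
    assume "EX C. ALL n. (n + 1) * mu n <= C * (n + 1) ^ b"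
    then obtain C where C: "!!n. (n + 1) * mu n <= C * (n + 1) ^ b" by blast
    have "limsup (%n. ereal (real (mu n) / real n powi (int b - 1))) <= ereal (real (C * 2 ^ b))"
    proof (rule Limsup_bounded, unfold eventually_sequentially, intro exI[of _ 1] allI impI)
      fix n :: nat assume n: "1 <= n"
      have "n * mu n <= C * (n + 1) ^ b" by (rule order_trans[OF _ C]) simp
      also have "... <= C * (2 * n) ^ b" using n by (intro mult_le_mono2 power_mono) auto
      finally have "real (n * mu n) <= real (C * 2 ^ b) * real (n ^ b)" unfolding of_nat_mult[symmetric] of_nat_le_iff by (simp add: power_mult_distrib)
      thus "ereal (real (mu n) / real n powi (int b - 1)) <= ereal (real (C * 2 ^ b))"
        unfolding q[OF n] using n by (simp add: pos_divide_le_eq)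
    qed
    also have "... < \<infinity>" by simp
    finally show "limsup (%n. ereal (real (mu n) / real n powi (int b - 1))) < \<infinity>" .
  qed
qed

text \<open>A vector of \<open>lpow\<close> has coordinates in the power of the ideal. On the finite
  set \<open>Y\<close> it is a combination of unit vectors, and the remainder lies in
  \<open>lo\<close>.\<close>

lemma (in pmod) ideal_smult_image:
  assumes hi: "hi = UNIV" and Y: "finite Y" "vk Y ker <= lo" and I: "ideal I R" and gs: "{x. h x : I} = ker + rs.gspan gs"
  shows "ideal_smult R (ideal_pow R I j) E = pr ` (vs.lpow gs j UNIV + lo)"
  unfolding ideal_smult_def
proof (rule mod_span_eqI)
  note pow = vimage_ideal_pow[OF I gs, of j] and sl = vs.lpow_smod[OF vs.smod_UNIV, of gs j]
  have mem: "h x : ideal_pow R I j \<longleftrightarrow> x : rs.lpow gs j UNIV + ker" for x using pow(2)[symmetric] by simp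
  show sm: "vs.smod (vs.lpow gs j UNIV + lo)" by (intro vs.smod_plus sl lo)
  show "vs.lpow gs j UNIV + lo <= hi" by (simp add: hi)
  show "{a \<odot>\<^bsub>E\<^esub> x |a x. a : ideal_pow R I j & x : carrier E} <= pr ` (vs.lpow gs j UNIV + lo)"
  proof
    fix z assume "z : {a \<odot>\<^bsub>E\<^esub> x |a x. a : ideal_pow R I j & x : carrier E}"
    then obtain a x where ax: "z = a \<odot>\<^bsub>E\<^esub> x" "a : ideal_pow R I j" "x : carrier E" by blast
    obtain c where c: "a = h c" by (rule surjE[OF ideal.Icarr[OF pow(1) ax(2)]])
    obtain v where v: "x = pr v" using ax(3) by (auto simp: car)
    have "c : rs.lpow gs j UNIV + ker" using ax(2) unfolding c mem .
    then obtain l k where lk: "c = l + k" "l : rs.lpow gs j UNIV" "k : ker" by (rule plusE)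
    have "(%l x. l * v x) ` rs.lpow gs j UNIV <= vs.lpow gs j UNIV"
      by (rule lpow_linear[OF rs.scal_axioms vs.scal_axioms _ _ subset_UNIV vs.smod_UNIV]) (simp_all add: fun_eq_iff algebra_simps)
    hence "(%x. l * v x) : vs.lpow gs j UNIV" using lk(2) by blast
    moreover have "(%x. k * v x) : lo" using killed_ker lk(3) unfolding vs.killed_def hi by simp
    ultimately have "(%x. l * v x) + (%x. k * v x) : vs.lpow gs j UNIV + lo" by (rule plusI)
    moreover have "(%x. l * v x) + (%x. k * v x) = (%x. c * v x)" by (simp add: fun_eq_iff lk(1) distrib_right)
    ultimately show "z : pr ` (vs.lpow gs j UNIV + lo)" unfolding ax(1) c v scal[of v c, unfolded hi, OF UNIV_I] by simp
  qed
  fix H assume H: "vs.smod H" "lo <= H"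
    and sub: "!!v. v : hi ==> pr v : {a \<odot>\<^bsub>E\<^esub> x |a x. a : ideal_pow R I j & x : carrier E} ==> v : H"
  have "vs.lpow gs j UNIV <= H"
  proof
    fix v :: "'v => 'r" assume v: "v : vs.lpow gs j UNIV"
    let ?e = "%y x. if x = y then 1 else (0 :: 'r)"
    let ?u = "SUM y:Y. (%x. v y * ?e y x)"
    have "?u : H"
    proof (rule vs_sum[OF H(1)], rule sub)
      fix y
      have "v y : rs.lpow gs j UNIV + ker"
        by (rule subsetD[OF rs.upper1[OF ker_smod] lpow_coord[OF v]])
      hence "h (v y) : ideal_pow R I j" unfolding mem .
      moreover have "pr (%x. v y * ?e y x) = h (v y) \<odot>\<^bsub>E\<^esub> pr (?e y)" by (rule scal[symmetric]) (simp add: hi)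
      moreover have "pr (?e y) : carrier E" by (simp add: car hi)
      ultimately show "pr (%x. v y * ?e y x) : {a \<odot>\<^bsub>E\<^esub> x |a x. a : ideal_pow R I j & x : carrier E}" by blast
    qed (simp add: hi)
    moreover have "v - ?u : H"
    proof (rule subsetD[OF H(2)], rule subsetD[OF Y(2)])
      have "?u y = v y" if "y : Y" for y
        using that Y(1) by (simp add: sum_fun if_distrib[of "%c. _ * c"] cong: if_cong)
      thus "v - ?u : vk Y ker" using rs.smod_0[OF ker_smod] by (simp add: vk_def)
    qed
    ultimately show "v : H" using sgp_cancel[OF vs.smod_sgp[OF H(1)]] by blast
  qed
  thus "vs.lpow gs j UNIV + lo <= H" by (rule plus_least[OF vs.smod_sgp[OF H(1)] _ H(2)])
qed

theorem theorem4p2p1: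
  fixes A :: "('a, 'r) ring_scheme" and \<mm> :: "'a set"
    and M :: "('a, 'b, 's) module_scheme" and N :: "('a, 'c, 't) module_scheme"
    and I :: "'a set"
  assumes "local_complete_intersection TYPE('q) A \<mm>"
    and "module A M" and "fin_gen A M"
    and "module A N" and "fin_gen A N"
    and "ideal I A"
  shows "\<exists>j\<^sub>0. \<forall>j\<ge>j\<^sub>0.
    complexity A M (quot_module N (ideal_smult A (ideal_pow A I j) N)) =
    complexity A M (quot_module N (ideal_smult A (ideal_pow A I j\<^sub>0) N))"
proof -
  obtain al :: "('a, 'q) fring => 'a" and q f c as bs where al: "presentation A al" and noeth: "noetherian_ring A"
    and flat: "flat_extension sub0 (ring_map.ker A al) (jr q f c) as" and q: "local_ring_data q bs" "fpd q" "reg q f c"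
    using complete_intersection_presentation[OF assms(1)] by blast
  interpret presentation A al by fact
  have rno: "rs.rno ker UNIV" by (rule noetherian_rno[OF noeth])
  obtain nuM and prM :: "(nat => ('a, 'q) fring) => 'b" and KM where M: "pmod A al M prM KM UNIV" "vk {..<nuM} ker <= KM"
    using module_pmod[OF assms(2,3)] by blast
  obtain nu and pr :: "(nat => ('a, 'q) fring) => 'c" and K where N: "pmod A al N pr K UNIV" and K: "vk {..<nu} ker <= K"
    using module_pmod[OF assms(4,5)] by blast
  interpret N: pmod A al N pr K UNIV by fact
  obtain S where S: "S <= carrier A" "finite S" "I = Idl\<^bsub>A\<^esub> S" using noetherian_ring.finetely_gen[OF noeth assms(6)] by blast
  obtain gs where gs: "{x. al x : I} = ker + rs.gspan gs" "length gs = card S" "al ` set gs = S"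
    by (rule fin_gen_vimage[OF assms(6) S])
  \<comment> \<open>The pair chosen in the definition of \<open>Ext\<close>; it is the same for all
    \<open>n\<close> and all coefficient modules.\<close>
  obtain bt d where btd: "(SOME (bt, d). EX ep. free_resolution A M bt d ep) = (bt, d)" by fastforce
  have "EX ep. free_resolution A M bt d ep"
    using someI_ex[of "%(bt, d). EX ep. free_resolution A M bt d ep"] free_resolution_exists[OF M rno] unfolding btd by auto
  then obtain ep where "free_resolution A M bt d ep" by blast
  then interpret presented_resolution A al M bt d ep by unfold_locales
  let ?N = "%j. quot_module N (ideal_smult A (ideal_pow A I j) N)"
  let ?KI = "%j. vs.lpow gs j UNIV + K"
  let ?lo = "%j. loC (resB bt) dd (?KI j)" and ?hi = "%j. hiC (resB bt) dd (?KI j)"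
  have KI: "vs.smod (?KI j)" "K <= ?KI j" for j
  proof -
    show "vs.smod (?KI j)" by (intro vs.smod_plus vs.lpow_smod vs.smod_UNIV N.lo)
    show "K <= ?KI j" by (rule vs.upper2[OF vs.lpow_smod[OF vs.smod_UNIV]])
  qed
  have "EX rh. pmod A al (Ext A n M (?N j)) rh (?lo j n) (?hi j n)" for j n
  proof -
    have "pmod A al (?N j) (%v. pr ` ?KI j +>\<^bsub>N\<^esub> pr v) (?KI j) UNIV"
      unfolding N.ideal_smult_image[OF refl finite_lessThan K assms(6) gs(1)] by (rule N.pmod_quot[OF KI subset_UNIV])
    moreover have "vs.killed ker (?KI j) UNIV" by (rule vs.killed_mono[OF N.killed_ker KI(2) subset_refl])
    ultimately show ?thesis unfolding Ext_def btd by (simp add: cohomology_pmod)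
  qed
  note ext = this
  have cx: "complexity A M (?N j) = Inf (enat ` {b. grow b (?lo j) (?hi j)})" for j
  proof -
    have fg: "EX g. vs.gen g (?lo j n) (?hi j n)" for n
    proof -
      obtain rh where "pmod A al (Ext A n M (?N j)) rh (?lo j n) (?hi j n)" using ext by blast
      then interpret E: pmod A al "Ext A n M (?N j)" rh "?lo j n" "?hi j n" .
      have "vk (resB bt (Suc n) \<times> {..<nu}) ker <= ?lo j n" by (rule vk_loC[OF subset_trans[OF K KI(2)]])
      hence "vs.rno (?lo j n) (?hi j n)"
        by (intro vs.rno_mono[OF rno_vec[OF finite_cartesian_product[OF finite_basis finite_lessThan] rno ker_smod] _ subset_UNIV])
          (simp add: vk_def)
      thus ?thesis by (rule vs.rno_gen[OF _ E.lo E.hi E.lohi])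
    qed
    let ?mu = "%n. min_gens A (Ext A n M (?N j))"
    have mu: "vs.gen (?mu n) (?lo j n) (?hi j n)" "vs.gen g (?lo j n) (?hi j n) ==> ?mu n <= g" for n g
      using ext[of n j] fg[of n] pmod.min_gens_gen by blast+
    \<comment> \<open>\<open>?mu n\<close> is the least number of generators, so the growth
      condition may be tested on it alone.\<close>
    have "grow b (?lo j) (?hi j) \<longleftrightarrow> (EX C. ALL n. (n + 1) * ?mu n <= C * (n + 1) ^ b)" for b
      unfolding grow_def using mu by (meson mult_le_mono2 order_trans)
    thus ?thesis unfolding complexity_def limsup_finite_iff by simp
  qed
  have "EX j0. ALL j>=j0. ALL b. grow b (?lo j) (?hi j) \<longleftrightarrow> grow b (?lo j0) (?hi j0)"
    by (rule growth_stabilises_below_completion[OF flat q finite_resB _ dd_square dd_exact finite_lessThan N.lo K]) simp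
  then obtain j0 where j0: "!!j b. j >= j0 ==> grow b (?lo j) (?hi j) \<longleftrightarrow> grow b (?lo j0) (?hi j0)" by blast
  show ?thesis unfolding cx by (intro exI[of _ j0] allI impI arg_cong[where f = "%S. Inf (enat ` S)"] Collect_cong j0)
qed

end
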